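(* Let $R$ be a commutative ring with $\operatorname{splf} R<\infty$, let $S$ be a faithfully flat $R$-algebra whose projective dimension as an $R$-module is at most $1$, and let $M$ be an $R$-module. If $\operatorname{Ext}^1_R(S,M)=0$ and the $S$-module $\operatorname{Hom}_R(S,M)$ is injective, then $M$ is an injective $R$-module.
   Context: For a commutative ring $R$ (not necessarily noetherian), $$\operatorname{splf} R=\sup\{\operatorname{proj\,dim}_R F\mid F \text{ is a flat } R\text{-module}\}.$$ A faithfully flat $R$-algebra is an $R$-algebra that is faithfully flat as an $R$-module. *)

theory Defs
  imports "HOL-Library.Extended_Nat" "HOL-Library.Equipollence"
    "HOL-Algebra.AbelCoset" "HOL-Algebra.Module"
begin

text \<open>
  Universes. Flat, projective and injective modules, projective dimension and splf all refer to
  "all modules", which HOL cannot quantify over. Each of these notions therefore takes a type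
  argument \<open>TYPE('u)\<close>, and the modules quantified over in its definition are those with carrier
  in \<open>'u\<close>. If \<open>'u\<close> is infinite and is at least as large as the ring of scalars (and, for projectivity
  and projective dimension, as the module in question), the notions do not depend on the choice
  of \<open>'u\<close>.
\<close>

section \<open>Modules and algebras\<close>

text \<open>The library locale \<^locale>\<open>module\<close> requires commutative scalars; algebras need not be
  commutative, so left modules over an arbitrary ring are needed for modules over an algebra.\<close>

locale left_module = R?: ring R + M?: abelian_group M
  for R :: "('r, 'z) ring_scheme" (structure) and M :: "('r, 'm, 'y) module_scheme" (structure) +
  assumes smult_closed:
      "\<lbrakk>a \<in> carrier R; x \<in> carrier M\<rbrakk> \<Longrightarrow> a \<odot>\<^bsub>M\<^esub> x \<in> carrier M"
    and smult_l_distr: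
      "\<lbrakk>a \<in> carrier R; b \<in> carrier R; x \<in> carrier M\<rbrakk> \<Longrightarrow>
        (a \<oplus> b) \<odot>\<^bsub>M\<^esub> x = a \<odot>\<^bsub>M\<^esub> x \<oplus>\<^bsub>M\<^esub> b \<odot>\<^bsub>M\<^esub> x"
    and smult_r_distr:
      "\<lbrakk>a \<in> carrier R; x \<in> carrier M; y \<in> carrier M\<rbrakk> \<Longrightarrow>
        a \<odot>\<^bsub>M\<^esub> (x \<oplus>\<^bsub>M\<^esub> y) = a \<odot>\<^bsub>M\<^esub> x \<oplus>\<^bsub>M\<^esub> a \<odot>\<^bsub>M\<^esub> y"
    and smult_assoc:
      "\<lbrakk>a \<in> carrier R; b \<in> carrier R; x \<in> carrier M\<rbrakk> \<Longrightarrow>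
        (a \<otimes> b) \<odot>\<^bsub>M\<^esub> x = a \<odot>\<^bsub>M\<^esub> (b \<odot>\<^bsub>M\<^esub> x)"
    and smult_one:
      "x \<in> carrier M \<Longrightarrow> \<one> \<odot>\<^bsub>M\<^esub> x = x"

lemma left_module_iff_module:
  assumes "cring R"
  shows "left_module R M \<longleftrightarrow> module R M"
proof
  assume "left_module R M"
  then interpret left_module R M .
  show "module R M"
    by (rule moduleI) (auto simp: assms smult_closed smult_l_distr smult_r_distr smult_assoc
        smult_one intro: M.abelian_group_axioms)
next
  assume "module R M"
  then interpret module R M .
  show "left_module R M"
    by unfold_locales (auto simp: smult_l_distr smult_r_distr smult_assoc1)
qed

text \<open>Associative unital algebras, not necessarily commutative (unlike \<^locale>\<open>algebra\<close>).\<close>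

locale assoc_algebra = module R S + ring S
  for R :: "('r, 'z) ring_scheme" (structure) and S :: "('r, 's, 'y) module_scheme" (structure) +
  assumes smult_mult_left:
      "\<lbrakk>a \<in> carrier R; x \<in> carrier S; y \<in> carrier S\<rbrakk> \<Longrightarrow>
        (a \<odot>\<^bsub>S\<^esub> x) \<otimes>\<^bsub>S\<^esub> y = a \<odot>\<^bsub>S\<^esub> (x \<otimes>\<^bsub>S\<^esub> y)"
    and smult_mult_right:
      "\<lbrakk>a \<in> carrier R; x \<in> carrier S; y \<in> carrier S\<rbrakk> \<Longrightarrow>
        x \<otimes>\<^bsub>S\<^esub> (a \<odot>\<^bsub>S\<^esub> y) = a \<odot>\<^bsub>S\<^esub> (x \<otimes>\<^bsub>S\<^esub> y)"

section \<open>Homomorphisms, quotients, free modules\<close>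

text \<open>Homomorphisms are extensional functions, so that equality of homomorphisms is equality.\<close>

definition mod_hom ::
    "('r, 'z) ring_scheme \<Rightarrow> ('r, 'a, 'y) module_scheme \<Rightarrow> ('r, 'b, 'w) module_scheme \<Rightarrow> ('a \<Rightarrow> 'b) set"
  where "mod_hom R A B = {f \<in> carrier A \<rightarrow>\<^sub>E carrier B.
    (\<forall>x\<in>carrier A. \<forall>y\<in>carrier A. f (x \<oplus>\<^bsub>A\<^esub> y) = f x \<oplus>\<^bsub>B\<^esub> f y) \<and>
    (\<forall>r\<in>carrier R. \<forall>x\<in>carrier A. f (r \<odot>\<^bsub>A\<^esub> x) = r \<odot>\<^bsub>B\<^esub> f x)}"

text \<open>In module records the multiplicative fields inherited from rings carry no meaning.\<close>

definition hom_module ::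
    "('r, 'z) ring_scheme \<Rightarrow> ('r, 'a, 'y) module_scheme \<Rightarrow> ('r, 'b, 'w) module_scheme \<Rightarrow> ('r, 'a \<Rightarrow> 'b) module"
  where "hom_module R A B = \<lparr>carrier = mod_hom R A B, mult = undefined, one = undefined,
    zero = (\<lambda>x\<in>carrier A. \<zero>\<^bsub>B\<^esub>), add = (\<lambda>f g. \<lambda>x\<in>carrier A. f x \<oplus>\<^bsub>B\<^esub> g x),
    smult = (\<lambda>r f. \<lambda>x\<in>carrier A. r \<odot>\<^bsub>B\<^esub> f x)\<rparr>"

text \<open>\<open>Hom\<^sub>R(S, M)\<close> as a left \<open>S\<close>-module: \<open>(s f)(x) = f (x s)\<close>.\<close>

definition coinduced ::
    "('r, 'z) ring_scheme \<Rightarrow> ('r, 's, 'y) module_scheme \<Rightarrow> ('r, 'm, 'w) module_scheme \<Rightarrow> ('s, 's \<Rightarrow> 'm) module"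
  where "coinduced R S M = \<lparr>carrier = mod_hom R S M, mult = undefined, one = undefined,
    zero = (\<lambda>x\<in>carrier S. \<zero>\<^bsub>M\<^esub>), add = (\<lambda>f g. \<lambda>x\<in>carrier S. f x \<oplus>\<^bsub>M\<^esub> g x),
    smult = (\<lambda>s f. \<lambda>x\<in>carrier S. f (x \<otimes>\<^bsub>S\<^esub> s))\<rparr>"

definition quotient_module :: "('r, 'a, 'y) module_scheme \<Rightarrow> 'a set \<Rightarrow> ('r, 'a set) module"
  where "quotient_module M N = \<lparr>carrier = a_rcosets\<^bsub>M\<^esub> N, mult = undefined, one = undefined,
    zero = N, add = (\<lambda>X Y. X <+>\<^bsub>M\<^esub> Y), smult = (\<lambda>r X. \<Union>x\<in>X. N +>\<^bsub>M\<^esub> (r \<odot>\<^bsub>M\<^esub> x))\<rparr>"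

definition free_module :: "('r, 'z) ring_scheme \<Rightarrow> 'x set \<Rightarrow> ('r, 'x \<Rightarrow> 'r) module"
  where "free_module R X = \<lparr>
    carrier = {v. (\<forall>x\<in>X. v x \<in> carrier R) \<and> (\<forall>x. x \<notin> X \<longrightarrow> v x = \<zero>\<^bsub>R\<^esub>) \<and> finite {x. v x \<noteq> \<zero>\<^bsub>R\<^esub>}},
    mult = undefined, one = undefined,
    zero = (\<lambda>x. \<zero>\<^bsub>R\<^esub>), add = (\<lambda>v w x. v x \<oplus>\<^bsub>R\<^esub> w x), smult = (\<lambda>r v x. r \<otimes>\<^bsub>R\<^esub> v x)\<rparr>"

definition basis_elem :: "('r, 'z) ring_scheme \<Rightarrow> 'x \<Rightarrow> 'x \<Rightarrow> 'r"
  where "basis_elem R x = (\<lambda>y. if y = x then \<one>\<^bsub>R\<^esub> else \<zero>\<^bsub>R\<^esub>)"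

section \<open>Tensor products and flatness over a commutative ring\<close>

definition bilinear_relations ::
    "('r, 'z) ring_scheme \<Rightarrow> ('r, 'a, 'y) module_scheme \<Rightarrow> ('r, 'b, 'w) module_scheme \<Rightarrow> ('a \<times> 'b \<Rightarrow> 'r) set"
  where "bilinear_relations R A B =
    (let F = free_module R (carrier A \<times> carrier B); e = (\<lambda>x y. basis_elem R (x, y)) in
      {e (x \<oplus>\<^bsub>A\<^esub> x') y \<ominus>\<^bsub>F\<^esub> (e x y \<oplus>\<^bsub>F\<^esub> e x' y) | x x' y.
          x \<in> carrier A \<and> x' \<in> carrier A \<and> y \<in> carrier B} \<union>
      {e x (y \<oplus>\<^bsub>B\<^esub> y') \<ominus>\<^bsub>F\<^esub> (e x y \<oplus>\<^bsub>F\<^esub> e x y') | x y y'.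
          x \<in> carrier A \<and> y \<in> carrier B \<and> y' \<in> carrier B} \<union>
      {e (r \<odot>\<^bsub>A\<^esub> x) y \<ominus>\<^bsub>F\<^esub> r \<odot>\<^bsub>F\<^esub> e x y | r x y.
          r \<in> carrier R \<and> x \<in> carrier A \<and> y \<in> carrier B} \<union>
      {e x (r \<odot>\<^bsub>B\<^esub> y) \<ominus>\<^bsub>F\<^esub> r \<odot>\<^bsub>F\<^esub> e x y | r x y.
          r \<in> carrier R \<and> x \<in> carrier A \<and> y \<in> carrier B})"

definition tensor_rel ::
    "('r, 'z) ring_scheme \<Rightarrow> ('r, 'a, 'y) module_scheme \<Rightarrow> ('r, 'b, 'w) module_scheme \<Rightarrow> ('a \<times> 'b \<Rightarrow> 'r) set"
  where "tensor_rel R A B =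
    (\<lambda>N. submodule N R (free_module R (carrier A \<times> carrier B))) hull bilinear_relations R A B"

definition tensor ::
    "('r, 'z) ring_scheme \<Rightarrow> ('r, 'a, 'y) module_scheme \<Rightarrow> ('r, 'b, 'w) module_scheme
      \<Rightarrow> ('r, ('a \<times> 'b \<Rightarrow> 'r) set) module"
  where "tensor R A B =
    quotient_module (free_module R (carrier A \<times> carrier B)) (tensor_rel R A B)"

definition tensor_elem ::
    "('r, 'z) ring_scheme \<Rightarrow> ('r, 'a, 'y) module_scheme \<Rightarrow> ('r, 'b, 'w) module_scheme
      \<Rightarrow> 'a \<Rightarrow> 'b \<Rightarrow> ('a \<times> 'b \<Rightarrow> 'r) set"
  where "tensor_elem R A B x y =
    tensor_rel R A B +>\<^bsub>free_module R (carrier A \<times> carrier B)\<^esub> basis_elem R (x, y)"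

text \<open>The map \<open>F \<otimes> f : F \<otimes> A \<rightarrow> F \<otimes> B\<close> induced by \<open>f : A \<rightarrow> B\<close>.\<close>

definition tensor_map ::
    "('r, 'z) ring_scheme \<Rightarrow> ('r, 'f, 'v) module_scheme \<Rightarrow> ('r, 'a, 'y) module_scheme
      \<Rightarrow> ('r, 'b, 'w) module_scheme \<Rightarrow> ('a \<Rightarrow> 'b) \<Rightarrow> ('f \<times> 'a \<Rightarrow> 'r) set \<Rightarrow> ('f \<times> 'b \<Rightarrow> 'r) set"
  where "tensor_map R F A B f = (THE h. h \<in> mod_hom R (tensor R F A) (tensor R F B) \<and>
    (\<forall>x\<in>carrier F. \<forall>a\<in>carrier A. h (tensor_elem R F A x a) = tensor_elem R F B x (f a)))"

definition exact_at ::
    "('r, 'a, 'y) module_scheme \<Rightarrow> ('a \<Rightarrow> 'b) \<Rightarrow> ('r, 'b, 'w) module_scheme \<Rightarrow> ('b \<Rightarrow> 'c)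
      \<Rightarrow> ('r, 'c, 'v) module_scheme \<Rightarrow> bool"
  where "exact_at A f B g C \<longleftrightarrow> f ` carrier A = a_kernel B C g"

definition flat :: "'u itself \<Rightarrow> ('r, 'z) ring_scheme \<Rightarrow> ('r, 'f, 'y) module_scheme \<Rightarrow> bool"
  where "flat U R F \<longleftrightarrow> module R F \<and>
    (\<forall>(A :: ('r, 'u) module) (B :: ('r, 'u) module) (C :: ('r, 'u) module) f g.
      module R A \<and> module R B \<and> module R C \<and> f \<in> mod_hom R A B \<and> g \<in> mod_hom R B C \<longrightarrow>
      exact_at A f B g C \<longrightarrow>
      exact_at (tensor R F A) (tensor_map R F A B f) (tensor R F B) (tensor_map R F B C g)
        (tensor R F C))"

definition faithfully_flat :: "'u itself \<Rightarrow> ('r, 'z) ring_scheme \<Rightarrow> ('r, 'f, 'y) module_scheme \<Rightarrow> bool"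
  where "faithfully_flat U R F \<longleftrightarrow> module R F \<and>
    (\<forall>(A :: ('r, 'u) module) (B :: ('r, 'u) module) (C :: ('r, 'u) module) f g.
      module R A \<and> module R B \<and> module R C \<and> f \<in> mod_hom R A B \<and> g \<in> mod_hom R B C \<longrightarrow>
      (exact_at A f B g C \<longleftrightarrow>
       exact_at (tensor R F A) (tensor_map R F A B f) (tensor R F B) (tensor_map R F B C g)
         (tensor R F C)))"

section \<open>Injective and projective modules, projective dimension, Ext\<close>

definition injective :: "'u itself \<Rightarrow> ('r, 'z) ring_scheme \<Rightarrow> ('r, 'm, 'y) module_scheme \<Rightarrow> bool"
  where "injective U R M \<longleftrightarrow> left_module R M \<and>
    (\<forall>(A :: ('r, 'u) module) (B :: ('r, 'u) module) i f.
      left_module R A \<and> left_module R B \<and> i \<in> mod_hom R A B \<and> inj_on i (carrier A) \<and>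
      f \<in> mod_hom R A M \<longrightarrow>
      (\<exists>g\<in>mod_hom R B M. \<forall>a\<in>carrier A. g (i a) = f a))"

definition projective :: "'u itself \<Rightarrow> ('r, 'z) ring_scheme \<Rightarrow> ('r, 'p, 'y) module_scheme \<Rightarrow> bool"
  where "projective U R P \<longleftrightarrow> left_module R P \<and>
    (\<forall>(A :: ('r, 'u) module) (B :: ('r, 'u) module) q f.
      left_module R A \<and> left_module R B \<and> q \<in> mod_hom R A B \<and> q ` carrier A = carrier B \<and>
      f \<in> mod_hom R P B \<longrightarrow>
      (\<exists>g\<in>mod_hom R P A. \<forall>x\<in>carrier P. q (g x) = f x))"

text \<open>An augmented projective resolution
  \<open>\<dots> \<rightarrow> P 2 \<rightarrow> P 1 \<rightarrow> P 0 \<rightarrow> M \<rightarrow> 0\<close>, with differentials \<open>d n : P (n + 1) \<rightarrow> P n\<close> and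
  augmentation \<open>e : P 0 \<rightarrow> M\<close>.\<close>

definition projective_resolution ::
    "('r, 'z) ring_scheme \<Rightarrow> ('r, 'm, 'y) module_scheme \<Rightarrow> (nat \<Rightarrow> ('r, 'u) module)
      \<Rightarrow> (nat \<Rightarrow> 'u \<Rightarrow> 'u) \<Rightarrow> ('u \<Rightarrow> 'm) \<Rightarrow> bool"
  where "projective_resolution R M P d e \<longleftrightarrow>
    (\<forall>n. projective TYPE('u) R (P n)) \<and>
    (\<forall>n. d n \<in> mod_hom R (P (Suc n)) (P n)) \<and> e \<in> mod_hom R (P 0) M \<and>
    (\<forall>n. exact_at (P (Suc (Suc n))) (d (Suc n)) (P (Suc n)) (d n) (P n)) \<and>
    exact_at (P 1) (d 0) (P 0) e M \<and> e ` carrier (P 0) = carrier M"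

text \<open>The infimum of the lengths of projective resolutions, \<open>\<infinity>\<close> if there is none of finite length
  (hence \<open>0\<close> for the zero module).\<close>

definition proj_dim :: "'u itself \<Rightarrow> ('r, 'z) ring_scheme \<Rightarrow> ('r, 'm, 'y) module_scheme \<Rightarrow> enat"
  where "proj_dim U R M = Inf {enat n | n. \<exists>(P :: nat \<Rightarrow> ('r, 'u) module) d e.
    projective_resolution R M P d e \<and> (\<forall>k>n. carrier (P k) = {\<zero>\<^bsub>P k\<^esub>})}"

definition splf :: "'u itself \<Rightarrow> ('r, 'z) ring_scheme \<Rightarrow> enat"
  where "splf U R = (SUP F \<in> {F :: ('r, 'u) module. flat TYPE('u) R F}. proj_dim TYPE('u) R F)"

definition cocycles ::
    "('r, 'z) ring_scheme \<Rightarrow> (nat \<Rightarrow> ('r, 'u) module) \<Rightarrow> (nat \<Rightarrow> 'u \<Rightarrow> 'u) \<Rightarrow> ('r, 'm, 'y) module_scheme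
      \<Rightarrow> nat \<Rightarrow> ('u \<Rightarrow> 'm) set"
  where "cocycles R P d M n =
    {f \<in> mod_hom R (P n) M. \<forall>x\<in>carrier (P (Suc n)). f (d n x) = \<zero>\<^bsub>M\<^esub>}"

fun coboundaries ::
    "('r, 'z) ring_scheme \<Rightarrow> (nat \<Rightarrow> ('r, 'u) module) \<Rightarrow> (nat \<Rightarrow> 'u \<Rightarrow> 'u) \<Rightarrow> ('r, 'm, 'y) module_scheme
      \<Rightarrow> nat \<Rightarrow> ('u \<Rightarrow> 'm) set"
  where
    "coboundaries R P d M 0 = {\<zero>\<^bsub>hom_module R (P 0) M\<^esub>}"
  | "coboundaries R P d M (Suc n) =
      (\<lambda>f. compose (carrier (P (Suc n))) f (d n)) ` mod_hom R (P n) M"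

text \<open>\<open>Ext\<^sup>n(N, M)\<close>, computed from a chosen projective resolution of \<open>N\<close>; such a
  resolution exists in \<open>'u\<close> if \<open>'u\<close> is infinite and at least as large as \<open>R\<close> and \<open>N\<close>.\<close>

definition Ext ::
    "'u itself \<Rightarrow> ('r, 'z) ring_scheme \<Rightarrow> nat \<Rightarrow> ('r, 'n, 'y) module_scheme \<Rightarrow> ('r, 'm, 'w) module_scheme
      \<Rightarrow> ('r, ('u \<Rightarrow> 'm) set) module"
  where "Ext U R n N M =
    (case SOME (P :: nat \<Rightarrow> ('r, 'u) module, d, e). projective_resolution R N P d e of
      (P, d, e) \<Rightarrow> quotient_module ((hom_module R (P n) M)\<lparr>carrier := cocycles R P d M n\<rparr>)
        (coboundaries R P d M n))"

end

theory Submission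
  imports Defs
begin

text \<open>
  By Baer's criterion it suffices that \<open>N = Ext\<^sup>1(R / I, M)\<close> vanishes for every ideal \<open>I\<close> of \<open>R\<close>. Since
  \<open>Hom(S, M)\<close> is injective over the flat algebra \<open>S\<close>, it is injective over \<open>R\<close>; together with
  \<open>Ext\<^sup>1(S, M) = 0\<close> and a projective resolution \<open>0 \<rightarrow> A1 \<rightarrow> A \<rightarrow> S \<rightarrow> 0\<close> this gives
  \<open>Hom(S, N) = Ext\<^sup>1(S, N) = 0\<close>, so restriction \<open>Hom(A, N) \<rightarrow> Hom(A1, N)\<close> is bijective.

  By faithful flatness \<open>F = S / R\<close> is flat, and it has a projective resolution \<open>0 \<rightarrow> B \<rightarrow> A \<rightarrow> F \<rightarrow> 0\<close> in which
  \<open>B\<close> is the sum of \<open>A1\<close> and a copy of \<open>R\<close>. Splitting off the restrictions of maps \<open>A \<rightarrow> N\<close> gives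
  a functional \<open>\<tau> : Hom(B, N) \<rightarrow> N\<close>, i.e. an identification of \<open>N\<close> with \<open>Ext\<^sup>1(F, N)\<close>. For flat \<open>G\<close> it yields an
  injection of \<open>Ext\<^sup>n(G, N)\<close> into \<open>Ext\<^sup>n\<^sup>+\<^sup>1(F \<otimes> G, N)\<close>, and \<open>F \<otimes> G\<close> is again flat. Starting
  with \<open>G = R\<close> and iterating beyond \<open>splf R\<close>, where all these groups vanish, one finds \<open>N = 0\<close>.
\<close>

section \<open>Modules and homomorphisms\<close>

text \<open>In the derived category the vanishing of N is formal. Adjunction gives RHom(S, RHom(R /
  I, M)) = RHom(R / I, RHom(S, M)) = Hom(R / I, Hom(S, M)), concentrated in degree 0. As S has
  projective dimension at most 1, the spectral sequence with terms Ext^p(S, Ext^q(R / I, M)) has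
  only the columns p = 0, 1 and degenerates, so RHom(S, N) = 0. The triangle of 0 -> R -> S -> F ->
  0 turns this into RHom(F, N) = N[-1], and a second adjunction yields RHom(F \<otimes> G, N) =
  RHom(G, N)[-1] for flat G. The proof carries this out on explicit cochains: \<open>\<tau>\<close>
  is the chain-level form of the equality for F.

  The remaining obstacle is size. The module F \<otimes> G has a new type at every iteration,
  whereas flatness and \<open>splf\<close> test modules of the single type \<open>'u\<close>. Hence
  tensor products are copied back into \<open>'u\<close>, and vanishing of Ext is formulated so that
  resolutions with terms of different types can be compared.\<close>

locale base_ring = cring R for R :: "('r, 'z) ring_scheme" (structure)
begin

abbreviation Hom :: "('r, 'a) module \<Rightarrow> ('r, 'b) module \<Rightarrow> ('a \<Rightarrow> 'b) set"
  where "Hom \<equiv> mod_hom R"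

lemma module_addI [simp, intro]:
  fixes A :: "('r, 'a) module"
  assumes "module R A"
  shows "x \<in> carrier A \<Longrightarrow> y \<in> carrier A \<Longrightarrow> x \<oplus>\<^bsub>A\<^esub> y \<in> carrier A"
    and "\<zero>\<^bsub>A\<^esub> \<in> carrier A"
    and "x \<in> carrier A \<Longrightarrow> \<ominus>\<^bsub>A\<^esub> x \<in> carrier A"
    and "x \<in> carrier A \<Longrightarrow> y \<in> carrier A \<Longrightarrow> x \<ominus>\<^bsub>A\<^esub> y \<in> carrier A"
    and "r \<in> carrier R \<Longrightarrow> x \<in> carrier A \<Longrightarrow> r \<odot>\<^bsub>A\<^esub> x \<in> carrier A"
proof -
  interpret A: module R A by fact
  show "x \<in> carrier A \<Longrightarrow> y \<in> carrier A \<Longrightarrow> x \<oplus>\<^bsub>A\<^esub> y \<in> carrier A"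
    and "\<zero>\<^bsub>A\<^esub> \<in> carrier A"
    and "x \<in> carrier A \<Longrightarrow> \<ominus>\<^bsub>A\<^esub> x \<in> carrier A"
    and "x \<in> carrier A \<Longrightarrow> y \<in> carrier A \<Longrightarrow> x \<ominus>\<^bsub>A\<^esub> y \<in> carrier A"
    and "r \<in> carrier R \<Longrightarrow> x \<in> carrier A \<Longrightarrow> r \<odot>\<^bsub>A\<^esub> x \<in> carrier A"
    by auto
qed

lemma module_simps [simp]:
  fixes A :: "('r, 'a) module"
  assumes "module R A"
  shows "x \<in> carrier A \<Longrightarrow> \<zero>\<^bsub>A\<^esub> \<oplus>\<^bsub>A\<^esub> x = x"
    and "x \<in> carrier A \<Longrightarrow> x \<oplus>\<^bsub>A\<^esub> \<zero>\<^bsub>A\<^esub> = x"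
    and "x \<in> carrier A \<Longrightarrow> \<ominus>\<^bsub>A\<^esub> x \<oplus>\<^bsub>A\<^esub> x = \<zero>\<^bsub>A\<^esub>"
    and "x \<in> carrier A \<Longrightarrow> x \<oplus>\<^bsub>A\<^esub> \<ominus>\<^bsub>A\<^esub> x = \<zero>\<^bsub>A\<^esub>"
    and "x \<in> carrier A \<Longrightarrow> \<ominus>\<^bsub>A\<^esub> (\<ominus>\<^bsub>A\<^esub> x) = x"
    and "\<ominus>\<^bsub>A\<^esub> \<zero>\<^bsub>A\<^esub> = \<zero>\<^bsub>A\<^esub>"
    and "x \<in> carrier A \<Longrightarrow> x \<ominus>\<^bsub>A\<^esub> x = \<zero>\<^bsub>A\<^esub>"
    and "x \<in> carrier A \<Longrightarrow> \<one> \<odot>\<^bsub>A\<^esub> x = x"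
    and "x \<in> carrier A \<Longrightarrow> \<zero> \<odot>\<^bsub>A\<^esub> x = \<zero>\<^bsub>A\<^esub>"
    and "r \<in> carrier R \<Longrightarrow> r \<odot>\<^bsub>A\<^esub> \<zero>\<^bsub>A\<^esub> = \<zero>\<^bsub>A\<^esub>"
    and "x \<in> carrier A \<Longrightarrow> x \<ominus>\<^bsub>A\<^esub> \<zero>\<^bsub>A\<^esub> = x"
proof -
  interpret A: module R A by fact
  show "x \<in> carrier A \<Longrightarrow> \<zero>\<^bsub>A\<^esub> \<oplus>\<^bsub>A\<^esub> x = x"
    and "x \<in> carrier A \<Longrightarrow> x \<oplus>\<^bsub>A\<^esub> \<zero>\<^bsub>A\<^esub> = x"
    and "x \<in> carrier A \<Longrightarrow> \<ominus>\<^bsub>A\<^esub> x \<oplus>\<^bsub>A\<^esub> x = \<zero>\<^bsub>A\<^esub>"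
    and "x \<in> carrier A \<Longrightarrow> x \<oplus>\<^bsub>A\<^esub> \<ominus>\<^bsub>A\<^esub> x = \<zero>\<^bsub>A\<^esub>"
    and "x \<in> carrier A \<Longrightarrow> \<ominus>\<^bsub>A\<^esub> (\<ominus>\<^bsub>A\<^esub> x) = x"
    and "\<ominus>\<^bsub>A\<^esub> \<zero>\<^bsub>A\<^esub> = \<zero>\<^bsub>A\<^esub>"
    and "x \<in> carrier A \<Longrightarrow> x \<ominus>\<^bsub>A\<^esub> x = \<zero>\<^bsub>A\<^esub>"
    and "x \<in> carrier A \<Longrightarrow> \<one> \<odot>\<^bsub>A\<^esub> x = x"
    and "x \<in> carrier A \<Longrightarrow> \<zero> \<odot>\<^bsub>A\<^esub> x = \<zero>\<^bsub>A\<^esub>"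
    and "r \<in> carrier R \<Longrightarrow> r \<odot>\<^bsub>A\<^esub> \<zero>\<^bsub>A\<^esub> = \<zero>\<^bsub>A\<^esub>"
    and "x \<in> carrier A \<Longrightarrow> x \<ominus>\<^bsub>A\<^esub> \<zero>\<^bsub>A\<^esub> = x"
    by (auto simp: A.M.l_neg A.M.r_neg A.M.minus_eq)
qed

lemma module_ac:
  fixes A :: "('r, 'a) module"
  assumes "module R A"
  shows "x \<in> carrier A \<Longrightarrow> y \<in> carrier A \<Longrightarrow> z \<in> carrier A \<Longrightarrow> x \<oplus>\<^bsub>A\<^esub> y \<oplus>\<^bsub>A\<^esub> z = x \<oplus>\<^bsub>A\<^esub> (y \<oplus>\<^bsub>A\<^esub> z)"
    and "x \<in> carrier A \<Longrightarrow> y \<in> carrier A \<Longrightarrow> x \<oplus>\<^bsub>A\<^esub> y = y \<oplus>\<^bsub>A\<^esub> x"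
    and "x \<in> carrier A \<Longrightarrow> y \<in> carrier A \<Longrightarrow> z \<in> carrier A \<Longrightarrow> x \<oplus>\<^bsub>A\<^esub> (y \<oplus>\<^bsub>A\<^esub> z) = y \<oplus>\<^bsub>A\<^esub> (x \<oplus>\<^bsub>A\<^esub> z)"
proof -
  interpret A: module R A by fact
  show "x \<in> carrier A \<Longrightarrow> y \<in> carrier A \<Longrightarrow> z \<in> carrier A \<Longrightarrow> x \<oplus>\<^bsub>A\<^esub> y \<oplus>\<^bsub>A\<^esub> z = x \<oplus>\<^bsub>A\<^esub> (y \<oplus>\<^bsub>A\<^esub> z)"
    and "x \<in> carrier A \<Longrightarrow> y \<in> carrier A \<Longrightarrow> x \<oplus>\<^bsub>A\<^esub> y = y \<oplus>\<^bsub>A\<^esub> x"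
    and "x \<in> carrier A \<Longrightarrow> y \<in> carrier A \<Longrightarrow> z \<in> carrier A \<Longrightarrow> x \<oplus>\<^bsub>A\<^esub> (y \<oplus>\<^bsub>A\<^esub> z) = y \<oplus>\<^bsub>A\<^esub> (x \<oplus>\<^bsub>A\<^esub> z)"
    by (auto simp: A.M.a_ac)
qed

lemma module_diff:
  fixes A :: "('r, 'a) module"
  assumes "module R A" "x \<in> carrier A" "y \<in> carrier A"
  shows "x \<ominus>\<^bsub>A\<^esub> y = x \<oplus>\<^bsub>A\<^esub> \<ominus>\<^bsub>A\<^esub> y"
    and "\<ominus>\<^bsub>A\<^esub> (x \<oplus>\<^bsub>A\<^esub> y) = \<ominus>\<^bsub>A\<^esub> x \<oplus>\<^bsub>A\<^esub> \<ominus>\<^bsub>A\<^esub> y"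
    and "x \<ominus>\<^bsub>A\<^esub> y = \<zero>\<^bsub>A\<^esub> \<longleftrightarrow> x = y"
    and "x \<oplus>\<^bsub>A\<^esub> y = \<zero>\<^bsub>A\<^esub> \<longleftrightarrow> x = \<ominus>\<^bsub>A\<^esub> y"
    and "x \<ominus>\<^bsub>A\<^esub> y \<oplus>\<^bsub>A\<^esub> y = x"
    and "x \<oplus>\<^bsub>A\<^esub> y \<ominus>\<^bsub>A\<^esub> y = x"
    and "y \<oplus>\<^bsub>A\<^esub> (x \<ominus>\<^bsub>A\<^esub> y) = x"
proof -
  interpret A: module R A by fact
  show "x \<ominus>\<^bsub>A\<^esub> y = x \<oplus>\<^bsub>A\<^esub> \<ominus>\<^bsub>A\<^esub> y" by (simp add: A.M.minus_eq)
  show "\<ominus>\<^bsub>A\<^esub> (x \<oplus>\<^bsub>A\<^esub> y) = \<ominus>\<^bsub>A\<^esub> x \<oplus>\<^bsub>A\<^esub> \<ominus>\<^bsub>A\<^esub> y" using assms by (simp add: A.M.minus_add)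
  show "x \<oplus>\<^bsub>A\<^esub> y = \<zero>\<^bsub>A\<^esub> \<longleftrightarrow> x = \<ominus>\<^bsub>A\<^esub> y"
    using assms A.M.minus_equality by auto
  show "x \<ominus>\<^bsub>A\<^esub> y \<oplus>\<^bsub>A\<^esub> y = x" "x \<oplus>\<^bsub>A\<^esub> y \<ominus>\<^bsub>A\<^esub> y = x" "y \<oplus>\<^bsub>A\<^esub> (x \<ominus>\<^bsub>A\<^esub> y) = x"
    using assms by (simp_all add: A.M.minus_eq A.M.a_ac A.M.r_neg A.M.l_neg)
  then show "x \<ominus>\<^bsub>A\<^esub> y = \<zero>\<^bsub>A\<^esub> \<longleftrightarrow> x = y" using assms by force
qed

lemma module_smult:
  fixes A :: "('r, 'a) module"
  assumes "module R A" "x \<in> carrier A" "r \<in> carrier R"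
  shows "y \<in> carrier A \<Longrightarrow> r \<odot>\<^bsub>A\<^esub> (x \<oplus>\<^bsub>A\<^esub> y) = r \<odot>\<^bsub>A\<^esub> x \<oplus>\<^bsub>A\<^esub> r \<odot>\<^bsub>A\<^esub> y"
    and "s \<in> carrier R \<Longrightarrow> (r \<oplus> s) \<odot>\<^bsub>A\<^esub> x = r \<odot>\<^bsub>A\<^esub> x \<oplus>\<^bsub>A\<^esub> s \<odot>\<^bsub>A\<^esub> x"
    and "s \<in> carrier R \<Longrightarrow> (r \<otimes> s) \<odot>\<^bsub>A\<^esub> x = r \<odot>\<^bsub>A\<^esub> (s \<odot>\<^bsub>A\<^esub> x)"
    and "s \<in> carrier R \<Longrightarrow> r \<odot>\<^bsub>A\<^esub> (s \<odot>\<^bsub>A\<^esub> x) = s \<odot>\<^bsub>A\<^esub> (r \<odot>\<^bsub>A\<^esub> x)"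
    and "r \<odot>\<^bsub>A\<^esub> (\<ominus>\<^bsub>A\<^esub> x) = \<ominus>\<^bsub>A\<^esub> (r \<odot>\<^bsub>A\<^esub> x)"
    and "(\<ominus> r) \<odot>\<^bsub>A\<^esub> x = \<ominus>\<^bsub>A\<^esub> (r \<odot>\<^bsub>A\<^esub> x)"
    and "y \<in> carrier A \<Longrightarrow> r \<odot>\<^bsub>A\<^esub> (x \<ominus>\<^bsub>A\<^esub> y) = r \<odot>\<^bsub>A\<^esub> x \<ominus>\<^bsub>A\<^esub> r \<odot>\<^bsub>A\<^esub> y"
proof -
  interpret A: module R A by fact
  show "y \<in> carrier A \<Longrightarrow> r \<odot>\<^bsub>A\<^esub> (x \<oplus>\<^bsub>A\<^esub> y) = r \<odot>\<^bsub>A\<^esub> x \<oplus>\<^bsub>A\<^esub> r \<odot>\<^bsub>A\<^esub> y"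
    "s \<in> carrier R \<Longrightarrow> (r \<oplus> s) \<odot>\<^bsub>A\<^esub> x = r \<odot>\<^bsub>A\<^esub> x \<oplus>\<^bsub>A\<^esub> s \<odot>\<^bsub>A\<^esub> x"
    "s \<in> carrier R \<Longrightarrow> (r \<otimes> s) \<odot>\<^bsub>A\<^esub> x = r \<odot>\<^bsub>A\<^esub> (s \<odot>\<^bsub>A\<^esub> x)"
    using assms by (auto simp: A.smult_r_distr A.smult_l_distr A.smult_assoc1)
  show "s \<in> carrier R \<Longrightarrow> r \<odot>\<^bsub>A\<^esub> (s \<odot>\<^bsub>A\<^esub> x) = s \<odot>\<^bsub>A\<^esub> (r \<odot>\<^bsub>A\<^esub> x)"
    using assms by (metis A.smult_assoc1 m_comm)
  show "r \<odot>\<^bsub>A\<^esub> (\<ominus>\<^bsub>A\<^esub> x) = \<ominus>\<^bsub>A\<^esub> (r \<odot>\<^bsub>A\<^esub> x)"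
    "(\<ominus> r) \<odot>\<^bsub>A\<^esub> x = \<ominus>\<^bsub>A\<^esub> (r \<odot>\<^bsub>A\<^esub> x)"
    "y \<in> carrier A \<Longrightarrow> r \<odot>\<^bsub>A\<^esub> (x \<ominus>\<^bsub>A\<^esub> y) = r \<odot>\<^bsub>A\<^esub> x \<ominus>\<^bsub>A\<^esub> r \<odot>\<^bsub>A\<^esub> y"
    using assms by (auto simp: A.smult_r_minus A.smult_l_minus A.smult_r_distr A.M.minus_eq)
qed

text \<open>Homomorphisms are extensional, so a plain function becomes one only after restriction to
  \<open>carrier A\<close>; \<open>module R A\<close> keeps the sums and multiples in the two
  equations inside that domain.\<close>

lemma mod_homI:
  assumes "\<And>x. x \<in> carrier A \<Longrightarrow> f x \<in> carrier B"
    and "\<And>x y. x \<in> carrier A \<Longrightarrow> y \<in> carrier A \<Longrightarrow> f (x \<oplus>\<^bsub>A\<^esub> y) = f x \<oplus>\<^bsub>B\<^esub> f y"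
    and "\<And>r x. r \<in> carrier R \<Longrightarrow> x \<in> carrier A \<Longrightarrow> f (r \<odot>\<^bsub>A\<^esub> x) = r \<odot>\<^bsub>B\<^esub> f x"
    and "module R A"
  shows "(\<lambda>x\<in>carrier A. f x) \<in> Hom A B"
  using assms by (auto simp: mod_hom_def)

lemma homD:
  assumes "f \<in> Hom A B"
  shows "x \<in> carrier A \<Longrightarrow> f x \<in> carrier B"
    and "x \<in> carrier A \<Longrightarrow> y \<in> carrier A \<Longrightarrow> f (x \<oplus>\<^bsub>A\<^esub> y) = f x \<oplus>\<^bsub>B\<^esub> f y"
    and "r \<in> carrier R \<Longrightarrow> x \<in> carrier A \<Longrightarrow> f (r \<odot>\<^bsub>A\<^esub> x) = r \<odot>\<^bsub>B\<^esub> f x"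
    and "f \<in> extensional (carrier A)"
  using assms by (auto simp: mod_hom_def PiE_def)

lemma hom_zero_neg:
  assumes "f \<in> Hom A B" "module R A" "module R B"
  shows "f \<zero>\<^bsub>A\<^esub> = \<zero>\<^bsub>B\<^esub>"
    and "x \<in> carrier A \<Longrightarrow> f (\<ominus>\<^bsub>A\<^esub> x) = \<ominus>\<^bsub>B\<^esub> f x"
    and "x \<in> carrier A \<Longrightarrow> y \<in> carrier A \<Longrightarrow> f (x \<ominus>\<^bsub>A\<^esub> y) = f x \<ominus>\<^bsub>B\<^esub> f y"
proof -
  show z: "f \<zero>\<^bsub>A\<^esub> = \<zero>\<^bsub>B\<^esub>"
    using homD(3)[OF assms(1), of "\<zero>" "\<zero>\<^bsub>A\<^esub>"] homD(1)[OF assms(1), of "\<zero>\<^bsub>A\<^esub>"] assms by auto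
  show n: "x \<in> carrier A \<Longrightarrow> f (\<ominus>\<^bsub>A\<^esub> x) = \<ominus>\<^bsub>B\<^esub> f x" for x
    using homD(2)[OF assms(1), of "\<ominus>\<^bsub>A\<^esub> x" x] z homD(1)[OF assms(1)] assms
      module_diff(4)[of B "f (\<ominus>\<^bsub>A\<^esub> x)" "f x"] by auto
  show "x \<in> carrier A \<Longrightarrow> y \<in> carrier A \<Longrightarrow> f (x \<ominus>\<^bsub>A\<^esub> y) = f x \<ominus>\<^bsub>B\<^esub> f y"
    using assms n homD(1,2)[OF assms(1)] by (simp add: module_diff(1))
qed

lemma hom_eqI:
  assumes "f \<in> Hom A B" "g \<in> Hom A B" "\<And>x. x \<in> carrier A \<Longrightarrow> f x = g x"
  shows "f = g"
  using assms homD(4) extensionalityI by metis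

lemma hom_compose:
  assumes "module R A" "f \<in> Hom A B" "g \<in> Hom B C"
  shows "compose (carrier A) g f \<in> Hom A C"
  using assms by (auto simp: mod_hom_def compose_def PiE_def Pi_def)

lemma hom_id: "module R A \<Longrightarrow> (\<lambda>x\<in>carrier A. x) \<in> Hom A A"
  by (rule mod_homI) auto

lemma hom_zero: "module R A \<Longrightarrow> module R B \<Longrightarrow> (\<lambda>x\<in>carrier A. \<zero>\<^bsub>B\<^esub>) \<in> Hom A B"
  by (rule mod_homI) auto

text \<open>Additive inverses need no premise of their own: scaling by
  \<open>\<ominus> \<one>\<close> produces them as soon as scaling by \<open>\<zero>\<close> gives
  zero. This shortens the verification for the modules built below.\<close>

lemma moduleI2:
  fixes A :: "('r, 'a) module"
  assumes "\<And>x y. x \<in> carrier A \<Longrightarrow> y \<in> carrier A \<Longrightarrow> x \<oplus>\<^bsub>A\<^esub> y \<in> carrier A"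
    and "\<zero>\<^bsub>A\<^esub> \<in> carrier A"
    and "\<And>r x. r \<in> carrier R \<Longrightarrow> x \<in> carrier A \<Longrightarrow> r \<odot>\<^bsub>A\<^esub> x \<in> carrier A"
    and "\<And>x y z. x \<in> carrier A \<Longrightarrow> y \<in> carrier A \<Longrightarrow> z \<in> carrier A \<Longrightarrow> x \<oplus>\<^bsub>A\<^esub> y \<oplus>\<^bsub>A\<^esub> z = x \<oplus>\<^bsub>A\<^esub>
        (y \<oplus>\<^bsub>A\<^esub> z)"
    and "\<And>x y. x \<in> carrier A \<Longrightarrow> y \<in> carrier A \<Longrightarrow> x \<oplus>\<^bsub>A\<^esub> y = y \<oplus>\<^bsub>A\<^esub> x"
    and "\<And>x. x \<in> carrier A \<Longrightarrow> \<zero>\<^bsub>A\<^esub> \<oplus>\<^bsub>A\<^esub> x = x"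
    and "\<And>r s x. r \<in> carrier R \<Longrightarrow> s \<in> carrier R \<Longrightarrow> x \<in> carrier A \<Longrightarrow> (r \<oplus> s) \<odot>\<^bsub>A\<^esub> x = r \<odot>\<^bsub>A\<^esub> x \<oplus>\<^bsub>A\<^esub> s
        \<odot>\<^bsub>A\<^esub> x"
    and "\<And>r x y. r \<in> carrier R \<Longrightarrow> x \<in> carrier A \<Longrightarrow> y \<in> carrier A \<Longrightarrow> r \<odot>\<^bsub>A\<^esub> (x \<oplus>\<^bsub>A\<^esub> y) = r \<odot>\<^bsub>A\<^esub> x \<oplus>\<^bsub>A\<^esub>
        r \<odot>\<^bsub>A\<^esub> y"
    and "\<And>r s x. r \<in> carrier R \<Longrightarrow> s \<in> carrier R \<Longrightarrow> x \<in> carrier A \<Longrightarrow> (r \<otimes> s) \<odot>\<^bsub>A\<^esub> x = r \<odot>\<^bsub>A\<^esub> (s \<odot>\<^bsub>A\<^esub> x)"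
    and one: "\<And>x. x \<in> carrier A \<Longrightarrow> \<one> \<odot>\<^bsub>A\<^esub> x = x"
    and zero: "\<And>x. x \<in> carrier A \<Longrightarrow> \<zero> \<odot>\<^bsub>A\<^esub> x = \<zero>\<^bsub>A\<^esub>"
  shows "module R A"
proof (rule moduleI)
  show "cring R" by (rule is_cring)
  show "abelian_group A"
  proof (rule abelian_groupI)
    fix x assume x: "x \<in> carrier A"
    have "(\<ominus> \<one>) \<odot>\<^bsub>A\<^esub> x \<oplus>\<^bsub>A\<^esub> x = (\<ominus> \<one> \<oplus> \<one>) \<odot>\<^bsub>A\<^esub> x"
      using x assms(7)[of "\<ominus> \<one>" "\<one>" x] one by simp
    also have "\<dots> = \<zero>\<^bsub>A\<^esub>" using x zero by (simp add: l_neg)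
    finally show "\<exists>y\<in>carrier A. y \<oplus>\<^bsub>A\<^esub> x = \<zero>\<^bsub>A\<^esub>" using x assms(3)[of "\<ominus> \<one>" x] by auto
  qed (use assms in auto)
qed (use assms in auto)

section \<open>Submodules, kernels and images\<close>

lemma submoduleI2:
  fixes A :: "('r, 'a) module"
  assumes "module R A" "H \<subseteq> carrier A" "\<zero>\<^bsub>A\<^esub> \<in> H"
    "\<And>a b. a \<in> H \<Longrightarrow> b \<in> H \<Longrightarrow> a \<oplus>\<^bsub>A\<^esub> b \<in> H"
    "\<And>r a. r \<in> carrier R \<Longrightarrow> a \<in> H \<Longrightarrow> r \<odot>\<^bsub>A\<^esub> a \<in> H"
  shows "submodule H R A"
proof -
  interpret A: module R A by fact
  show ?thesis
  proof (rule A.submoduleI)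
    fix a assume a: "a \<in> H"
    then have "\<ominus>\<^bsub>A\<^esub> a = (\<ominus> \<one>) \<odot>\<^bsub>A\<^esub> a" using assms(1,2) by (auto simp: module_smult(6))
    then show "\<ominus>\<^bsub>A\<^esub> a \<in> H" using a assms(5)[of "\<ominus> \<one>" a] by simp
  qed (use assms in auto)
qed

lemma submoduleD:
  fixes A :: "('r, 'a) module"
  assumes "module R A" "submodule H R A"
  shows "H \<subseteq> carrier A" "\<zero>\<^bsub>A\<^esub> \<in> H"
    "\<And>a b. a \<in> H \<Longrightarrow> b \<in> H \<Longrightarrow> a \<oplus>\<^bsub>A\<^esub> b \<in> H"
    "\<And>a. a \<in> H \<Longrightarrow> \<ominus>\<^bsub>A\<^esub> a \<in> H"
    "\<And>a b. a \<in> H \<Longrightarrow> b \<in> H \<Longrightarrow> a \<ominus>\<^bsub>A\<^esub> b \<in> H"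
    "\<And>r a. r \<in> carrier R \<Longrightarrow> a \<in> H \<Longrightarrow> r \<odot>\<^bsub>A\<^esub> a \<in> H"
proof -
  interpret A: module R A by fact
  note E = A.submoduleE[OF assms(2)]
  show "H \<subseteq> carrier A" "\<And>a b. a \<in> H \<Longrightarrow> b \<in> H \<Longrightarrow> a \<oplus>\<^bsub>A\<^esub> b \<in> H"
    "\<And>a. a \<in> H \<Longrightarrow> \<ominus>\<^bsub>A\<^esub> a \<in> H" "\<And>r a. r \<in> carrier R \<Longrightarrow> a \<in> H \<Longrightarrow> r \<odot>\<^bsub>A\<^esub> a \<in> H"
    using E by auto
  obtain h where h: "h \<in> H" using E(2) by auto
  then have "h \<oplus>\<^bsub>A\<^esub> \<ominus>\<^bsub>A\<^esub> h \<in> H" using E by auto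
  then show "\<zero>\<^bsub>A\<^esub> \<in> H" using h E(1) assms(1) by auto
  fix a b assume "a \<in> H" "b \<in> H"
  then show "a \<ominus>\<^bsub>A\<^esub> b \<in> H" using E by (auto simp: A.M.minus_eq)
qed

text \<open>Elements and operations are literally those of \<open>A\<close>, so an inclusion is a
  restricted identity and a corestricted map is the same function.\<close>

definition submod :: "('r, 'a) module \<Rightarrow> 'a set \<Rightarrow> ('r, 'a) module"
  where "submod A H = A\<lparr>carrier := H\<rparr>"

lemma submod_simps [simp]:
  "carrier (submod A H) = H" "\<zero>\<^bsub>submod A H\<^esub> = \<zero>\<^bsub>A\<^esub>" "x \<oplus>\<^bsub>submod A H\<^esub> y = x \<oplus>\<^bsub>A\<^esub> y"
  "r \<odot>\<^bsub>submod A H\<^esub> x = r \<odot>\<^bsub>A\<^esub> x"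
  by (simp_all add: submod_def)

lemma module_submod: "module R A \<Longrightarrow> submodule H R A \<Longrightarrow> module R (submod A H)"
  unfolding submod_def by (rule submodule.submodule_is_module)

lemma submod_incl: "module R A \<Longrightarrow> submodule H R A \<Longrightarrow> (\<lambda>x\<in>H. x) \<in> Hom (submod A H) A"
  using submoduleD(1,3,6)[of A H] by (auto simp: mod_hom_def)

lemma kernel_submodule:
  assumes "module R A" "module R B" "f \<in> Hom A B"
  shows "submodule {x \<in> carrier A. f x = \<zero>\<^bsub>B\<^esub>} R A"
  using assms by (intro submoduleI2) (auto simp: homD hom_zero_neg)

lemma image_submodule:
  assumes "module R A" "module R B" "f \<in> Hom A B"
  shows "submodule (f ` carrier A) R B"
proof (rule submoduleI2)
  fix a b assume "a \<in> f ` carrier A" "b \<in> f ` carrier A"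
  then show "a \<oplus>\<^bsub>B\<^esub> b \<in> f ` carrier A"
    using assms homD(2)[OF assms(3)] by (metis (no_types, lifting) image_iff module_addI(1))
next
  fix r a assume "r \<in> carrier R" "a \<in> f ` carrier A"
  then show "r \<odot>\<^bsub>B\<^esub> a \<in> f ` carrier A"
    using assms homD(3)[OF assms(3)] by (metis (no_types, lifting) image_iff module_addI(5))
next
  show "\<zero>\<^bsub>B\<^esub> \<in> f ` carrier A" using assms by (metis hom_zero_neg(1) image_eqI module_addI(2))
qed (use assms homD(1) in auto)

lemma exact_at_iff:
  "exact_at A f B g C \<longleftrightarrow> f ` carrier A = {x \<in> carrier B. g x = \<zero>\<^bsub>C\<^esub>}"
  by (simp add: exact_at_def a_kernel_def kernel_def)

section \<open>Modules of homomorphisms\<close>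

lemma module_hom_module:
  fixes A :: "('r, 'a) module" and B :: "('r, 'b) module"
  assumes "module R A" "module R B"
  shows "module R (hom_module R A B)"
proof -
  interpret A: module R A by fact
  interpret B: module R B by fact
  show ?thesis
  proof (rule moduleI2)
    fix f g assume "f \<in> carrier (hom_module R A B)" "g \<in> carrier (hom_module R A B)"
    then have f: "f \<in> Hom A B" and g: "g \<in> Hom A B" by (simp_all add: hom_module_def)
    show "f \<oplus>\<^bsub>hom_module R A B\<^esub> g \<in> carrier (hom_module R A B)"
      unfolding hom_module_def
      by simp (rule mod_homI, use homD[OF f] homD[OF g] assms in \<open>auto simp: module_smult B.M.a_ac\<close>)
    show "f \<oplus>\<^bsub>hom_module R A B\<^esub> g = g \<oplus>\<^bsub>hom_module R A B\<^esub> f"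
      using homD[OF f] homD[OF g] by (auto simp: hom_module_def B.M.a_ac fun_eq_iff)
  next
    fix r f assume r: "r \<in> carrier R" and "f \<in> carrier (hom_module R A B)"
    then have f: "f \<in> Hom A B" by (simp_all add: hom_module_def)
    show "r \<odot>\<^bsub>hom_module R A B\<^esub> f \<in> carrier (hom_module R A B)"
      unfolding hom_module_def
      by simp (rule mod_homI, use homD[OF f] r assms in \<open>auto simp: module_smult\<close>)
  next
    show "\<zero>\<^bsub>hom_module R A B\<^esub> \<in> carrier (hom_module R A B)"
      using assms by (simp add: hom_module_def hom_zero)
  next
    fix r s f assume rs: "r \<in> carrier R" "s \<in> carrier R" and "f \<in> carrier (hom_module R A B)"
    then have f: "f \<in> Hom A B" by (simp_all add: hom_module_def)
    show "(r \<oplus> s) \<odot>\<^bsub>hom_module R A B\<^esub> f = r \<odot>\<^bsub>hom_module R A B\<^esub> f \<oplus>\<^bsub>hom_module R A B\<^esub> s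
        \<odot>\<^bsub>hom_module R A B\<^esub> f"
      "(r \<otimes> s) \<odot>\<^bsub>hom_module R A B\<^esub> f = r \<odot>\<^bsub>hom_module R A B\<^esub> (s \<odot>\<^bsub>hom_module R A B\<^esub> f)"
      using homD(1)[OF f] rs assms by (auto simp: hom_module_def fun_eq_iff module_smult)
  next
    fix f assume "f \<in> carrier (hom_module R A B)"
    then have f: "f \<in> Hom A B" by (simp_all add: hom_module_def)
    have ext: "f x = undefined" if "x \<notin> carrier A" for x
      using extensional_arb[OF homD(4)[OF f] that] .
    show "\<zero>\<^bsub>hom_module R A B\<^esub> \<oplus>\<^bsub>hom_module R A B\<^esub> f = f" "\<one> \<odot>\<^bsub>hom_module R A B\<^esub> f = f"
      "\<zero> \<odot>\<^bsub>hom_module R A B\<^esub> f = \<zero>\<^bsub>hom_module R A B\<^esub>"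
      using homD(1)[OF f] assms by (auto simp: hom_module_def fun_eq_iff ext)
  next
    fix r f g assume r: "r \<in> carrier R" and "f \<in> carrier (hom_module R A B)"
        "g \<in> carrier (hom_module R A B)"
    then have "f \<in> Hom A B" "g \<in> Hom A B" by (simp_all add: hom_module_def)
    note fg = homD(1)[OF this(1)] homD(1)[OF this(2)]
    show "r \<odot>\<^bsub>hom_module R A B\<^esub> (f \<oplus>\<^bsub>hom_module R A B\<^esub> g) = r \<odot>\<^bsub>hom_module R A B\<^esub> f
        \<oplus>\<^bsub>hom_module R A B\<^esub> r \<odot>\<^bsub>hom_module R A B\<^esub> g"
      using r assms fg by (auto simp: hom_module_def fun_eq_iff module_smult)
  next
    fix f g h assume "f \<in> carrier (hom_module R A B)" "g \<in> carrier (hom_module R A B)"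
        "h \<in> carrier (hom_module R A B)"
    then have "f \<in> Hom A B" "g \<in> Hom A B" "h \<in> Hom A B" by (simp_all add: hom_module_def)
    note fgh = homD(1)[OF this(1)] homD(1)[OF this(2)] homD(1)[OF this(3)]
    show "f \<oplus>\<^bsub>hom_module R A B\<^esub> g \<oplus>\<^bsub>hom_module R A B\<^esub> h = f \<oplus>\<^bsub>hom_module R A B\<^esub>
        (g \<oplus>\<^bsub>hom_module R A B\<^esub> h)"
      using fgh by (auto simp: hom_module_def fun_eq_iff B.M.a_assoc)
  qed
qed

lemma hom_module_simps:
  fixes A :: "('r, 'a) module" and B :: "('r, 'b) module"
  shows
  "carrier (hom_module R A B) = Hom A B"
  "x \<in> carrier A \<Longrightarrow> \<zero>\<^bsub>hom_module R A B\<^esub> x = \<zero>\<^bsub>B\<^esub>"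
  "x \<in> carrier A \<Longrightarrow> (f \<oplus>\<^bsub>hom_module R A B\<^esub> g) x = f x \<oplus>\<^bsub>B\<^esub> g x"
  "x \<in> carrier A \<Longrightarrow> (r \<odot>\<^bsub>hom_module R A B\<^esub> f) x = r \<odot>\<^bsub>B\<^esub> f x"
  by (simp_all add: hom_module_def)

text \<open>Negation in \<open>hom_module\<close> exists only as an abstract additive inverse.
  Evaluation at \<open>x\<close> is a homomorphism, and homomorphisms respect negatives and
  differences.\<close>

lemma hom_module_minus:
  fixes A :: "('r, 'a) module" and B :: "('r, 'b) module"
  assumes "module R A" "module R B" "x \<in> carrier A" "f \<in> Hom A B"
  shows "(\<ominus>\<^bsub>hom_module R A B\<^esub> f) x = \<ominus>\<^bsub>B\<^esub> f x"
    "g \<in> Hom A B \<Longrightarrow> (f \<ominus>\<^bsub>hom_module R A B\<^esub> g) x = f x \<ominus>\<^bsub>B\<^esub> g x"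
proof -
  let ?H = "hom_module R A B"
  have ev: "(\<lambda>f\<in>carrier ?H. f x) \<in> Hom ?H B"
    using assms by (intro mod_homI) (auto simp: hom_module_simps homD module_hom_module)
  note z = hom_zero_neg[OF ev module_hom_module[OF assms(1,2)] assms(2)]
  show "(\<ominus>\<^bsub>hom_module R A B\<^esub> f) x = \<ominus>\<^bsub>B\<^esub> f x"
    using z(2)[of f] assms module_addI(3)[OF module_hom_module[OF assms(1,2)], of f]
      by (simp add: hom_module_simps)
  show "g \<in> Hom A B \<Longrightarrow> (f \<ominus>\<^bsub>hom_module R A B\<^esub> g) x = f x \<ominus>\<^bsub>B\<^esub> g x"
    using z(3)[of f g] assms module_addI(4)[OF module_hom_module[OF assms(1,2)], of f g]
      by (simp add: hom_module_simps)
qed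

section \<open>Quotient modules and factorization\<close>

definition quot_map :: "('r, 'a) module \<Rightarrow> 'a set \<Rightarrow> 'a \<Rightarrow> 'a set"
  where "quot_map A H = (\<lambda>x\<in>carrier A. H +>\<^bsub>A\<^esub> x)"

lemma quotient_module:
  fixes A :: "('r, 'a) module"
  assumes A: "module R A" and H: "submodule H R A"
  shows module_quotient: "module R (quotient_module A H)"
    and quot_map_hom: "quot_map A H \<in> Hom A (quotient_module A H)"
    and quot_map_surj: "quot_map A H ` carrier A = carrier (quotient_module A H)"
    and quot_map_eq_iff: "x \<in> carrier A \<Longrightarrow> y \<in> carrier A \<Longrightarrow> quot_map A H x = quot_map A H y \<longleftrightarrow>
        x \<ominus>\<^bsub>A\<^esub> y \<in> H"
    and quot_map_zero_iff: "x \<in> carrier A \<Longrightarrow> quot_map A H x = \<zero>\<^bsub>quotient_module A H\<^esub> \<longleftrightarrow> x \<in> H"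
proof -
  interpret A: module R A by fact
  have sg: "subgroup H (add_monoid A)" using H by (rule submodule.axioms)
  interpret H: abelian_subgroup H A
    by (rule abelian_subgroupI3) (use sg in \<open>auto intro: additive_subgroup.intro
        A.M.abelian_group_axioms\<close>)
  let ?Q = "quotient_module A H"
  let ?p = "quot_map A H"
  note HD = submoduleD[OF A H]
  have surj: "?p ` carrier A = carrier ?Q"
    by (auto simp: quot_map_def quotient_module_def A_RCOSETS_def')
  have eq: "?p x = ?p y \<longleftrightarrow> x \<ominus>\<^bsub>A\<^esub> y \<in> H" if xy: "x \<in> carrier A" "y \<in> carrier A" for x y
  proof -
    have "H +>\<^bsub>A\<^esub> x = H +>\<^bsub>A\<^esub> y \<longleftrightarrow> x \<in> H +>\<^bsub>A\<^esub> y"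
      using H.a_rcos_self[OF xy(1)] H.a_repr_independence'[of x y] xy by metis
    also have "\<dots> \<longleftrightarrow> x \<oplus>\<^bsub>A\<^esub> \<ominus>\<^bsub>A\<^esub> y \<in> H" using H.a_rcos_module[of y x] xy by simp
    finally show ?thesis using xy A by (simp add: quot_map_def module_diff(1))
  qed
  have zero: "\<zero>\<^bsub>?Q\<^esub> = ?p \<zero>\<^bsub>A\<^esub>"
    by (simp add: quotient_module_def quot_map_def A.M.a_coset_add_zero HD(1))
  have add: "?p x \<oplus>\<^bsub>?Q\<^esub> ?p y = ?p (x \<oplus>\<^bsub>A\<^esub> y)" if "x \<in> carrier A" "y \<in> carrier A" for x y
    using that H.a_rcos_sum[of x y] by (simp add: quotient_module_def quot_map_def)
  have smult: "r \<odot>\<^bsub>?Q\<^esub> ?p x = ?p (r \<odot>\<^bsub>A\<^esub> x)" if "r \<in> carrier R" "x \<in> carrier A" for r x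
  proof -
    \<comment> \<open>In \<open>quotient_module\<close> a scalar multiple of a coset is a union over
      all its representatives. Any two of them give the same coset, so the union collapses to a
      single one.\<close>
    have *: "H +>\<^bsub>A\<^esub> (r \<odot>\<^bsub>A\<^esub> y) = H +>\<^bsub>A\<^esub> (r \<odot>\<^bsub>A\<^esub> x)" if y: "y \<in> H +>\<^bsub>A\<^esub> x" for y
    proof -
      obtain h where h: "h \<in> H" "y = h \<oplus>\<^bsub>A\<^esub> x" using y by (auto simp: a_r_coset_def')
      have hA: "h \<in> carrier A" using h HD(1) by auto
      have "r \<odot>\<^bsub>A\<^esub> y \<ominus>\<^bsub>A\<^esub> r \<odot>\<^bsub>A\<^esub> x = r \<odot>\<^bsub>A\<^esub> h"
        using h hA that(1) \<open>x \<in> carrier A\<close> \<open>r \<in> carrier R\<close> A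
        by (simp add: module_smult(1) module_diff(6))
      then show ?thesis using eq[of "r \<odot>\<^bsub>A\<^esub> y" "r \<odot>\<^bsub>A\<^esub> x"] h HD(6)[OF \<open>r \<in> carrier R\<close> h(1)] hA A
          \<open>x \<in> carrier A\<close> \<open>r \<in> carrier R\<close>
        by (simp add: quot_map_def)
    qed
    have "x \<in> H +>\<^bsub>A\<^esub> x" using that H.a_rcos_self by auto
    then have "(\<Union>y\<in>H +>\<^bsub>A\<^esub> x. H +>\<^bsub>A\<^esub> (r \<odot>\<^bsub>A\<^esub> y)) = H +>\<^bsub>A\<^esub> (r \<odot>\<^bsub>A\<^esub> x)" using * by blast
    then show ?thesis using that A by (simp add: quotient_module_def quot_map_def)
  qed
  have QE: "\<exists>x\<in>carrier A. X = ?p x" if "X \<in> carrier ?Q" for X using that surj by auto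
  have pc: "?p x \<in> carrier ?Q" if "x \<in> carrier A" for x using that surj by auto
  show "module R ?Q"
  proof (rule moduleI2)
    fix x y assume "x \<in> carrier ?Q" "y \<in> carrier ?Q"
    then obtain a b where ab: "a \<in> carrier A" "b \<in> carrier A" "x = ?p a" "y = ?p b" using QE
      by meson
    show "x \<oplus>\<^bsub>?Q\<^esub> y \<in> carrier ?Q" "x \<oplus>\<^bsub>?Q\<^esub> y = y \<oplus>\<^bsub>?Q\<^esub> x" using ab A
      by (simp_all add: add pc A.M.a_comm)
    fix z assume "z \<in> carrier ?Q"
    then obtain c where "c \<in> carrier A" "z = ?p c" using QE by meson
    then show "x \<oplus>\<^bsub>?Q\<^esub> y \<oplus>\<^bsub>?Q\<^esub> z = x \<oplus>\<^bsub>?Q\<^esub> (y \<oplus>\<^bsub>?Q\<^esub> z)" using ab A by (simp add: add A.M.a_assoc)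
  next
    fix r s x y assume r: "r \<in> carrier R" and "x \<in> carrier ?Q" "y \<in> carrier ?Q"
    then obtain a b where ab: "a \<in> carrier A" "b \<in> carrier A" "x = ?p a" "y = ?p b" using QE
      by meson
    show "r \<odot>\<^bsub>?Q\<^esub> (x \<oplus>\<^bsub>?Q\<^esub> y) = r \<odot>\<^bsub>?Q\<^esub> x \<oplus>\<^bsub>?Q\<^esub> r \<odot>\<^bsub>?Q\<^esub> y"
      using ab r A by (simp add: add smult module_smult)
  next
    fix r s x assume r: "r \<in> carrier R" "s \<in> carrier R" and "x \<in> carrier ?Q"
    then obtain a where ab: "a \<in> carrier A" "x = ?p a" using QE by meson
    show "(r \<oplus> s) \<odot>\<^bsub>?Q\<^esub> x = r \<odot>\<^bsub>?Q\<^esub> x \<oplus>\<^bsub>?Q\<^esub> s \<odot>\<^bsub>?Q\<^esub> x"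
      "(r \<otimes> s) \<odot>\<^bsub>?Q\<^esub> x = r \<odot>\<^bsub>?Q\<^esub> (s \<odot>\<^bsub>?Q\<^esub> x)"
      using ab r A by (simp_all add: add smult module_smult)
  next
    fix r x assume r: "r \<in> carrier R" and "x \<in> carrier ?Q"
    then obtain a where ab: "a \<in> carrier A" "x = ?p a" using QE by meson
    show "r \<odot>\<^bsub>?Q\<^esub> x \<in> carrier ?Q" using ab r A by (simp add: smult pc)
  next
    fix x assume "x \<in> carrier ?Q"
    then obtain a where ab: "a \<in> carrier A" "x = ?p a" using QE by meson
    show "\<zero>\<^bsub>?Q\<^esub> \<oplus>\<^bsub>?Q\<^esub> x = x" "\<one> \<odot>\<^bsub>?Q\<^esub> x = x" "\<zero> \<odot>\<^bsub>?Q\<^esub> x = \<zero>\<^bsub>?Q\<^esub>"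
      using ab A by (simp_all add: add smult zero)
  next
    show "\<zero>\<^bsub>?Q\<^esub> \<in> carrier ?Q" using A by (simp add: pc zero)
  qed
  show "?p \<in> Hom A ?Q"
    using A pc by (auto simp: mod_hom_def add smult PiE_def) (simp add: quot_map_def
        extensional_def)
  show "?p ` carrier A = carrier ?Q" by fact
  show "x \<in> carrier A \<Longrightarrow> y \<in> carrier A \<Longrightarrow> ?p x = ?p y \<longleftrightarrow> x \<ominus>\<^bsub>A\<^esub> y \<in> H" by (rule eq)
  show "x \<in> carrier A \<Longrightarrow> ?p x = \<zero>\<^bsub>?Q\<^esub> \<longleftrightarrow> x \<in> H" using eq[of x "\<zero>\<^bsub>A\<^esub>"] A zero by simp
qed

text \<open>A set-theoretic section \<open>s\<close> of \<open>q\<close> suffices: since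
  \<open>f\<close> kills the kernel of \<open>q\<close>, the value \<open>f (s y)\<close> does not
  depend on the preimage, and this independence also gives linearity.\<close>

lemma hom_factor:
  assumes "module R A" "module R B" "module R C" "q \<in> Hom A B" "q ` carrier A = carrier B"
      "f \<in> Hom A C"
    and ker: "\<And>x. x \<in> carrier A \<Longrightarrow> q x = \<zero>\<^bsub>B\<^esub> \<Longrightarrow> f x = \<zero>\<^bsub>C\<^esub>"
  obtains g where "g \<in> Hom B C" "\<And>x. x \<in> carrier A \<Longrightarrow> g (q x) = f x"
proof -
  define s where "s y = (SOME x. x \<in> carrier A \<and> q x = y)" for y
  have s: "s y \<in> carrier A" "q (s y) = y" if "y \<in> carrier B" for y
  proof -
    have "\<exists>x. x \<in> carrier A \<and> q x = y" using that assms(5) by (metis imageE)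
    then have "s y \<in> carrier A \<and> q (s y) = y" unfolding s_def by (rule someI_ex)
    then show "s y \<in> carrier A" "q (s y) = y" by auto
  qed
  have eq: "f x = f y" if "x \<in> carrier A" "y \<in> carrier A" "q x = q y" for x y
  proof -
    have "q (x \<ominus>\<^bsub>A\<^esub> y) = \<zero>\<^bsub>B\<^esub>" using that assms homD(1)[OF assms(4)] by (simp add: hom_zero_neg)
    then have "f (x \<ominus>\<^bsub>A\<^esub> y) = \<zero>\<^bsub>C\<^esub>" using ker that assms by auto
    then have "f x \<ominus>\<^bsub>C\<^esub> f y = \<zero>\<^bsub>C\<^esub>" using that assms by (simp add: hom_zero_neg)
    then show ?thesis using that assms homD(1)[OF assms(6)] by (simp add: module_diff)
  qed
  define g where "g = (\<lambda>y\<in>carrier B. f (s y))"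
  have g: "g (q x) = f x" if "x \<in> carrier A" for x
    using that eq[of "s (q x)" x] s[of "q x"] homD(1)[OF assms(4)] by (simp add: g_def)
  have "g \<in> Hom B C"
    unfolding g_def
  proof (rule mod_homI)
    fix x y assume xy: "x \<in> carrier B" "y \<in> carrier B"
    have "f (s (x \<oplus>\<^bsub>B\<^esub> y)) = f (s x \<oplus>\<^bsub>A\<^esub> s y)"
      by (rule eq) (use xy s assms(1-3) in \<open>simp_all add: homD(2)[OF assms(4)]\<close>)
    then show "f (s (x \<oplus>\<^bsub>B\<^esub> y)) = f (s x) \<oplus>\<^bsub>C\<^esub> f (s y)" using s xy assms(1-3)
      by (simp add: homD(2)[OF assms(6)])
  next
    fix r x assume xy: "r \<in> carrier R" "x \<in> carrier B"
    have "f (s (r \<odot>\<^bsub>B\<^esub> x)) = f (r \<odot>\<^bsub>A\<^esub> s x)"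
      by (rule eq) (use xy s assms(1-3) in \<open>simp_all add: homD(3)[OF assms(4)]\<close>)
    then show "f (s (r \<odot>\<^bsub>B\<^esub> x)) = r \<odot>\<^bsub>C\<^esub> f (s x)" using s xy assms(1-3)
      by (simp add: homD(3)[OF assms(6)])
  qed (use s homD(1)[OF assms(6)] assms(2) in auto)
  then show ?thesis using g that by blast
qed

end

section \<open>Cardinality and transfer to the universe\<close>

lemma infinite_times_eqpoll_self: "infinite A \<Longrightarrow> A \<times> A \<approx> A"
  by (simp add: card_of_Times_same_infinite eqpoll_iff_card_of_ordIso)

text \<open>Iterating an injective pairing codes lists of one fixed length injectively; pairing the
  code with the length separates lists of different lengths.\<close>

lemma lists_lepoll:
  assumes "infinite (UNIV :: 'u set)"
  shows "(UNIV :: 'u list set) \<lesssim> (UNIV :: 'u set)"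
proof -
  obtain p :: "'u \<times> 'u \<Rightarrow> 'u" where p: "inj p"
    using infinite_times_eqpoll_self[OF assms] by (auto simp: eqpoll_def bij_betw_def)
  obtain c :: "nat \<Rightarrow> 'u" where c: "inj c"
    using assms infinite_countable_subset by blast
  define code :: "'u list \<Rightarrow> 'u" where "code xs = foldr (\<lambda>x y. p (x, y)) xs (c 0)" for xs
  have code: "xs = ys" if "length xs = length ys" "code xs = code ys" for xs ys
    using that by (induction xs ys rule: list_induct2) (auto simp: code_def dest: injD[OF p])
  have "inj (\<lambda>xs. p (c (length xs), code xs))"
  proof (rule injI)
    fix xs ys assume "p (c (length xs), code xs) = p (c (length ys), code ys)"
    then have "c (length xs) = c (length ys)" "code xs = code ys" using injD[OF p] by blast+
    then show "xs = ys" using code injD[OF c] by metis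
  qed
  then show ?thesis unfolding lepoll_def by blast
qed

lemma lepoll_UNIV_trans:
  assumes "f ` A = B" "A \<lesssim> (UNIV :: 'u set)"
  shows "B \<lesssim> (UNIV :: 'u set)"
  using assms image_lepoll lepoll_trans by blast

lemma times_lepoll_infinite:
  assumes "infinite (UNIV :: 'u set)" "A \<lesssim> (UNIV :: 'u set)" "B \<lesssim> (UNIV :: 'u set)"
  shows "A \<times> B \<lesssim> (UNIV :: 'u set)"
proof -
  have "A \<times> B \<lesssim> (UNIV :: 'u set) \<times> (UNIV :: 'u set)"
    using assms(2,3) by (rule times_lepoll_mono)
  also have "\<dots> \<approx> (UNIV :: 'u set)" using infinite_times_eqpoll_self[OF assms(1)] by simp
  finally show ?thesis .
qed

text \<open>A finitely supported function is determined by the finite set of its nonzero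
  argument-value pairs, hence by a list that enumerates this set.\<close>

lemma free_module_lepoll:
  fixes X :: "'x set" and R :: "('r, 'z) ring_scheme"
  assumes inf: "infinite (UNIV :: 'u set)" and R: "carrier R \<lesssim> (UNIV :: 'u set)"
    and X: "X \<lesssim> (UNIV :: 'u set)"
  shows "carrier (free_module R X) \<lesssim> (UNIV :: 'u set)"
proof -
  have "X \<times> carrier R \<lesssim> (UNIV :: 'u set)" using times_lepoll_infinite[OF inf X R] .
  then obtain c :: "'x \<times> 'r \<Rightarrow> 'u" where c: "inj_on c (X \<times> carrier R)" by (auto simp: lepoll_def)
  define g where "g v = (SOME xs. set xs = {(x, v x) | x. v x \<noteq> \<zero>\<^bsub>R\<^esub>})" for v :: "'x \<Rightarrow> 'r"
  have g: "set (g v) = {(x, v x) | x. v x \<noteq> \<zero>\<^bsub>R\<^esub>}" if "v \<in> carrier (free_module R X)" for v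
  proof -
    have "finite ((\<lambda>x. (x, v x)) ` {x. v x \<noteq> \<zero>\<^bsub>R\<^esub>})" using that by (simp add: free_module_def)
    moreover have "(\<lambda>x. (x, v x)) ` {x. v x \<noteq> \<zero>\<^bsub>R\<^esub>} = {(x, v x) | x. v x \<noteq> \<zero>\<^bsub>R\<^esub>}" by auto
    ultimately have "\<exists>xs. set xs = {(x, v x) | x. v x \<noteq> \<zero>\<^bsub>R\<^esub>}" using finite_list by metis
    then show ?thesis unfolding g_def by (rule someI_ex)
  qed
  have sub: "set (g v) \<subseteq> X \<times> carrier R" if "v \<in> carrier (free_module R X)" for v
    using that g[OF that] by (auto simp: free_module_def)
  have "inj_on (\<lambda>v. map c (g v)) (carrier (free_module R X))"
  proof (rule inj_onI)
    fix v w assume vw: "v \<in> carrier (free_module R X)" "w \<in> carrier (free_module R X)"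
        "map c (g v) = map c (g w)"
    then have "g v = g w" using inj_on_map_eq_map[of c "g v" "g w"] c sub[OF vw(1)] sub[OF vw(2)]
      by (meson inj_on_subset le_sup_iff)
    with g[OF vw(1)] have "set (g w) = {(x, v x) | x. v x \<noteq> \<zero>\<^bsub>R\<^esub>}" by simp
    then have "{(x, v x) | x. v x \<noteq> \<zero>\<^bsub>R\<^esub>} = {(x, w x) | x. w x \<noteq> \<zero>\<^bsub>R\<^esub>}" using g[OF vw(2)] by argo
    note eq = eqset_imp_iff[OF this]
    have "(y = v x \<and> v x \<noteq> \<zero>\<^bsub>R\<^esub>) \<longleftrightarrow> (y = w x \<and> w x \<noteq> \<zero>\<^bsub>R\<^esub>)" for x y
      using eq[of "(x, y)"] by blast
    then have "v x = w x" for x by metis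
    then show "v = w" ..
  qed
  then have "carrier (free_module R X) \<lesssim> (UNIV :: 'u list set)" unfolding lepoll_def by auto
  then show ?thesis using lists_lepoll[OF inf] lepoll_trans by blast
qed

text \<open>Transport of structure along an injection into \<open>'u\<close>. This moves free
  modules, tensor products and left ideals into the universe over which flatness, projectivity and
  injectivity quantify.\<close>

lemma transfer_left_module:
  fixes A :: "('s, 'a) module" and S :: "('s, 'z) ring_scheme"
  assumes "left_module S A" "carrier A \<lesssim> (UNIV :: 'u set)"
  obtains A' :: "('s, 'u) module" and \<phi> where "left_module S A'" "\<phi> \<in> mod_hom S A A'"
    "bij_betw \<phi> (carrier A) (carrier A')"
proof -
  interpret A: left_module S A by fact
  obtain c :: "'a \<Rightarrow> 'u" where c: "inj_on c (carrier A)" using assms(2) by (auto simp: lepoll_def)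
  define d where "d = inv_into (carrier A) c"
  have dc [simp]: "d (c x) = x" if "x \<in> carrier A" for x using that c by (simp add: d_def)
  define A' :: "('s, 'u) module" where
    "A' = \<lparr>carrier = c ` carrier A, mult = undefined, one = undefined, zero = c \<zero>\<^bsub>A\<^esub>,
      add = (\<lambda>x y. c (d x \<oplus>\<^bsub>A\<^esub> d y)), smult = (\<lambda>r x. c (r \<odot>\<^bsub>A\<^esub> d x))\<rparr>"
  have "abelian_group A'"
  proof (rule abelian_groupI)
    fix x assume "x \<in> carrier A'"
    then obtain a where a: "a \<in> carrier A" "x = c a" by (auto simp: A'_def)
    then show "\<exists>y\<in>carrier A'. y \<oplus>\<^bsub>A'\<^esub> x = \<zero>\<^bsub>A'\<^esub>"
      by (intro bexI[of _ "c (\<ominus>\<^bsub>A\<^esub> a)"]) (auto simp: A'_def A.l_neg)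
  qed (auto simp: A'_def A.a_ac)
  then have "left_module S A'"
    by (intro left_module.intro left_module_axioms.intro A.ring_axioms)
      (auto simp: A'_def A.smult_closed A.smult_l_distr A.smult_r_distr A.smult_assoc A.smult_one)
  moreover have "(\<lambda>x\<in>carrier A. c x) \<in> mod_hom S A A'"
    by (auto simp: mod_hom_def A'_def A.smult_closed)
  moreover have "bij_betw (\<lambda>x\<in>carrier A. c x) (carrier A) (carrier A')"
    using c by (auto simp: bij_betw_def inj_on_def A'_def)
  ultimately show ?thesis using that by blast
qed

context base_ring
begin

lemma transfer_module:
  fixes A :: "('r, 'a) module"
  assumes "module R A" "carrier A \<lesssim> (UNIV :: 'u set)"
  obtains A' :: "('r, 'u) module" and \<phi> where "module R A'" "\<phi> \<in> Hom A A'"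
    "bij_betw \<phi> (carrier A) (carrier A')"
  using transfer_left_module[of R A] left_module_iff_module[OF is_cring] assms by metis

lemma hom_inverse:
  assumes "module R A" "module R B" "f \<in> Hom A B" "bij_betw f (carrier A) (carrier B)"
  obtains g where "g \<in> Hom B A" "\<And>x. x \<in> carrier A \<Longrightarrow> g (f x) = x" "\<And>y. y \<in> carrier B \<Longrightarrow> f (g y) = y"
    "bij_betw g (carrier B) (carrier A)"
proof -
  define g where "g = (\<lambda>y\<in>carrier B. inv_into (carrier A) f y)"
  have gf: "g (f x) = x" if "x \<in> carrier A" for x
    using that assms(3,4) homD(1)[OF assms(3)] by (simp add: g_def bij_betw_inv_into_left)
  have fg: "f (g y) = y" "g y \<in> carrier A" if "y \<in> carrier B" for y
    using that assms(4) by (simp_all add: g_def bij_betw_inv_into_right)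
      (metis bij_betw_def inv_into_into)
  have "g = (\<lambda>y\<in>carrier B. g y)" by (simp add: g_def fun_eq_iff)
  also have "(\<lambda>y\<in>carrier B. g y) \<in> Hom B A"
  proof (rule mod_homI)
    fix x y assume xy: "x \<in> carrier B" "y \<in> carrier B"
    have "f (g x \<oplus>\<^bsub>A\<^esub> g y) = x \<oplus>\<^bsub>B\<^esub> y" using xy fg assms by (simp add: homD(2)[OF assms(3)])
    then show "g (x \<oplus>\<^bsub>B\<^esub> y) = g x \<oplus>\<^bsub>A\<^esub> g y" using gf[of "g x \<oplus>\<^bsub>A\<^esub> g y"] fg xy assms by simp
  next
    fix r x assume xy: "r \<in> carrier R" "x \<in> carrier B"
    have "f (r \<odot>\<^bsub>A\<^esub> g x) = r \<odot>\<^bsub>B\<^esub> x" using xy fg assms by (simp add: homD(3)[OF assms(3)])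
    then show "g (r \<odot>\<^bsub>B\<^esub> x) = r \<odot>\<^bsub>A\<^esub> g x" using gf[of "r \<odot>\<^bsub>A\<^esub> g x"] fg xy assms by simp
  qed (use fg assms in auto)
  finally have g: "g \<in> Hom B A" .
  have "bij_betw g (carrier B) (carrier A)"
    by (rule bij_betw_byWitness[where f' = f]) (use fg gf homD(1)[OF assms(3)] in auto)
  then show ?thesis using that g gf fg by blast
qed

section \<open>Free and projective modules\<close>

definition Rmod :: "('r, 'r) module"
  where "Rmod = \<lparr>carrier = carrier R, mult = undefined, one = undefined, zero = \<zero>,
    add = (\<lambda>x y. x \<oplus> y), smult = (\<lambda>x y. x \<otimes> y)\<rparr>"

lemma Rmod_simps [simp]:
  "carrier Rmod = carrier R" "\<zero>\<^bsub>Rmod\<^esub> = \<zero>" "x \<oplus>\<^bsub>Rmod\<^esub> y = x \<oplus> y" "x \<odot>\<^bsub>Rmod\<^esub> y = x \<otimes> y"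
  by (simp_all add: Rmod_def)

lemma module_Rmod [simp]: "module R Rmod"
  by (rule moduleI2) (auto simp: m_assoc a_ac l_distr r_distr)

text \<open>The zero module on an arbitrary type: \<open>undefined\<close> is the one element that
  every type provides.\<close>

definition Zmod :: "('r, 'a) module"
  where "Zmod = \<lparr>carrier = {undefined}, mult = undefined, one = undefined, zero = undefined,
    add = (\<lambda>x y. undefined), smult = (\<lambda>x y. undefined)\<rparr>"

lemma Zmod_simps [simp]:
  "carrier Zmod = {undefined}" "\<zero>\<^bsub>Zmod\<^esub> = undefined" "x \<oplus>\<^bsub>Zmod\<^esub> y = undefined"
      "r \<odot>\<^bsub>Zmod\<^esub> y = undefined"
  by (simp_all add: Zmod_def)

lemma module_Zmod [simp]: "module R Zmod"
  by (rule moduleI2) auto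

abbreviation free :: "'x set \<Rightarrow> ('r, 'x \<Rightarrow> 'r) module"
  where "free X \<equiv> free_module R X"

abbreviation bas :: "'x \<Rightarrow> 'x \<Rightarrow> 'r"
  where "bas \<equiv> basis_elem R"

lemma free_carrierD:
  assumes "v \<in> carrier (free X)"
  shows "v x \<in> carrier R" "x \<notin> X \<Longrightarrow> v x = \<zero>" "finite {x. v x \<noteq> \<zero>}"
  using assms by (auto simp: free_module_def)

lemma free_simps:
  "(v \<oplus>\<^bsub>free X\<^esub> w) x = v x \<oplus> w x" "(r \<odot>\<^bsub>free X\<^esub> v) x = r \<otimes> v x" "\<zero>\<^bsub>free X\<^esub> x = \<zero>"
  by (simp_all add: free_module_def)

lemma module_free [simp]: "module R (free X)"
proof (rule moduleI2)
  fix v w assume "v \<in> carrier (free X)" "w \<in> carrier (free X)"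
  moreover have "{x. v x \<oplus> w x \<noteq> \<zero>} \<subseteq> {x. v x \<noteq> \<zero>} \<union> {x. w x \<noteq> \<zero>}" by auto
  ultimately show "v \<oplus>\<^bsub>free X\<^esub> w \<in> carrier (free X)"
    by (auto simp: free_module_def intro: finite_subset)
next
  fix r v assume "r \<in> carrier R" "v \<in> carrier (free X)"
  moreover have "{x. r \<otimes> v x \<noteq> \<zero>} \<subseteq> {x. v x \<noteq> \<zero>}" using \<open>r \<in> carrier R\<close> by auto
  ultimately show "r \<odot>\<^bsub>free X\<^esub> v \<in> carrier (free X)"
    by (auto simp: free_module_def intro: finite_subset)
next
  show "\<zero>\<^bsub>free X\<^esub> \<in> carrier (free X)" by (simp add: free_module_def)
next
  fix v w assume "v \<in> carrier (free X)" "w \<in> carrier (free X)"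
  note vw = free_carrierD(1)[OF this(1)] free_carrierD(1)[OF this(2)]
  show "v \<oplus>\<^bsub>free X\<^esub> w = w \<oplus>\<^bsub>free X\<^esub> v" using vw by (simp add: fun_eq_iff free_simps a_comm)
  fix u assume "u \<in> carrier (free X)"
  note u = free_carrierD(1)[OF this]
  show "v \<oplus>\<^bsub>free X\<^esub> w \<oplus>\<^bsub>free X\<^esub> u = v \<oplus>\<^bsub>free X\<^esub> (w \<oplus>\<^bsub>free X\<^esub> u)"
    using vw u by (simp add: fun_eq_iff free_simps a_assoc)
next
  fix v assume "v \<in> carrier (free X)"
  note v = free_carrierD(1)[OF this]
  show "\<zero>\<^bsub>free X\<^esub> \<oplus>\<^bsub>free X\<^esub> v = v" "\<one> \<odot>\<^bsub>free X\<^esub> v = v" "\<zero> \<odot>\<^bsub>free X\<^esub> v = \<zero>\<^bsub>free X\<^esub>"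
    using v by (simp_all add: fun_eq_iff free_simps)
next
  fix r s v assume rs: "r \<in> carrier R" "s \<in> carrier R" and "v \<in> carrier (free X)"
  note v = free_carrierD(1)[OF this(3)]
  show "(r \<oplus> s) \<odot>\<^bsub>free X\<^esub> v = r \<odot>\<^bsub>free X\<^esub> v \<oplus>\<^bsub>free X\<^esub> s \<odot>\<^bsub>free X\<^esub> v"
    "(r \<otimes> s) \<odot>\<^bsub>free X\<^esub> v = r \<odot>\<^bsub>free X\<^esub> (s \<odot>\<^bsub>free X\<^esub> v)"
    using v rs by (simp_all add: fun_eq_iff free_simps l_distr m_assoc)
next
  fix r v w assume r: "r \<in> carrier R" and "v \<in> carrier (free X)" "w \<in> carrier (free X)"
  note vw = free_carrierD(1)[OF this(2)] free_carrierD(1)[OF this(3)]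
  show "r \<odot>\<^bsub>free X\<^esub> (v \<oplus>\<^bsub>free X\<^esub> w) = r \<odot>\<^bsub>free X\<^esub> v \<oplus>\<^bsub>free X\<^esub> r \<odot>\<^bsub>free X\<^esub> w"
    using vw r by (simp add: fun_eq_iff free_simps r_distr)
qed

lemma bas_carrier [simp, intro]: "x \<in> X \<Longrightarrow> bas x \<in> carrier (free X)"
  by (auto simp: free_module_def basis_elem_def)

lemma bas_simps [simp]: "bas x x = \<one>" "x \<noteq> y \<Longrightarrow> bas x y = \<zero>"
  by (auto simp: basis_elem_def)

text \<open>Induction on a finite set containing the support: one coordinate \<open>v x\<close> is
  split off at a time as a multiple of \<open>bas x\<close>.\<close>

lemma free_induct:
  assumes v: "v \<in> carrier (free X)"
    and zero: "P \<zero>\<^bsub>free X\<^esub>"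
    and add: "\<And>v w. v \<in> carrier (free X) \<Longrightarrow> w \<in> carrier (free X) \<Longrightarrow> P v \<Longrightarrow> P w \<Longrightarrow> P (v \<oplus>\<^bsub>free X\<^esub> w)"
    and smult: "\<And>r x. r \<in> carrier R \<Longrightarrow> x \<in> X \<Longrightarrow> P (r \<odot>\<^bsub>free X\<^esub> bas x)"
  shows "P v"
proof -
  have "finite F \<Longrightarrow> v \<in> carrier (free X) \<Longrightarrow> {x. v x \<noteq> \<zero>} \<subseteq> F \<Longrightarrow> P v" for F v
  proof (induction F arbitrary: v rule: finite_induct)
    case empty
    then have "v = \<zero>\<^bsub>free X\<^esub>" by (auto simp: fun_eq_iff free_simps)
    then show ?case using zero by simp
  next
    case (insert x F)
    show ?case
    proof (cases "x \<in> X")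
      case False
      then have "{x. v x \<noteq> \<zero>} \<subseteq> F" using insert free_carrierD(2) by fastforce
      then show ?thesis using insert by auto
    next
      case True
      have "{y. (v(x := \<zero>)) y \<noteq> \<zero>} \<subseteq> {x. v x \<noteq> \<zero>}" by auto
      then have w: "v(x := \<zero>) \<in> carrier (free X)"
        using insert(4) by (auto simp: free_module_def intro: finite_subset)
      have "P (v(x := \<zero>))" by (rule insert.IH[OF w]) (use insert in auto)
      moreover have "v = v x \<odot>\<^bsub>free X\<^esub> bas x \<oplus>\<^bsub>free X\<^esub> v(x := \<zero>)"
        using free_carrierD(1)[OF insert(4)] by (auto simp: fun_eq_iff free_simps basis_elem_def)
      moreover have "v x \<odot>\<^bsub>free X\<^esub> bas x \<in> carrier (free X)"
        using True free_carrierD(1)[OF insert(4)] by simp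
      ultimately show ?thesis using add smult True free_carrierD(1)[OF insert(4)] w by metis
    qed
  qed
  then show ?thesis using v free_carrierD(3)[OF v] by blast
qed

lemma hom_free_eqI:
  assumes "f \<in> Hom (free X) A" "g \<in> Hom (free X) A" "module R A" "\<And>x. x \<in> X \<Longrightarrow> f (bas x) = g (bas x)"
    and v: "v \<in> carrier (free X)"
  shows "f v = g v"
  by (rule free_induct[OF v])
    (use assms(3,4) in \<open>simp_all add: hom_zero_neg(1)[OF assms(1)] hom_zero_neg(1)[OF assms(2)]
      homD(2)[OF assms(1)] homD(2)[OF assms(2)] homD(3)[OF assms(1)] homD(3)[OF assms(2)]\<close>)

lemma free_extend:
  fixes A :: "('r, 'a) module"
  assumes A: "module R A" and c: "\<And>x. x \<in> X \<Longrightarrow> c x \<in> carrier A"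
  obtains f where "f \<in> Hom (free X) A" "\<And>x. x \<in> X \<Longrightarrow> f (bas x) = c x"
proof -
  interpret A: module R A by fact
  define s where "s v F = finsum A (\<lambda>x. v x \<odot>\<^bsub>A\<^esub> c x) F" for v F
  \<comment> \<open>The sum may be taken over any finite set between the support and
    \<open>X\<close>. This matters for additivity, where \<open>v\<close>, \<open>w\<close> and
    their sum have different supports but are summed over one common set.\<close>
  have s: "s v F = s v {x. v x \<noteq> \<zero>}" if "v \<in> carrier (free X)" "finite F" "{x. v x \<noteq> \<zero>} \<subseteq> F"
      "F \<subseteq> X" for v F
    unfolding s_def
    by (rule A.M.add.finprod_mono_neutral_cong_right)
      (use that c free_carrierD(1)[OF that(1)] A in auto)
  have supp: "finite {x. v x \<noteq> \<zero>}" "{x. v x \<noteq> \<zero>} \<subseteq> X" if "v \<in> carrier (free X)" for v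
    using free_carrierD(3)[OF that] free_carrierD(2)[OF that] by blast+
  define f where "f = (\<lambda>v\<in>carrier (free X). s v {x. v x \<noteq> \<zero>})"
  have "f \<in> Hom (free X) A"
    unfolding f_def
  proof (rule mod_homI)
    fix v assume v: "v \<in> carrier (free X)"
    show "s v {x. v x \<noteq> \<zero>} \<in> carrier A"
      unfolding s_def using supp[OF v] c free_carrierD(1)[OF v] A by (intro A.M.finsum_closed) auto
  next
    fix v w assume vw: "v \<in> carrier (free X)" "w \<in> carrier (free X)"
    let ?F = "{x. v x \<noteq> \<zero>} \<union> {x. w x \<noteq> \<zero>}"
    have F: "finite ?F" "?F \<subseteq> X" using supp vw by auto
    have sub: "{x. (v \<oplus>\<^bsub>free X\<^esub> w) x \<noteq> \<zero>} \<subseteq> ?F" by (auto simp: free_simps)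
    have "s (v \<oplus>\<^bsub>free X\<^esub> w) ?F = s v ?F \<oplus>\<^bsub>A\<^esub> s w ?F"
      unfolding s_def
      by (subst A.M.finsum_addf[symmetric], use F c free_carrierD(1)[OF vw(1)] free_carrierD(1)[OF
          vw(2)] A in auto)
        (intro A.M.finsum_cong', use F c free_carrierD(1)[OF vw(1)] free_carrierD(1)[OF vw(2)] A
            in \<open>auto simp: free_simps module_smult\<close>)
    moreover have "v \<oplus>\<^bsub>free X\<^esub> w \<in> carrier (free X)" using vw by simp
    ultimately show "s (v \<oplus>\<^bsub>free X\<^esub> w) {x. (v \<oplus>\<^bsub>free X\<^esub> w) x \<noteq> \<zero>} = s v {x. v x \<noteq> \<zero>} \<oplus>\<^bsub>A\<^esub> s w {x.
        w x \<noteq> \<zero>}"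
      using s[of v ?F] s[of w ?F] s[of "v \<oplus>\<^bsub>free X\<^esub> w" ?F] F sub vw by auto
  next
    fix r v assume r: "r \<in> carrier R" and v: "v \<in> carrier (free X)"
    let ?F = "{x. v x \<noteq> \<zero>}"
    have F: "finite ?F" "?F \<subseteq> X" using supp[OF v] by auto
    have sub: "{x. (r \<odot>\<^bsub>free X\<^esub> v) x \<noteq> \<zero>} \<subseteq> ?F" using r by (auto simp: free_simps)
    have "s (r \<odot>\<^bsub>free X\<^esub> v) ?F = r \<odot>\<^bsub>A\<^esub> s v ?F"
      unfolding s_def
      by (subst A.finsum_smult_ldistr, use F c free_carrierD(1)[OF v] A r in auto)
        (intro A.M.finsum_cong', use F c free_carrierD(1)[OF v] A r in \<open>auto simp: free_simps
            module_smult\<close>)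
    moreover have "r \<odot>\<^bsub>free X\<^esub> v \<in> carrier (free X)" using r v by simp
    ultimately show "s (r \<odot>\<^bsub>free X\<^esub> v) {x. (r \<odot>\<^bsub>free X\<^esub> v) x \<noteq> \<zero>} = r \<odot>\<^bsub>A\<^esub> s v {x. v x \<noteq> \<zero>}"
      using s[of "r \<odot>\<^bsub>free X\<^esub> v" ?F] F sub by auto
  qed simp
  moreover have "f (bas x) = c x" if "x \<in> X" for x
  proof -
    have "f (bas x) = s (bas x) {x}"
    proof -
      have "{y. bas x y \<noteq> \<zero>} \<subseteq> {x}" by (auto simp: basis_elem_def)
      then show ?thesis using s[of "bas x" "{x}"] that bas_carrier[OF that] by (simp add: f_def)
    qed
    then show ?thesis using that c A by (auto simp: s_def)
  qed
  ultimately show ?thesis using that by blast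
qed

text \<open>The canonical presentation with all elements of \<open>A\<close> as generators. Fixing
  one surjection per module lets projectivity be expressed by a section of it.\<close>

definition free_cover :: "('r, 'a) module \<Rightarrow> ('a \<Rightarrow> 'r) \<Rightarrow> 'a"
  where "free_cover A = (SOME f. f \<in> Hom (free (carrier A)) A \<and> (\<forall>x\<in>carrier A. f (bas x) = x))"

lemma free_cover:
  assumes "module R A"
  shows "free_cover A \<in> Hom (free (carrier A)) A" and "x \<in> carrier A \<Longrightarrow> free_cover A (bas x) = x"
    and "free_cover A ` carrier (free (carrier A)) = carrier A"
proof -
  obtain f where "f \<in> Hom (free (carrier A)) A" "\<And>x. x \<in> carrier A \<Longrightarrow> f (bas x) = x"
    using free_extend[OF assms, of "carrier A" "\<lambda>x. x"] by blast
  then have "\<exists>f. f \<in> Hom (free (carrier A)) A \<and> (\<forall>x\<in>carrier A. f (bas x) = x)" by blast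
  then have *: "free_cover A \<in> Hom (free (carrier A)) A \<and> (\<forall>x\<in>carrier A. free_cover A (bas x) = x)"
    unfolding free_cover_def by (rule someI_ex)
  then show "free_cover A \<in> Hom (free (carrier A)) A" "x \<in> carrier A \<Longrightarrow> free_cover A (bas x) = x"
    by auto
  show "free_cover A ` carrier (free (carrier A)) = carrier A"
  proof
    show "free_cover A ` carrier (free (carrier A)) \<subseteq> carrier A" using homD(1)[OF conjunct1[OF *]]
      by blast
    show "carrier A \<subseteq> free_cover A ` carrier (free (carrier A))"
    proof
      fix x assume "x \<in> carrier A"
      then have "x = free_cover A (bas x)" "bas x \<in> carrier (free (carrier A))" using * by auto
      then show "x \<in> free_cover A ` carrier (free (carrier A))" by (rule image_eqI)
    qed
  qed
qed

text \<open>Unlike \<^const>\<open>projective\<close>, this notion does not refer to a universe of test modules.\<close>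

definition proj :: "('r, 'p) module \<Rightarrow> bool"
  where "proj P \<longleftrightarrow> module R P \<and>
    (\<exists>s\<in>Hom P (free (carrier P)). \<forall>x\<in>carrier P. free_cover P (s x) = x)"

lemma proj_module: "proj P \<Longrightarrow> module R P"
  by (simp add: proj_def)

text \<open>Elementwise preimages \<open>c\<close> define a homomorphism on the free cover of
  \<open>P\<close>, and the section \<open>s\<close> restricts it to \<open>P\<close>. The types of
  \<open>A\<close> and \<open>B\<close> are arbitrary, which the universe-bound notion would not
  allow.\<close>

lemma proj_lift:
  assumes P: "proj P" and A: "module R A" and B: "module R B"
    and q: "q \<in> Hom A B" "q ` carrier A = carrier B" and f: "f \<in> Hom P B"
  obtains g where "g \<in> Hom P A" "\<And>x. x \<in> carrier P \<Longrightarrow> q (g x) = f x"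
proof -
  have mP: "module R P" using P by (rule proj_module)
  obtain s where s: "s \<in> Hom P (free (carrier P))" "\<And>x. x \<in> carrier P \<Longrightarrow> free_cover P (s x) = x"
    using P by (auto simp: proj_def)
  have "\<forall>x\<in>carrier P. \<exists>a\<in>carrier A. q a = f x" using q(2) homD(1)[OF f] by (metis imageE)
  then obtain c where c: "\<And>x. x \<in> carrier P \<Longrightarrow> c x \<in> carrier A" "\<And>x. x \<in> carrier P \<Longrightarrow> q (c x) = f x"
    by metis
  obtain h where h: "h \<in> Hom (free (carrier P)) A" "\<And>x. x \<in> carrier P \<Longrightarrow> h (bas x) = c x"
    using free_extend[OF A, of "carrier P" c] c by blast
  let ?F = "free (carrier P)"
  have eq: "compose (carrier ?F) q h v = compose (carrier ?F) f (free_cover P) v"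
      if "v \<in> carrier ?F" for v
    by (rule hom_free_eqI[OF hom_compose[OF module_free h(1) q(1)] hom_compose[OF module_free
        free_cover(1)[OF mP] f] B _ that])
      (use h c free_cover(2)[OF mP] in \<open>simp add: compose_eq\<close>)
  show ?thesis
  proof
    show "compose (carrier P) h s \<in> Hom P A" using hom_compose[OF mP s(1) h(1)] .
    fix x assume x: "x \<in> carrier P"
    then show "q (compose (carrier P) h s x) = f x"
      using eq[of "s x"] homD(1)[OF s(1) x] s(2)[OF x] by (simp add: compose_eq)
  qed
qed

lemma projI:
  assumes "module R P" "s \<in> Hom P (free (carrier P))" "\<And>x. x \<in> carrier P \<Longrightarrow> free_cover P (s x) = x"
  shows "proj P"
  using assms by (auto simp: proj_def)

text \<open>The free cover of \<open>P\<close> has a copy in \<open>'u\<close>, so projectivity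
  tested inside the universe already lifts the identity of \<open>P\<close> along it.\<close>

lemma proj_of_projective:
  fixes P :: "('r, 'u) module"
  assumes inf: "infinite (UNIV :: 'u set)" and R: "carrier R \<lesssim> (UNIV :: 'u set)"
    and P: "projective TYPE('u) R P"
  shows "proj P"
proof -
  have mP: "module R P" using P left_module_iff_module[OF is_cring] by (auto simp: projective_def)
  have "carrier (free (carrier P)) \<lesssim> (UNIV :: 'u set)"
    using free_module_lepoll[OF inf R] subset_imp_lepoll by blast
  then obtain L :: "('r, 'u) module" and \<phi> where L: "module R L" "\<phi> \<in> Hom (free (carrier P)) L"
    "bij_betw \<phi> (carrier (free (carrier P))) (carrier L)"
    using transfer_module[OF module_free] by metis
  obtain \<psi> where \<psi>: "\<psi> \<in> Hom L (free (carrier P))"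
      "bij_betw \<psi> (carrier L) (carrier (free (carrier P)))"
    using hom_inverse[OF module_free L] by metis
  let ?q = "compose (carrier L) (free_cover P) \<psi>"
  have q: "?q \<in> Hom L P" using hom_compose[OF L(1) \<psi>(1) free_cover(1)[OF mP]] .
  have "?q ` carrier L = free_cover P ` (\<psi> ` carrier L)" by (auto simp: compose_def image_image)
  then have surj: "?q ` carrier L = carrier P"
    using \<psi>(2) free_cover(3)[OF mP] by (simp add: bij_betw_def)
  obtain g where g: "g \<in> Hom P L" "\<forall>x\<in>carrier P. ?q (g x) = (\<lambda>x\<in>carrier P. x) x"
    using P L(1) mP q surj hom_id[OF mP] left_module_iff_module[OF is_cring]
      unfolding projective_def by metis
  show ?thesis
    by (rule projI[OF mP hom_compose[OF mP g(1) \<psi>(1)]])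
      (use g homD(1)[OF g(1)] in \<open>simp add: compose_eq\<close>)
qed

text \<open>The section sends \<open>bas x\<close> to the generator indexed by the element
  \<open>bas x\<close>.\<close>

lemma proj_free: "proj (free X)"
proof -
  obtain s where s: "s \<in> Hom (free X) (free (carrier (free X)))" "\<And>x. x \<in> X \<Longrightarrow>
      s (bas x) = bas (bas x)"
    by (rule free_extend[OF module_free[of "carrier (free X)"], of X "\<lambda>x. bas (bas x)"]) auto
  have "compose (carrier (free X)) (free_cover (free X)) s v = (\<lambda>v\<in>carrier (free X). v) v"
      if "v \<in> carrier (free X)" for v
    by (rule hom_free_eqI[OF hom_compose[OF module_free s(1) free_cover(1)[OF module_free]]
        hom_id[OF module_free] module_free _ that])
      (use s in \<open>simp add: compose_eq free_cover\<close>)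
  then show ?thesis by (intro projI[OF module_free s(1)]) (simp add: compose_eq)
qed

lemma proj_retract:
  assumes P: "proj P" and A: "module R A" and i: "i \<in> Hom A P" and p: "p \<in> Hom P A"
    and pi: "\<And>x. x \<in> carrier A \<Longrightarrow> p (i x) = x"
  shows "proj A"
proof -
  obtain g where g: "g \<in> Hom P (free (carrier A))" "\<And>x. x \<in> carrier P \<Longrightarrow> free_cover A (g x) = p x"
    using proj_lift[OF P module_free A free_cover(1,3)[OF A] p] by blast
  show ?thesis
    by (rule projI[OF A hom_compose[OF A i g(1)]]) (use g pi homD(1)[OF i] in
        \<open>simp add: compose_eq\<close>)
qed

lemma proj_Rmod: "proj Rmod"
proof -
  let ?L = "free {()}"
  obtain p where p: "p \<in> Hom ?L Rmod" "\<And>x. x \<in> {()} \<Longrightarrow> p (bas x) = \<one>"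
    using free_extend[OF module_Rmod, of "{()}" "\<lambda>_. \<one>"] by auto
  have "(\<lambda>r\<in>carrier Rmod. r \<odot>\<^bsub>?L\<^esub> bas ()) \<in> Hom Rmod ?L"
    by (rule mod_homI) (auto simp: module_smult)
  from proj_retract[OF proj_free module_Rmod this p(1)] show ?thesis
    using p by (simp add: homD(3)[OF p(1)])
qed

text \<open>The zero module will be the degree 0 term of the shifted resolution
  \<open>P'\<close>.\<close>

lemma proj_Zmod: "proj Zmod"
proof -
  have "(\<lambda>x\<in>carrier Zmod. \<zero>\<^bsub>Rmod\<^esub>) \<in> Hom Zmod Rmod" "(\<lambda>x\<in>carrier Rmod. \<zero>\<^bsub>Zmod\<^esub>) \<in> Hom Rmod Zmod"
    by (rule hom_zero; simp)+
  from proj_retract[OF proj_Rmod module_Zmod this] show ?thesis by simp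
qed

section \<open>Tensor products\<close>

abbreviation tens :: "('r, 'a) module \<Rightarrow> ('r, 'b) module \<Rightarrow> ('r, ('a \<times> 'b \<Rightarrow> 'r) set) module"
  where "tens \<equiv> tensor R"

abbreviation te :: "('r, 'a) module \<Rightarrow> ('r, 'b) module \<Rightarrow> 'a \<Rightarrow> 'b \<Rightarrow> ('a \<times> 'b \<Rightarrow> 'r) set"
  where "te \<equiv> tensor_elem R"

definition bilin :: "('r, 'a) module \<Rightarrow> ('r, 'b) module \<Rightarrow> ('r, 'c) module \<Rightarrow> ('a \<Rightarrow> 'b \<Rightarrow> 'c) \<Rightarrow> bool"
  where "bilin A B C b \<longleftrightarrow>
    (\<forall>x\<in>carrier A. \<forall>y\<in>carrier B. b x y \<in> carrier C) \<and>
    (\<forall>x\<in>carrier A. \<forall>x'\<in>carrier A. \<forall>y\<in>carrier B. b (x \<oplus>\<^bsub>A\<^esub> x') y = b x y \<oplus>\<^bsub>C\<^esub> b x' y) \<and>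
    (\<forall>x\<in>carrier A. \<forall>y\<in>carrier B. \<forall>y'\<in>carrier B. b x (y \<oplus>\<^bsub>B\<^esub> y') = b x y \<oplus>\<^bsub>C\<^esub> b x y') \<and>
    (\<forall>r\<in>carrier R. \<forall>x\<in>carrier A. \<forall>y\<in>carrier B. b (r \<odot>\<^bsub>A\<^esub> x) y = r \<odot>\<^bsub>C\<^esub> b x y) \<and>
    (\<forall>r\<in>carrier R. \<forall>x\<in>carrier A. \<forall>y\<in>carrier B. b x (r \<odot>\<^bsub>B\<^esub> y) = r \<odot>\<^bsub>C\<^esub> b x y)"

lemma bilinI:
  assumes "\<And>x y. x \<in> carrier A \<Longrightarrow> y \<in> carrier B \<Longrightarrow> b x y \<in> carrier C"
    "\<And>x x' y. x \<in> carrier A \<Longrightarrow> x' \<in> carrier A \<Longrightarrow> y \<in> carrier B \<Longrightarrow> b (x \<oplus>\<^bsub>A\<^esub> x') y = b x y \<oplus>\<^bsub>C\<^esub> b x' y"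
    "\<And>x y y'. x \<in> carrier A \<Longrightarrow> y \<in> carrier B \<Longrightarrow> y' \<in> carrier B \<Longrightarrow> b x (y \<oplus>\<^bsub>B\<^esub> y') = b x y \<oplus>\<^bsub>C\<^esub> b x y'"
    "\<And>r x y. r \<in> carrier R \<Longrightarrow> x \<in> carrier A \<Longrightarrow> y \<in> carrier B \<Longrightarrow> b (r \<odot>\<^bsub>A\<^esub> x) y = r \<odot>\<^bsub>C\<^esub> b x y"
    "\<And>r x y. r \<in> carrier R \<Longrightarrow> x \<in> carrier A \<Longrightarrow> y \<in> carrier B \<Longrightarrow> b x (r \<odot>\<^bsub>B\<^esub> y) = r \<odot>\<^bsub>C\<^esub> b x y"
  shows "bilin A B C b"
  using assms by (simp add: bilin_def)

lemma bilinD: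
  assumes "bilin A B C b"
  shows "x \<in> carrier A \<Longrightarrow> y \<in> carrier B \<Longrightarrow> b x y \<in> carrier C"
    "x \<in> carrier A \<Longrightarrow> x' \<in> carrier A \<Longrightarrow> y \<in> carrier B \<Longrightarrow> b (x \<oplus>\<^bsub>A\<^esub> x') y = b x y \<oplus>\<^bsub>C\<^esub> b x' y"
    "x \<in> carrier A \<Longrightarrow> y \<in> carrier B \<Longrightarrow> y' \<in> carrier B \<Longrightarrow> b x (y \<oplus>\<^bsub>B\<^esub> y') = b x y \<oplus>\<^bsub>C\<^esub> b x y'"
    "r \<in> carrier R \<Longrightarrow> x \<in> carrier A \<Longrightarrow> y \<in> carrier B \<Longrightarrow> b (r \<odot>\<^bsub>A\<^esub> x) y = r \<odot>\<^bsub>C\<^esub> b x y"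
    "r \<in> carrier R \<Longrightarrow> x \<in> carrier A \<Longrightarrow> y \<in> carrier B \<Longrightarrow> b x (r \<odot>\<^bsub>B\<^esub> y) = r \<odot>\<^bsub>C\<^esub> b x y"
  using assms by (simp_all add: bilin_def)

lemma bilinear_relations_subset:
  fixes A :: "('r, 'a) module" and B :: "('r, 'b) module"
  assumes A: "module R A" and B: "module R B"
  shows "bilinear_relations R A B \<subseteq> carrier (free (carrier A \<times> carrier B))"
proof -
  have "bas (x, y) \<in> carrier (free (carrier A \<times> carrier B))" if "x \<in> carrier A" "y \<in> carrier B"
      for x y
    using that by simp
  then show ?thesis using A B by (auto simp: bilinear_relations_def Let_def)
qed

lemma tensor_rel:
  fixes A :: "('r, 'a) module" and B :: "('r, 'b) module"
  assumes A: "module R A" and B: "module R B"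
  shows "submodule (tensor_rel R A B) R (free (carrier A \<times> carrier B))"
    and "bilinear_relations R A B \<subseteq> tensor_rel R A B"
    and "submodule N R (free (carrier A \<times> carrier B)) \<Longrightarrow> bilinear_relations R A B \<subseteq> N \<Longrightarrow>
        tensor_rel R A B \<subseteq> N"
proof -
  let ?F = "free (carrier A \<times> carrier B)"
  let ?T = "{t. submodule t R ?F \<and> bilinear_relations R A B \<subseteq> t}"
  \<comment> \<open>The whole free module belongs to the family, so the intersection that defines
    the hull lies inside it.\<close>
  have ne: "carrier ?F \<in> ?T"
    using bilinear_relations_subset[OF A B] module.carrier_is_submodule[OF module_free] by simp
  have D: "t \<subseteq> carrier ?F" "\<zero>\<^bsub>?F\<^esub> \<in> t" "a \<in> t \<Longrightarrow> b \<in> t \<Longrightarrow> a \<oplus>\<^bsub>?F\<^esub> b \<in> t"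
    "r \<in> carrier R \<Longrightarrow> a \<in> t \<Longrightarrow> r \<odot>\<^bsub>?F\<^esub> a \<in> t" if "t \<in> ?T" for t a b r
    using that submoduleD[OF module_free, of t "carrier A \<times> carrier B"] by simp_all
  have "submodule (\<Inter>?T) R ?F"
  proof (rule submoduleI2[OF module_free])
    show "\<Inter>?T \<subseteq> carrier ?F" using ne by (rule Inter_lower)
    show "\<zero>\<^bsub>?F\<^esub> \<in> \<Inter>?T" using D(2) by (rule InterI)
    fix a b assume "a \<in> \<Inter>?T" "b \<in> \<Inter>?T"
    then show "a \<oplus>\<^bsub>?F\<^esub> b \<in> \<Inter>?T" using D(3) by (meson InterD InterI)
  next
    fix r a assume "r \<in> carrier R" "a \<in> \<Inter>?T"
    then show "r \<odot>\<^bsub>?F\<^esub> a \<in> \<Inter>?T" using D(4) by (meson InterD InterI)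
  qed
  then show "submodule (tensor_rel R A B) R ?F" by (simp add: tensor_rel_def hull_def)
  show "bilinear_relations R A B \<subseteq> tensor_rel R A B" by (auto simp: tensor_rel_def hull_def)
  show "submodule N R ?F \<Longrightarrow> bilinear_relations R A B \<subseteq> N \<Longrightarrow> tensor_rel R A B \<subseteq> N"
    by (auto simp: tensor_rel_def hull_def)
qed

lemma module_tens [simp]: "module R A \<Longrightarrow> module R B \<Longrightarrow> module R (tens A B)"
  unfolding tensor_def by (rule module_quotient[OF module_free tensor_rel(1)])

lemma te_bilin:
  fixes A :: "('r, 'a) module" and B :: "('r, 'b) module"
  assumes A: "module R A" and B: "module R B"
  shows "bilin A B (tens A B) (te A B)"
proof -
  let ?F = "free (carrier A \<times> carrier B)"
  let ?K = "tensor_rel R A B"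
  let ?p = "quot_map ?F ?K"
  let ?e = "\<lambda>x y. bas (x, y)"
  note K = tensor_rel(1,2)[OF A B]
  note q = quotient_module[OF module_free K(1)]
  have p: "?p \<in> Hom ?F (tens A B)" using q(2) by (simp add: tensor_def)
  have te: "te A B x y = ?p (?e x y)" if "x \<in> carrier A" "y \<in> carrier B" for x y
    using that by (simp add: tensor_elem_def quot_map_def)
  have e: "?e x y \<in> carrier ?F" if "x \<in> carrier A" "y \<in> carrier B" for x y using that by simp
  have eq: "?p u = ?p v" if "u \<ominus>\<^bsub>?F\<^esub> v \<in> bilinear_relations R A B" "u \<in> carrier ?F"
      "v \<in> carrier ?F" for u v
    using q(4)[OF that(2,3)] that(1) K(2) by blast
  show ?thesis
  proof (rule bilinI)
    fix x y assume xy: "x \<in> carrier A" "y \<in> carrier B"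
    show "te A B x y \<in> carrier (tens A B)" using te[OF xy] homD(1)[OF p e[OF xy]] by simp
  next
    fix x x' y assume *: "x \<in> carrier A" "x' \<in> carrier A" "y \<in> carrier B"
    have "?p (?e (x \<oplus>\<^bsub>A\<^esub> x') y) = ?p (?e x y \<oplus>\<^bsub>?F\<^esub> ?e x' y)"
      by (rule eq) (use * A e in \<open>auto simp: bilinear_relations_def Let_def\<close>)
    then show "te A B (x \<oplus>\<^bsub>A\<^esub> x') y = te A B x y \<oplus>\<^bsub>tens A B\<^esub> te A B x' y"
      using * A by (simp add: te homD(2)[OF p])
  next
    fix x y y' assume *: "x \<in> carrier A" "y \<in> carrier B" "y' \<in> carrier B"
    have "?p (?e x (y \<oplus>\<^bsub>B\<^esub> y')) = ?p (?e x y \<oplus>\<^bsub>?F\<^esub> ?e x y')"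
      by (rule eq) (use * B e in \<open>auto simp: bilinear_relations_def Let_def\<close>)
    then show "te A B x (y \<oplus>\<^bsub>B\<^esub> y') = te A B x y \<oplus>\<^bsub>tens A B\<^esub> te A B x y'"
      using * B by (simp add: te homD(2)[OF p])
  next
    fix r x y assume *: "r \<in> carrier R" "x \<in> carrier A" "y \<in> carrier B"
    have "?p (?e (r \<odot>\<^bsub>A\<^esub> x) y) = ?p (r \<odot>\<^bsub>?F\<^esub> ?e x y)"
      by (rule eq) (use * A e in \<open>auto simp: bilinear_relations_def Let_def\<close>)
    then show "te A B (r \<odot>\<^bsub>A\<^esub> x) y = r \<odot>\<^bsub>tens A B\<^esub> te A B x y"
      using * A by (simp add: te homD(3)[OF p])
    have "?p (?e x (r \<odot>\<^bsub>B\<^esub> y)) = ?p (r \<odot>\<^bsub>?F\<^esub> ?e x y)"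
      by (rule eq) (use * B e in \<open>auto simp: bilinear_relations_def Let_def\<close>)
    then show "te A B x (r \<odot>\<^bsub>B\<^esub> y) = r \<odot>\<^bsub>tens A B\<^esub> te A B x y"
      using * B by (simp add: te homD(3)[OF p])
  qed
qed

lemma te_closed [simp]:
  "module R A \<Longrightarrow> module R B \<Longrightarrow> x \<in> carrier A \<Longrightarrow> y \<in> carrier B \<Longrightarrow> te A B x y \<in> carrier (tens A B)"
  by (rule bilinD(1)[OF te_bilin])

lemma te_zero:
  fixes A :: "('r, 'a) module" and B :: "('r, 'b) module"
  assumes A: "module R A" and B: "module R B"
  shows "y \<in> carrier B \<Longrightarrow> te A B \<zero>\<^bsub>A\<^esub> y = \<zero>\<^bsub>tens A B\<^esub>"
    and "x \<in> carrier A \<Longrightarrow> te A B x \<zero>\<^bsub>B\<^esub> = \<zero>\<^bsub>tens A B\<^esub>"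
  using bilinD(4)[OF te_bilin[OF A B], of \<zero> "\<zero>\<^bsub>A\<^esub>" y] bilinD(5)[OF te_bilin[OF A B], of \<zero> x
      "\<zero>\<^bsub>B\<^esub>"] A B
  by simp_all

text \<open>The universal property. The extension of \<open>b\<close> to the free module kills the
  bilinear relations; its kernel is a submodule, so it also kills their hull and factors through the
  quotient.\<close>

lemma tens_lift:
  fixes A :: "('r, 'a) module" and B :: "('r, 'b) module" and C :: "('r, 'c) module"
  assumes A: "module R A" and B: "module R B" and C: "module R C" and b: "bilin A B C b"
  obtains h where "h \<in> Hom (tens A B) C" "\<And>x y. x \<in> carrier A \<Longrightarrow> y \<in> carrier B \<Longrightarrow> h (te A B x y) = b
      x y"
proof -
  let ?F = "free (carrier A \<times> carrier B)"
  let ?K = "tensor_rel R A B"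
  let ?p = "quot_map ?F ?K"
  note K = tensor_rel[OF A B]
  note q = quotient_module[OF module_free K(1), folded tensor_def]
  obtain f where f: "f \<in> Hom ?F C" "\<And>z. z \<in> carrier A \<times> carrier B \<Longrightarrow> f (bas z) = b (fst z) (snd z)"
    by (rule free_extend[OF C, of "carrier A \<times> carrier B" "\<lambda>z. b (fst z) (snd z)"])
        (use bilinD(1)[OF b] in auto)
  have fb: "f (bas (x, y)) = b x y" if "x \<in> carrier A" "y \<in> carrier B" for x y
    using f(2)[of "(x, y)"] that by simp
  have e: "bas (x, y) \<in> carrier ?F" if "x \<in> carrier A" "y \<in> carrier B" for x y using that by simp
  note fs = hom_zero_neg(3)[OF f(1) module_free C] homD(2)[OF f(1)] homD(3)[OF f(1)]
  have "bilinear_relations R A B \<subseteq> {v \<in> carrier ?F. f v = \<zero>\<^bsub>C\<^esub>}"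
    using bilinear_relations_subset[OF A B] A B C bilinD[OF b] e
    by (auto simp: bilinear_relations_def Let_def fs fb)
  then have "?K \<subseteq> {v \<in> carrier ?F. f v = \<zero>\<^bsub>C\<^esub>}"
    using K(3) kernel_submodule[OF module_free C f(1)] by blast
  then have ker: "f v = \<zero>\<^bsub>C\<^esub>" if "v \<in> carrier ?F" "?p v = \<zero>\<^bsub>tens A B\<^esub>" for v
    using q(5)[OF that(1)] that(2) by blast
  obtain h where h: "h \<in> Hom (tens A B) C" "\<And>v. v \<in> carrier ?F \<Longrightarrow> h (?p v) = f v"
    using hom_factor[OF module_free q(1) C q(2,3) f(1) ker] by blast
  show ?thesis
  proof
    show "h \<in> Hom (tens A B) C" by fact
    fix x y assume "x \<in> carrier A" "y \<in> carrier B"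
    then show "h (te A B x y) = b x y" using h(2)[of "bas (x, y)"] fb
      by (simp add: tensor_elem_def quot_map_def)
  qed
qed

text \<open>There are no cases for zero and scalars: zero is the pure tensor of two zeros and a
  scalar moves into the left factor, so sums of pure tensors exhaust the tensor product.\<close>

lemma tens_induct:
  fixes A :: "('r, 'a) module" and B :: "('r, 'b) module"
  assumes A: "module R A" and B: "module R B" and t: "t \<in> carrier (tens A B)"
    and te: "\<And>x y. x \<in> carrier A \<Longrightarrow> y \<in> carrier B \<Longrightarrow> P (te A B x y)"
    and add: "\<And>t u. t \<in> carrier (tens A B) \<Longrightarrow> u \<in> carrier (tens A B) \<Longrightarrow> P t \<Longrightarrow> P u \<Longrightarrow>
        P (t \<oplus>\<^bsub>tens A B\<^esub> u)"
  shows "P t"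
proof -
  let ?F = "free (carrier A \<times> carrier B)"
  let ?p = "quot_map ?F (tensor_rel R A B)"
  note q = quotient_module[OF module_free tensor_rel(1)[OF A B], folded tensor_def]
  have P0: "P \<zero>\<^bsub>tens A B\<^esub>" using te[of "\<zero>\<^bsub>A\<^esub>" "\<zero>\<^bsub>B\<^esub>"] te_zero(1)[OF A B, of "\<zero>\<^bsub>B\<^esub>"] A B by simp
  have "P (?p v)" if v: "v \<in> carrier ?F" for v
  proof (rule free_induct[OF v])
    show "P (?p \<zero>\<^bsub>?F\<^esub>)" using hom_zero_neg(1)[OF q(2) module_free q(1)] P0 by simp
  next
    fix v w assume "v \<in> carrier ?F" "w \<in> carrier ?F" "P (?p v)" "P (?p w)"
    then show "P (?p (v \<oplus>\<^bsub>?F\<^esub> w))" using add homD(1)[OF q(2)] by (simp add: homD(2)[OF q(2)])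
  next
    fix r z assume r: "r \<in> carrier R" and z: "z \<in> carrier A \<times> carrier B"
    obtain x y where xy: "z = (x, y)" "x \<in> carrier A" "y \<in> carrier B" using z by auto
    have "?p (bas z) = te A B x y" using xy by (simp add: tensor_elem_def quot_map_def)
    then have "?p (r \<odot>\<^bsub>?F\<^esub> bas z) = te A B (r \<odot>\<^bsub>A\<^esub> x) y"
      using r z xy bilinD(4)[OF te_bilin[OF A B]] by (simp add: homD(3)[OF q(2)])
    then show "P (?p (r \<odot>\<^bsub>?F\<^esub> bas z))" using te xy r A by simp
  qed
  then show ?thesis using t unfolding q(3)[symmetric] by blast
qed

lemma tens_hom_eqI:
  fixes A :: "('r, 'a) module" and B :: "('r, 'b) module" and C :: "('r, 'c) module"
  assumes A: "module R A" and B: "module R B" and f: "f \<in> Hom (tens A B) C"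
      and g: "g \<in> Hom (tens A B) C"
    and eq: "\<And>x y. x \<in> carrier A \<Longrightarrow> y \<in> carrier B \<Longrightarrow> f (te A B x y) = g (te A B x y)"
    and t: "t \<in> carrier (tens A B)"
  shows "f t = g t"
  by (rule tens_induct[OF A B t]) (use eq in \<open>simp_all add: homD(2)[OF f] homD(2)[OF g]\<close>)

text \<open>The choice merely names the induced map: extensional homomorphisms that agree on pure
  tensors are equal.\<close>

definition tens_lin :: "('r, 'a) module \<Rightarrow> ('r, 'b) module \<Rightarrow> ('r, 'c) module \<Rightarrow> ('a \<Rightarrow> 'b \<Rightarrow> 'c) \<Rightarrow>
    ('a \<times> 'b \<Rightarrow> 'r) set \<Rightarrow> 'c"
  where "tens_lin A B C b = (SOME h. h \<in> Hom (tens A B) C \<and>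
      (\<forall>x\<in>carrier A. \<forall>y\<in>carrier B. h (te A B x y) = b x y))"

lemma tens_lin:
  fixes A :: "('r, 'a) module" and B :: "('r, 'b) module" and C :: "('r, 'c) module"
  assumes "module R A" "module R B" "module R C" "bilin A B C b"
  shows "tens_lin A B C b \<in> Hom (tens A B) C"
    and "x \<in> carrier A \<Longrightarrow> y \<in> carrier B \<Longrightarrow> tens_lin A B C b (te A B x y) = b x y"
proof -
  have "\<exists>h. h \<in> Hom (tens A B) C \<and> (\<forall>x\<in>carrier A. \<forall>y\<in>carrier B. h (te A B x y) = b x y)"
    by (rule tens_lift[OF assms]) blast
  then have "tens_lin A B C b \<in> Hom (tens A B) C \<and> (\<forall>x\<in>carrier A. \<forall>y\<in>carrier B. tens_lin A B C b
      (te A B x y) = b x y)"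
    unfolding tens_lin_def by (rule someI_ex)
  then show "tens_lin A B C b \<in> Hom (tens A B) C"
    "x \<in> carrier A \<Longrightarrow> y \<in> carrier B \<Longrightarrow> tens_lin A B C b (te A B x y) = b x y" by auto
qed

definition tens_map :: "('r, 'a) module \<Rightarrow> ('r, 'b) module \<Rightarrow> ('r, 'c) module \<Rightarrow> ('r, 'd) module \<Rightarrow>
    ('a \<Rightarrow> 'c) \<Rightarrow> ('b \<Rightarrow> 'd) \<Rightarrow> ('a \<times> 'b \<Rightarrow> 'r) set \<Rightarrow> ('c \<times> 'd \<Rightarrow> 'r) set"
  where "tens_map A B C D f g = tens_lin A B (tens C D) (\<lambda>x y. te C D (f x) (g y))"

lemma tens_map:
  fixes A :: "('r, 'a) module" and B :: "('r, 'b) module" and C :: "('r, 'c) module"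
      and D :: "('r, 'd) module"
  assumes "module R A" "module R B" "module R C" "module R D" "f \<in> Hom A C" "g \<in> Hom B D"
  shows "tens_map A B C D f g \<in> Hom (tens A B) (tens C D)"
    and "x \<in> carrier A \<Longrightarrow> y \<in> carrier B \<Longrightarrow> tens_map A B C D f g (te A B x y) = te C D (f x) (g y)"
proof -
  have b: "bilin A B (tens C D) (\<lambda>x y. te C D (f x) (g y))"
    using assms bilinD[OF te_bilin[OF assms(3,4)]]
    by (intro bilinI) (simp_all add: homD(1)[OF assms(5)] homD(1)[OF assms(6)]
        homD(2)[OF assms(5)] homD(2)[OF assms(6)]
      homD(3)[OF assms(5)] homD(3)[OF assms(6)])
  show "tens_map A B C D f g \<in> Hom (tens A B) (tens C D)"
    and "x \<in> carrier A \<Longrightarrow> y \<in> carrier B \<Longrightarrow> tens_map A B C D f g (te A B x y) = te C D (f x) (g y)"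
    unfolding tens_map_def using tens_lin[OF assms(1,2) module_tens[OF assms(3,4)] b] by blast+
qed

text \<open>The composites \<open>k\<close> and \<open>l\<close> are given only up to pointwise
  equality on the carriers, so that different factorizations of one map can be compared
  directly.\<close>

lemma tens_map_tens_map:
  fixes A :: "('r, 'a) module" and B :: "('r, 'b) module" and C :: "('r, 'c) module"
      and D :: "('r, 'd) module"
    and E :: "('r, 'e) module" and F :: "('r, 'f) module"
  assumes "module R A" "module R B" "module R C" "module R D" "module R E" "module R F"
    "f \<in> Hom A C" "g \<in> Hom B D" "f' \<in> Hom C E" "g' \<in> Hom D F" "k \<in> Hom A E" "l \<in> Hom B F"
    "\<And>x. x \<in> carrier A \<Longrightarrow> f' (f x) = k x" "\<And>y. y \<in> carrier B \<Longrightarrow> g' (g y) = l y"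
    and t: "t \<in> carrier (tens A B)"
  shows "tens_map C D E F f' g' (tens_map A B C D f g t) = tens_map A B E F k l t"
proof -
  note m = tens_map[OF assms(1-4,7,8)] tens_map[OF assms(3-6,9,10)]
      tens_map[OF assms(1,2,5,6,11,12)]
  have "compose (carrier (tens A B)) (tens_map C D E F f' g') (tens_map A B C D f g) t = tens_map
      A B E F k l t"
    by (rule tens_hom_eqI[OF assms(1,2) hom_compose[OF module_tens[OF assms(1,2)] m(1,3)] m(5) _ t])
      (use assms(1-4,13,14) homD(1)[OF assms(7)] homD(1)[OF assms(8)] in \<open>simp add: compose_eq m\<close>)
  then show ?thesis using t by (simp add: compose_eq)
qed

abbreviation idm :: "('r, 'a) module \<Rightarrow> 'a \<Rightarrow> 'a"
  where "idm A \<equiv> (\<lambda>x\<in>carrier A. x)"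

lemma tens_map_id:
  fixes A :: "('r, 'a) module" and B :: "('r, 'b) module"
  assumes "module R A" "module R B" "t \<in> carrier (tens A B)"
    "f \<in> Hom A A" "g \<in> Hom B B" "\<And>x. x \<in> carrier A \<Longrightarrow> f x = x" "\<And>y. y \<in> carrier B \<Longrightarrow> g y = y"
  shows "tens_map A B A B f g t = t"
proof -
  note m = tens_map[OF assms(1,2,1,2,4,5)]
  have "tens_map A B A B f g t = (\<lambda>t\<in>carrier (tens A B). t) t"
    by (rule tens_hom_eqI[OF assms(1,2) m(1) hom_id[OF module_tens[OF assms(1,2)]] _ assms(3)])
      (use m(2) assms in simp)
  then show ?thesis using assms(3) by simp
qed

lemma tens_map_zero:
  fixes A :: "('r, 'a) module" and B :: "('r, 'b) module" and C :: "('r, 'c) module"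
      and D :: "('r, 'd) module"
  assumes "module R A" "module R B" "module R C" "module R D" "f \<in> Hom A C" "g \<in> Hom B D"
    and z: "(\<forall>x\<in>carrier A. f x = \<zero>\<^bsub>C\<^esub>) \<or> (\<forall>y\<in>carrier B. g y = \<zero>\<^bsub>D\<^esub>)"
    and t: "t \<in> carrier (tens A B)"
  shows "tens_map A B C D f g t = \<zero>\<^bsub>tens C D\<^esub>"
proof -
  note m = tens_map[OF assms(1-6)]
  have "tens_map A B C D f g t = (\<lambda>t\<in>carrier (tens A B). \<zero>\<^bsub>tens C D\<^esub>) t"
    by (rule tens_hom_eqI[OF assms(1,2) m(1) hom_zero _ t])
      (use z assms(1-4) te_zero[OF assms(3,4)] homD(1)[OF assms(5)] homD(1)[OF assms(6)] in
          \<open>auto simp: m(2)\<close>)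
  then show ?thesis using t by simp
qed

text \<open>The image is a submodule that contains every pure tensor.\<close>

lemma tens_map_surj:
  fixes A :: "('r, 'a) module" and B :: "('r, 'b) module" and C :: "('r, 'c) module"
      and D :: "('r, 'd) module"
  assumes "module R A" "module R B" "module R C" "module R D" "f \<in> Hom A C" "g \<in> Hom B D"
    and f: "f ` carrier A = carrier C" and g: "g ` carrier B = carrier D"
  shows "tens_map A B C D f g ` carrier (tens A B) = carrier (tens C D)"
proof -
  note m = tens_map[OF assms(1-6)]
  let ?I = "tens_map A B C D f g ` carrier (tens A B)"
  note I = submoduleD[OF _ image_submodule[OF module_tens[OF assms(1,2)] module_tens[OF
      assms(3,4)] m(1)]]
  have "t \<in> ?I" if t: "t \<in> carrier (tens C D)" for t
  proof (rule tens_induct[OF assms(3,4) t])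
    fix x y assume "x \<in> carrier C" "y \<in> carrier D"
    then obtain a b where "a \<in> carrier A" "b \<in> carrier B" "x = f a" "y = g b" using f g by blast
    then show "te C D x y \<in> ?I" using m(2)[of a b] assms(1,2) by (metis image_eqI te_closed)
  qed (use I(3) assms(3,4) in simp)
  then show ?thesis using I(1) assms(3,4) by auto
qed

text \<open>Bridge to the definite description behind flatness: \<open>tens_map\<close> satisfies
  its condition, and agreement on pure tensors makes the solution unique.\<close>

lemma tensor_map_eq:
  fixes F :: "('r, 'f) module" and A :: "('r, 'a) module" and B :: "('r, 'b) module"
  assumes "module R F" "module R A" "module R B" "f \<in> Hom A B"
  shows "tensor_map R F A B f = tens_map F A F B (idm F) f"
proof -
  note m = tens_map[OF assms(1,2,1,3) hom_id[OF assms(1)] assms(4)]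
  show ?thesis
    unfolding tensor_map_def
  proof (rule the_equality)
    show "tens_map F A F B (idm F) f \<in> Hom (tens F A) (tens F B) \<and>
      (\<forall>x\<in>carrier F. \<forall>a\<in>carrier A. tens_map F A F B (idm F) f (te F A x a) = te F B x
          (f a))" using m by simp
    fix h assume h: "h \<in> Hom (tens F A) (tens F B) \<and> (\<forall>x\<in>carrier F. \<forall>a\<in>carrier A. h (te F A x a)
        = te F B x (f a))"
    show "h = tens_map F A F B (idm F) f"
      by (rule hom_eqI[OF conjunct1[OF h] m(1)], rule tens_hom_eqI[OF assms(1,2) conjunct1[OF h]
          m(1)])
        (use h m(2) in auto)
  qed
qed

lemma tens_lepoll:
  fixes A :: "('r, 'a) module" and B :: "('r, 'b) module"
  assumes inf: "infinite (UNIV :: 'u set)" and R: "carrier R \<lesssim> (UNIV :: 'u set)"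
    and "module R A" "module R B" and A: "carrier A \<lesssim> (UNIV :: 'u set)"
        and B: "carrier B \<lesssim> (UNIV :: 'u set)"
  shows "carrier (tens A B) \<lesssim> (UNIV :: 'u set)"
  using quotient_module(3)[OF module_free tensor_rel(1)[OF assms(3,4)], folded tensor_def]
    free_module_lepoll[OF inf R times_lepoll_infinite[OF inf A B]]
  by (rule lepoll_UNIV_trans)

text \<open>Right exactness of the tensor product. Modulo the image \<open>W\<close> of
  \<open>tens B G\<close>, the tensor of a preimage of \<open>f\<close> with \<open>g\<close> does
  not depend on the preimage. This gives a left inverse to the map from the quotient by
  \<open>W\<close> to \<open>tens F G\<close>, so everything killed by \<open>e\<close> lies in
  \<open>W\<close>.\<close>

lemma tens_exact_left:
  fixes A :: "('r, 'a) module" and B :: "('r, 'b) module" and F :: "('r, 'f) module"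
      and G :: "('r, 'g) module"
  assumes A: "module R A" and B: "module R B" and F: "module R F" and G: "module R G"
    and b: "b \<in> Hom B A" and e: "e \<in> Hom A F" "e ` carrier A = carrier F"
    and ex: "\<And>x. x \<in> carrier A \<Longrightarrow> e x = \<zero>\<^bsub>F\<^esub> \<Longrightarrow> x \<in> b ` carrier B"
    and t: "t \<in> carrier (tens A G)" "tens_map A G F G e (idm G) t = \<zero>\<^bsub>tens F G\<^esub>"
  shows "t \<in> tens_map B G A G b (idm G) ` carrier (tens B G)"
proof -
  note id = hom_id[OF G]
  note mb = tens_map[OF B G A G b id] and me = tens_map[OF A G F G e(1) id]
  let ?W = "tens_map B G A G b (idm G) ` carrier (tens B G)"
  have W: "submodule ?W R (tens A G)" by (rule image_submodule) (use A B G mb in simp_all)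
  let ?Q = "quotient_module (tens A G) ?W"
  let ?p = "quot_map (tens A G) ?W"
  note q = quotient_module[OF module_tens[OF A G] W]
  note tb = bilinD[OF te_bilin[OF A G]]
  define s where "s f = (SOME a. a \<in> carrier A \<and> e a = f)" for f
  have s: "s f \<in> carrier A" "e (s f) = f" if "f \<in> carrier F" for f
  proof -
    have "\<exists>a. a \<in> carrier A \<and> e a = f" using that e(2) by (metis imageE)
    then have "s f \<in> carrier A \<and> e (s f) = f" unfolding s_def by (rule someI_ex)
    then show "s f \<in> carrier A" "e (s f) = f" by auto
  qed
  have indep: "?p (te A G a g) = ?p (te A G a' g)"
    if "a \<in> carrier A" "a' \<in> carrier A" "e a = e a'" "g \<in> carrier G" for a a' g
  proof -
    have d: "a \<ominus>\<^bsub>A\<^esub> a' \<in> carrier A" using that A by simp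
    have "e (a \<ominus>\<^bsub>A\<^esub> a') = \<zero>\<^bsub>F\<^esub>" using that A F homD(1)[OF e(1)]
      by (simp add: hom_zero_neg(3)[OF e(1)])
    then obtain u where u: "u \<in> carrier B" "a \<ominus>\<^bsub>A\<^esub> a' = b u" using ex[OF d] by blast
    have "te A G a g = te A G (a \<ominus>\<^bsub>A\<^esub> a' \<oplus>\<^bsub>A\<^esub> a') g" using that A by (simp add: module_diff(5))
    also have "\<dots> = te A G (b u) g \<oplus>\<^bsub>tens A G\<^esub> te A G a' g" using that A u tb(2)[of "b u" a' g]
        homD(1)[OF b] by simp
    finally have "te A G a g \<ominus>\<^bsub>tens A G\<^esub> te A G a' g = te A G (b u) g"
      using that A G u homD(1)[OF b] by (simp add: module_diff(6))
    also have "\<dots> = tens_map B G A G b (idm G) (te B G u g)" using mb(2)[of u g] u that by simp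
    also have "\<dots> \<in> ?W" using u that B G by simp
    finally show ?thesis using q(4)[of "te A G a g" "te A G a' g"] that A G by simp
  qed
  have pc: "?p x \<in> carrier ?Q" if "x \<in> carrier (tens A G)" for x using homD(1)[OF q(2) that] .
  have b': "bilin F G ?Q (\<lambda>f g. ?p (te A G (s f) g))"
  proof (rule bilinI)
    fix f g assume "f \<in> carrier F" "g \<in> carrier G"
    then show "?p (te A G (s f) g) \<in> carrier ?Q" using s A G by (intro pc) simp
  next
    fix f f' g assume *: "f \<in> carrier F" "f' \<in> carrier F" "g \<in> carrier G"
    have "?p (te A G (s (f \<oplus>\<^bsub>F\<^esub> f')) g) = ?p (te A G (s f \<oplus>\<^bsub>A\<^esub> s f') g)"
      by (rule indep) (use * s A F in \<open>simp_all add: homD(2)[OF e(1)]\<close>)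
    then show "?p (te A G (s (f \<oplus>\<^bsub>F\<^esub> f')) g) = ?p (te A G (s f) g) \<oplus>\<^bsub>?Q\<^esub> ?p (te A G (s f') g)"
      using * s(1) A G by (simp add: tb(2) homD(2)[OF q(2)])
  next
    fix f g g' assume *: "f \<in> carrier F" "g \<in> carrier G" "g' \<in> carrier G"
    then show "?p (te A G (s f) (g \<oplus>\<^bsub>G\<^esub> g')) = ?p (te A G (s f) g) \<oplus>\<^bsub>?Q\<^esub> ?p (te A G (s f) g')"
      using s(1) A G by (simp add: tb(3) homD(2)[OF q(2)])
  next
    fix r f g assume *: "r \<in> carrier R" "f \<in> carrier F" "g \<in> carrier G"
    have "?p (te A G (s (r \<odot>\<^bsub>F\<^esub> f)) g) = ?p (te A G (r \<odot>\<^bsub>A\<^esub> s f) g)"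
      by (rule indep) (use * s A F in \<open>simp_all add: homD(3)[OF e(1)]\<close>)
    then show "?p (te A G (s (r \<odot>\<^bsub>F\<^esub> f)) g) = r \<odot>\<^bsub>?Q\<^esub> ?p (te A G (s f) g)"
      using * s(1) A G by (simp add: tb(4) homD(3)[OF q(2)])
    show "?p (te A G (s f) (r \<odot>\<^bsub>G\<^esub> g)) = r \<odot>\<^bsub>?Q\<^esub> ?p (te A G (s f) g)"
      using * s(1) A G by (simp add: tb(5) homD(3)[OF q(2)])
  qed
  obtain h where h: "h \<in> Hom (tens F G) ?Q"
    "\<And>f g. f \<in> carrier F \<Longrightarrow> g \<in> carrier G \<Longrightarrow> h (te F G f g) = ?p (te A G (s f) g)"
    by (rule tens_lift[OF F G q(1) b']) blast
  have "compose (carrier (tens A G)) h (tens_map A G F G e (idm G)) t = ?p t"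
  proof (rule tens_hom_eqI[OF A G hom_compose[OF module_tens[OF A G] me(1) h(1)] q(2) _ t(1)])
    fix x y assume xy: "x \<in> carrier A" "y \<in> carrier G"
    then have "?p (te A G (s (e x)) y) = ?p (te A G x y)"
      by (intro indep) (use xy s homD(1)[OF e(1)] in simp_all)
    then show "compose (carrier (tens A G)) h (tens_map A G F G e (idm G)) (te A G x y) = ?p
        (te A G x y)"
      using xy A G homD(1)[OF e(1)] by (simp add: compose_eq me(2) h(2))
  qed
  then have "?p t = \<zero>\<^bsub>?Q\<^esub>"
    using t hom_zero_neg(1)[OF h(1) module_tens[OF F G] q(1)] by (simp add: compose_eq)
  then show ?thesis using q(5)[OF t(1)] by simp
qed

section \<open>Symmetry and functoriality in each factor\<close>

definition tens_swap :: "('r, 'a) module \<Rightarrow> ('r, 'b) module \<Rightarrow> ('a \<times> 'b \<Rightarrow> 'r) set \<Rightarrow> ('b \<times> 'a \<Rightarrow> 'r)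
    set"
  where "tens_swap A B = tens_lin A B (tens B A) (\<lambda>x y. te B A y x)"

lemma tens_swap:
  fixes A :: "('r, 'a) module" and B :: "('r, 'b) module"
  assumes A: "module R A" and B: "module R B"
  shows "tens_swap A B \<in> Hom (tens A B) (tens B A)"
    and "x \<in> carrier A \<Longrightarrow> y \<in> carrier B \<Longrightarrow> tens_swap A B (te A B x y) = te B A y x"
proof -
  have b: "bilin A B (tens B A) (\<lambda>x y. te B A y x)"
    using bilinD[OF te_bilin[OF B A]] by (intro bilinI) simp_all
  show "tens_swap A B \<in> Hom (tens A B) (tens B A)"
    and "x \<in> carrier A \<Longrightarrow> y \<in> carrier B \<Longrightarrow> tens_swap A B (te A B x y) = te B A y x"
    unfolding tens_swap_def using tens_lin[OF A B module_tens[OF B A] b] by blast+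
qed

lemma tens_swap_tens_swap:
  fixes A :: "('r, 'a) module" and B :: "('r, 'b) module"
  assumes A: "module R A" and B: "module R B" and t: "t \<in> carrier (tens A B)"
  shows "tens_swap B A (tens_swap A B t) = t"
proof -
  have "compose (carrier (tens A B)) (tens_swap B A) (tens_swap A B) t = (\<lambda>t\<in>carrier (tens A B).
      t) t"
    by (rule tens_hom_eqI[OF A B hom_compose[OF module_tens[OF A B] tens_swap(1)[OF A B]
        tens_swap(1)[OF B A]] hom_id[OF module_tens[OF A B]] _ t])
      (use A B in \<open>simp add: compose_eq tens_swap(2)\<close>)
  then show ?thesis using t by (simp add: compose_eq)
qed

lemma tens_swap_tens_map:
  fixes A :: "('r, 'a) module" and B :: "('r, 'b) module" and C :: "('r, 'c) module"
      and D :: "('r, 'd) module"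
  assumes "module R A" "module R B" "module R C" "module R D" "f \<in> Hom A C" "g \<in> Hom B D"
    and t: "t \<in> carrier (tens A B)"
  shows "tens_swap C D (tens_map A B C D f g t) = tens_map B A D C g f (tens_swap A B t)"
proof -
  note m = tens_map[OF assms(1-6)] tens_map[OF assms(2,1,4,3,6,5)]
  note s = tens_swap[OF assms(1,2)] tens_swap[OF assms(3,4)]
  have "compose (carrier (tens A B)) (tens_swap C D) (tens_map A B C D f g) t = compose
      (carrier (tens A B)) (tens_map B A D C g f) (tens_swap A B) t"
    by (rule tens_hom_eqI[OF assms(1,2) hom_compose[OF module_tens[OF assms(1,2)] m(1) s(3)]
        hom_compose[OF module_tens[OF assms(1,2)] s(1) m(3)] _ t])
      (use assms(1-4) homD(1)[OF assms(5)] homD(1)[OF assms(6)] in \<open>simp add: compose_eq m s\<close>)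
  then show ?thesis using t by (simp add: compose_eq)
qed

abbreviation tens_r :: "('r, 'f) module \<Rightarrow> ('r, 'a) module \<Rightarrow> ('r, 'b) module \<Rightarrow> ('a \<Rightarrow> 'b) \<Rightarrow> _"
  where "tens_r F A B f \<equiv> tens_map F A F B (idm F) f"

abbreviation tens_l :: "('r, 'a) module \<Rightarrow> ('r, 'b) module \<Rightarrow> ('r, 'g) module \<Rightarrow> ('a \<Rightarrow> 'b) \<Rightarrow> _"
  where "tens_l A B G f \<equiv> tens_map A G B G f (idm G)"

lemma tens_r:
  fixes F :: "('r, 'f) module" and A :: "('r, 'a) module" and B :: "('r, 'b) module"
  assumes "module R F" "module R A" "module R B" "f \<in> Hom A B"
  shows "tens_r F A B f \<in> Hom (tens F A) (tens F B)"
    and "x \<in> carrier F \<Longrightarrow> y \<in> carrier A \<Longrightarrow> tens_r F A B f (te F A x y) = te F B x (f y)"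
  using tens_map[OF assms(1,2,1,3) hom_id[OF assms(1)] assms(4)] by simp_all

lemma tens_l:
  fixes F :: "('r, 'f) module" and A :: "('r, 'a) module" and B :: "('r, 'b) module"
  assumes "module R F" "module R A" "module R B" "f \<in> Hom A B"
  shows "tens_l A B F f \<in> Hom (tens A F) (tens B F)"
    and "x \<in> carrier A \<Longrightarrow> y \<in> carrier F \<Longrightarrow> tens_l A B F f (te A F x y) = te B F (f x) y"
  using tens_map[OF assms(2,1,3,1) assms(4) hom_id[OF assms(1)]] by simp_all

lemma tens_r_tens_r:
  fixes F :: "('r, 'f) module" and A :: "('r, 'a) module" and B :: "('r, 'b) module"
      and C :: "('r, 'c) module"
  assumes "module R F" "module R A" "module R B" "module R C" "f \<in> Hom A B" "g \<in> Hom B C"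
      "h \<in> Hom A C"
    "\<And>x. x \<in> carrier A \<Longrightarrow> g (f x) = h x" "t \<in> carrier (tens F A)"
  shows "tens_r F B C g (tens_r F A B f t) = tens_r F A C h t"
  by (rule tens_map_tens_map[OF assms(1,2,1,3,1,4) hom_id[OF assms(1)] assms(5)
      hom_id[OF assms(1)] assms(6)
        hom_id[OF assms(1)] assms(7) _ assms(8) assms(9)]) simp

lemma tens_l_tens_l:
  fixes F :: "('r, 'f) module" and A :: "('r, 'a) module" and B :: "('r, 'b) module"
      and C :: "('r, 'c) module"
  assumes "module R F" "module R A" "module R B" "module R C" "f \<in> Hom A B" "g \<in> Hom B C"
      "h \<in> Hom A C"
    "\<And>x. x \<in> carrier A \<Longrightarrow> g (f x) = h x" "t \<in> carrier (tens A F)"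
  shows "tens_l B C F g (tens_l A B F f t) = tens_l A C F h t"
  using tens_map_tens_map[OF assms(2,1,3,1,4,1) assms(5) hom_id[OF assms(1)] assms(6)
      hom_id[OF assms(1)]
        assms(7) hom_id[OF assms(1)] assms(8) _ assms(9)] by simp

text \<open>Both composites are the tensor product of \<open>f\<close> with
  \<open>g\<close>.\<close>

lemma tens_r_tens_l:
  fixes A :: "('r, 'a) module" and B :: "('r, 'b) module" and C :: "('r, 'c) module"
      and D :: "('r, 'd) module"
  assumes "module R A" "module R B" "module R C" "module R D" "f \<in> Hom A B" "g \<in> Hom C D"
      "t \<in> carrier (tens A C)"
  shows "tens_r B C D g (tens_l A B C f t) = tens_l A B D f (tens_r A C D g t)"
proof -
  have "tens_r B C D g (tens_l A B C f t) = tens_map A C B D f g t"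
    by (rule tens_map_tens_map[OF assms(1,3,2,3,2,4) assms(5) hom_id[OF assms(3)]
        hom_id[OF assms(2)] assms(6)
        assms(5,6) _ _ assms(7)]) (simp_all add: homD(1)[OF assms(5)])
  also have "\<dots> = tens_l A B D f (tens_r A C D g t)"
    by (rule sym, rule tens_map_tens_map[OF assms(1,3,1,4,2,4) hom_id[OF assms(1)] assms(6)
        assms(5) hom_id[OF assms(4)]
        assms(5,6) _ _ assms(7)]) (simp_all add: homD(1)[OF assms(6)])
  finally show ?thesis .
qed

lemma tens_r_id:
  fixes A :: "('r, 'a) module" and B :: "('r, 'b) module"
  assumes "module R A" "module R B" "t \<in> carrier (tens A B)" "g \<in> Hom B B" "\<And>y. y \<in> carrier B \<Longrightarrow>
      g y = y"
  shows "tens_r A B B g t = t"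
  by (rule tens_map_id[OF assms(1,2,3) hom_id[OF assms(1)] assms(4) _ assms(5)]) simp

lemma tens_l_id:
  fixes A :: "('r, 'a) module" and B :: "('r, 'b) module"
  assumes "module R A" "module R B" "t \<in> carrier (tens A B)" "f \<in> Hom A A" "\<And>y. y \<in> carrier A \<Longrightarrow>
      f y = y"
  shows "tens_l A A B f t = t"
  by (rule tens_map_id[OF assms(1,2,3,4) hom_id[OF assms(2)] assms(5)]) simp_all

section \<open>Exactness of tensoring with free and projective modules\<close>

lemma exact_atD:
  assumes "exact_at A f B g C"
  shows "x \<in> carrier A \<Longrightarrow> g (f x) = \<zero>\<^bsub>C\<^esub>" "x \<in> carrier A \<Longrightarrow> f x \<in> carrier B"
    and "y \<in> carrier B \<Longrightarrow> g y = \<zero>\<^bsub>C\<^esub> \<Longrightarrow> \<exists>x\<in>carrier A. y = f x"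
  using assms unfolding exact_at_iff by blast+

lemma exact_atI:
  assumes "\<And>x. x \<in> carrier A \<Longrightarrow> f x \<in> carrier B" "\<And>x. x \<in> carrier A \<Longrightarrow> g (f x) = \<zero>\<^bsub>C\<^esub>"
    and "\<And>y. y \<in> carrier B \<Longrightarrow> g y = \<zero>\<^bsub>C\<^esub> \<Longrightarrow> y \<in> f ` carrier A"
  shows "exact_at A f B g C"
  using assms unfolding exact_at_iff by blast

text \<open>Functoriality takes care of vanishing composites, so only the inclusion of the kernel in
  the image remains. The later exactness proofs for fixed left factor all start here.\<close>

lemma tens_r_exactI:
  fixes F :: "('r, 'f) module" and A :: "('r, 'a) module" and B :: "('r, 'b) module"
      and C :: "('r, 'c) module"
  assumes "module R F" "module R A" "module R B" "module R C" "f \<in> Hom A B" "g \<in> Hom B C"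
    and ex: "exact_at A f B g C"
    and "\<And>t. t \<in> carrier (tens F B) \<Longrightarrow> tens_r F B C g t = \<zero>\<^bsub>tens F C\<^esub> \<Longrightarrow> t \<in> tens_r F A B f `
        carrier (tens F A)"
  shows "exact_at (tens F A) (tens_r F A B f) (tens F B) (tens_r F B C g) (tens F C)"
proof (rule exact_atI)
  fix t assume t: "t \<in> carrier (tens F A)"
  show "tens_r F A B f t \<in> carrier (tens F B)" using homD(1)[OF tens_r(1)[OF assms(1,2,3,5)] t] .
  have "tens_r F B C g (tens_r F A B f t) = tens_r F A C (\<lambda>x\<in>carrier A. \<zero>\<^bsub>C\<^esub>) t"
    by (rule tens_r_tens_r[OF assms(1-6) hom_zero[OF assms(2,4)] _ t]) (use exact_atD(1)[OF ex] in
        simp)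
  also have "\<dots> = \<zero>\<^bsub>tens F C\<^esub>"
    by (rule tens_map_zero[OF assms(1,2,1,4) hom_id[OF assms(1)] hom_zero[OF assms(2,4)] _ t]) simp
  finally show "tens_r F B C g (tens_r F A B f t) = \<zero>\<^bsub>tens F C\<^esub>" .
qed (use assms(8) in blast)

text \<open>The map induced by \<open>v x \<odot> y\<close> is the coordinate at \<open>x\<close>
  when the tensor product is viewed as the direct sum of copies of \<open>Y\<close> indexed by
  \<open>X\<close>; each tensor is the finite sum of its coordinates.\<close>

lemma tens_free_normal_form:
  fixes Y :: "('r, 'y) module" and X :: "'x set"
  assumes Y: "module R Y" and t: "t \<in> carrier (tens (free X) Y)"
  obtains F where "finite F" "F \<subseteq> X"
    "t = finsum (tens (free X) Y) (\<lambda>x. te (free X) Y (bas x) (tens_lin (free X) Y Y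
        (\<lambda>v y. v x \<odot>\<^bsub>Y\<^esub> y) t)) F"
proof -
  let ?L = "free X" and ?T = "tens (free X) Y"
  let ?c = "\<lambda>x. tens_lin ?L Y Y (\<lambda>v y. v x \<odot>\<^bsub>Y\<^esub> y)"
  define s where "s t F = finsum ?T (\<lambda>x. te ?L Y (bas x) (?c x t)) F" for t F
  \<comment> \<open>Asking for the expansion over all finite sets beyond \<open>F\<close>, not just
    over one, makes the property additive: two tensors are then expanded over a common index
    set.\<close>
  define Q where "Q t \<longleftrightarrow> (\<exists>F. finite F \<and> F \<subseteq> X \<and> (\<forall>F'. finite F' \<longrightarrow> F \<subseteq> F' \<longrightarrow> F' \<subseteq> X \<longrightarrow> t = s t F'))"
      for t
  have b: "bilin ?L Y Y (\<lambda>v y. v x \<odot>\<^bsub>Y\<^esub> y)" for x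
    by (rule bilinI) (use Y in \<open>simp_all add: free_carrierD(1)[where X = X] free_simps
        module_smult\<close>)
  note c = tens_lin[OF module_free Y Y b]
  note tb = bilinD[OF te_bilin[OF module_free[of X] Y]]
  interpret T: module R ?T using Y by simp
  have mT: "module R ?T" using Y by simp
  have cl: "te ?L Y (bas x) (?c x t) \<in> carrier ?T" if "x \<in> X" "t \<in> carrier ?T" for x t
    using that homD(1)[OF c(1)] Y by simp
  have add: "Q (t \<oplus>\<^bsub>?T\<^esub> u)" if tu: "t \<in> carrier ?T" "u \<in> carrier ?T" "Q t" "Q u" for t u
  proof -
    obtain F G where F: "finite F" "F \<subseteq> X" "\<And>F'. finite F' \<Longrightarrow> F \<subseteq> F' \<Longrightarrow> F' \<subseteq> X \<Longrightarrow> t = s t F'"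
      and G: "finite G" "G \<subseteq> X" "\<And>F'. finite F' \<Longrightarrow> G \<subseteq> F' \<Longrightarrow> F' \<subseteq> X \<Longrightarrow> u = s u F'"
      using tu unfolding Q_def by metis
    have "t \<oplus>\<^bsub>?T\<^esub> u = s (t \<oplus>\<^bsub>?T\<^esub> u) F'" if F': "finite F'" "F \<union> G \<subseteq> F'" "F' \<subseteq> X" for F'
    proof -
      have "s (t \<oplus>\<^bsub>?T\<^esub> u) F' = finsum ?T (\<lambda>x. te ?L Y (bas x) (?c x t) \<oplus>\<^bsub>?T\<^esub> te ?L Y (bas x)
          (?c x u)) F'"
        unfolding s_def
        by (rule T.M.finsum_cong') (use F' tu cl homD(1)[OF c(1)] homD(2)[OF c(1)] tb(3) in
            \<open>auto simp: subset_iff\<close>)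
      also have "\<dots> = s t F' \<oplus>\<^bsub>?T\<^esub> s u F'"
        unfolding s_def by (rule T.M.finsum_addf) (use F' tu cl in auto)
      finally show ?thesis using F(3)[OF F'(1) _ F'(3)] G(3)[OF F'(1) _ F'(3)] F'(2) by simp
    qed
    then show ?thesis unfolding Q_def using F G by (intro exI[of _ "F \<union> G"]) simp
  qed
  have Qb: "Q (te ?L Y (bas x) y)" if xy: "x \<in> X" "y \<in> carrier Y" for x y
  proof -
    have "te ?L Y (bas x) y = s (te ?L Y (bas x) y) F'" if F': "finite F'" "{x} \<subseteq> F'" "F' \<subseteq> X"
        for F'
    proof -
      have el: "te ?L Y (bas z) (?c z (te ?L Y (bas x) y)) = (if x = z then te ?L Y (bas x) y else
          \<zero>\<^bsub>?T\<^esub>)"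
        if z: "z \<in> X" for z
        using c(2)[OF bas_carrier[OF xy(1)] xy(2), of z] te_zero(2)[OF module_free Y
            bas_carrier[OF z]] xy Y by simp
      have "s (te ?L Y (bas x) y) F' = finsum ?T (\<lambda>z. if x = z then te ?L Y (bas x) y else \<zero>\<^bsub>?T\<^esub>)
          F'"
        unfolding s_def
        by (rule T.M.finsum_cong'[OF refl _ el]) (use F' xy Y in auto)
      also have "\<dots> = te ?L Y (bas x) y"
        using T.M.finsum_singleton[of x F' "\<lambda>z. te ?L Y (bas x) y"] F' xy Y by simp
      finally show ?thesis by simp
    qed
    then show ?thesis unfolding Q_def using xy by (intro exI[of _ "{x}"]) simp
  qed
  have Qe: "\<forall>y\<in>carrier Y. Q (te ?L Y v y)" if v: "v \<in> carrier ?L" for v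
  proof (rule free_induct[OF v])
    show "\<forall>y\<in>carrier Y. Q (te ?L Y \<zero>\<^bsub>?L\<^esub> y)"
    proof
      fix y assume y: "y \<in> carrier Y"
      have "s \<zero>\<^bsub>?T\<^esub> F' = \<zero>\<^bsub>?T\<^esub>" if "F' \<subseteq> X" for F'
        unfolding s_def
      proof (rule T.M.add.finprod_one_eqI)
        fix x assume "x \<in> F'"
        then have "bas x \<in> carrier ?L" using that by auto
        then show "te ?L Y (bas x) (?c x \<zero>\<^bsub>?T\<^esub>) = \<zero>\<^bsub>?T\<^esub>"
          by (simp only: hom_zero_neg(1)[OF c(1) mT Y] te_zero(2)[OF module_free Y])
      qed
      then show "Q (te ?L Y \<zero>\<^bsub>?L\<^esub> y)" unfolding Q_def te_zero(1)[OF module_free Y y]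
        by (intro exI[of _ "{}"]) simp
    qed
  next
    fix v w assume "v \<in> carrier ?L" "w \<in> carrier ?L" "\<forall>y\<in>carrier Y. Q (te ?L Y v y)"
        "\<forall>y\<in>carrier Y. Q (te ?L Y w y)"
    then show "\<forall>y\<in>carrier Y. Q (te ?L Y (v \<oplus>\<^bsub>?L\<^esub> w) y)"
      using add[OF te_closed[OF module_free Y] te_closed[OF module_free Y]] by (simp add: tb(2))
  next
    fix r x assume "r \<in> carrier R" "x \<in> X"
    then have "te ?L Y (r \<odot>\<^bsub>?L\<^esub> bas x) y = te ?L Y (bas x) (r \<odot>\<^bsub>Y\<^esub> y)" if "y \<in> carrier Y" for y
      using that by (simp add: tb(4) tb(5))
    then show "\<forall>y\<in>carrier Y. Q (te ?L Y (r \<odot>\<^bsub>?L\<^esub> bas x) y)" using Qb Y \<open>r \<in> carrier R\<close> \<open>x \<in> X\<close>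
      by simp
  qed
  have "Q t"
  proof (rule tens_induct[OF module_free Y t])
    show "Q (te ?L Y v y)" if "v \<in> carrier ?L" "y \<in> carrier Y" for v y using Qe[OF that(1)]
        that(2) ..
  qed (rule add)
  then obtain F where F: "finite F" "F \<subseteq> X"
    and "\<forall>F'. finite F' \<longrightarrow> F \<subseteq> F' \<longrightarrow> F' \<subseteq> X \<longrightarrow> t = s t F'"
    unfolding Q_def by (elim exE conjE)
  from this(3)[rule_format, OF F(1) subset_refl F(2)] show ?thesis
    unfolding s_def by (rule that[OF F])
qed

text \<open>Exactness is checked coordinate by coordinate: the coordinates of a kernel element lie
  in the kernel of \<open>g\<close>, hence in the image of \<open>f\<close>, and the normal form
  reassembles them.\<close>

lemma tens_free_exact:
  fixes A :: "('r, 'a) module" and B :: "('r, 'b) module" and C :: "('r, 'c) module"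
      and X :: "'x set"
  assumes A: "module R A" and B: "module R B" and C: "module R C" and f: "f \<in> Hom A B"
      and g: "g \<in> Hom B C"
    and ex: "exact_at A f B g C"
  shows "exact_at (tens (free X) A) (tens_r (free X) A B f) (tens (free X) B) (tens_r (free X) B C
      g) (tens (free X) C)"
proof (rule tens_r_exactI[OF module_free A B C f g ex])
  let ?L = "free X"
  fix t assume t: "t \<in> carrier (tens ?L B)" and z: "tens_r ?L B C g t = \<zero>\<^bsub>tens ?L C\<^esub>"
  define I where "I = tens_r ?L A B f ` carrier (tens ?L A)"
  let ?c = "\<lambda>x. tens_lin ?L B B (\<lambda>v y. v x \<odot>\<^bsub>B\<^esub> y)"
      and ?d = "\<lambda>x. tens_lin ?L C C (\<lambda>v y. v x \<odot>\<^bsub>C\<^esub> y)"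
  have "bilin ?L B B (\<lambda>v y. v x \<odot>\<^bsub>B\<^esub> y)" for x
    by (rule bilinI) (use B in \<open>simp_all add: free_carrierD(1)[where X = X] free_simps
        module_smult\<close>)
  note c = tens_lin[OF module_free B B this]
  have "bilin ?L C C (\<lambda>v y. v x \<odot>\<^bsub>C\<^esub> y)" for x
    by (rule bilinI) (use C in \<open>simp_all add: free_carrierD(1)[where X = X] free_simps
        module_smult\<close>)
  note d = tens_lin[OF module_free C C this]
  note mg = tens_r[OF module_free[of X] B C g] and mf = tens_r[OF module_free[of X] A B f]
  have I: "submodule I R (tens ?L B)" unfolding I_def
    by (rule image_submodule) (use A B mf in simp_all)
  have gc: "g (?c x t) = \<zero>\<^bsub>C\<^esub>" for x
  proof -
    have "compose (carrier (tens ?L B)) g (?c x) t = compose (carrier (tens ?L B)) (?d x)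
        (tens_r ?L B C g) t"
      by (rule tens_hom_eqI[OF module_free B hom_compose[OF module_tens[OF module_free B] c(1) g]
          hom_compose[OF module_tens[OF module_free B] mg(1) d(1)] _ t])
        (use B homD(1)[OF g] homD(3)[OF g] in \<open>simp add: compose_eq mg c d free_carrierD(1)[where
            X = X]\<close>)
    then show ?thesis using t z hom_zero_neg(1)[OF d(1) module_tens[OF module_free C] C]
      by (simp add: compose_eq)
  qed
  have cI: "te ?L B (bas x) (?c x t) \<in> I" if x: "x \<in> X" for x
  proof -
    obtain a where a: "a \<in> carrier A" "?c x t = f a"
      using exact_atD(3)[OF ex homD(1)[OF c(1) t] gc] by blast
    then have "te ?L B (bas x) (?c x t) = tens_r ?L A B f (te ?L A (bas x) a)" using x mf(2) by simp
    moreover have "te ?L A (bas x) a \<in> carrier (tens ?L A)" using a x A by simp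
    ultimately show ?thesis unfolding I_def by (rule image_eqI)
  qed
  obtain F where F: "finite F" "F \<subseteq> X" "t = finsum (tens ?L B) (\<lambda>x. te ?L B (bas x) (?c x t)) F"
    by (rule tens_free_normal_form[OF B t])
  interpret T: module R "tens ?L B" using B by simp
  note ID = submoduleD[OF T.module_axioms I]
  have "finsum (tens ?L B) (\<lambda>x. te ?L B (bas x) (?c x t)) F \<in> I" using F(1,2)
  proof (induction F rule: finite_induct)
    case empty
    show ?case using ID(2) by simp
  next
    case (insert x F)
    have "te ?L B (bas z) (?c z t) \<in> I" if "z \<in> insert x F" for z using cI insert.prems that
      by blast
    then have el: "te ?L B (bas z) (?c z t) \<in> carrier (tens ?L B)" if "z \<in> insert x F"
        for z using ID(1) that by blast
    have "finsum (tens ?L B) (\<lambda>x. te ?L B (bas x) (?c x t)) (insert x F) =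
        te ?L B (bas x) (?c x t) \<oplus>\<^bsub>tens ?L B\<^esub> finsum (tens ?L B) (\<lambda>x. te ?L B (bas x) (?c x t)) F"
      by (rule T.M.finsum_insert[OF insert.hyps]) (use el in blast)+
    then show ?case using ID(3)[OF cI insert.IH] insert.prems by simp
  qed
  then show "t \<in> tens_r ?L A B f ` carrier (tens ?L A)" unfolding F(3)[symmetric] I_def .
qed

text \<open>A projective module is a retract of its free cover: a kernel element is pushed into the
  free case along \<open>s\<close>, solved there and pulled back. No size restriction is involved,
  which suits the later cone of tensor products.\<close>

lemma tens_proj_exact:
  fixes A :: "('r, 'a) module" and B :: "('r, 'b) module" and C :: "('r, 'c) module"
      and P :: "('r, 'p) module"
  assumes P: "proj P" and A: "module R A" and B: "module R B" and C: "module R C"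
      and f: "f \<in> Hom A B" and g: "g \<in> Hom B C"
    and ex: "exact_at A f B g C"
  shows "exact_at (tens P A) (tens_r P A B f) (tens P B) (tens_r P B C g) (tens P C)"
proof -
  let ?L = "free (carrier P)"
  have mP: "module R P" using P by (rule proj_module)
  obtain s where s: "s \<in> Hom P ?L" "\<And>x. x \<in> carrier P \<Longrightarrow> free_cover P (s x) = x" using P
    by (auto simp: proj_def)
  note e = free_cover(1)[OF mP]
  show ?thesis
  proof (rule tens_r_exactI[OF mP A B C f g ex])
    fix t assume t: "t \<in> carrier (tens P B)" and z: "tens_r P B C g t = \<zero>\<^bsub>tens P C\<^esub>"
    note sB = tens_l[OF B mP module_free s(1)] and sC = tens_l[OF C mP module_free s(1)]
    have st: "tens_l P ?L B s t \<in> carrier (tens ?L B)" using homD(1)[OF sB(1) t] .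
    have "tens_r ?L B C g (tens_l P ?L B s t) = \<zero>\<^bsub>tens ?L C\<^esub>"
      using tens_r_tens_l[OF mP module_free B C s(1) g t] z hom_zero_neg(1)[OF sC(1)] mP C by simp
    then obtain u where u: "u \<in> carrier (tens ?L A)" "tens_l P ?L B s t = tens_r ?L A B f u"
      using exact_atD(3)[OF tens_free_exact[OF A B C f g ex] st] by blast
    have "t = tens_l ?L P B (free_cover P) (tens_l P ?L B s t)"
      using tens_l_tens_l[OF B mP module_free mP s(1) e hom_id[OF mP] _ t] tens_l_id[OF mP B t
          hom_id[OF mP]] s(2) by simp
    also have "\<dots> = tens_r P A B f (tens_l ?L P A (free_cover P) u)"
      using u tens_r_tens_l[OF module_free mP A B e f u(1)] by simp
    finally show "t \<in> tens_r P A B f ` carrier (tens P A)"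
      using homD(1)[OF tens_l(1)[OF A module_free mP e] u(1)] by simp
  qed
qed

lemma hom_module_compose:
  fixes A :: "('r, 'a) module" and B :: "('r, 'b) module" and C :: "('r, 'c) module"
  assumes "module R A" "module R B" "module R C" "g \<in> Hom B C"
  shows "(\<lambda>f\<in>carrier (hom_module R A B). compose (carrier A) g f) \<in> Hom (hom_module R A B)
      (hom_module R A C)"
proof (rule mod_homI)
  fix f f' assume "f \<in> carrier (hom_module R A B)" "f' \<in> carrier (hom_module R A B)"
  then have *: "f \<in> Hom A B" "f' \<in> Hom A B" by (simp_all add: hom_module_simps)
  show "compose (carrier A) g f \<in> carrier (hom_module R A C)"
    using hom_compose[OF assms(1) *(1) assms(4)] by (simp add: hom_module_simps)
  show "compose (carrier A) g (f \<oplus>\<^bsub>hom_module R A B\<^esub> f') =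
      compose (carrier A) g f \<oplus>\<^bsub>hom_module R A C\<^esub> compose (carrier A) g f'"
    using homD(1)[OF *(1)] homD(1)[OF *(2)] by (auto simp: hom_module_def compose_def fun_eq_iff
        homD(2)[OF assms(4)])
next
  fix r f assume "r \<in> carrier R" "f \<in> carrier (hom_module R A B)"
  then have *: "f \<in> Hom A B" "r \<in> carrier R" by (simp_all add: hom_module_simps)
  show "compose (carrier A) g (r \<odot>\<^bsub>hom_module R A B\<^esub> f) = r \<odot>\<^bsub>hom_module R A C\<^esub> compose
      (carrier A) g f"
    using homD(1)[OF *(1)] *(2)
      by (auto simp: hom_module_def compose_def fun_eq_iff homD(3)[OF assms(4)])
qed (use module_hom_module assms in blast)

text \<open>By adjunction Hom(A \<otimes> P, -) is the composite of the exact functors Hom(P, -) and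
  Hom(A, -). Concretely, the curried tensor map from \<open>A\<close> to Hom(P, A \<otimes> P) is
  lifted along Hom(P, free cover), and uncurrying the lift gives the section.\<close>

lemma proj_tens:
  fixes A :: "('r, 'a) module" and P :: "('r, 'p) module"
  assumes A: "proj A" and P: "proj P"
  shows "proj (tens A P)"
proof -
  have mA: "module R A" and mP: "module R P" using A P by (auto intro: proj_module)
  let ?Z = "tens A P"
  let ?L = "free (carrier ?Z)"
  have mZ: "module R ?Z" using mA mP by simp
  note e = free_cover[OF mZ]
  note tb = bilinD[OF te_bilin[OF mA mP]]
  let ?HL = "hom_module R P ?L" and ?HZ = "hom_module R P ?Z"
  have mHL: "module R ?HL" and mHZ: "module R ?HZ" using module_hom_module mP mZ
    by (blast intro: module_free)+
  have f: "(\<lambda>a\<in>carrier A. (\<lambda>p\<in>carrier P. te A P a p)) \<in> Hom A ?HZ"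
  proof (rule mod_homI)
    fix a assume "a \<in> carrier A"
    then show "(\<lambda>p\<in>carrier P. te A P a p) \<in> carrier ?HZ"
      unfolding hom_module_simps by (intro mod_homI) (use tb mP in simp_all)
  qed (use tb mA in \<open>auto simp: hom_module_def fun_eq_iff\<close>)
  note q = hom_module_compose[OF mP module_free mZ e(1)]
  have "(\<lambda>f\<in>carrier ?HL. compose (carrier P) (free_cover ?Z) f) ` carrier ?HL = carrier ?HZ"
  proof
    show "(\<lambda>f\<in>carrier ?HL. compose (carrier P) (free_cover ?Z) f) ` carrier ?HL \<subseteq> carrier ?HZ"
      using homD(1)[OF q] by blast
    show "carrier ?HZ \<subseteq> (\<lambda>f\<in>carrier ?HL. compose (carrier P) (free_cover ?Z) f) ` carrier ?HL"
    proof
      fix h assume "h \<in> carrier ?HZ"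
      then have h: "h \<in> Hom P ?Z" by (simp add: hom_module_simps)
      obtain g where g: "g \<in> Hom P ?L" "\<And>x. x \<in> carrier P \<Longrightarrow> free_cover ?Z (g x) = h x"
        using proj_lift[OF P module_free mZ e(1,3) h] by blast
      have "h = compose (carrier P) (free_cover ?Z) g"
        by (rule hom_eqI[OF h hom_compose[OF mP g(1) e(1)]]) (simp add: compose_eq g)
      then show "h \<in> (\<lambda>f\<in>carrier ?HL. compose (carrier P) (free_cover ?Z) f) ` carrier ?HL"
        using g(1) by (auto simp: hom_module_simps)
    qed
  qed
  then obtain g where g: "g \<in> Hom A ?HL" "\<And>x. x \<in> carrier A \<Longrightarrow>
      (\<lambda>f\<in>carrier ?HL. compose (carrier P) (free_cover ?Z) f) (g x) = (\<lambda>a\<in>carrier A.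
          (\<lambda>p\<in>carrier P. te A P a p)) x"
    using proj_lift[OF A mHL mHZ q _ f] by blast
  have gH: "g a \<in> Hom P ?L" if "a \<in> carrier A" for a using homD(1)[OF g(1) that]
    by (simp add: hom_module_simps)
  have ge: "free_cover ?Z (g a p) = te A P a p" if "a \<in> carrier A" "p \<in> carrier P" for a p
    using fun_cong[OF g(2)[OF that(1)], of p] that gH[OF that(1)]
      by (simp add: hom_module_simps compose_eq)
  have b: "bilin A P ?L g"
    by (rule bilinI)
      (use homD(1)[OF gH] homD(2)[OF gH] homD(3)[OF gH] in \<open>simp_all add: homD(2)[OF g(1)]
          homD(3)[OF g(1)] hom_module_simps\<close>)
  note s = tens_lin[OF mA mP module_free b]
  show ?thesis
  proof (rule projI[OF mZ s(1)])
    fix t assume t: "t \<in> carrier ?Z"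
    have "compose (carrier ?Z) (free_cover ?Z) (tens_lin A P ?L g) t = (\<lambda>t\<in>carrier ?Z. t) t"
      by (rule tens_hom_eqI[OF mA mP hom_compose[OF mZ s(1) e(1)] hom_id[OF mZ] _ t])
        (use mA mP s(2) ge in \<open>simp add: compose_eq\<close>)
    then show "free_cover ?Z (tens_lin A P ?L g t) = t" using t by (simp add: compose_eq)
  qed
qed

section \<open>Projective resolutions and vanishing of Ext\<close>

text \<open>The form in which lifting is applied to differentials, which are surjective only onto
  their images.\<close>

lemma proj_lift_image:
  fixes P :: "('r, 'p) module" and A :: "('r, 'a) module" and B :: "('r, 'b) module"
  assumes P: "proj P" and A: "module R A" and B: "module R B" and q: "q \<in> Hom A B"
      and f: "f \<in> Hom P B"
    and im: "\<And>x. x \<in> carrier P \<Longrightarrow> f x \<in> q ` carrier A"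
  obtains g where "g \<in> Hom P A" "\<And>x. x \<in> carrier P \<Longrightarrow> q (g x) = f x"
proof -
  define I where "I = q ` carrier A"
  have I: "submodule I R B" unfolding I_def by (rule image_submodule[OF A B q])
  have q': "q \<in> Hom A (submod B I)" using q by (auto simp: mod_hom_def I_def)
  have f': "f \<in> Hom P (submod B I)" using f im by (auto simp: mod_hom_def I_def)
  have surj: "q ` carrier A = carrier (submod B I)" by (simp add: I_def)
  show ?thesis
    by (rule proj_lift[OF P A module_submod[OF B I] q' surj f']) (rule that)
qed

lemma proj_iso:
  fixes P :: "('r, 'p) module" and Q :: "('r, 'q) module"
  assumes "proj P" "module R Q" "f \<in> Hom P Q" "bij_betw f (carrier P) (carrier Q)"
  shows "proj Q"
proof -
  obtain g where g: "g \<in> Hom Q P" "\<And>y. y \<in> carrier Q \<Longrightarrow> f (g y) = y"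
    using hom_inverse[OF proj_module[OF assms(1)] assms(2-4)] by metis
  show ?thesis by (rule proj_retract[OF assms(1,2) g(1) assms(3) g(2)])
qed

text \<open>Built on the intrinsic \<open>proj\<close> and with terms of any type \<open>'p\<close>,
  so that resolutions in different universes, such as the mapping cone below, can be
  compared.\<close>

definition resolution :: "('r, 'g) module \<Rightarrow> (nat \<Rightarrow> ('r, 'p) module) \<Rightarrow> (nat \<Rightarrow> 'p \<Rightarrow> 'p) \<Rightarrow> ('p \<Rightarrow> 'g)
    \<Rightarrow> bool"
  where "resolution G P d e \<longleftrightarrow> module R G \<and> (\<forall>n. proj (P n)) \<and>
    (\<forall>n. d n \<in> Hom (P (Suc n)) (P n)) \<and> e \<in> Hom (P 0) G \<and>
    (\<forall>n. exact_at (P (Suc (Suc n))) (d (Suc n)) (P (Suc n)) (d n) (P n)) \<and>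
    exact_at (P 1) (d 0) (P 0) e G \<and> e ` carrier (P 0) = carrier G"

lemma resolutionD:
  assumes "resolution G P d e"
  shows "module R G" "proj (P n)" "module R (P n)" "d n \<in> Hom (P (Suc n)) (P n)" "e \<in> Hom (P 0) G"
    "exact_at (P (Suc (Suc n))) (d (Suc n)) (P (Suc n)) (d n) (P n)" "exact_at (P (Suc 0)) (d 0)
        (P 0) e G"
    "e ` carrier (P 0) = carrier G"
  using assms by (simp_all add: resolution_def proj_module)

text \<open>The comparison theorem over the identity of \<open>G\<close>. The terms of
  \<open>P\<close> and \<open>Q\<close> may have different types.\<close>

lemma chain_map_exists:
  fixes G :: "('r, 'g) module" and P :: "nat \<Rightarrow> ('r, 'p) module" and Q :: "nat \<Rightarrow> ('r, 'q) module"
  assumes P: "resolution G P d e" and Q: "resolution G Q d' e'"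
  obtains a where "\<And>n. a n \<in> Hom (P n) (Q n)" "\<And>x. x \<in> carrier (P 0) \<Longrightarrow> e' (a 0 x) = e x"
    "\<And>n x. x \<in> carrier (P (Suc n)) \<Longrightarrow> d' n (a (Suc n) x) = a n (d n x)"
proof -
  note P' = resolutionD[OF P] and Q' = resolutionD[OF Q]
  \<comment> \<open>The last clause of the invariant is exactly the hypothesis for lifting in the
    next degree: \<open>f\<close> carries the image of \<open>d n\<close> into the image of
    \<open>d' n\<close>.\<close>
  define I where "I n f \<longleftrightarrow> f \<in> Hom (P n) (Q n) \<and> (n = 0 \<longrightarrow> (\<forall>x\<in>carrier (P 0). e' (f x) = e x)) \<and>
    (\<forall>x\<in>carrier (P (Suc n)). f (d n x) \<in> d' n ` carrier (Q (Suc n)))" for n f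
  have "\<exists>a. \<forall>n. I n (a n) \<and> (\<forall>x\<in>carrier (P (Suc n)). d' n (a (Suc n) x) = a n (d n x))"
  proof (rule dependent_nat_choice)
    obtain f where f: "f \<in> Hom (P 0) (Q 0)" "\<And>x. x \<in> carrier (P 0) \<Longrightarrow> e' (f x) = e x"
      using proj_lift[OF P'(2) Q'(3) Q'(1) Q'(5,8) P'(5)] by blast
    have "f (d 0 x) \<in> d' 0 ` carrier (Q (Suc 0))" if x: "x \<in> carrier (P (Suc 0))" for x
    proof -
      have dx: "d 0 x \<in> carrier (P 0)" using homD(1)[OF P'(4) x] .
      have "e' (f (d 0 x)) = \<zero>\<^bsub>G\<^esub>" using f(2)[OF dx] exact_atD(1)[OF P'(7) x] by simp
      then show ?thesis using exact_atD(3)[OF Q'(7) homD(1)[OF f(1) dx]] by blast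
    qed
    then show "\<exists>f. I 0 f" unfolding I_def using f by blast
  next
    fix f n assume "I n f"
    then have f: "f \<in> Hom (P n) (Q n)" "\<And>x. x \<in> carrier (P (Suc n)) \<Longrightarrow> f (d n x) \<in> d' n ` carrier
        (Q (Suc n))"
      by (auto simp: I_def)
    have fd: "compose (carrier (P (Suc n))) f (d n) \<in> Hom (P (Suc n)) (Q n)"
      by (rule hom_compose[OF P'(3,4) f(1)])
    obtain g where g: "g \<in> Hom (P (Suc n)) (Q (Suc n))"
      "\<And>x. x \<in> carrier (P (Suc n)) \<Longrightarrow> d' n (g x) = compose (carrier (P (Suc n))) f (d n) x"
      by (rule proj_lift_image[OF P'(2) Q'(3) Q'(3) Q'(4) fd])
          (use f(2) in \<open>simp add: compose_eq\<close>, blast)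
    have g': "d' n (g x) = f (d n x)" if "x \<in> carrier (P (Suc n))" for x using g(2)[OF that] that
      by (simp add: compose_eq)
    have "g (d (Suc n) x) \<in> d' (Suc n) ` carrier (Q (Suc (Suc n)))"
        if x: "x \<in> carrier (P (Suc (Suc n)))" for x
    proof -
      have dx: "d (Suc n) x \<in> carrier (P (Suc n))" using homD(1)[OF P'(4) x] .
      have "d' n (g (d (Suc n) x)) = \<zero>\<^bsub>Q n\<^esub>"
        using g'[OF dx] exact_atD(1)[OF P'(6) x] hom_zero_neg(1)[OF f(1) P'(3) Q'(3)] by simp
      then show ?thesis using exact_atD(3)[OF Q'(6) homD(1)[OF g(1) dx]] by blast
    qed
    then have "I (Suc n) g" unfolding I_def using g(1) by blast
    then show "\<exists>g. I (Suc n) g \<and> (\<forall>x\<in>carrier (P (Suc n)). d' n (g x) = f (d n x))" using g' by blast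
  qed
  then obtain a where "\<And>n. I n (a n)" "\<And>n x. x \<in> carrier (P (Suc n)) \<Longrightarrow> d' n (a (Suc n) x) = a n
      (d n x)" by blast
  then show ?thesis using that[of a] unfolding I_def by blast
qed

text \<open>A chain endomorphism over the zero map of \<open>G\<close> is null-homotopic. As before,
  the invariant records that the error term of the next degree is already a boundary.\<close>

lemma homotopy_exists:
  fixes G :: "('r, 'g) module" and Q :: "nat \<Rightarrow> ('r, 'q) module"
  assumes Q: "resolution G Q d e" and f: "\<And>n. f n \<in> Hom (Q n) (Q n)" "\<And>x. x \<in> carrier (Q 0) \<Longrightarrow>
      e (f 0 x) = \<zero>\<^bsub>G\<^esub>"
    "\<And>n x. x \<in> carrier (Q (Suc n)) \<Longrightarrow> d n (f (Suc n) x) = f n (d n x)"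
  obtains h where "\<And>n. h n \<in> Hom (Q n) (Q (Suc n))" "\<And>x. x \<in> carrier (Q 0) \<Longrightarrow> d 0 (h 0 x) = f 0 x"
    "\<And>n x. x \<in> carrier (Q (Suc n)) \<Longrightarrow> d (Suc n) (h (Suc n) x) = f (Suc n) x \<ominus>\<^bsub>Q (Suc n)\<^esub> h n (d n x)"
proof -
  note Q' = resolutionD[OF Q]
  define I where "I n h \<longleftrightarrow> h \<in> Hom (Q n) (Q (Suc n)) \<and>
      (n = 0 \<longrightarrow> (\<forall>x\<in>carrier (Q 0). d 0 (h x) = f 0 x)) \<and>
    (\<forall>x\<in>carrier (Q (Suc n)). f (Suc n) x \<ominus>\<^bsub>Q (Suc n)\<^esub> h (d n x) \<in> d (Suc n) ` carrier
        (Q (Suc (Suc n))))" for n h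
  have "\<exists>h. \<forall>n. I n (h n) \<and> (\<forall>x\<in>carrier (Q (Suc n)). d (Suc n) (h (Suc n) x) = f (Suc n) x
      \<ominus>\<^bsub>Q (Suc n)\<^esub> h n (d n x))"
  proof (rule dependent_nat_choice)
    have im: "f 0 x \<in> d 0 ` carrier (Q (Suc 0))" if x: "x \<in> carrier (Q 0)" for x
      using exact_atD(3)[OF Q'(7) homD(1)[OF f(1) x] f(2)[OF x]] by blast
    obtain h where h: "h \<in> Hom (Q 0) (Q (Suc 0))" "\<And>x. x \<in> carrier (Q 0) \<Longrightarrow> d 0 (h x) = f 0 x"
      using proj_lift_image[OF Q'(2,3,3,4) f(1) im] by blast
    have "f (Suc 0) x \<ominus>\<^bsub>Q (Suc 0)\<^esub> h (d 0 x) \<in> d (Suc 0) ` carrier (Q (Suc (Suc 0)))"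
        if x: "x \<in> carrier (Q (Suc 0))" for x
    proof -
      have dx: "d 0 x \<in> carrier (Q 0)" using homD(1)[OF Q'(4) x] .
      note c = homD(1)[OF f(1) x] homD(1)[OF h(1) dx]
      have "d 0 (f (Suc 0) x \<ominus>\<^bsub>Q (Suc 0)\<^esub> h (d 0 x)) = f 0 (d 0 x) \<ominus>\<^bsub>Q 0\<^esub> f 0 (d 0 x)"
        using hom_zero_neg(3)[OF Q'(4,3,3) c] f(3)[OF x] h(2)[OF dx] by simp
      then have "d 0 (f (Suc 0) x \<ominus>\<^bsub>Q (Suc 0)\<^esub> h (d 0 x)) = \<zero>\<^bsub>Q 0\<^esub>"
        using homD(1)[OF f(1) dx] Q'(3) by simp
      then show ?thesis using exact_atD(3)[OF Q'(6) module_addI(4)[OF Q'(3) c]] by blast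
    qed
    then show "\<exists>h. I 0 h" unfolding I_def using h by blast
  next
    fix h n assume "I n h"
    then have h: "h \<in> Hom (Q n) (Q (Suc n))"
      "\<And>x. x \<in> carrier (Q (Suc n)) \<Longrightarrow> f (Suc n) x \<ominus>\<^bsub>Q (Suc n)\<^esub> h (d n x) \<in> d (Suc n) ` carrier
          (Q (Suc (Suc n)))"
      by (auto simp: I_def)
    let ?H = "hom_module R (Q (Suc n)) (Q (Suc n))"
    have hd: "compose (carrier (Q (Suc n))) h (d n) \<in> Hom (Q (Suc n)) (Q (Suc n))"
      using hom_compose[OF Q'(3,4) h(1)] .
    have g0: "f (Suc n) \<ominus>\<^bsub>?H\<^esub> compose (carrier (Q (Suc n))) h (d n) \<in> Hom (Q (Suc n)) (Q (Suc n))"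
      using module_addI(4)[OF module_hom_module[OF Q'(3,3)], of "f (Suc n)" "Suc n" "Suc n"] f(1)
          hd by (simp add: hom_module_simps)
    have g0x: "(f (Suc n) \<ominus>\<^bsub>?H\<^esub> compose (carrier (Q (Suc n))) h (d n)) x = f (Suc n) x
        \<ominus>\<^bsub>Q (Suc n)\<^esub> h (d n x)"
      if x: "x \<in> carrier (Q (Suc n))" for x
      using hom_module_minus(2)[OF Q'(3,3) x f(1) hd] x by (simp add: compose_eq)
    obtain g where g: "g \<in> Hom (Q (Suc n)) (Q (Suc (Suc n)))"
      "\<And>x. x \<in> carrier (Q (Suc n)) \<Longrightarrow> d (Suc n) (g x) = f (Suc n) x \<ominus>\<^bsub>Q (Suc n)\<^esub> h (d n x)"
      using proj_lift_image[OF Q'(2,3,3,4) g0] g0x h(2) by metis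
    have "f (Suc (Suc n)) x \<ominus>\<^bsub>Q (Suc (Suc n))\<^esub> g (d (Suc n) x) \<in> d (Suc (Suc n)) ` carrier
        (Q (Suc (Suc (Suc n))))"
      if x: "x \<in> carrier (Q (Suc (Suc n)))" for x
    proof -
      have dx: "d (Suc n) x \<in> carrier (Q (Suc n))" using homD(1)[OF Q'(4) x] .
      note c = homD(1)[OF f(1) x] homD(1)[OF g(1) dx]
      have "h (d n (d (Suc n) x)) = \<zero>\<^bsub>Q (Suc n)\<^esub>"
        using exact_atD(1)[OF Q'(6) x] hom_zero_neg(1)[OF h(1) Q'(3,3)] by simp
      then have "d (Suc n) (g (d (Suc n) x)) = f (Suc n) (d (Suc n) x)"
        using g(2)[OF dx] homD(1)[OF f(1) dx] Q'(3) by simp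
      then have "d (Suc n) (f (Suc (Suc n)) x \<ominus>\<^bsub>Q (Suc (Suc n))\<^esub> g (d (Suc n) x)) = \<zero>\<^bsub>Q (Suc n)\<^esub>"
        using hom_zero_neg(3)[OF Q'(4,3,3) c] f(3)[OF x] homD(1)[OF f(1) dx] Q'(3) by simp
      then show ?thesis using exact_atD(3)[OF Q'(6) module_addI(4)[OF Q'(3) c]] by blast
    qed
    then have "I (Suc n) g" unfolding I_def using g(1) by blast
    then show "\<exists>g. I (Suc n) g \<and> (\<forall>x\<in>carrier (Q (Suc n)). d (Suc n) (g x) = f (Suc n) x
        \<ominus>\<^bsub>Q (Suc n)\<^esub> h (d n x))"
      using g(2) by blast
  qed
  then obtain h where "\<And>n. I n (h n)"
    "\<And>n x. x \<in> carrier (Q (Suc n)) \<Longrightarrow> d (Suc n) (h (Suc n) x) = f (Suc n) x \<ominus>\<^bsub>Q (Suc n)\<^esub> h n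
        (d n x)" by blast
  then show ?thesis using that[of h] unfolding I_def by blast
qed

text \<open>Vanishing on the level of cochains, meaningful for resolutions of any type. In degree 0
  the coboundaries are trivial, so it then says that there are no nonzero maps from the resolved
  module to \<open>N\<close>.\<close>

definition Ext_vanish :: "(nat \<Rightarrow> ('r, 'p) module) \<Rightarrow> (nat \<Rightarrow> 'p \<Rightarrow> 'p) \<Rightarrow> ('r, 'n) module \<Rightarrow> nat \<Rightarrow> bool"
  where "Ext_vanish P d N n \<longleftrightarrow> cocycles R P d N n \<subseteq> coboundaries R P d N n"

lemma Ext_vanish_SucD:
  assumes "Ext_vanish P d N (Suc n)" "z \<in> Hom (P (Suc n)) N"
    "\<And>x. x \<in> carrier (P (Suc (Suc n))) \<Longrightarrow> z (d (Suc n) x) = \<zero>\<^bsub>N\<^esub>"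
  obtains w where "w \<in> Hom (P n) N" "\<And>x. x \<in> carrier (P (Suc n)) \<Longrightarrow> z x = w (d n x)"
proof -
  have "z \<in> coboundaries R P d N (Suc n)" using assms by (auto simp: Ext_vanish_def cocycles_def)
  then obtain w where "w \<in> Hom (P n) N" "z = compose (carrier (P (Suc n))) w (d n)" by auto
  then show ?thesis using that[of w] by (simp add: compose_eq)
qed

lemma Ext_vanish_SucI:
  assumes "module R (P (Suc n))" "d n \<in> Hom (P (Suc n)) (P n)"
    "\<And>z. z \<in> Hom (P (Suc n)) N \<Longrightarrow> (\<And>x. x \<in> carrier (P (Suc (Suc n))) \<Longrightarrow> z (d (Suc n) x) = \<zero>\<^bsub>N\<^esub>) \<Longrightarrow>
      \<exists>w\<in>Hom (P n) N. \<forall>x\<in>carrier (P (Suc n)). z x = w (d n x)"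
  shows "Ext_vanish P d N (Suc n)"
  unfolding Ext_vanish_def
proof
  fix z assume "z \<in> cocycles R P d N (Suc n)"
  then have z: "z \<in> Hom (P (Suc n)) N" "\<And>x. x \<in> carrier (P (Suc (Suc n))) \<Longrightarrow> z (d (Suc n) x) = \<zero>\<^bsub>N\<^esub>"
    by (auto simp: cocycles_def)
  then obtain w where w: "w \<in> Hom (P n) N" "\<forall>x\<in>carrier (P (Suc n)). z x = w (d n x)"
    using assms(3) by blast
  have "z = compose (carrier (P (Suc n))) w (d n)"
    by (rule hom_eqI[OF z(1) hom_compose[OF assms(1,2) w(1)]]) (use w(2) in \<open>simp add: compose_eq\<close>)
  then show "z \<in> coboundaries R P d N (Suc n)" using w(1) by auto
qed

lemma Ext_vanish_0_iff:
  fixes P :: "nat \<Rightarrow> ('r, 'p) module" and N :: "('r, 'n) module"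
  shows "Ext_vanish P d N 0 \<longleftrightarrow> (\<forall>z\<in>Hom (P 0) N. (\<forall>x\<in>carrier (P (Suc 0)). z (d 0 x) = \<zero>\<^bsub>N\<^esub>) \<longrightarrow>
    (\<forall>x\<in>carrier (P 0). z x = \<zero>\<^bsub>N\<^esub>))" (is "_ \<longleftrightarrow> ?r")
proof
  assume *: "Ext_vanish P d N 0"
  show ?r
  proof (intro ballI impI)
    fix z x assume "z \<in> Hom (P 0) N" "\<forall>x\<in>carrier (P (Suc 0)). z (d 0 x) = \<zero>\<^bsub>N\<^esub>"
        and x: "x \<in> carrier (P 0)"
    then have "z = \<zero>\<^bsub>hom_module R (P 0) N\<^esub>" using * by (auto simp: Ext_vanish_def cocycles_def)
    then show "z x = \<zero>\<^bsub>N\<^esub>" using hom_module_simps(2)[OF x] by simp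
  qed
next
  assume *: ?r
  show "Ext_vanish P d N 0"
    unfolding Ext_vanish_def
  proof
    fix z assume "z \<in> cocycles R P d N 0"
    then have z: "z \<in> Hom (P 0) N" "\<forall>x\<in>carrier (P 0). z x = \<zero>\<^bsub>N\<^esub>" using *
      by (auto simp: cocycles_def)
    have "z = \<zero>\<^bsub>hom_module R (P 0) N\<^esub>"
      unfolding hom_module_def
      by simp (rule extensionalityI[OF homD(4)[OF z(1)]], use z(2) in simp_all)
    then show "z \<in> coboundaries R P d N 0" by simp
  qed
qed

text \<open>A cocycle \<open>z\<close> on \<open>Q\<close> is pulled back to \<open>P\<close> along
  \<open>b\<close>, bounded there, and the bounding cochain is pulled back along \<open>a\<close>.
  This bounds \<open>z b a\<close>, and the homotopy bounds the difference from
  \<open>z\<close>.\<close>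

lemma Ext_vanish_independent:
  fixes G :: "('r, 'g) module" and P :: "nat \<Rightarrow> ('r, 'p) module" and Q :: "nat \<Rightarrow> ('r, 'q) module"
      and N :: "('r, 'n) module"
  assumes P: "resolution G P dP eP" and Q: "resolution G Q dQ eQ" and N: "module R N"
      and v: "Ext_vanish P dP N n"
  shows "Ext_vanish Q dQ N n"
proof -
  note P' = resolutionD[OF P] and Q' = resolutionD[OF Q]
  obtain a where a: "\<And>n. a n \<in> Hom (Q n) (P n)" "\<And>x. x \<in> carrier (Q 0) \<Longrightarrow> eP (a 0 x) = eQ x"
    "\<And>n x. x \<in> carrier (Q (Suc n)) \<Longrightarrow> dP n (a (Suc n) x) = a n (dQ n x)"
    by (rule chain_map_exists[OF Q P]) blast
  obtain b where b: "\<And>n. b n \<in> Hom (P n) (Q n)" "\<And>x. x \<in> carrier (P 0) \<Longrightarrow> eQ (b 0 x) = eP x"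
    "\<And>n x. x \<in> carrier (P (Suc n)) \<Longrightarrow> dQ n (b (Suc n) x) = b n (dP n x)"
    by (rule chain_map_exists[OF P Q]) blast
  have ac: "a n x \<in> carrier (P n)" if "x \<in> carrier (Q n)" for n x using homD(1)[OF a(1) that] .
  have bc: "b n x \<in> carrier (Q n)" if "x \<in> carrier (P n)" for n x using homD(1)[OF b(1) that] .
  have dc: "dQ n x \<in> carrier (Q n)" if "x \<in> carrier (Q (Suc n))" for n x
    using homD(1)[OF Q'(4) that] .
  \<comment> \<open>The difference of the identity and \<open>b a\<close> covers the zero map of
    \<open>G\<close>, so it is homotopic to zero.\<close>
  define f where "f n = idm (Q n) \<ominus>\<^bsub>hom_module R (Q n) (Q n)\<^esub> compose (carrier (Q n)) (b n) (a n)"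
      for n
  have ba: "compose (carrier (Q n)) (b n) (a n) \<in> Hom (Q n) (Q n)" for n
    by (rule hom_compose[OF Q'(3) a(1) b(1)])
  have f: "f n \<in> Hom (Q n) (Q n)" for n
    unfolding f_def
    using module_addI(4)[OF module_hom_module[OF Q'(3,3)], of _ n n] hom_id[OF Q'(3)] ba
      by (simp add: hom_module_simps)
  have fx: "f n x = x \<ominus>\<^bsub>Q n\<^esub> b n (a n x)" if "x \<in> carrier (Q n)" for n x
    unfolding f_def using hom_module_minus(2)[OF Q'(3,3) that hom_id[OF Q'(3)] ba] that
      by (simp add: compose_eq)
  obtain h where h: "\<And>n. h n \<in> Hom (Q n) (Q (Suc n))" "\<And>x. x \<in> carrier (Q 0) \<Longrightarrow> dQ 0 (h 0 x) = f 0 x"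
    "\<And>n x. x \<in> carrier (Q (Suc n)) \<Longrightarrow> dQ (Suc n) (h (Suc n) x) = f (Suc n) x \<ominus>\<^bsub>Q (Suc n)\<^esub> h n
        (dQ n x)"
  proof (rule homotopy_exists[OF Q f])
    fix x assume x: "x \<in> carrier (Q 0)"
    show "eQ (f 0 x) = \<zero>\<^bsub>G\<^esub>"
      using x fx[OF x] a(2)[OF x] b(2)[OF ac[OF x]] hom_zero_neg(3)[OF Q'(5,3,1) x bc[OF ac[OF x]]]
        homD(1)[OF Q'(5) x] Q'(1) by simp
  next
    fix n x assume x: "x \<in> carrier (Q (Suc n))"
    show "dQ n (f (Suc n) x) = f n (dQ n x)"
      using x fx[OF x] fx[OF dc[OF x]] a(3)[OF x] b(3)[OF ac[OF x]] hom_zero_neg(3)[OF Q'(4,3,3) x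
          bc[OF ac[OF x]]] by simp
  qed blast
  have hc: "h n x \<in> carrier (Q (Suc n))" if "x \<in> carrier (Q n)" for n x
    using homD(1)[OF h(1) that] .
  show ?thesis
  proof (cases n)
    case 0
    show ?thesis
      unfolding 0 Ext_vanish_0_iff
    proof (intro ballI impI)
      fix z x assume z: "z \<in> Hom (Q 0) N" "\<forall>x\<in>carrier (Q (Suc 0)). z (dQ 0 x) = \<zero>\<^bsub>N\<^esub>"
          and x: "x \<in> carrier (Q 0)"
      have "compose (carrier (P 0)) z (b 0) \<in> Hom (P 0) N" by (rule hom_compose[OF P'(3) b(1) z(1)])
      moreover have "compose (carrier (P 0)) z (b 0) (dP 0 y) = \<zero>\<^bsub>N\<^esub>" if "y \<in> carrier (P (Suc 0))"
          for y
        using homD(1)[OF P'(4) that] b(3)[OF that, symmetric] z(2) bc[OF that]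
          by (simp add: compose_eq)
      ultimately have *: "compose (carrier (P 0)) z (b 0) (a 0 x) = \<zero>\<^bsub>N\<^esub>"
        using v ac[OF x] unfolding 0 Ext_vanish_0_iff by blast
      then have "z (b 0 (a 0 x)) = \<zero>\<^bsub>N\<^esub>" using ac[OF x] by (simp add: compose_eq)
      moreover have "z (f 0 x) = \<zero>\<^bsub>N\<^esub>" using h(2)[OF x, symmetric] z(2) hc[OF x] by simp
      ultimately show "z x = \<zero>\<^bsub>N\<^esub>"
        using fx[OF x] hom_zero_neg(3)[OF z(1) Q'(3) N x bc[OF ac[OF x]]] homD(1)[OF z(1) x] N
          by simp
    qed
  next
    case (Suc m)
    show ?thesis
      unfolding Suc
    proof (rule Ext_vanish_SucI)
      show "module R (Q (Suc m))" "dQ m \<in> Hom (Q (Suc m)) (Q m)" by (rule Q'(3), rule Q'(4))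
      fix z assume z: "z \<in> Hom (Q (Suc m)) N" "\<And>x. x \<in> carrier (Q (Suc (Suc m))) \<Longrightarrow>
          z (dQ (Suc m) x) = \<zero>\<^bsub>N\<^esub>"
      have zb: "compose (carrier (P (Suc m))) z (b (Suc m)) \<in> Hom (P (Suc m)) N"
        by (rule hom_compose[OF P'(3) b(1) z(1)])
      have "compose (carrier (P (Suc m))) z (b (Suc m)) (dP (Suc m) y) = \<zero>\<^bsub>N\<^esub>"
          if "y \<in> carrier (P (Suc (Suc m)))" for y
        using homD(1)[OF P'(4) that] b(3)[OF that, symmetric] z(2)[OF bc[OF that]]
          by (simp add: compose_eq)
      then obtain w where w: "w \<in> Hom (P m) N"
        "\<And>x. x \<in> carrier (P (Suc m)) \<Longrightarrow> compose (carrier (P (Suc m))) z (b (Suc m)) x = w (dP m x)"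
        using Ext_vanish_SucD[OF v[unfolded Suc] zb] by metis
      have w': "z (b (Suc m) (a (Suc m) x)) = w (a m (dQ m x))" if x: "x \<in> carrier (Q (Suc m))"
          for x
        using w(2)[OF ac[OF x]] ac[OF x] a(3)[OF x] by (simp add: compose_eq)
      \<comment> \<open>The first summand bounds \<open>z b a\<close>. The second is what the
        homotopy leaves of \<open>z (f x)\<close>, since \<open>z\<close> kills the boundary
        \<open>d h x\<close>.\<close>
      define u where "u = compose (carrier (Q m)) w (a m) \<oplus>\<^bsub>hom_module R (Q m) N\<^esub> compose
          (carrier (Q m)) z (h m)"
      have c: "compose (carrier (Q m)) w (a m) \<in> Hom (Q m) N" "compose (carrier (Q m)) z (h m)
          \<in> Hom (Q m) N"
        by (rule hom_compose[OF Q'(3) a(1) w(1)], rule hom_compose[OF Q'(3) h(1) z(1)])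
      have "u \<in> Hom (Q m) N"
        unfolding u_def using module_addI(1)[OF module_hom_module[OF Q'(3) N], of _ m] c
          by (simp add: hom_module_simps)
      moreover have "z x = u (dQ m x)" if x: "x \<in> carrier (Q (Suc m))" for x
      proof -
        note hx = hc[OF dc[OF x]] and bx = bc[OF ac[OF x]]
        have "f (Suc m) x = dQ (Suc m) (h (Suc m) x) \<oplus>\<^bsub>Q (Suc m)\<^esub> h m (dQ m x)"
          using h(3)[OF x] module_diff(5)[OF Q'(3) homD(1)[OF f x] hx] by simp
        then have "z (f (Suc m) x) = z (h m (dQ m x))"
          using homD(2)[OF z(1) dc[OF hc[OF x]] hx] z(2)[OF hc[OF x]] homD(1)[OF z(1) hx] N by simp
        moreover have "z (f (Suc m) x) = z x \<ominus>\<^bsub>N\<^esub> z (b (Suc m) (a (Suc m) x))"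
          using fx[OF x] hom_zero_neg(3)[OF z(1) Q'(3) N x bx] by simp
        ultimately have "z x = z (b (Suc m) (a (Suc m) x)) \<oplus>\<^bsub>N\<^esub> z (h m (dQ m x))"
          using module_diff(7)[OF N homD(1)[OF z(1) x] homD(1)[OF z(1) bx]] by simp
        then show ?thesis
          unfolding u_def using w'[OF x] dc[OF x] by (simp add: hom_module_simps compose_eq)
      qed
      ultimately show "\<exists>w\<in>Hom (Q m) N. \<forall>x\<in>carrier (Q (Suc m)). z x = w (dQ m x)" by blast
    qed
  qed
qed

section \<open>Associativity of the tensor product\<close>

text \<open>The universal property of a triple tensor product: for fixed \<open>y\<close> the map
  \<open>k y\<close> on \<open>tens F G\<close> is induced by bilinearity, and its linearity in
  \<open>y\<close> is tested on pure tensors.\<close>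

lemma lift_tens_left:
  fixes F :: "('r, 'f) module" and G :: "('r, 'g) module" and Y :: "('r, 'y) module"
      and C :: "('r, 'c) module"
  assumes F: "module R F" and G: "module R G" and Y: "module R Y" and C: "module R C"
    and b: "\<And>y. y \<in> carrier Y \<Longrightarrow> bilin F G C (\<lambda>f g. c f g y)"
    and add: "\<And>f g y y'. f \<in> carrier F \<Longrightarrow> g \<in> carrier G \<Longrightarrow> y \<in> carrier Y \<Longrightarrow> y' \<in> carrier Y \<Longrightarrow>
      c f g (y \<oplus>\<^bsub>Y\<^esub> y') = c f g y \<oplus>\<^bsub>C\<^esub> c f g y'"
    and smult: "\<And>f g r y. f \<in> carrier F \<Longrightarrow> g \<in> carrier G \<Longrightarrow> r \<in> carrier R \<Longrightarrow> y \<in> carrier Y \<Longrightarrow>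
      c f g (r \<odot>\<^bsub>Y\<^esub> y) = r \<odot>\<^bsub>C\<^esub> c f g y"
  obtains h where "h \<in> Hom (tens (tens F G) Y) C"
    "\<And>f g y. f \<in> carrier F \<Longrightarrow> g \<in> carrier G \<Longrightarrow> y \<in> carrier Y \<Longrightarrow> h (te (tens F G) Y (te F G f g) y)
        = c f g y"
proof -
  define k where "k y = tens_lin F G C (\<lambda>f g. c f g y)" for y
  have k: "k y \<in> Hom (tens F G) C" "\<And>f g. f \<in> carrier F \<Longrightarrow> g \<in> carrier G \<Longrightarrow> k y (te F G f g) = c f g
      y"
    if "y \<in> carrier Y" for y
    unfolding k_def using tens_lin[OF F G C b[OF that]] by blast+
  have mT: "module R (tens F G)" using F G by simp
  have kadd: "k (y \<oplus>\<^bsub>Y\<^esub> y') t = k y t \<oplus>\<^bsub>C\<^esub> k y' t"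
    if y: "y \<in> carrier Y" "y' \<in> carrier Y" and t: "t \<in> carrier (tens F G)" for y y' t
  proof -
    let ?s = "\<lambda>t\<in>carrier (tens F G). k y t \<oplus>\<^bsub>C\<^esub> k y' t"
    have yy: "y \<oplus>\<^bsub>Y\<^esub> y' \<in> carrier Y" using y Y by simp
    note ky = k(1)[OF y(1)] k(1)[OF y(2)]
    have s: "?s \<in> Hom (tens F G) C"
      by (rule mod_homI) (use mT C homD(1)[OF ky(1)] homD(1)[OF ky(2)]
        in \<open>simp_all add: homD(2)[OF ky(1)] homD(2)[OF ky(2)] homD(3)[OF ky(1)] homD(3)[OF ky(2)]
            module_smult(1) module_ac[of C]\<close>)
    have "k (y \<oplus>\<^bsub>Y\<^esub> y') t = ?s t"
      by (rule tens_hom_eqI[OF F G k(1)[OF yy] s _ t]) (use F G y in \<open>simp add: k(2)[OF yy] k(2)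
          add\<close>)
    then show ?thesis using t by simp
  qed
  have ksm: "k (r \<odot>\<^bsub>Y\<^esub> y) t = r \<odot>\<^bsub>C\<^esub> k y t"
    if r: "r \<in> carrier R" and y: "y \<in> carrier Y" and t: "t \<in> carrier (tens F G)" for r y t
  proof -
    let ?s = "\<lambda>t\<in>carrier (tens F G). r \<odot>\<^bsub>C\<^esub> k y t"
    have ry: "r \<odot>\<^bsub>Y\<^esub> y \<in> carrier Y" using y r Y by simp
    note ky = k(1)[OF y]
    have s: "?s \<in> Hom (tens F G) C"
      by (rule mod_homI) (use mT C r homD(1)[OF ky]
        in \<open>simp_all add: homD(2)[OF ky] homD(3)[OF ky] module_smult(1) module_smult(4)[of C]\<close>)
    have "k (r \<odot>\<^bsub>Y\<^esub> y) t = ?s t"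
      by (rule tens_hom_eqI[OF F G k(1)[OF ry] s _ t]) (use F G y r in \<open>simp add: k(2)[OF ry] k(2)
          smult\<close>)
    then show ?thesis using t by simp
  qed
  have "bilin (tens F G) Y C (\<lambda>t y. k y t)"
    by (rule bilinI) (simp_all add: kadd ksm homD(1)[OF k(1)] homD(2)[OF k(1)] homD(3)[OF k(1)])
  from tens_lin[OF mT Y C this] show ?thesis using that k(2) F G
    by (metis (no_types, lifting) te_closed)
qed

text \<open>The other bracketing is reduced to the previous one by swapping the outer
  factors.\<close>

lemma lift_tens_right:
  fixes F :: "('r, 'f) module" and G :: "('r, 'g) module" and Y :: "('r, 'y) module"
      and C :: "('r, 'c) module"
  assumes F: "module R F" and G: "module R G" and Y: "module R Y" and C: "module R C"
    and b: "\<And>f. f \<in> carrier F \<Longrightarrow> bilin G Y C (c f)"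
    and add: "\<And>f f' g y. f \<in> carrier F \<Longrightarrow> f' \<in> carrier F \<Longrightarrow> g \<in> carrier G \<Longrightarrow> y \<in> carrier Y \<Longrightarrow>
      c (f \<oplus>\<^bsub>F\<^esub> f') g y = c f g y \<oplus>\<^bsub>C\<^esub> c f' g y"
    and smult: "\<And>f g r y. f \<in> carrier F \<Longrightarrow> g \<in> carrier G \<Longrightarrow> r \<in> carrier R \<Longrightarrow> y \<in> carrier Y \<Longrightarrow>
      c (r \<odot>\<^bsub>F\<^esub> f) g y = r \<odot>\<^bsub>C\<^esub> c f g y"
  obtains h where "h \<in> Hom (tens F (tens G Y)) C"
    "\<And>f g y. f \<in> carrier F \<Longrightarrow> g \<in> carrier G \<Longrightarrow> y \<in> carrier Y \<Longrightarrow> h (te F (tens G Y) f (te G Y g y))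
        = c f g y"
proof -
  have mT: "module R (tens G Y)" using Y G by simp
  obtain h where h: "h \<in> Hom (tens (tens G Y) F) C"
    "\<And>g y f. g \<in> carrier G \<Longrightarrow> y \<in> carrier Y \<Longrightarrow> f \<in> carrier F \<Longrightarrow> h (te (tens G Y) F (te G Y g y) f)
        = c f g y"
    by (rule lift_tens_left[OF G Y F C, of "\<lambda>g y f. c f g y"]) (use b add smult in auto)
  have "compose (carrier (tens F (tens G Y))) h (tens_swap F (tens G Y)) \<in> Hom (tens F (tens G Y))
      C"
    by (rule hom_compose[OF module_tens[OF F mT] tens_swap(1)[OF F mT] h(1)])
  moreover have "compose (carrier (tens F (tens G Y))) h (tens_swap F (tens G Y)) (te F (tens G Y)
      f (te G Y g y)) = c f g y"
    if "f \<in> carrier F" "g \<in> carrier G" "y \<in> carrier Y" for f g y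
    using that F G Y mT by (simp add: compose_eq tens_swap(2)[OF F mT] h(2))
  ultimately show ?thesis by (rule that)
qed

lemma tens_tens_hom_eqI:
  fixes F :: "('r, 'f) module" and G :: "('r, 'g) module" and Y :: "('r, 'y) module"
      and C :: "('r, 'c) module"
  assumes F: "module R F" and G: "module R G" and Y: "module R Y"
    and h: "h \<in> Hom (tens (tens F G) Y) C" and k: "k \<in> Hom (tens (tens F G) Y) C"
    and eq: "\<And>f g y. f \<in> carrier F \<Longrightarrow> g \<in> carrier G \<Longrightarrow> y \<in> carrier Y \<Longrightarrow>
      h (te (tens F G) Y (te F G f g) y) = k (te (tens F G) Y (te F G f g) y)"
    and t: "t \<in> carrier (tens (tens F G) Y)"
  shows "h t = k t"
proof -
  have mT: "module R (tens F G)" using F G by simp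
  note tb = bilinD[OF te_bilin[OF mT Y]]
  show ?thesis
  proof (rule tens_hom_eqI[OF mT Y h k _ t])
    fix x y assume x: "x \<in> carrier (tens F G)" and y: "y \<in> carrier Y"
    show "h (te (tens F G) Y x y) = k (te (tens F G) Y x y)"
      by (rule tens_induct[OF F G x])
        (use eq y mT Y in \<open>simp_all add: tb(2) homD(2)[OF h] homD(2)[OF k]\<close>)
  qed
qed

lemma tens_right_hom_eqI:
  fixes F :: "('r, 'f) module" and G :: "('r, 'g) module" and Y :: "('r, 'y) module"
      and C :: "('r, 'c) module"
  assumes F: "module R F" and G: "module R G" and Y: "module R Y"
    and h: "h \<in> Hom (tens F (tens G Y)) C" and k: "k \<in> Hom (tens F (tens G Y)) C"
    and eq: "\<And>f g y. f \<in> carrier F \<Longrightarrow> g \<in> carrier G \<Longrightarrow> y \<in> carrier Y \<Longrightarrow>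
      h (te F (tens G Y) f (te G Y g y)) = k (te F (tens G Y) f (te G Y g y))"
    and t: "t \<in> carrier (tens F (tens G Y))"
  shows "h t = k t"
proof -
  have mT: "module R (tens G Y)" using Y G by simp
  note tb = bilinD[OF te_bilin[OF F mT]]
  show ?thesis
  proof (rule tens_hom_eqI[OF F mT h k _ t])
    fix x y assume x: "x \<in> carrier F" and y: "y \<in> carrier (tens G Y)"
    show "h (te F (tens G Y) x y) = k (te F (tens G Y) x y)"
      by (rule tens_induct[OF G Y y])
        (use eq x mT F in \<open>simp_all add: tb(3) homD(2)[OF h] homD(2)[OF k]\<close>)
  qed
qed

end

section \<open>Flat modules\<close>

text \<open>These size assumptions make \<open>'u\<close> a workable universe: it has room for
  copies of \<open>R\<close>, of free modules on sets of size at most \<open>'u\<close>, and of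
  tensor products of small modules.\<close>

locale small_ring = base_ring R for R :: "('r, 'z) ring_scheme" (structure) +
  fixes U :: "'u itself"
  assumes inf: "infinite (UNIV :: 'u set)" and R_small: "carrier R \<lesssim> (UNIV :: 'u set)"
begin

abbreviation flatU :: "('r, 'a) module \<Rightarrow> bool"
  where "flatU F \<equiv> flat U R F"

lemma small_U [simp]: "carrier (A :: ('r, 'u) module) \<lesssim> (UNIV :: 'u set)"
  by (rule subset_imp_lepoll) simp

lemma small_tens: "module R A \<Longrightarrow> module R B \<Longrightarrow> carrier A \<lesssim> (UNIV :: 'u set) \<Longrightarrow>
    carrier B \<lesssim> (UNIV :: 'u set) \<Longrightarrow> carrier (tens A B) \<lesssim> (UNIV :: 'u set)"
  by (rule tens_lepoll[OF inf R_small])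

lemma flat_module: "flatU F \<Longrightarrow> module R F"
  by (simp add: flat_def)

lemma flatI:
  fixes F :: "('r, 'f) module"
  assumes F: "module R F"
    and ex: "\<And>(A :: ('r, 'u) module) (B :: ('r, 'u) module) (C :: ('r, 'u) module) f g t.
      module R A \<Longrightarrow> module R B \<Longrightarrow> module R C \<Longrightarrow> f \<in> Hom A B \<Longrightarrow> g \<in> Hom B C \<Longrightarrow> exact_at A f B g C \<Longrightarrow>
      t \<in> carrier (tens F B) \<Longrightarrow> tens_r F B C g t = \<zero>\<^bsub>tens F C\<^esub> \<Longrightarrow> t \<in> tens_r F A B f ` carrier
          (tens F A)"
  shows "flatU F"
  unfolding flat_def
proof (intro conjI allI impI)
  fix A B C :: "('r, 'u) module" and f g
  assume "module R A \<and> module R B \<and> module R C \<and> f \<in> Hom A B \<and> g \<in> Hom B C"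
      and e: "exact_at A f B g C"
  then have *: "module R A" "module R B" "module R C" "f \<in> Hom A B" "g \<in> Hom B C" by auto
  show "exact_at (tens F A) (tensor_map R F A B f) (tens F B) (tensor_map R F B C g) (tens F C)"
    unfolding tensor_map_eq[OF F *(1,2,4)] tensor_map_eq[OF F *(2,3,5)]
    by (rule tens_r_exactI[OF F * e]) (rule ex[OF * e])
qed (rule F)

lemma flatD:
  fixes A :: "('r, 'u) module" and B :: "('r, 'u) module" and C :: "('r, 'u) module"
      and F :: "('r, 'f) module"
  assumes F: "flatU F" and *: "module R A" "module R B" "module R C" "f \<in> Hom A B" "g \<in> Hom B C"
      and e: "exact_at A f B g C"
  shows "exact_at (tens F A) (tens_r F A B f) (tens F B) (tens_r F B C g) (tens F C)"
proof -
  have "exact_at (tens F A) (tensor_map R F A B f) (tens F B) (tensor_map R F B C g) (tens F C)"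
    using F * e unfolding flat_def by blast
  then show ?thesis
    unfolding tensor_map_eq[OF flat_module[OF F] *(1,2,4)] tensor_map_eq[OF flat_module[OF F]
        *(2,3,5)] .
qed

lemma small_transfer:
  fixes A :: "('r, 'a) module"
  assumes "module R A" "carrier A \<lesssim> (UNIV :: 'u set)"
  obtains A' :: "('r, 'u) module" and \<phi> \<psi> where "module R A'" "\<phi> \<in> Hom A A'" "\<psi> \<in> Hom A' A"
    "\<And>x. x \<in> carrier A \<Longrightarrow> \<psi> (\<phi> x) = x" "\<And>y. y \<in> carrier A' \<Longrightarrow> \<phi> (\<psi> y) = y"
proof -
  obtain A' :: "('r, 'u) module" and \<phi> where *: "module R A'" "\<phi> \<in> Hom A A'"
      "bij_betw \<phi> (carrier A) (carrier A')"
    by (rule transfer_module[OF assms]) blast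
  show ?thesis by (rule hom_inverse[OF assms(1) *]) (rule that[OF *(1,2)])
qed

text \<open>Flatness tests only sequences with terms of type \<open>'u\<close>. A sequence of small
  modules is replaced by an isomorphic one there, and the preimage found is carried back.\<close>

lemma flat_exact:
  fixes A :: "('r, 'a) module" and B :: "('r, 'b) module" and C :: "('r, 'c) module"
      and F :: "('r, 'f) module"
  assumes F: "flatU F" and m: "module R A" "module R B" "module R C"
      and s: "carrier A \<lesssim> (UNIV :: 'u set)" "carrier B \<lesssim> (UNIV :: 'u set)"
      "carrier C \<lesssim> (UNIV :: 'u set)"
    and f: "f \<in> Hom A B" and g: "g \<in> Hom B C" and e: "exact_at A f B g C"
  shows "exact_at (tens F A) (tens_r F A B f) (tens F B) (tens_r F B C g) (tens F C)"
proof (rule tens_r_exactI[OF flat_module[OF F] m f g e])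
  note mF = flat_module[OF F]
  fix t assume t: "t \<in> carrier (tens F B)" and z: "tens_r F B C g t = \<zero>\<^bsub>tens F C\<^esub>"
  obtain A' :: "('r, 'u) module" and a a' where A': "module R A'" "a \<in> Hom A A'" "a' \<in> Hom A' A"
    "\<And>x. x \<in> carrier A \<Longrightarrow> a' (a x) = x" "\<And>y. y \<in> carrier A' \<Longrightarrow> a (a' y) = y"
    by (rule small_transfer[OF m(1) s(1)]) blast
  obtain B' :: "('r, 'u) module" and b b' where B': "module R B'" "b \<in> Hom B B'" "b' \<in> Hom B' B"
    "\<And>x. x \<in> carrier B \<Longrightarrow> b' (b x) = x" "\<And>y. y \<in> carrier B' \<Longrightarrow> b (b' y) = y"
    by (rule small_transfer[OF m(2) s(2)]) blast
  obtain C' :: "('r, 'u) module" and c c' where C': "module R C'" "c \<in> Hom C C'" "c' \<in> Hom C' C"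
    "\<And>x. x \<in> carrier C \<Longrightarrow> c' (c x) = x" "\<And>y. y \<in> carrier C' \<Longrightarrow> c (c' y) = y"
    by (rule small_transfer[OF m(3) s(3)]) blast
  define f1 where "f1 = compose (carrier A') f a'"
  define f' where "f' = compose (carrier A') b f1"
  define g1 where "g1 = compose (carrier B') g b'"
  define g' where "g' = compose (carrier B') c g1"
  define h where "h = compose (carrier B) c g"
  have f1: "f1 \<in> Hom A' B" unfolding f1_def by (rule hom_compose[OF A'(1,3) f])
  have f': "f' \<in> Hom A' B'" unfolding f'_def by (rule hom_compose[OF A'(1) f1 B'(2)])
  have g1: "g1 \<in> Hom B' C" unfolding g1_def by (rule hom_compose[OF B'(1,3) g])
  have g': "g' \<in> Hom B' C'" unfolding g'_def by (rule hom_compose[OF B'(1) g1 C'(2)])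
  have h: "h \<in> Hom B C'" unfolding h_def by (rule hom_compose[OF m(2) g C'(2)])
  have f'x: "f' x = b (f (a' x))" if "x \<in> carrier A'" for x using that
    by (simp add: f'_def f1_def compose_eq)
  have g'x: "g' x = c (g (b' x))" if "x \<in> carrier B'" for x using that
    by (simp add: g'_def g1_def compose_eq)
  have e': "exact_at A' f' B' g' C'"
  proof (rule exact_atI)
    fix x assume x: "x \<in> carrier A'"
    note ax = homD(1)[OF A'(3) x]
    show "f' x \<in> carrier B'" by (rule homD(1)[OF f' x])
    show "g' (f' x) = \<zero>\<^bsub>C'\<^esub>"
      using g'x[OF homD(1)[OF f' x]] f'x[OF x] B'(4)[OF homD(1)[OF f ax]] exact_atD(1)[OF e ax]
        hom_zero_neg(1)[OF C'(2) m(3) C'(1)] by simp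
  next
    fix y assume y: "y \<in> carrier B'" and "g' y = \<zero>\<^bsub>C'\<^esub>"
    note yB = homD(1)[OF B'(3) y]
    have "c (g (b' y)) = \<zero>\<^bsub>C'\<^esub>" using g'x[OF y] \<open>g' y = \<zero>\<^bsub>C'\<^esub>\<close> by simp
    then have "g (b' y) = c' \<zero>\<^bsub>C'\<^esub>" using C'(4)[OF homD(1)[OF g yB]] by simp
    then have "g (b' y) = \<zero>\<^bsub>C\<^esub>" using hom_zero_neg(1)[OF C'(3,1) m(3)] by simp
    then obtain x where x: "x \<in> carrier A" "b' y = f x" using exact_atD(3)[OF e yB] by blast
    have "f' (a x) = b (f x)" using f'x[OF homD(1)[OF A'(2) x(1)]] A'(4)[OF x(1)] by simp
    then have "y = f' (a x)" using x(2)[symmetric] B'(5)[OF y] by simp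
    then show "y \<in> f' ` carrier A'" using homD(1)[OF A'(2) x(1)] by blast
  qed
  note E = flatD[OF F A'(1) B'(1) C'(1) f' g' e']
  have bt: "tens_r F B B' b t \<in> carrier (tens F B')"
    by (rule homD(1)[OF tens_r(1)[OF mF m(2) B'(1,2)] t])
  have "tens_r F B' C' g' (tens_r F B B' b t) = tens_r F B C' h t"
    by (rule tens_r_tens_r[OF mF m(2) B'(1) C'(1) B'(2) g' h _ t])
      (use g'x[OF homD(1)[OF B'(2)]] B'(4) in \<open>simp add: h_def compose_eq\<close>)
  also have "\<dots> = tens_r F C C' c (tens_r F B C g t)"
    by (rule tens_r_tens_r[OF mF m(2,3) C'(1) g C'(2) h _ t, symmetric]) (simp add: h_def
        compose_eq)
  also have "\<dots> = \<zero>\<^bsub>tens F C'\<^esub>"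
    unfolding z by (rule hom_zero_neg(1)[OF tens_r(1)[OF mF m(3) C'(1,2)] module_tens[OF mF m(3)]
        module_tens[OF mF C'(1)]])
  finally obtain u where u: "u \<in> carrier (tens F A')" "tens_r F B B' b t = tens_r F A' B' f' u"
    using exact_atD(3)[OF E bt] by blast
  have "t = tens_r F B' B b' (tens_r F B B' b t)"
    using tens_r_tens_r[OF mF m(2) B'(1) m(2) B'(2,3) hom_id[OF m(2)] _ t] B'(4) tens_r_id[OF mF
        m(2) t hom_id[OF m(2)]] by simp
  also have "\<dots> = tens_r F A' B f1 u"
    unfolding u(2)
    by (rule tens_r_tens_r[OF mF A'(1) B'(1) m(2) f' B'(3) f1 _ u(1)])
      (use f'x B'(4)[OF homD(1)[OF f homD(1)[OF A'(3)]]] in \<open>simp add: f1_def compose_eq\<close>)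
  also have "\<dots> = tens_r F A B f (tens_r F A' A a' u)"
    by (rule tens_r_tens_r[OF mF A'(1) m(1,2) A'(3) f f1 _ u(1), symmetric]) (simp add: f1_def
        compose_eq)
  finally show "t \<in> tens_r F A B f ` carrier (tens F A)"
    using homD(1)[OF tens_r(1)[OF mF A'(1) m(1) A'(3)] u(1)] by blast
qed

lemma proj_flat: "proj P \<Longrightarrow> flatU P"
proof (rule flatI[OF proj_module])
  fix A B C :: "('r, 'u) module" and f g t
  assume P: "proj P" and m: "module R A" "module R B" "module R C" and f: "f \<in> Hom A B"
      and g: "g \<in> Hom B C"
    and e: "exact_at A f B g C" and t: "t \<in> carrier (tens P B)" "tens_r P B C g t = \<zero>\<^bsub>tens P C\<^esub>"
  from exact_atD(3)[OF tens_proj_exact[OF P m f g e] t] show "t \<in> tens_r P A B f ` carrier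
      (tens P A)" by blast
qed

text \<open>Injectivity of \<open>g\<close> is exactness of 0 -> Y -> Z at Y, and flatness preserves
  this exactness.\<close>

lemma flat_kernel:
  fixes Y :: "('r, 'y) module" and Z :: "('r, 'w) module" and F :: "('r, 'f) module"
  assumes F: "flatU F" and m: "module R Y" "module R Z" and s: "carrier Y \<lesssim> (UNIV :: 'u set)"
      "carrier Z \<lesssim> (UNIV :: 'u set)" and g: "g \<in> Hom Y Z"
    and inj: "\<And>y. y \<in> carrier Y \<Longrightarrow> g y = \<zero>\<^bsub>Z\<^esub> \<Longrightarrow> y = \<zero>\<^bsub>Y\<^esub>"
    and t: "t \<in> carrier (tens F Y)" and z: "tens_r F Y Z g t = \<zero>\<^bsub>tens F Z\<^esub>"
  shows "t = \<zero>\<^bsub>tens F Y\<^esub>"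
proof -
  let ?O = "Zmod :: ('r, 'u) module"
  let ?f = "\<lambda>x\<in>carrier ?O. \<zero>\<^bsub>Y\<^esub>"
  have f: "?f \<in> Hom ?O Y" by (rule hom_zero[OF module_Zmod m(1)])
  have "exact_at ?O ?f Y g Z"
    by (rule exact_atI) (use m inj hom_zero_neg(1)[OF g m] in auto)
  from exact_atD(3)[OF flat_exact[OF F module_Zmod m small_U s f g this] t z]
  obtain u where u: "u \<in> carrier (tens F ?O)" "t = tens_r F ?O Y ?f u" by blast
  show ?thesis
    unfolding u(2)
    by (rule tens_map_zero[OF flat_module[OF F] module_Zmod flat_module[OF F] m(1)
        hom_id[OF flat_module[OF F]] f _ u(1)]) simp
qed

text \<open>Flatness passes to retracts: a kernel element is moved to \<open>F\<close> by
  \<open>b\<close>, solved there and moved back by \<open>a\<close>.\<close>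

lemma flat_iso:
  fixes F :: "('r, 'f) module" and F' :: "('r, 'g) module"
  assumes F: "flatU F" and F': "module R F'" and a: "a \<in> Hom F F'" and b: "b \<in> Hom F' F"
    and ab: "\<And>y. y \<in> carrier F' \<Longrightarrow> a (b y) = y"
  shows "flatU F'"
proof (rule flatI[OF F'])
  note mF = flat_module[OF F]
  fix A B C :: "('r, 'u) module" and f g t
  assume m: "module R A" "module R B" "module R C" and f: "f \<in> Hom A B" and g: "g \<in> Hom B C"
      and e: "exact_at A f B g C"
    and t: "t \<in> carrier (tens F' B)" and z: "tens_r F' B C g t = \<zero>\<^bsub>tens F' C\<^esub>"
  have bt: "tens_l F' F B b t \<in> carrier (tens F B)"
    by (rule homD(1)[OF tens_l(1)[OF m(2) F' mF b] t])
  have "tens_r F B C g (tens_l F' F B b t) = \<zero>\<^bsub>tens F C\<^esub>"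
    unfolding tens_r_tens_l[OF F' mF m(2,3) b g t] z
    by (rule hom_zero_neg(1)[OF tens_l(1)[OF m(3) F' mF b] module_tens[OF F' m(3)] module_tens[OF
        mF m(3)]])
  then obtain u where u: "u \<in> carrier (tens F A)" "tens_l F' F B b t = tens_r F A B f u"
    using exact_atD(3)[OF flatD[OF F m f g e] bt] by blast
  have "t = tens_l F F' B a (tens_l F' F B b t)"
    using tens_l_tens_l[OF m(2) F' mF F' b a hom_id[OF F'] _ t] ab tens_l_id[OF F' m(2) t
        hom_id[OF F']] by simp
  also have "\<dots> = tens_r F' A B f (tens_l F F' A a u)"
    unfolding u(2) by (rule tens_r_tens_l[OF mF F' m(1,2) a f u(1), symmetric])
  finally show "t \<in> tens_r F' A B f ` carrier (tens F' A)"
    using homD(1)[OF tens_l(1)[OF m(1) mF F' a] u(1)] by blast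
qed

text \<open>Tensoring with \<open>tens F G\<close> is tensoring with \<open>G\<close> and then with
  \<open>F\<close>, through the natural associativity maps \<open>p\<close> and \<open>q\<close>.
  After the first step the terms no longer have type \<open>'u\<close>, so \<open>flat_exact\<close>
  is applied to \<open>F\<close>; smallness of \<open>G\<close> keeps them small.\<close>

lemma flat_tens:
  fixes F :: "('r, 'f) module" and G :: "('r, 'g) module"
  assumes F: "flatU F" and G: "flatU G" and sG: "carrier G \<lesssim> (UNIV :: 'u set)"
  shows "flatU (tens F G)"
proof -
  have mF: "module R F" and mG: "module R G" using F G by (auto intro: flat_module)
  have mT: "module R (tens F G)" using mF mG by simp
  have mGY: "module R (tens G Y)" if "module R Y" for Y :: "('r, 'u) module" using that mG by simp
  have mFGY: "module R (tens F (tens G Y))" if "module R Y" for Y :: "('r, 'u) module" using that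
      mG mF by simp
  have mTY: "module R (tens (tens F G) Y)" if "module R Y" for Y :: "('r, 'u) module" using that
      mT by simp
  have "\<exists>p. p \<in> Hom (tens (tens F G) Y) (tens F (tens G Y)) \<and>
      (\<forall>f\<in>carrier F. \<forall>g\<in>carrier G. \<forall>y\<in>carrier Y.
      p (te (tens F G) Y (te F G f g) y) = te F (tens G Y) f (te G Y g y))" if Y: "module R
          Y" for Y :: "('r, 'u) module"
  proof -
    note b = bilinD[OF te_bilin[OF mF mGY[OF Y]]] and c = bilinD[OF te_bilin[OF mG Y]]
    obtain p where "p \<in> Hom (tens (tens F G) Y) (tens F (tens G Y))"
      "\<And>f g y. f \<in> carrier F \<Longrightarrow> g \<in> carrier G \<Longrightarrow> y \<in> carrier Y \<Longrightarrow>
        p (te (tens F G) Y (te F G f g) y) = te F (tens G Y) f (te G Y g y)"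
      by (rule lift_tens_left[OF mF mG Y mFGY[OF Y], of "\<lambda>f g y. te F (tens G Y) f (te G Y g y)"])
        (use Y mG mF in \<open>simp_all add: bilin_def b c\<close>)
    then show ?thesis by blast
  qed
  then obtain p where p: "\<And>Y :: ('r, 'u) module. module R Y \<Longrightarrow> p Y \<in> Hom (tens (tens F G) Y)
      (tens F (tens G Y))"
    "\<And>(Y :: ('r, 'u) module) f g y. module R Y \<Longrightarrow> f \<in> carrier F \<Longrightarrow> g \<in> carrier G \<Longrightarrow> y \<in> carrier Y \<Longrightarrow>
      p Y (te (tens F G) Y (te F G f g) y) = te F (tens G Y) f (te G Y g y)" by metis
  have "\<exists>q. q \<in> Hom (tens F (tens G Y)) (tens (tens F G) Y) \<and>
      (\<forall>f\<in>carrier F. \<forall>g\<in>carrier G. \<forall>y\<in>carrier Y.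
      q (te F (tens G Y) f (te G Y g y)) = te (tens F G) Y (te F G f g) y)" if Y: "module R
          Y" for Y :: "('r, 'u) module"
  proof -
    note b = bilinD[OF te_bilin[OF mT Y]] and c = bilinD[OF te_bilin[OF mF mG]]
    obtain q where "q \<in> Hom (tens F (tens G Y)) (tens (tens F G) Y)"
      "\<And>f g y. f \<in> carrier F \<Longrightarrow> g \<in> carrier G \<Longrightarrow> y \<in> carrier Y \<Longrightarrow>
        q (te F (tens G Y) f (te G Y g y)) = te (tens F G) Y (te F G f g) y"
      by (rule lift_tens_right[OF mF mG Y mTY[OF Y], of "\<lambda>f g y. te (tens F G) Y (te F G f g) y"])
        (use Y mG mF mT in \<open>simp_all add: bilin_def b c\<close>)
    then show ?thesis by blast
  qed
  then obtain q where q: "\<And>Y :: ('r, 'u) module. module R Y \<Longrightarrow> q Y \<in> Hom (tens F (tens G Y))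
      (tens (tens F G) Y)"
    "\<And>(Y :: ('r, 'u) module) f g y. module R Y \<Longrightarrow> f \<in> carrier F \<Longrightarrow> g \<in> carrier G \<Longrightarrow> y \<in> carrier Y \<Longrightarrow>
      q Y (te F (tens G Y) f (te G Y g y)) = te (tens F G) Y (te F G f g) y" by metis
  have qp: "q Y (p Y t) = t" if Y: "module R Y" and t: "t \<in> carrier (tens (tens F G) Y)" for Y t
  proof -
    have "compose (carrier (tens (tens F G) Y)) (q Y) (p Y) t = idm (tens (tens F G) Y) t"
      by (rule tens_tens_hom_eqI[OF mF mG Y hom_compose[OF mTY[OF Y] p(1)[OF Y] q(1)[OF Y]]
          hom_id[OF mTY[OF Y]] _ t])
        (use mF mG mT Y in \<open>simp add: compose_eq p q\<close>)
    then show ?thesis using t by (simp add: compose_eq)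
  qed
  have pn: "p Z (tens_r (tens F G) Y Z f t) = tens_r F (tens G Y) (tens G Z) (tens_r G Y Z f)
      (p Y t)"
    if Y: "module R Y" and Z: "module R Z" and f: "f \<in> Hom Y Z"
        and t: "t \<in> carrier (tens (tens F G) Y)" for Y Z f t
  proof -
    note t1 = tens_r[OF mT Y Z f] and t2 = tens_r[OF mG Y Z f]
    note t3 = tens_r[OF mF mGY[OF Y] mGY[OF Z] t2(1)]
    have "compose (carrier (tens (tens F G) Y)) (p Z) (tens_r (tens F G) Y Z f) t =
        compose (carrier (tens (tens F G) Y)) (tens_r F (tens G Y) (tens G Z) (tens_r G Y Z f))
            (p Y) t"
    proof (rule tens_tens_hom_eqI[OF mF mG Y hom_compose[OF mTY[OF Y] t1(1) p(1)[OF Z]]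
        hom_compose[OF mTY[OF Y] p(1)[OF Y] t3(1)] _ t])
      fix a g y assume "a \<in> carrier F" "g \<in> carrier G" "y \<in> carrier Y"
      then show "compose (carrier (tens (tens F G) Y)) (p Z) (tens_r (tens F G) Y Z f)
          (te (tens F G) Y (te F G a g) y) =
        compose (carrier (tens (tens F G) Y)) (tens_r F (tens G Y) (tens G Z) (tens_r G Y Z f))
            (p Y) (te (tens F G) Y (te F G a g) y)"
        using mF mG mT Y homD(1)[OF f]
          by (simp only: compose_eq te_closed t1(2) p(2)[OF Y] p(2)[OF Z] t2(2) t3(2))
    qed
    then show ?thesis using t by (simp add: compose_eq)
  qed
  have qn: "q Z (tens_r F (tens G Y) (tens G Z) (tens_r G Y Z f) t) = tens_r (tens F G) Y Z f
      (q Y t)"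
    if Y: "module R Y" and Z: "module R Z" and f: "f \<in> Hom Y Z"
        and t: "t \<in> carrier (tens F (tens G Y))" for Y Z f t
  proof -
    note t1 = tens_r[OF mT Y Z f] and t2 = tens_r[OF mG Y Z f]
    note t3 = tens_r[OF mF mGY[OF Y] mGY[OF Z] t2(1)]
    have "compose (carrier (tens F (tens G Y))) (q Z) (tens_r F (tens G Y) (tens G Z)
        (tens_r G Y Z f)) t =
        compose (carrier (tens F (tens G Y))) (tens_r (tens F G) Y Z f) (q Y) t"
    proof (rule tens_right_hom_eqI[OF mF mG Y hom_compose[OF mFGY[OF Y] t3(1) q(1)[OF Z]]
        hom_compose[OF mFGY[OF Y] q(1)[OF Y] t1(1)] _ t])
      fix a g y assume "a \<in> carrier F" "g \<in> carrier G" "y \<in> carrier Y"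
      then show "compose (carrier (tens F (tens G Y))) (q Z) (tens_r F (tens G Y) (tens G Z)
          (tens_r G Y Z f)) (te F (tens G Y) a (te G Y g y)) =
        compose (carrier (tens F (tens G Y))) (tens_r (tens F G) Y Z f) (q Y) (te F (tens G Y) a
            (te G Y g y))"
        using mF mG mT Y mGY[OF Y] homD(1)[OF f]
          by (simp only: compose_eq te_closed t1(2) q(2)[OF Y] q(2)[OF Z] t2(2) t3(2))
    qed
    then show ?thesis using t by (simp add: compose_eq)
  qed
  show ?thesis
  proof (rule flatI[OF mT])
    fix A B C :: "('r, 'u) module" and f g t
    assume m: "module R A" "module R B" "module R C" and f: "f \<in> Hom A B" and g: "g \<in> Hom B C"
        and e: "exact_at A f B g C"
      and t: "t \<in> carrier (tens (tens F G) B)"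
          and z: "tens_r (tens F G) B C g t = \<zero>\<^bsub>tens (tens F G) C\<^esub>"
    have pt: "p B t \<in> carrier (tens F (tens G B))" by (rule homD(1)[OF p(1)[OF m(2)] t])
    have z': "tens_r F (tens G B) (tens G C) (tens_r G B C g) (p B t) = \<zero>\<^bsub>tens F (tens G C)\<^esub>"
      unfolding pn[OF m(2,3) g t, symmetric] z
      by (rule hom_zero_neg(1)[OF p(1)[OF m(3)] mTY[OF m(3)] mFGY[OF m(3)]])
    note E = flat_exact[OF F mGY[OF m(1)] mGY[OF m(2)] mGY[OF m(3)] small_tens[OF mG m(1) sG
        small_U]
      small_tens[OF mG m(2) sG small_U] small_tens[OF mG m(3) sG small_U] tens_r(1)[OF mG m(1,2)
          f] tens_r(1)[OF mG m(2,3) g]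
      flatD[OF G m f g e]]
    obtain u where u: "u \<in> carrier (tens F (tens G A))" "p B t = tens_r F (tens G A) (tens G B)
        (tens_r G A B f) u"
      using exact_atD(3)[OF E pt z'] by blast
    have "t = q B (p B t)" using qp[OF m(2) t] by simp
    also have "\<dots> = tens_r (tens F G) A B f (q A u)" unfolding u(2) by (rule qn[OF m(1,2) f u(1)])
    finally show "t \<in> tens_r (tens F G) A B f ` carrier (tens (tens F G) A)"
      using homD(1)[OF q(1)[OF m(1)] u(1)] by blast
  qed
qed

lemma resolution_of_projective_resolution:
  fixes G :: "('r, 'g) module" and P :: "nat \<Rightarrow> ('r, 'u) module"
  assumes "module R G" "projective_resolution R G P d e"
  shows "resolution G P d e"
proof -
  have "proj (P n)" for n
    using assms(2) proj_of_projective[OF inf R_small, of "P n"]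
      unfolding projective_resolution_def by simp
  then show ?thesis using assms unfolding projective_resolution_def resolution_def by simp
qed

text \<open>Finiteness rules out the empty set of lengths, whose infimum is \<infinity>. In a
  well-order the infimum of a nonempty set is attained, so some resolution realizes it.\<close>

lemma finite_proj_dim:
  fixes G :: "('r, 'g) module"
  assumes "module R G" "proj_dim TYPE('u) R G \<le> enat n"
  obtains P :: "nat \<Rightarrow> ('r, 'u) module" and d e where "projective_resolution R G P d e"
      "resolution G P d e"
    "\<And>k. k > n \<Longrightarrow> carrier (P k) = {\<zero>\<^bsub>P k\<^esub>}"
proof -
  let ?S = "{enat n | n. \<exists>(P :: nat \<Rightarrow> ('r, 'u) module) d e.
    projective_resolution R G P d e \<and> (\<forall>k>n. carrier (P k) = {\<zero>\<^bsub>P k\<^esub>})}"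
  have "?S \<noteq> {}"
  proof
    assume "?S = {}"
    then have "proj_dim TYPE('u) R G = Inf {}" unfolding proj_dim_def by (rule arg_cong)
    then show False using assms(2) by (simp add: top_enat_def)
  qed
  then obtain k where "k \<in> ?S" by blast
  then have "Inf ?S \<in> ?S" by (rule wellorder_InfI)
  then have "proj_dim TYPE('u) R G \<in> ?S" unfolding proj_dim_def .
  then obtain m where "proj_dim TYPE('u) R G = enat m"
    and "\<exists>(P :: nat \<Rightarrow> ('r, 'u) module) d e. projective_resolution R G P d e \<and>
        (\<forall>k>m. carrier (P k) = {\<zero>\<^bsub>P k\<^esub>})"
    by (elim CollectE exE conjE) blast
  then obtain P :: "nat \<Rightarrow> ('r, 'u) module" and d e where m: "proj_dim TYPE('u) R G = enat m"
    "projective_resolution R G P d e" "\<And>k. k > m \<Longrightarrow> carrier (P k) = {\<zero>\<^bsub>P k\<^esub>}"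
    by (elim exE conjE) simp
  then have "m \<le> n" using assms(2) by simp
  show ?thesis
    by (rule that[OF m(2) resolution_of_projective_resolution[OF assms(1) m(2)] m(3)])
        (use \<open>m \<le> n\<close> in simp)
qed

lemma finite_splf:
  assumes "splf TYPE('u) R < \<infinity>"
  obtains n where "\<And>F :: ('r, 'u) module. flatU F \<Longrightarrow> proj_dim TYPE('u) R F \<le> enat n"
proof -
  obtain n where n: "splf TYPE('u) R = enat n" using assms by (cases "splf TYPE('u) R") auto
  have "proj_dim TYPE('u) R F \<le> enat n" if "flatU F" for F :: "('r, 'u) module"
    unfolding n[symmetric] splf_def by (rule SUP_upper) (use that in \<open>simp add: flat_def\<close>)
  then show ?thesis by (rule that)
qed

end

section \<open>Direct sums\<close>

context base_ring
begin

definition dsum :: "('r, 'a) module \<Rightarrow> ('r, 'b) module \<Rightarrow> ('r, 'a \<times> 'b) module"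
  where "dsum A B = \<lparr>carrier = carrier A \<times> carrier B, mult = undefined, one = undefined,
    zero = (\<zero>\<^bsub>A\<^esub>, \<zero>\<^bsub>B\<^esub>), add = (\<lambda>x y. (fst x \<oplus>\<^bsub>A\<^esub> fst y, snd x \<oplus>\<^bsub>B\<^esub> snd y)),
    smult = (\<lambda>r x. (r \<odot>\<^bsub>A\<^esub> fst x, r \<odot>\<^bsub>B\<^esub> snd x))\<rparr>"

lemma dsum_simps [simp]:
  "carrier (dsum A B) = carrier A \<times> carrier B" "\<zero>\<^bsub>dsum A B\<^esub> = (\<zero>\<^bsub>A\<^esub>, \<zero>\<^bsub>B\<^esub>)"
  "x \<oplus>\<^bsub>dsum A B\<^esub> y = (fst x \<oplus>\<^bsub>A\<^esub> fst y, snd x \<oplus>\<^bsub>B\<^esub> snd y)"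
  "r \<odot>\<^bsub>dsum A B\<^esub> x = (r \<odot>\<^bsub>A\<^esub> fst x, r \<odot>\<^bsub>B\<^esub> snd x)"
  by (simp_all add: dsum_def)

lemma module_dsum:
  fixes A :: "('r, 'a) module" and B :: "('r, 'b) module"
  assumes "module R A" "module R B"
  shows "module R (dsum A B)"
  by (rule moduleI2) (use assms in \<open>auto simp: module_smult(1-3) module_ac(1) intro: module_ac(2)\<close>)

lemma dsum_maps:
  fixes A :: "('r, 'a) module" and B :: "('r, 'b) module"
  assumes "module R A" "module R B"
  shows "(\<lambda>z\<in>carrier (dsum A B). fst z) \<in> Hom (dsum A B) A"
    and "(\<lambda>z\<in>carrier (dsum A B). snd z) \<in> Hom (dsum A B) B"
    and "(\<lambda>x\<in>carrier A. (x, \<zero>\<^bsub>B\<^esub>)) \<in> Hom A (dsum A B)"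
    and "(\<lambda>y\<in>carrier B. (\<zero>\<^bsub>A\<^esub>, y)) \<in> Hom B (dsum A B)"
  by (rule mod_homI; use assms module_dsum[OF assms] in auto)+

lemma hom_add:
  fixes A :: "('r, 'a) module" and B :: "('r, 'b) module"
  assumes "module R A" "module R B" "f \<in> Hom A B" "g \<in> Hom A B"
  shows "(\<lambda>x\<in>carrier A. f x \<oplus>\<^bsub>B\<^esub> g x) \<in> Hom A B"
  using module_addI(1)[OF module_hom_module[OF assms(1,2)], of f g] assms(3,4)
    by (simp add: hom_module_def)

lemma hom_neg:
  fixes A :: "('r, 'a) module" and B :: "('r, 'b) module"
  assumes "module R A" "module R B" "f \<in> Hom A B"
  shows "(\<lambda>x\<in>carrier A. \<ominus>\<^bsub>B\<^esub> f x) \<in> Hom A B"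
proof -
  let ?H = "hom_module R A B"
  have n: "\<ominus>\<^bsub>?H\<^esub> f \<in> Hom A B"
    using module_addI(3)[OF module_hom_module[OF assms(1,2)], of f] assms(3)
      by (simp add: hom_module_simps)
  have "\<ominus>\<^bsub>?H\<^esub> f = (\<lambda>x\<in>carrier A. \<ominus>\<^bsub>B\<^esub> f x)"
    by (rule extensionalityI[OF homD(4)[OF n]]) (use hom_module_minus(1)[OF assms(1,2) _ assms(3)]
        in simp_all)
  then show ?thesis using n by simp
qed

text \<open>The two inclusions lift to the free cover of the sum; the lifts composed with the
  projections add up to a section.\<close>

lemma proj_dsum:
  fixes A :: "('r, 'a) module" and B :: "('r, 'b) module"
  assumes A: "proj A" and B: "proj B"
  shows "proj (dsum A B)"
proof -
  have mA: "module R A" and mB: "module R B" using A B by (auto intro: proj_module)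
  let ?D = "dsum A B"
  let ?L = "free (carrier ?D)"
  have mD: "module R ?D" by (rule module_dsum[OF mA mB])
  note i = dsum_maps[OF mA mB]
  note e = free_cover[OF mD]
  obtain s where s: "s \<in> Hom A ?L" "\<And>x. x \<in> carrier A \<Longrightarrow> free_cover ?D (s x) = (\<lambda>x\<in>carrier A.
      (x, \<zero>\<^bsub>B\<^esub>)) x"
    by (rule proj_lift[OF A module_free mD e(1,3) i(3)]) blast
  obtain t where t: "t \<in> Hom B ?L" "\<And>x. x \<in> carrier B \<Longrightarrow> free_cover ?D (t x) = (\<lambda>y\<in>carrier B.
      (\<zero>\<^bsub>A\<^esub>, y)) x"
    by (rule proj_lift[OF B module_free mD e(1,3) i(4)]) blast
  note c = hom_compose[OF mD i(1) s(1)] hom_compose[OF mD i(2) t(1)]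
  show ?thesis
  proof (rule projI[OF mD hom_add[OF mD module_free c]])
    fix z assume z: "z \<in> carrier ?D"
    then have z': "fst z \<in> carrier A" "snd z \<in> carrier B" by auto
    then show "free_cover ?D ((\<lambda>x\<in>carrier ?D. compose (carrier ?D) s (\<lambda>z\<in>carrier ?D. fst z) x \<oplus>\<^bsub>?L\<^esub>
        compose (carrier ?D) t (\<lambda>z\<in>carrier ?D. snd z) x) z) = z"
      using z homD(2)[OF e(1) homD(1)[OF s(1) z'(1)] homD(1)[OF t(1) z'(2)]] s(2)[OF z'(1)]
          t(2)[OF z'(2)] mA mB
      by (auto simp: compose_eq)
  qed
qed

end

section \<open>Dimension shifting along a flat quotient\<close>

text \<open>The data extracted from \<open>0 \<rightarrow> B \<rightarrow> A \<rightarrow> F \<rightarrow> 0\<close>, a projective resolution of \<open>F = S / R\<close>: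
  the functional \<open>\<tau>\<close> on \<open>Hom(B, N)\<close> kills the restrictions of maps \<open>A \<rightarrow> N\<close> and is inverse to
  \<open>n \<mapsto> p n\<close>.\<close>

locale factor_data = small_ring R U
  for R :: "('r, 'z) ring_scheme" (structure) and U :: "'u itself" +
  fixes A :: "('r, 'u) module" and B :: "'u set" and F :: "('r, 'f) module"
    and \<pi> :: "'u \<Rightarrow> 'f" and p :: "'u \<Rightarrow> 'r" and N :: "('r, 'n) module" and \<tau> :: "('u \<Rightarrow> 'n) \<Rightarrow> 'n"
  assumes A: "proj A" and B_sub: "submodule B R A" and B: "proj (submod A B)"
    and F: "flatU F" and F_small: "carrier F \<lesssim> (UNIV :: 'u set)"
    and \<pi>: "\<pi> \<in> Hom A F" and \<pi>_surj: "\<pi> ` carrier A = carrier F"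
    and \<pi>_ker: "\<And>x. x \<in> carrier A \<Longrightarrow> \<pi> x = \<zero>\<^bsub>F\<^esub> \<longleftrightarrow> x \<in> B"
    and p: "p \<in> Hom (submod A B) Rmod"
    and N: "module R N"
    and \<tau>: "\<tau> \<in> Hom (hom_module R (submod A B) N) N"
    and \<tau>_restrict: "\<And>x. x \<in> Hom A N \<Longrightarrow> \<tau> (\<lambda>b\<in>B. x b) = \<zero>\<^bsub>N\<^esub>"
    and \<tau>_p: "\<And>n. n \<in> carrier N \<Longrightarrow> \<tau> (\<lambda>b\<in>B. p b \<odot>\<^bsub>N\<^esub> n) = n"
begin

abbreviation BM :: "('r, 'u) module"
  where "BM \<equiv> submod A B"

abbreviation inc :: "'u \<Rightarrow> 'u"
  where "inc \<equiv> (\<lambda>x\<in>B. x)"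

lemma mA: "module R A" by (rule proj_module[OF A])
lemma mB: "module R BM" by (rule proj_module[OF B])
lemma mF: "module R F" by (rule flat_module[OF F])
lemma inc: "inc \<in> Hom BM A" by (rule submod_incl[OF mA B_sub])

lemma B_A: "b \<in> B \<Longrightarrow> b \<in> carrier A"
  using submoduleD(1)[OF mA B_sub] by blast

text \<open>Flatness of \<open>G\<close> preserves the injectivity of \<open>B\<close> into
  \<open>A\<close>. The factors are swapped first because the definition of flatness has the flat
  module on the left.\<close>

lemma inc_tens_kernel:
  fixes G :: "('r, 'u) module"
  assumes G: "flatU G" and t: "t \<in> carrier (tens BM G)" and z: "tens_l BM A G inc t = \<zero>\<^bsub>tens A G\<^esub>"
  shows "t = \<zero>\<^bsub>tens BM G\<^esub>"
proof -
  have mG: "module R G" by (rule flat_module[OF G])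
  note s = tens_swap(1)[OF mB mG] tens_swap(1)[OF mA mG] tens_swap(1)[OF mG mB]
  have st: "tens_swap BM G t \<in> carrier (tens G BM)" by (rule homD(1)[OF s(1) t])
  have "tens_r G BM A inc (tens_swap BM G t) = tens_swap A G \<zero>\<^bsub>tens A G\<^esub>"
    using tens_swap_tens_map[OF mB mG mA mG inc hom_id[OF mG] t] z by simp
  also have "\<dots> = \<zero>\<^bsub>tens G A\<^esub>"
    by (rule hom_zero_neg(1)[OF s(2) module_tens[OF mA mG] module_tens[OF mG mA]])
  finally have "tens_swap BM G t = \<zero>\<^bsub>tens G BM\<^esub>"
    by (intro flat_kernel[OF G mB mA small_U small_U inc _ st]) (simp_all add: restrict_def)
  then have "t = tens_swap G BM \<zero>\<^bsub>tens G BM\<^esub>" using tens_swap_tens_swap[OF mB mG t] by simp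
  also have "\<dots> = \<zero>\<^bsub>tens BM G\<^esub>"
    by (rule hom_zero_neg(1)[OF s(3) module_tens[OF mG mB] module_tens[OF mB mG]])
  finally show ?thesis .
qed

context
  fixes G :: "('r, 'u) module" and P :: "nat \<Rightarrow> ('r, 'u) module" and d :: "nat \<Rightarrow> 'u \<Rightarrow> 'u"
      and e :: "'u \<Rightarrow> 'u"
  assumes G: "flatU G" and P: "resolution G P d e"
begin

text \<open>The shift is arranged so that \<open>d' n\<close> goes from \<open>P n\<close> to
  \<open>P' n\<close>: it is the differential one index lower, and the zero map for
  \<open>n = 0\<close>. The cone and its differential then need no case distinction.\<close>

definition P' :: "nat \<Rightarrow> ('r, 'u) module"
  where "P' n = (case n of 0 \<Rightarrow> Zmod | Suc m \<Rightarrow> P m)"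

definition d' :: "nat \<Rightarrow> 'u \<Rightarrow> 'u"
  where "d' n = (case n of 0 \<Rightarrow> (\<lambda>x\<in>carrier (P 0). \<zero>\<^bsub>Zmod :: ('r, 'u) module\<^esub>) | Suc m \<Rightarrow> d m)"

lemma P'_Suc [simp]: "P' (Suc n) = P n" and P'_0 [simp]: "P' 0 = Zmod"
  by (simp_all add: P'_def)

lemma d'_Suc [simp]: "d' (Suc n) = d n"
  by (simp add: d'_def)

lemmas PD = resolutionD[OF P]

lemma mG: "module R G" by (rule PD(1))

lemma proj_P': "proj (P' n)"
  by (cases n) (simp_all add: proj_Zmod PD(2))

lemma mP': "module R (P' n)"
  by (rule proj_module[OF proj_P'])

lemma d': "d' n \<in> Hom (P n) (P' n)"
proof (cases n)
  case 0
  show ?thesis unfolding 0 P'_0 using hom_zero[OF PD(3)[of 0] module_Zmod] by (simp add: d'_def)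
qed (simp add: PD(4))

lemma d'_d: "x \<in> carrier (P (Suc n)) \<Longrightarrow> d' n (d n x) = \<zero>\<^bsub>P' n\<^esub>"
  using exact_atD(1)[OF PD(6)] homD(1)[OF PD(4)] by (cases n) (auto simp: d'_def)

text \<open>The mapping cone of \<open>B \<otimes> P \<rightarrow> A \<otimes> P\<close>, with \<open>P\<close> shifted to \<open>P'\<close>; it resolves \<open>F \<otimes> G\<close>.\<close>

definition T :: "nat \<Rightarrow> ('r, ('u \<times> 'u \<Rightarrow> 'r) set \<times> ('u \<times> 'u \<Rightarrow> 'r) set) module"
  where "T n = dsum (tens A (P n)) (tens BM (P' n))"

text \<open>The minus sign of the cone differential makes the two copies of the tensor product of
  \<open>inc\<close> with \<open>d\<close> cancel in the square of \<open>D\<close>.\<close>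

definition D :: "nat \<Rightarrow> ('u \<times> 'u \<Rightarrow> 'r) set \<times> ('u \<times> 'u \<Rightarrow> 'r) set \<Rightarrow> ('u \<times> 'u \<Rightarrow> 'r) set \<times>
    ('u \<times> 'u \<Rightarrow> 'r) set"
  where "D n = (\<lambda>z\<in>carrier (T (Suc n)).
    (tens_r A (P (Suc n)) (P n) (d n) (fst z) \<oplus>\<^bsub>tens A (P n)\<^esub> tens_l BM A (P n) inc (snd z),
     \<ominus>\<^bsub>tens BM (P' n)\<^esub> tens_r BM (P n) (P' n) (d' n) (snd z)))"

text \<open>The second component contributes nothing to the augmentation: in degree 0 it lies in the
  tensor product of \<open>BM\<close> with the zero module.\<close>

definition E :: "('u \<times> 'u \<Rightarrow> 'r) set \<times> ('u \<times> 'u \<Rightarrow> 'r) set \<Rightarrow> ('f \<times> 'u \<Rightarrow> 'r) set"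
  where "E = (\<lambda>z\<in>carrier (T 0). tens_l A F G \<pi> (tens_r A (P 0) G e (fst z)))"

lemma mAP: "module R (tens A (P n))" by (rule module_tens[OF mA PD(3)])
lemma mBP: "module R (tens BM (P n))" by (rule module_tens[OF mB PD(3)])
lemma mBP': "module R (tens BM (P' n))" by (rule module_tens[OF mB mP'])
lemma mAG: "module R (tens A G)" by (rule module_tens[OF mA mG])
lemma mFG: "module R (tens F G)" by (rule module_tens[OF mF mG])

lemma T_carrier: "carrier (T n) = carrier (tens A (P n)) \<times> carrier (tens BM (P' n))"
  by (simp add: T_def)

lemma proj_T: "proj (T n)"
  unfolding T_def by (intro proj_dsum proj_tens A B PD(2) proj_P')

lemma mT: "module R (T n)"
  by (rule proj_module[OF proj_T])

lemma Ad: "tens_r A (P (Suc n)) (P n) (d n) \<in> Hom (tens A (P (Suc n))) (tens A (P n))"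
  by (rule tens_r(1)[OF mA PD(3,3,4)])

lemma Bd: "tens_r BM (P (Suc n)) (P n) (d n) \<in> Hom (tens BM (P (Suc n))) (tens BM (P n))"
  by (rule tens_r(1)[OF mB PD(3,3,4)])

lemma Bd': "tens_r BM (P n) (P' n) (d' n) \<in> Hom (tens BM (P n)) (tens BM (P' n))"
  by (rule tens_r(1)[OF mB PD(3) mP' d'])

lemma iP: "tens_l BM A (P n) inc \<in> Hom (tens BM (P n)) (tens A (P n))"
  by (rule tens_l(1)[OF PD(3) mB mA inc])

lemma Ae: "tens_r A (P 0) G e \<in> Hom (tens A (P 0)) (tens A G)"
  by (rule tens_r(1)[OF mA PD(3) mG PD(5)])

lemma Be: "tens_r BM (P 0) G e \<in> Hom (tens BM (P 0)) (tens BM G)"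
  by (rule tens_r(1)[OF mB PD(3) mG PD(5)])

lemma \<pi>G: "tens_l A F G \<pi> \<in> Hom (tens A G) (tens F G)"
  by (rule tens_l(1)[OF mG mA mF \<pi>])

lemma D_eq:
  assumes "x \<in> carrier (tens A (P (Suc n)))" "y \<in> carrier (tens BM (P n))"
  shows "D n (x, y) = (tens_r A (P (Suc n)) (P n) (d n) x \<oplus>\<^bsub>tens A (P n)\<^esub> tens_l BM A (P n) inc y,
    \<ominus>\<^bsub>tens BM (P' n)\<^esub> tens_r BM (P n) (P' n) (d' n) y)"
  using assms by (simp add: D_def T_carrier)

lemma D_hom: "D n \<in> Hom (T (Suc n)) (T n)"
proof -
  have m: "module R (dsum (tens A (P (Suc n))) (tens BM (P n)))" using mT[of "Suc n"]
    by (simp add: T_def)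
  note q = dsum_maps(1,2)[OF mAP[of "Suc n"] mBP[of n]]
  have c1: "(\<lambda>z\<in>carrier (T (Suc n)). compose (carrier (T (Suc n))) (tens_r A (P (Suc n)) (P n)
      (d n)) (\<lambda>z\<in>carrier (T (Suc n)). fst z) z
     \<oplus>\<^bsub>tens A (P n)\<^esub> compose (carrier (T (Suc n))) (tens_l BM A (P n) inc)
         (\<lambda>z\<in>carrier (T (Suc n)). snd z) z) \<in> Hom (T (Suc n)) (tens A (P n))"
    using hom_add[OF m mAP hom_compose[OF m q(1) Ad] hom_compose[OF m q(2) iP]] by (simp add: T_def)
  have c2: "(\<lambda>z\<in>carrier (T (Suc n)). \<ominus>\<^bsub>tens BM (P' n)\<^esub> compose (carrier (T (Suc n)))
      (tens_r BM (P n) (P' n) (d' n)) (\<lambda>z\<in>carrier (T (Suc n)). snd z) z)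
    \<in> Hom (T (Suc n)) (tens BM (P' n))"
    using hom_neg[OF m mBP' hom_compose[OF m q(2) Bd']] by (simp add: T_def)
  \<comment> \<open>In this form each component is a sum or a negative of composites with the
    projections, so linearity is inherited from \<open>hom_add\<close> and
    \<open>hom_neg\<close>.\<close>
  have D: "D n = (\<lambda>z\<in>carrier (T (Suc n)).
    ((\<lambda>z\<in>carrier (T (Suc n)). compose (carrier (T (Suc n))) (tens_r A (P (Suc n)) (P n) (d n))
        (\<lambda>z\<in>carrier (T (Suc n)). fst z) z
     \<oplus>\<^bsub>tens A (P n)\<^esub> compose (carrier (T (Suc n))) (tens_l BM A (P n) inc)
         (\<lambda>z\<in>carrier (T (Suc n)). snd z) z) z,
     (\<lambda>z\<in>carrier (T (Suc n)). \<ominus>\<^bsub>tens BM (P' n)\<^esub> compose (carrier (T (Suc n))) (tens_r BM (P n)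
         (P' n) (d' n)) (\<lambda>z\<in>carrier (T (Suc n)). snd z) z) z))"
    by (simp add: D_def fun_eq_iff compose_eq)
  show ?thesis
    unfolding D
    by (rule mod_homI[OF _ _ _ mT])
      (use homD(1)[OF c1] homD(1)[OF c2] homD(2)[OF c1] homD(2)[OF c2] homD(3)[OF c1]
          homD(3)[OF c2] in \<open>simp_all add: T_def[of n]\<close>)
qed

lemma E_eq: "x \<in> carrier (tens A (P 0)) \<Longrightarrow> y \<in> carrier (tens BM (P' 0)) \<Longrightarrow> E (x, y) = tens_l A F G \<pi>
    (tens_r A (P 0) G e x)"
  by (simp add: E_def T_carrier)

lemma E_hom: "E \<in> Hom (T 0) (tens F G)"
proof -
  have m: "module R (dsum (tens A (P 0)) (tens BM (P' 0)))" using mT[of 0] by (simp add: T_def)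
  note q = dsum_maps(1)[OF mAP[of 0] mBP'[of 0]]
  have "compose (carrier (T 0)) (tens_l A F G \<pi>) (compose (carrier (T 0)) (tens_r A (P 0) G e)
      (\<lambda>z\<in>carrier (T 0). fst z)) \<in> Hom (T 0) (tens F G)"
    using hom_compose[OF m hom_compose[OF m q Ae] \<pi>G] by (simp add: T_def)
  moreover have "E = compose (carrier (T 0)) (tens_l A F G \<pi>) (compose (carrier (T 0))
      (tens_r A (P 0) G e) (\<lambda>z\<in>carrier (T 0). fst z))"
    by (simp add: E_def compose_def fun_eq_iff)
  ultimately show ?thesis by simp
qed

lemma exact_A: "exact_at (tens A (P (Suc (Suc n)))) (tens_r A (P (Suc (Suc n))) (P (Suc n))
    (d (Suc n))) (tens A (P (Suc n)))
    (tens_r A (P (Suc n)) (P n) (d n)) (tens A (P n))"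
  by (rule tens_proj_exact[OF A PD(3,3,3,4,4,6)])

lemma exact_A0: "exact_at (tens A (P (Suc 0))) (tens_r A (P (Suc 0)) (P 0) (d 0)) (tens A (P 0))
    (tens_r A (P 0) G e) (tens A G)"
  by (rule tens_proj_exact[OF A PD(3,3,1,4,5,7)])

lemma exact_B: "exact_at (tens BM (P (Suc (Suc n)))) (tens_r BM (P (Suc (Suc n))) (P (Suc n))
    (d (Suc n))) (tens BM (P (Suc n)))
    (tens_r BM (P (Suc n)) (P n) (d n)) (tens BM (P n))"
  by (rule tens_proj_exact[OF B PD(3,3,3,4,4,6)])

lemma exact_B0: "exact_at (tens BM (P (Suc 0))) (tens_r BM (P (Suc 0)) (P 0) (d 0))
    (tens BM (P 0)) (tens_r BM (P 0) G e) (tens BM G)"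
  by (rule tens_proj_exact[OF B PD(3,3,1,4,5,7)])

text \<open>In positive degrees exactness of B \<otimes> P suffices. For \<open>n = 0\<close> the
  second equation is void; applying the augmentation to the first one puts the image of
  \<open>y\<close> in B \<otimes> G into the kernel of the map to A \<otimes> G, which is zero. This
  is where flatness of \<open>G\<close> makes the cone exact.\<close>

lemma BM_boundary:
  assumes x: "x \<in> carrier (tens A (P (Suc n)))" and y: "y \<in> carrier (tens BM (P n))"
    and 1: "tens_r A (P (Suc n)) (P n) (d n) x \<oplus>\<^bsub>tens A (P n)\<^esub> tens_l BM A (P n) inc y
        = \<zero>\<^bsub>tens A (P n)\<^esub>"
    and 2: "tens_r BM (P n) (P' n) (d' n) y = \<zero>\<^bsub>tens BM (P' n)\<^esub>"
  obtains y' where "y' \<in> carrier (tens BM (P (Suc n)))" "y = tens_r BM (P (Suc n)) (P n) (d n) y'"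
proof (cases n)
  case (Suc m)
  then show ?thesis using exact_atD(3)[OF exact_B[of m], of y] y 2 that by auto
next
  case 0
  have y0: "y \<in> carrier (tens BM (P 0))" using y 0 by simp
  have x0: "x \<in> carrier (tens A (P (Suc 0)))" using x 0 by simp
  have dx: "tens_r A (P (Suc 0)) (P 0) (d 0) x \<in> carrier (tens A (P 0))" by (rule homD(1)[OF Ad x0])
  have iy: "tens_l BM A (P 0) inc y \<in> carrier (tens A (P 0))" by (rule homD(1)[OF iP y0])
  have "tens_r A (P 0) G e (tens_r A (P (Suc 0)) (P 0) (d 0) x \<oplus>\<^bsub>tens A (P 0)\<^esub> tens_l BM A (P 0)
      inc y) = \<zero>\<^bsub>tens A G\<^esub>"
    using 1 0 hom_zero_neg(1)[OF Ae mAP mAG] by simp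
  then have "tens_r A (P 0) G e (tens_l BM A (P 0) inc y) = \<zero>\<^bsub>tens A G\<^esub>"
    using homD(2)[OF Ae dx iy] exact_atD(1)[OF exact_A0 x0] homD(1)[OF Ae iy] mAG by simp
  then have "tens_l BM A G inc (tens_r BM (P 0) G e y) = \<zero>\<^bsub>tens A G\<^esub>"
    using tens_r_tens_l[OF mB mA PD(3) mG inc PD(5) y0] by simp
  then have "tens_r BM (P 0) G e y = \<zero>\<^bsub>tens BM G\<^esub>" by (rule inc_tens_kernel[OF G homD(1)[OF Be y0]])
  then show ?thesis using exact_atD(3)[OF exact_B0 y0] that 0 by blast
qed

lemma D_D:
  assumes "z \<in> carrier (T (Suc (Suc n)))"
  shows "D n (D (Suc n) z) = \<zero>\<^bsub>T n\<^esub>"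
proof -
  obtain x y where z: "z = (x, y)" and x: "x \<in> carrier (tens A (P (Suc (Suc n))))"
      and y: "y \<in> carrier (tens BM (P (Suc n)))"
    using assms by (auto simp: T_carrier)
  let ?dx = "tens_r A (P (Suc (Suc n))) (P (Suc n)) (d (Suc n)) x"
      and ?iy = "tens_l BM A (P (Suc n)) inc y"
  let ?dy = "tens_r BM (P (Suc n)) (P n) (d n) y"
  have c: "?dx \<in> carrier (tens A (P (Suc n)))" "?iy \<in> carrier (tens A (P (Suc n)))"
      "?dy \<in> carrier (tens BM (P n))"
    using homD(1)[OF Ad x] homD(1)[OF iP y] homD(1)[OF Bd y] by auto
  have ndy: "\<ominus>\<^bsub>tens BM (P n)\<^esub> ?dy \<in> carrier (tens BM (P n))" using c(3) mBP by simp
  have s: "?dx \<oplus>\<^bsub>tens A (P (Suc n))\<^esub> ?iy \<in> carrier (tens A (P (Suc n)))" using c mAP by simp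
  have "D (Suc n) z = (?dx \<oplus>\<^bsub>tens A (P (Suc n))\<^esub> ?iy, \<ominus>\<^bsub>tens BM (P n)\<^esub> ?dy)"
    unfolding z using D_eq[of x "Suc n" y] x y by simp
  then have DD: "D n (D (Suc n) z) = (tens_r A (P (Suc n)) (P n) (d n) (?dx \<oplus>\<^bsub>tens A (P (Suc n))\<^esub>
      ?iy) \<oplus>\<^bsub>tens A (P n)\<^esub>
      tens_l BM A (P n) inc (\<ominus>\<^bsub>tens BM (P n)\<^esub> ?dy), \<ominus>\<^bsub>tens BM (P' n)\<^esub> tens_r BM (P n) (P' n)
          (d' n) (\<ominus>\<^bsub>tens BM (P n)\<^esub> ?dy))"
    using D_eq[OF s ndy] by simp
  have diy: "tens_r A (P (Suc n)) (P n) (d n) ?iy = tens_l BM A (P n) inc ?dy"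
    by (rule tens_r_tens_l[OF mB mA PD(3,3) inc PD(4) y])
  have "tens_r A (P (Suc n)) (P n) (d n) (?dx \<oplus>\<^bsub>tens A (P (Suc n))\<^esub> ?iy) = tens_l BM A (P n) inc
      ?dy"
    using homD(2)[OF Ad c(1,2)] exact_atD(1)[OF exact_A x] diy homD(1)[OF iP c(3)] mAP by simp
  moreover have "tens_l BM A (P n) inc (\<ominus>\<^bsub>tens BM (P n)\<^esub> ?dy) = \<ominus>\<^bsub>tens A (P n)\<^esub> tens_l BM A (P n)
      inc ?dy"
    by (rule hom_zero_neg(2)[OF iP mBP mAP c(3)])
  moreover have "tens_r BM (P n) (P' n) (d' n) ?dy = \<zero>\<^bsub>tens BM (P' n)\<^esub>"
  proof -
    have "tens_r BM (P n) (P' n) (d' n) ?dy = tens_r BM (P (Suc n)) (P' n)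
        (\<lambda>x\<in>carrier (P (Suc n)). \<zero>\<^bsub>P' n\<^esub>) y"
      by (rule tens_r_tens_r[OF mB PD(3,3) mP' PD(4) d' hom_zero[OF PD(3) mP'] _ y])
          (simp add: d'_d)
    also have "\<dots> = \<zero>\<^bsub>tens BM (P' n)\<^esub>"
      by (rule tens_map_zero[OF mB PD(3) mB mP' hom_id[OF mB] hom_zero[OF PD(3) mP'] _ y]) simp
    finally show ?thesis .
  qed
  moreover have "tens_r BM (P n) (P' n) (d' n) (\<ominus>\<^bsub>tens BM (P n)\<^esub> ?dy) = \<ominus>\<^bsub>tens BM (P' n)\<^esub> tens_r
      BM (P n) (P' n) (d' n) ?dy"
    by (rule hom_zero_neg(2)[OF Bd' mBP mBP' c(3)])
  ultimately show ?thesis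
    unfolding DD using homD(1)[OF iP c(3)] mAP mBP' by (simp add: T_def)
qed

text \<open>For a cycle \<open>(x, y)\<close> write \<open>y\<close> as the boundary of
  \<open>y'\<close>. Then the sum of \<open>x\<close> and the image of \<open>y'\<close> is a cycle
  of A \<otimes> P, hence the boundary of some \<open>x'\<close>, and \<open>(x', -y')\<close> is
  the preimage; its sign undoes the one in \<open>D\<close>.\<close>

lemma exact_T: "exact_at (T (Suc (Suc n))) (D (Suc n)) (T (Suc n)) (D n) (T n)"
proof (rule exact_atI)
  fix z assume z: "z \<in> carrier (T (Suc n))" and Dz: "D n z = \<zero>\<^bsub>T n\<^esub>"
  obtain x y where xy: "z = (x, y)" and x: "x \<in> carrier (tens A (P (Suc n)))"
      and y: "y \<in> carrier (tens BM (P n))"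
    using z by (auto simp: T_carrier)
  have 1: "tens_r A (P (Suc n)) (P n) (d n) x \<oplus>\<^bsub>tens A (P n)\<^esub> tens_l BM A (P n) inc y
      = \<zero>\<^bsub>tens A (P n)\<^esub>"
    and "\<ominus>\<^bsub>tens BM (P' n)\<^esub> tens_r BM (P n) (P' n) (d' n) y = \<zero>\<^bsub>tens BM (P' n)\<^esub>"
    using Dz D_eq[OF x y] unfolding xy by (simp_all add: T_def)
  then have 2: "tens_r BM (P n) (P' n) (d' n) y = \<zero>\<^bsub>tens BM (P' n)\<^esub>"
    using mBP' homD(1)[OF Bd' y] by (metis module_simps(5,6))
  obtain y' where y': "y' \<in> carrier (tens BM (P (Suc n)))" "y = tens_r BM (P (Suc n)) (P n) (d n)
      y'"
    by (rule BM_boundary[OF x y 1 2])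
  have iy: "tens_l BM A (P (Suc n)) inc y' \<in> carrier (tens A (P (Suc n)))"
    by (rule homD(1)[OF iP y'(1)])
  have s: "x \<oplus>\<^bsub>tens A (P (Suc n))\<^esub> tens_l BM A (P (Suc n)) inc y' \<in> carrier (tens A (P (Suc n)))"
    using x iy mAP by simp
  have "tens_r A (P (Suc n)) (P n) (d n) (tens_l BM A (P (Suc n)) inc y') = tens_l BM A (P n) inc y"
    unfolding y'(2) by (rule tens_r_tens_l[OF mB mA PD(3,3) inc PD(4) y'(1)])
  then have "tens_r A (P (Suc n)) (P n) (d n) (x \<oplus>\<^bsub>tens A (P (Suc n))\<^esub> tens_l BM A (P (Suc n)) inc
      y') = \<zero>\<^bsub>tens A (P n)\<^esub>"
    using homD(2)[OF Ad x iy] 1 by simp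
  then obtain x' where x': "x' \<in> carrier (tens A (P (Suc (Suc n))))"
    "x \<oplus>\<^bsub>tens A (P (Suc n))\<^esub> tens_l BM A (P (Suc n)) inc y' = tens_r A (P (Suc (Suc n)))
        (P (Suc n)) (d (Suc n)) x'"
    using exact_atD(3)[OF exact_A s] by blast
  have ny: "\<ominus>\<^bsub>tens BM (P (Suc n))\<^esub> y' \<in> carrier (tens BM (P (Suc n)))" using y'(1) mBP by simp
  have "D (Suc n) (x', \<ominus>\<^bsub>tens BM (P (Suc n))\<^esub> y') = (x, y)"
  proof -
    have "D (Suc n) (x', \<ominus>\<^bsub>tens BM (P (Suc n))\<^esub> y') =
      (x \<oplus>\<^bsub>tens A (P (Suc n))\<^esub> tens_l BM A (P (Suc n)) inc y' \<oplus>\<^bsub>tens A (P (Suc n))\<^esub>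
          \<ominus>\<^bsub>tens A (P (Suc n))\<^esub> tens_l BM A (P (Suc n)) inc y',
       \<ominus>\<^bsub>tens BM (P n)\<^esub> (\<ominus>\<^bsub>tens BM (P n)\<^esub> y))"
      using D_eq[OF x'(1) ny] x'(2) y'(2) hom_zero_neg(2)[OF iP mBP mAP y'(1)] hom_zero_neg(2)[OF
          Bd mBP mBP y'(1)] by simp
    then show ?thesis
      using module_diff(6)[OF mAP x iy] module_diff(1)[OF mAP s iy] y mBP by simp
  qed
  then show "z \<in> D (Suc n) ` carrier (T (Suc (Suc n)))"
    unfolding xy using x' ny by (force simp: T_carrier)
qed (use homD(1)[OF D_hom] D_D in blast)+

text \<open>What remains is degree 0. It combines right exactness of B \<otimes> G -> A \<otimes> G
  -> F \<otimes> G -> 0 with surjectivity of the augmentations of B \<otimes> P and A \<otimes> P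
  onto the first two terms.\<close>

lemma resolution_T: "resolution (tens F G) T D E"
proof -
  have "exact_at (T (Suc 0)) (D 0) (T 0) E (tens F G)"
  proof (rule exact_atI)
    fix z assume z: "z \<in> carrier (T (Suc 0))"
    show "D 0 z \<in> carrier (T 0)" by (rule homD(1)[OF D_hom z])
    obtain x y where xy: "z = (x, y)" and x: "x \<in> carrier (tens A (P (Suc 0)))"
        and y: "y \<in> carrier (tens BM (P 0))"
      using z by (auto simp: T_carrier)
    let ?dx = "tens_r A (P (Suc 0)) (P 0) (d 0) x" and ?iy = "tens_l BM A (P 0) inc y"
    have c: "?dx \<in> carrier (tens A (P 0))" "?iy \<in> carrier (tens A (P 0))"
        "tens_r BM (P 0) G e y \<in> carrier (tens BM G)"
      using homD(1)[OF Ad x] homD(1)[OF iP y] homD(1)[OF Be y] by auto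
    have c2: "\<ominus>\<^bsub>tens BM (P' 0)\<^esub> tens_r BM (P 0) (P' 0) (d' 0) y \<in> carrier (tens BM (P' 0))"
      using homD(1)[OF Bd' y] mBP' by blast
    have s: "?dx \<oplus>\<^bsub>tens A (P 0)\<^esub> ?iy \<in> carrier (tens A (P 0))" using c mAP by simp
    have "tens_r A (P 0) G e (?dx \<oplus>\<^bsub>tens A (P 0)\<^esub> ?iy) = tens_r A (P 0) G e ?iy"
      using homD(2)[OF Ae c(1,2)] exact_atD(1)[OF exact_A0 x] homD(1)[OF Ae c(2)] mAG by simp
    also have "\<dots> = tens_l BM A G inc (tens_r BM (P 0) G e y)"
      by (rule tens_r_tens_l[OF mB mA PD(3) mG inc PD(5) y])
    finally have "E (D 0 z) = tens_l A F G \<pi> (tens_l BM A G inc (tens_r BM (P 0) G e y))"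
      unfolding xy D_eq[OF x y] E_eq[OF s c2] by simp
    also have "\<dots> = tens_l BM F G (\<lambda>x\<in>carrier BM. \<zero>\<^bsub>F\<^esub>) (tens_r BM (P 0) G e y)"
      by (rule tens_l_tens_l[OF mG mB mA mF inc \<pi> hom_zero[OF mB mF] _ c(3)]) (use \<pi>_ker B_A in
          auto)
    also have "\<dots> = \<zero>\<^bsub>tens F G\<^esub>"
      by (rule tens_map_zero[OF mB mG mF mG hom_zero[OF mB mF] hom_id[OF mG] _ c(3)]) simp
    finally show "E (D 0 z) = \<zero>\<^bsub>tens F G\<^esub>" .
  next
    fix z assume z: "z \<in> carrier (T 0)" and Ez: "E z = \<zero>\<^bsub>tens F G\<^esub>"
    obtain x y where xy: "z = (x, y)" and x: "x \<in> carrier (tens A (P 0))"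
        and y: "y \<in> carrier (tens BM (P' 0))"
      using z by (auto simp: T_carrier)
    have ex: "tens_r A (P 0) G e x \<in> carrier (tens A G)" by (rule homD(1)[OF Ae x])
    have "tens_r A (P 0) G e x \<in> tens_l BM A G inc ` carrier (tens BM G)"
    proof (rule tens_exact_left[OF mA mB mF mG inc \<pi> \<pi>_surj _ ex])
      show "a \<in> inc ` carrier BM" if "a \<in> carrier A" "\<pi> a = \<zero>\<^bsub>F\<^esub>" for a using that \<pi>_ker by force
      show "tens_l A F G \<pi> (tens_r A (P 0) G e x) = \<zero>\<^bsub>tens F G\<^esub>" using Ez E_eq[OF x y] xy by simp
    qed
    then obtain w where w: "w \<in> carrier (tens BM G)" "tens_r A (P 0) G e x = tens_l BM A G inc w"
      by blast
    have "tens_r BM (P 0) G e ` carrier (tens BM (P 0)) = carrier (tens BM G)"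
      by (rule tens_map_surj[OF mB PD(3) mB mG hom_id[OF mB] PD(5) _ PD(8)]) simp
    then have "w \<in> tens_r BM (P 0) G e ` carrier (tens BM (P 0))" using w(1) by (simp only:)
    then obtain v where v: "v \<in> carrier (tens BM (P 0))" "w = tens_r BM (P 0) G e v" by blast
    let ?iv = "tens_l BM A (P 0) inc v"
    have iv: "?iv \<in> carrier (tens A (P 0))" by (rule homD(1)[OF iP v(1)])
    have s: "x \<ominus>\<^bsub>tens A (P 0)\<^esub> ?iv \<in> carrier (tens A (P 0))" using x iv mAP by simp
    have "tens_r A (P 0) G e x = tens_r A (P 0) G e ?iv"
      unfolding w(2) v(2) by (rule tens_r_tens_l[OF mB mA PD(3) mG inc PD(5) v(1), symmetric])
    then have "tens_r A (P 0) G e (x \<ominus>\<^bsub>tens A (P 0)\<^esub> ?iv) = \<zero>\<^bsub>tens A G\<^esub>"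
      using hom_zero_neg(3)[OF Ae mAP mAG x iv] homD(1)[OF Ae iv] mAG by simp
    then obtain u where u: "u \<in> carrier (tens A (P (Suc 0)))" "x \<ominus>\<^bsub>tens A (P 0)\<^esub> ?iv = tens_r A
        (P (Suc 0)) (P 0) (d 0) u"
      using exact_atD(3)[OF exact_A0 s] by blast
    \<comment> \<open>On the tensor product with the zero module the identity is induced by a zero
      map, so it is zero.\<close>
    have t0: "t = \<zero>\<^bsub>tens BM (P' 0)\<^esub>" if t: "t \<in> carrier (tens BM (P' 0))" for t
    proof -
      have h: "idm (P' 0) \<in> Hom (P' 0) (P' 0)" by (rule hom_id[OF mP'])
      have "tens_r BM (P' 0) (P' 0) (idm (P' 0)) t = \<zero>\<^bsub>tens BM (P' 0)\<^esub>"
        by (rule tens_map_zero[OF mB mP' mB mP' hom_id[OF mB] h _ t]) simp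
      then show ?thesis using tens_r_id[OF mB mP' t h] by simp
    qed
    have "D 0 (u, v) = (x, \<ominus>\<^bsub>tens BM (P' 0)\<^esub> tens_r BM (P 0) (P' 0) (d' 0) v)"
      using D_eq[OF u(1) v(1)] u(2)[symmetric] module_diff(5)[OF mAP x iv] by simp
    moreover have "\<ominus>\<^bsub>tens BM (P' 0)\<^esub> tens_r BM (P 0) (P' 0) (d' 0) v \<in> carrier (tens BM (P' 0))"
      using homD(1)[OF Bd' v(1)] mBP' by blast
    ultimately have "D 0 (u, v) = z" unfolding xy
      using t0[OF y] t0[of "\<ominus>\<^bsub>tens BM (P' 0)\<^esub> tens_r BM (P 0) (P' 0) (d' 0) v"] by simp
    then show "z \<in> D 0 ` carrier (T (Suc 0))" using u(1) v(1) by (force simp: T_carrier)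
  qed
  moreover have "E ` carrier (T 0) = carrier (tens F G)"
  proof
    show "E ` carrier (T 0) \<subseteq> carrier (tens F G)" using homD(1)[OF E_hom] by blast
    show "carrier (tens F G) \<subseteq> E ` carrier (T 0)"
    proof
      fix t assume t: "t \<in> carrier (tens F G)"
      have "tens_l A F G \<pi> ` carrier (tens A G) = carrier (tens F G)"
        by (rule tens_map_surj[OF mA mG mF mG \<pi> hom_id[OF mG] \<pi>_surj]) simp
      then have "t \<in> tens_l A F G \<pi> ` carrier (tens A G)" using t by (simp only:)
      then obtain s where s: "s \<in> carrier (tens A G)" "t = tens_l A F G \<pi> s" by blast
      have "tens_r A (P 0) G e ` carrier (tens A (P 0)) = carrier (tens A G)"
        by (rule tens_map_surj[OF mA PD(3) mA mG hom_id[OF mA] PD(5) _ PD(8)]) simp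
      then have "s \<in> tens_r A (P 0) G e ` carrier (tens A (P 0))" using s(1) by (simp only:)
      then obtain x where x: "x \<in> carrier (tens A (P 0))" "s = tens_r A (P 0) G e x" by blast
      have z: "\<zero>\<^bsub>tens BM (P' 0)\<^esub> \<in> carrier (tens BM (P' 0))" using mBP' by blast
      have "t = E (x, \<zero>\<^bsub>tens BM (P' 0)\<^esub>)" using E_eq[OF x(1) z] s(2) x(2) by simp
      then show "t \<in> E ` carrier (T 0)" using x(1) z by (auto simp: T_carrier)
    qed
  qed
  ultimately show ?thesis
    unfolding resolution_def using mFG proj_T D_hom E_hom exact_T by simp
qed

text \<open>A cocycle \<open>z\<close> of \<open>P\<close> gives the cocycle \<open>p \<otimes> z\<close> of the cone in one degree more; applying \<open>\<tau>\<close> to a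
  cochain that bounds the latter gives a cochain that bounds \<open>z\<close>.\<close>

lemma Ext_vanish_descend:
  assumes v: "Ext_vanish T D N (Suc n)"
  shows "Ext_vanish P d N n"
proof -
  \<comment> \<open>Stated with \<open>P'\<close> and \<open>d'\<close>, this covers every degree:
    composing \<open>\<psi>\<close> with \<open>d' n\<close> gives a coboundary for positive
    \<open>n\<close> and zero for \<open>n = 0\<close>.\<close>
  have key: "\<exists>\<psi>\<in>Hom (P' n) N. \<forall>q\<in>carrier (P n). z q = \<psi> (d' n q)"
    if z: "z \<in> Hom (P n) N" and zd: "\<And>x. x \<in> carrier (P (Suc n)) \<Longrightarrow> z (d n x) = \<zero>\<^bsub>N\<^esub>" for z
  proof -
    have pB: "p b \<in> carrier R" if "b \<in> B" for b using homD(1)[OF p] that by simp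
    have bz: "bilin BM (P n) N (\<lambda>b q. p b \<odot>\<^bsub>N\<^esub> z q)"
    proof (rule bilinI)
    qed (use pB homD(1)[OF z] N homD(2)[OF p] homD(3)[OF p] in
        \<open>simp_all add: homD(2)[OF z] homD(3)[OF z] module_smult(1,2,3,4)\<close>)
    define \<zeta> where "\<zeta> = tens_lin BM (P n) N (\<lambda>b q. p b \<odot>\<^bsub>N\<^esub> z q)"
    have \<zeta>: "\<zeta> \<in> Hom (tens BM (P n)) N"
      "\<And>b q. b \<in> B \<Longrightarrow> q \<in> carrier (P n) \<Longrightarrow> \<zeta> (te BM (P n) b q) = p b \<odot>\<^bsub>N\<^esub> z q"
      unfolding \<zeta>_def using tens_lin[OF mB PD(3) N bz] by simp_all
    have \<zeta>d: "\<zeta> (tens_r BM (P (Suc n)) (P n) (d n) y) = \<zero>\<^bsub>N\<^esub>"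
        if y: "y \<in> carrier (tens BM (P (Suc n)))" for y
    proof -
      have "compose (carrier (tens BM (P (Suc n)))) \<zeta> (tens_r BM (P (Suc n)) (P n) (d n)) y
          = (\<lambda>y\<in>carrier (tens BM (P (Suc n))). \<zero>\<^bsub>N\<^esub>) y"
      proof (rule tens_hom_eqI[OF mB PD(3) hom_compose[OF mBP Bd \<zeta>(1)] hom_zero[OF mBP N] _ y])
        fix b q assume bq: "b \<in> carrier BM" "q \<in> carrier (P (Suc n))"
        then have dq: "d n q \<in> carrier (P n)" by (intro homD(1)[OF PD(4)])
        have "te BM (P (Suc n)) b q \<in> carrier (tens BM (P (Suc n)))"
          by (rule te_closed[OF mB PD(3) bq])
        then show "compose (carrier (tens BM (P (Suc n)))) \<zeta> (tens_r BM (P (Suc n)) (P n) (d n))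
            (te BM (P (Suc n)) b q) =
            (\<lambda>y\<in>carrier (tens BM (P (Suc n))). \<zero>\<^bsub>N\<^esub>) (te BM (P (Suc n)) b q)"
          using tens_r(2)[OF mB PD(3,3,4) bq] \<zeta>(2)[OF _ dq, of b] zd[OF bq(2)] bq(1) pB N
            by (simp add: compose_eq)
      qed
      then show ?thesis using y by (simp add: compose_eq)
    qed
    \<comment> \<open>The second summand of the cone in degree \<open>Suc n\<close> is B \<otimes> P
      in degree \<open>n\<close>, where \<open>\<zeta>\<close> lives. It is a cocycle since
      \<open>\<zeta>\<close> kills boundaries, a property inherited from \<open>z\<close>.\<close>
    define z' where "z' = compose (carrier (T (Suc n))) \<zeta> (\<lambda>t\<in>carrier (T (Suc n)). snd t)"
    have z': "z' \<in> Hom (T (Suc n)) N"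
      unfolding z'_def
      by (rule hom_compose[OF mT _ \<zeta>(1)]) (use dsum_maps(2)[OF mAP mBP'] in
          \<open>simp add: T_def[of "Suc n"]\<close>, metis P'_Suc)
    have z'D: "z' (D (Suc n) t) = \<zero>\<^bsub>N\<^esub>" if t: "t \<in> carrier (T (Suc (Suc n)))" for t
    proof -
      obtain x y where xy: "t = (x, y)" and x: "x \<in> carrier (tens A (P (Suc (Suc n))))"
          and y: "y \<in> carrier (tens BM (P (Suc n)))"
        using t by (auto simp: T_carrier)
      have "snd (D (Suc n) t) = \<ominus>\<^bsub>tens BM (P n)\<^esub> tens_r BM (P (Suc n)) (P n) (d n) y"
        unfolding xy using D_eq[OF x y] by simp
      then have "z' (D (Suc n) t) = \<zeta> (\<ominus>\<^bsub>tens BM (P n)\<^esub> tens_r BM (P (Suc n)) (P n) (d n) y)"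
        unfolding z'_def using homD(1)[OF D_hom t] by (simp add: compose_eq)
      also have "\<dots> = \<zero>\<^bsub>N\<^esub>"
        using hom_zero_neg(2)[OF \<zeta>(1) mBP N homD(1)[OF Bd y]] \<zeta>d[OF y] N by simp
      finally show ?thesis .
    qed
    obtain w where w: "w \<in> Hom (T n) N" "\<And>t. t \<in> carrier (T (Suc n)) \<Longrightarrow> z' t = w (D n t)"
      by (rule Ext_vanish_SucD[OF v z' z'D]) blast+
    note zAP = module_addI(2)[OF mAP] and zBP = module_addI(2)[OF mBP']
    define w1 where "w1 x = w (x, \<zero>\<^bsub>tens BM (P' n)\<^esub>)" for x
    define w2 where "w2 y = w (\<zero>\<^bsub>tens A (P n)\<^esub>, y)" for y
    have w12: "w (x, y) = w1 x \<oplus>\<^bsub>N\<^esub> w2 y" if "x \<in> carrier (tens A (P n))"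
        "y \<in> carrier (tens BM (P' n))" for x y
      unfolding w1_def w2_def
      using homD(2)[OF w(1), of "(x, \<zero>\<^bsub>tens BM (P' n)\<^esub>)" "(\<zero>\<^bsub>tens A (P n)\<^esub>, y)"] that zAP zBP mAP
          mBP' by (simp add: T_def)
    have w1: "compose (carrier (tens A (P n))) w (\<lambda>x\<in>carrier (tens A (P n)).
        (x, \<zero>\<^bsub>tens BM (P' n)\<^esub>)) \<in> Hom (tens A (P n)) N"
      by (rule hom_compose[OF mAP _ w(1)]) (use dsum_maps(3)[OF mAP mBP'] in \<open>simp add: T_def\<close>)
    have w1c1: "w1 x \<in> carrier N" if "x \<in> carrier (tens A (P n))" for x
      using homD(1)[OF w1 that] that by (simp add: compose_eq w1_def)
    have w1c2: "w1 (x \<oplus>\<^bsub>tens A (P n)\<^esub> x') = w1 x \<oplus>\<^bsub>N\<^esub> w1 x'"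
      if "x \<in> carrier (tens A (P n))" "x' \<in> carrier (tens A (P n))" for x x'
      using homD(2)[OF w1 that] that mAP by (simp add: compose_eq w1_def)
    have w1c3: "w1 (r \<odot>\<^bsub>tens A (P n)\<^esub> x) = r \<odot>\<^bsub>N\<^esub> w1 x"
        if "r \<in> carrier R" "x \<in> carrier (tens A (P n))" for r x
      using homD(3)[OF w1 that] that mAP by (simp add: compose_eq w1_def)
    note w1c = w1c1 w1c2 w1c3
    have w2: "compose (carrier (tens BM (P' n))) w (\<lambda>y\<in>carrier (tens BM (P' n)). (\<zero>\<^bsub>tens A (P n)\<^esub>,
        y)) \<in> Hom (tens BM (P' n)) N"
      by (rule hom_compose[OF mBP' _ w(1)]) (use dsum_maps(4)[OF mAP mBP'] in \<open>simp add: T_def\<close>)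
    have w2c1: "w2 x \<in> carrier N" if "x \<in> carrier (tens BM (P' n))" for x
      using homD(1)[OF w2 that] that by (simp add: compose_eq w2_def)
    have w2c2: "w2 (x \<oplus>\<^bsub>tens BM (P' n)\<^esub> x') = w2 x \<oplus>\<^bsub>N\<^esub> w2 x'"
      if "x \<in> carrier (tens BM (P' n))" "x' \<in> carrier (tens BM (P' n))" for x x'
      using homD(2)[OF w2 that] that mBP' by (simp add: compose_eq w2_def)
    have w2c3: "w2 (r \<odot>\<^bsub>tens BM (P' n)\<^esub> x) = r \<odot>\<^bsub>N\<^esub> w2 x"
        if "r \<in> carrier R" "x \<in> carrier (tens BM (P' n))" for r x
      using homD(3)[OF w2 that] that mBP' by (simp add: compose_eq w2_def)
    have w2c4: "w2 (\<ominus>\<^bsub>tens BM (P' n)\<^esub> x) = \<ominus>\<^bsub>N\<^esub> w2 x" if "x \<in> carrier (tens BM (P' n))" for x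
      using hom_zero_neg(2)[OF w2 mBP' N that] that mBP' by (simp add: compose_eq w2_def)
    note w2c = w2c1 w2c2 w2c3 w2c4
    let ?H = "hom_module R BM N"
    have mH: "module R ?H" by (rule module_hom_module[OF mB N])
    note tA = bilinD[OF te_bilin[OF mA PD(3)[of n]]] and tB = bilinD[OF te_bilin[OF mB mP'[of n]]]
    \<comment> \<open>Currying the second part of the bounding cochain: each \<open>r\<close> gives
      a map from \<open>B\<close> to \<open>N\<close>, the kind of argument that
      \<open>\<tau>\<close> accepts.\<close>
    define Y where "Y r = (\<lambda>b\<in>B. w2 (te BM (P' n) b r))" for r
    have tBc: "te BM (P' n) b r \<in> carrier (tens BM (P' n))" if "b \<in> B" "r \<in> carrier (P' n)" for b r
      by (rule te_closed[OF mB mP']) (use that in simp_all)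
    have Yh: "Y r \<in> Hom BM N" if r: "r \<in> carrier (P' n)" for r
    proof -
      have "(\<lambda>b\<in>carrier BM. w2 (te BM (P' n) b r)) \<in> Hom BM N"
        by (rule mod_homI[OF _ _ _ mB]) (use r tBc w2c tB(2,4) in simp_all)
      then show ?thesis by (simp add: Y_def)
    qed
    have Y: "(\<lambda>r\<in>carrier (P' n). Y r) \<in> Hom (P' n) ?H"
    proof (rule mod_homI[OF _ _ _ mP'])
      show "Y r \<in> carrier ?H" if "r \<in> carrier (P' n)" for r using Yh[OF that]
        by (simp add: hom_module_simps)
    qed (use tBc w2c tB(3,5) in \<open>auto simp: Y_def hom_module_def fun_eq_iff\<close>)
    define \<psi> where "\<psi> = (\<lambda>r\<in>carrier (P' n). \<ominus>\<^bsub>N\<^esub> compose (carrier (P' n)) \<tau> (\<lambda>r\<in>carrier (P' n). Y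
        r) r)"
    have \<psi>: "\<psi> \<in> Hom (P' n) N" unfolding \<psi>_def by (rule hom_neg[OF mP' N hom_compose[OF mP' Y \<tau>]])
    have "z q = \<psi> (d' n q)" if q: "q \<in> carrier (P n)" for q
    proof -
      have dq: "d' n q \<in> carrier (P' n)" by (rule homD(1)[OF d' q])
      define X where "X = (\<lambda>a\<in>carrier A. w1 (te A (P n) a q))"
      have tAc: "te A (P n) a q \<in> carrier (tens A (P n))" if "a \<in> carrier A" for a
        by (rule te_closed[OF mA PD(3) that q])
      have X: "X \<in> Hom A N" unfolding X_def
        by (rule mod_homI[OF _ _ _ mA]) (use q tAc w1c tA(2,4) in simp_all)
      have XB: "(\<lambda>b\<in>B. X b) \<in> Hom BM N"
        using hom_compose[OF mB inc X] by (simp add: compose_def restrict_def cong: if_cong)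
      have zq: "z q \<in> carrier N" by (rule homD(1)[OF z q])
      have Zq: "(\<lambda>b\<in>B. p b \<odot>\<^bsub>N\<^esub> z q) \<in> Hom BM N"
      proof -
        have "(\<lambda>b\<in>carrier BM. p b \<odot>\<^bsub>N\<^esub> z q) \<in> Hom BM N"
          by (rule mod_homI[OF _ _ _ mB]) (use zq pB N homD(2)[OF p] homD(3)[OF p] in
              \<open>simp_all add: module_smult(2,3)\<close>)
        then show ?thesis by simp
      qed
      \<comment> \<open>The bounding equation is evaluated at the pair of zero and the pure tensor
        of \<open>b\<close> and \<open>q\<close>. As a function of \<open>b\<close>, the left side
        is recognized by \<open>\<tau>\<close> as \<open>z q\<close>, and \<open>X\<close> is the
        restriction of a map on \<open>A\<close>, hence invisible to \<open>\<tau>\<close>. This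
        also explains the sign in \<open>\<psi>\<close>.\<close>
      have eq: "p b \<odot>\<^bsub>N\<^esub> z q = X b \<ominus>\<^bsub>N\<^esub> Y (d' n q) b" if b: "b \<in> B" for b
      proof -
        have tb: "te BM (P n) b q \<in> carrier (tens BM (P n))" by (rule te_closed[OF mB PD(3)])
            (use b q in simp_all)
        have in_T: "(\<zero>\<^bsub>tens A (P (Suc n))\<^esub>, te BM (P n) b q) \<in> carrier (T (Suc n))"
          using tb module_addI(2)[OF mAP] by (simp add: T_carrier)
        have "D n (\<zero>\<^bsub>tens A (P (Suc n))\<^esub>, te BM (P n) b q) = (te A (P n) b q, \<ominus>\<^bsub>tens BM (P' n)\<^esub> te
            BM (P' n) b (d' n q))"
          using D_eq[OF module_addI(2)[OF mAP] tb] hom_zero_neg(1)[OF Ad mAP mAP]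
              tens_l(2)[OF PD(3) mB mA inc, of b q n]
            tens_r(2)[OF mB PD(3) mP' d', of b q n] b q tAc[OF B_A[OF b]] mAP by simp
        then have "z' (\<zero>\<^bsub>tens A (P (Suc n))\<^esub>, te BM (P n) b q) = w1 (te A (P n) b q) \<oplus>\<^bsub>N\<^esub> \<ominus>\<^bsub>N\<^esub> w2
            (te BM (P' n) b (d' n q))"
          using w(2)[OF in_T] w12[OF tAc[OF B_A[OF b]]] w2c(4)[OF tBc[OF b dq]] tBc[OF b dq] mBP'
            by simp
        moreover have "z' (\<zero>\<^bsub>tens A (P (Suc n))\<^esub>, te BM (P n) b q) = p b \<odot>\<^bsub>N\<^esub> z q"
          unfolding z'_def using in_T \<zeta>(2)[OF b q] by (simp add: compose_eq)
        ultimately show ?thesis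
          using b B_A[OF b] module_diff(1)[OF N w1c(1)[OF tAc[OF B_A[OF b]]]
              w2c(1)[OF tBc[OF b dq]]]
          by (simp add: X_def Y_def)
      qed
      have Yq: "Y (d' n q) \<in> Hom BM N" by (rule Yh[OF dq])
      have sub: "(\<lambda>b\<in>B. X b) \<ominus>\<^bsub>?H\<^esub> Y (d' n q) \<in> Hom BM N"
        using module_addI(4)[OF mH, of "\<lambda>b\<in>B. X b" "Y (d' n q)"] XB Yq
          by (simp add: hom_module_simps)
      have "(\<lambda>b\<in>B. p b \<odot>\<^bsub>N\<^esub> z q) = (\<lambda>b\<in>B. X b) \<ominus>\<^bsub>?H\<^esub> Y (d' n q)"
        by (rule hom_eqI[OF Zq sub]) (use eq hom_module_minus(2)[OF mB N _ XB Yq] in simp)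
      then have "z q = \<tau> ((\<lambda>b\<in>B. X b) \<ominus>\<^bsub>?H\<^esub> Y (d' n q))" using \<tau>_p[OF zq] by simp
      also have "\<dots> = \<tau> (\<lambda>b\<in>B. X b) \<ominus>\<^bsub>N\<^esub> \<tau> (Y (d' n q))"
        by (rule hom_zero_neg(3)[OF \<tau> mH N]) (use XB Yq in \<open>simp_all add: hom_module_simps\<close>)
      also have "\<dots> = \<ominus>\<^bsub>N\<^esub> \<tau> (Y (d' n q))"
        unfolding \<tau>_restrict[OF X]
        using homD(1)[OF \<tau>, of "Y (d' n q)"] Yq N module_diff(1)[OF N module_addI(2)[OF N], of
            "\<tau> (Y (d' n q))"]
        by (simp add: hom_module_simps)
      also have "\<dots> = \<psi> (d' n q)" using dq by (simp add: \<psi>_def compose_eq)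
      finally show ?thesis .
    qed
    then show ?thesis using \<psi> by blast
  qed
  show ?thesis
  proof (cases n)
    case 0
    show ?thesis
      unfolding 0 Ext_vanish_0_iff
    proof (intro ballI impI)
      fix z x assume z: "z \<in> Hom (P 0) N" "\<forall>x\<in>carrier (P (Suc 0)). z (d 0 x) = \<zero>\<^bsub>N\<^esub>"
          and x: "x \<in> carrier (P 0)"
      obtain \<psi> where \<psi>: "\<psi> \<in> Hom (P' 0) N" "z x = \<psi> (d' 0 x)" using key[unfolded 0, OF z(1)] z(2)
          x by blast
      have "d' 0 x = \<zero>\<^bsub>P' 0\<^esub>" using x by (simp add: d'_def)
      then show "z x = \<zero>\<^bsub>N\<^esub>" using \<psi> hom_zero_neg(1)[OF \<psi>(1) mP' N] by simp
    qed
  next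
    case (Suc m)
    show ?thesis
      unfolding Suc
    proof (rule Ext_vanish_SucI)
      show "module R (P (Suc m))" "d m \<in> Hom (P (Suc m)) (P m)" by (rule PD(3), rule PD(4))
      fix z assume "z \<in> Hom (P (Suc m)) N" "\<And>x. x \<in> carrier (P (Suc (Suc m))) \<Longrightarrow>
          z (d (Suc m) x) = \<zero>\<^bsub>N\<^esub>"
      then show "\<exists>w\<in>Hom (P m) N. \<forall>x\<in>carrier (P (Suc m)). z x = w (d m x)"
        using key[unfolded Suc, of z] by simp
    qed
  qed
qed

end

end

section \<open>Baer's criterion\<close>

context base_ring
begin

text \<open>An extension of \<open>f\<close> from the ideal to \<open>R\<close> is determined by its
  value \<open>n\<close> at \<open>\<one>\<close>, so extendability is expressed by \<open>n\<close>
  alone.\<close>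

definition baer :: "('r, 'n) module \<Rightarrow> bool"
  where "baer N \<longleftrightarrow> (\<forall>I. submodule I R Rmod \<longrightarrow> (\<forall>f\<in>Hom (submod Rmod I) N. \<exists>n\<in>carrier N. \<forall>a\<in>I. f a = a
      \<odot>\<^bsub>N\<^esub> n))"

lemma baerD:
  assumes "baer N" "submodule I R Rmod" "f \<in> Hom (submod Rmod I) N"
  obtains n where "n \<in> carrier N" "\<And>a. a \<in> I \<Longrightarrow> f a = a \<odot>\<^bsub>N\<^esub> n"
  using assms unfolding baer_def by blast

text \<open>Zorn's lemma for partial extensions, encoded as graphs in
  \<open>carrier B \<times> carrier N\<close>: the order is inclusion and a chain is bounded by its
  union. Given closure under the operations, the condition at zero expresses
  single-valuedness.\<close>

lemma baer_extend:
  fixes B :: "('r, 'b) module" and N :: "('r, 'n) module"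
  assumes B: "module R B" and N: "module R N" and baer: "baer N" and A: "submodule A R B"
      and f: "f \<in> Hom (submod B A) N"
  obtains g where "g \<in> Hom B N" "\<And>a. a \<in> A \<Longrightarrow> g a = f a"
proof -
  note AD = submoduleD[OF B A]
  have fA: "f a \<in> carrier N" if "a \<in> A" for a using homD(1)[OF f] that by simp
  have AB: "a \<in> carrier B" if "a \<in> A" for a using AD(1) that by blast
  define K where "K \<Gamma> \<longleftrightarrow> \<Gamma> \<subseteq> carrier B \<times> carrier N \<and> (\<forall>a\<in>A. (a, f a) \<in> \<Gamma>) \<and>
    (\<forall>x n y m. (x, n) \<in> \<Gamma> \<longrightarrow> (y, m) \<in> \<Gamma> \<longrightarrow> (x \<oplus>\<^bsub>B\<^esub> y, n \<oplus>\<^bsub>N\<^esub> m) \<in> \<Gamma>) \<and>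
    (\<forall>r x n. r \<in> carrier R \<longrightarrow> (x, n) \<in> \<Gamma> \<longrightarrow> (r \<odot>\<^bsub>B\<^esub> x, r \<odot>\<^bsub>N\<^esub> n) \<in> \<Gamma>) \<and>
    (\<forall>n. (\<zero>\<^bsub>B\<^esub>, n) \<in> \<Gamma> \<longrightarrow> n = \<zero>\<^bsub>N\<^esub>)" for \<Gamma>
  have KI: "K \<Gamma>" if "\<Gamma> \<subseteq> carrier B \<times> carrier N" "\<And>a. a \<in> A \<Longrightarrow> (a, f a) \<in> \<Gamma>"
    "\<And>x n y m. (x, n) \<in> \<Gamma> \<Longrightarrow> (y, m) \<in> \<Gamma> \<Longrightarrow> (x \<oplus>\<^bsub>B\<^esub> y, n \<oplus>\<^bsub>N\<^esub> m) \<in> \<Gamma>"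
    "\<And>r x n. r \<in> carrier R \<Longrightarrow> (x, n) \<in> \<Gamma> \<Longrightarrow> (r \<odot>\<^bsub>B\<^esub> x, r \<odot>\<^bsub>N\<^esub> n) \<in> \<Gamma>"
    "\<And>n. (\<zero>\<^bsub>B\<^esub>, n) \<in> \<Gamma> \<Longrightarrow> n = \<zero>\<^bsub>N\<^esub>" for \<Gamma>
    using that unfolding K_def by blast
  have KD: "\<Gamma> \<subseteq> carrier B \<times> carrier N" "\<And>a. a \<in> A \<Longrightarrow> (a, f a) \<in> \<Gamma>"
    "\<And>x n y m. (x, n) \<in> \<Gamma> \<Longrightarrow> (y, m) \<in> \<Gamma> \<Longrightarrow> (x \<oplus>\<^bsub>B\<^esub> y, n \<oplus>\<^bsub>N\<^esub> m) \<in> \<Gamma>"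
    "\<And>r x n. r \<in> carrier R \<Longrightarrow> (x, n) \<in> \<Gamma> \<Longrightarrow> (r \<odot>\<^bsub>B\<^esub> x, r \<odot>\<^bsub>N\<^esub> n) \<in> \<Gamma>"
    "\<And>n. (\<zero>\<^bsub>B\<^esub>, n) \<in> \<Gamma> \<Longrightarrow> n = \<zero>\<^bsub>N\<^esub>" if "K \<Gamma>" for \<Gamma>
  proof -
    note k = that[unfolded K_def]
    show "\<Gamma> \<subseteq> carrier B \<times> carrier N" by (rule k[THEN conjunct1])
    show "a \<in> A \<Longrightarrow> (a, f a) \<in> \<Gamma>" for a by (rule k[THEN conjunct2, THEN conjunct1, rule_format])
    show "(x, n) \<in> \<Gamma> \<Longrightarrow> (y, m) \<in> \<Gamma> \<Longrightarrow> (x \<oplus>\<^bsub>B\<^esub> y, n \<oplus>\<^bsub>N\<^esub> m) \<in> \<Gamma>" for x n y m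
      by (rule k[THEN conjunct2, THEN conjunct2, THEN conjunct1, rule_format])
    show "r \<in> carrier R \<Longrightarrow> (x, n) \<in> \<Gamma> \<Longrightarrow> (r \<odot>\<^bsub>B\<^esub> x, r \<odot>\<^bsub>N\<^esub> n) \<in> \<Gamma>" for r x n
      by (rule k[THEN conjunct2, THEN conjunct2, THEN conjunct2, THEN conjunct1, rule_format])
    show "(\<zero>\<^bsub>B\<^esub>, n) \<in> \<Gamma> \<Longrightarrow> n = \<zero>\<^bsub>N\<^esub>" for n
      by (rule k[THEN conjunct2, THEN conjunct2, THEN conjunct2, THEN conjunct2, rule_format])
  qed
  have "{(a, f a) | a. a \<in> A} \<in> Collect K"
  proof (rule CollectI, rule KI)
    show "n = \<zero>\<^bsub>N\<^esub>" if "(\<zero>\<^bsub>B\<^esub>, n) \<in> {(a, f a) | a. a \<in> A}" for n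
      using that hom_zero_neg(1)[OF f module_submod[OF B A] N] by auto
  qed (use AB fA AD homD(2)[OF f] homD(3)[OF f] in auto)
  then have ne: "Collect K \<noteq> {}" by blast
  have chain: "\<Union>\<C> \<in> Collect K" if c: "\<C> \<noteq> {}" "subset.chain (Collect K) \<C>" for \<C>
  proof (rule CollectI, rule KI)
    have mem: "K \<Gamma>" if "\<Gamma> \<in> \<C>" for \<Gamma> using c(2) that by (auto simp: subset.chain_def)
    show "\<Union>\<C> \<subseteq> carrier B \<times> carrier N" by (rule Union_least[OF KD(1)[OF mem]])
    obtain \<Gamma>0 where "\<Gamma>0 \<in> \<C>" using c(1) by blast
    then show "(a, f a) \<in> \<Union>\<C>" if "a \<in> A" for a using KD(2)[OF mem that] by blast
    show "(x \<oplus>\<^bsub>B\<^esub> y, n \<oplus>\<^bsub>N\<^esub> m) \<in> \<Union>\<C>" if xy: "(x, n) \<in> \<Union>\<C>" "(y, m) \<in> \<Union>\<C>" for x n y m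
    proof -
      obtain \<Gamma> \<Delta> where gd: "\<Gamma> \<in> \<C>" "\<Delta> \<in> \<C>" "(x, n) \<in> \<Gamma>" "(y, m) \<in> \<Delta>" using xy by blast
      have "\<Gamma> \<subseteq> \<Delta> \<or> \<Delta> \<subseteq> \<Gamma>" using c(2) gd(1,2) by (auto simp: subset.chain_def)
      then obtain \<Theta> where "\<Theta> \<in> \<C>" "(x, n) \<in> \<Theta>" "(y, m) \<in> \<Theta>" using gd by blast
      then show ?thesis using KD(3)[OF mem] by blast
    qed
    show "(r \<odot>\<^bsub>B\<^esub> x, r \<odot>\<^bsub>N\<^esub> n) \<in> \<Union>\<C>" if "r \<in> carrier R" "(x, n) \<in> \<Union>\<C>" for r x n
      using that(2) KD(4)[OF mem that(1)] by blast
    show "n = \<zero>\<^bsub>N\<^esub>" if "(\<zero>\<^bsub>B\<^esub>, n) \<in> \<Union>\<C>" for n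
      using that KD(5)[OF mem] by blast
  qed
  obtain \<Gamma> where "\<Gamma> \<in> Collect K" and max: "\<And>\<Delta>. K \<Delta> \<Longrightarrow> \<Gamma> \<subseteq> \<Delta> \<Longrightarrow> \<Delta> = \<Gamma>"
    using subset_Zorn_nonempty[OF ne chain] by blast
  then have K: "K \<Gamma>" by simp
  have c: "x \<in> carrier B" "n \<in> carrier N" if "(x, n) \<in> \<Gamma>" for x n using KD(1)[OF K] that by blast+
  note Af = KD(2)[OF K] and add = KD(3)[OF K] and smul = KD(4)[OF K] and zero = KD(5)[OF K]
  have neg: "(\<ominus>\<^bsub>B\<^esub> x, \<ominus>\<^bsub>N\<^esub> n) \<in> \<Gamma>" if "(x, n) \<in> \<Gamma>" for x n
    using smul[of "\<ominus> \<one>" x n] that c[OF that] B N by (simp add: module_smult(6))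
  have uniq: "n = m" if nm: "(x, n) \<in> \<Gamma>" "(x, m) \<in> \<Gamma>" for x n m
  proof -
    have "(x \<oplus>\<^bsub>B\<^esub> \<ominus>\<^bsub>B\<^esub> x, n \<oplus>\<^bsub>N\<^esub> \<ominus>\<^bsub>N\<^esub> m) \<in> \<Gamma>" by (rule add[OF nm(1) neg[OF nm(2)]])
    then have "n \<oplus>\<^bsub>N\<^esub> \<ominus>\<^bsub>N\<^esub> m = \<zero>\<^bsub>N\<^esub>" using zero c[OF nm(1)] B by simp
    then show ?thesis using module_diff(4)[OF N c(2)[OF nm(1)], of "\<ominus>\<^bsub>N\<^esub> m"] c(2)[OF nm(2)] N
      by simp
  qed
  have z0: "(\<zero>\<^bsub>B\<^esub>, \<zero>\<^bsub>N\<^esub>) \<in> \<Gamma>"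
    using Af[OF AD(2)] zero[OF Af[OF AD(2)]] by simp
  have dom: "\<exists>n. (b, n) \<in> \<Gamma>" if b: "b \<in> carrier B" for b
  proof -
    \<comment> \<open>The ideal of scalars that move \<open>b\<close> into the present domain. The
      values of the graph there form a map from this ideal to \<open>N\<close>, and the Baer
      condition writes it as multiplication by some \<open>n0\<close>.\<close>
    define I where "I = {r \<in> carrier R. \<exists>n. (r \<odot>\<^bsub>B\<^esub> b, n) \<in> \<Gamma>}"
    have I: "submodule I R Rmod"
    proof (rule submoduleI2[OF module_Rmod])
      show "\<zero>\<^bsub>Rmod\<^esub> \<in> I" using z0 b B by (auto simp: I_def)
      show "r \<oplus>\<^bsub>Rmod\<^esub> s \<in> I" if "r \<in> I" "s \<in> I" for r s
        using that b B add[of "r \<odot>\<^bsub>B\<^esub> b" _ "s \<odot>\<^bsub>B\<^esub> b"] unfolding I_def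
          by (simp add: module_smult(2)) blast
      show "r \<odot>\<^bsub>Rmod\<^esub> s \<in> I" if "r \<in> carrier R" "s \<in> I" for r s
        using that b B smul[of r "s \<odot>\<^bsub>B\<^esub> b"] unfolding I_def by (simp add: module_smult(3)) blast
    qed (auto simp: I_def)
    define h where "h r = (SOME n. (r \<odot>\<^bsub>B\<^esub> b, n) \<in> \<Gamma>)" for r
    have h: "(r \<odot>\<^bsub>B\<^esub> b, h r) \<in> \<Gamma>" if "r \<in> I" for r
    proof -
      have "\<exists>n. (r \<odot>\<^bsub>B\<^esub> b, n) \<in> \<Gamma>" using that by (simp add: I_def)
      then show ?thesis unfolding h_def by (rule someI_ex)
    qed
    have IR: "r \<in> carrier R" if "r \<in> I" for r using that by (simp add: I_def)
    note ID = submoduleD[OF module_Rmod I]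
    have "(\<lambda>r\<in>carrier (submod Rmod I). h r) \<in> Hom (submod Rmod I) N"
    proof (rule mod_homI[OF _ _ _ module_submod[OF module_Rmod I]])
      show "h r \<in> carrier N" if "r \<in> carrier (submod Rmod I)" for r using h c(2) that by auto
      show "h (r \<oplus>\<^bsub>submod Rmod I\<^esub> s) = h r \<oplus>\<^bsub>N\<^esub> h s"
        if rs: "r \<in> carrier (submod Rmod I)" "s \<in> carrier (submod Rmod I)" for r s
      proof -
        have rs': "r \<in> I" "s \<in> I" "r \<oplus> s \<in> I" using rs ID(3) by auto
        have "((r \<oplus> s) \<odot>\<^bsub>B\<^esub> b, h r \<oplus>\<^bsub>N\<^esub> h s) \<in> \<Gamma>"
          using add[OF h[OF rs'(1)] h[OF rs'(2)]] IR rs' b B by (simp add: module_smult(2))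
        then show ?thesis using uniq[OF h[OF rs'(3)]] by simp
      qed
      show "h (r \<odot>\<^bsub>submod Rmod I\<^esub> s) = r \<odot>\<^bsub>N\<^esub> h s" if rs: "r \<in> carrier R"
          "s \<in> carrier (submod Rmod I)" for r s
      proof -
        have rs': "s \<in> I" "r \<otimes> s \<in> I" using rs ID(6) by auto
        have "((r \<otimes> s) \<odot>\<^bsub>B\<^esub> b, r \<odot>\<^bsub>N\<^esub> h s) \<in> \<Gamma>"
          using smul[OF rs(1) h[OF rs'(1)]] IR rs(1) rs' b B by (simp add: module_smult(3))
        then show ?thesis using uniq[OF h[OF rs'(2)]] by simp
      qed
    qed
    then obtain n0 where n0: "n0 \<in> carrier N" and "\<And>a. a \<in> I \<Longrightarrow> (\<lambda>r\<in>carrier (submod Rmod I). h r) a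
        = a \<odot>\<^bsub>N\<^esub> n0"
      by (rule baerD[OF baer I]) blast
    then have hn: "h a = a \<odot>\<^bsub>N\<^esub> n0" if "a \<in> I" for a using that by simp
    \<comment> \<open>The graph is enlarged by giving \<open>b\<close> the value \<open>n0\<close>.
      Single-valuedness holds because \<open>n0\<close> agrees with the old values wherever a
      multiple of \<open>b\<close> was already in the domain.\<close>
    define \<Delta> where "\<Delta> = {(x \<oplus>\<^bsub>B\<^esub> r \<odot>\<^bsub>B\<^esub> b, n \<oplus>\<^bsub>N\<^esub> r \<odot>\<^bsub>N\<^esub> n0) | x n r. (x, n) \<in> \<Gamma> \<and> r \<in> carrier R}"
    have \<Delta>I: "(x \<oplus>\<^bsub>B\<^esub> r \<odot>\<^bsub>B\<^esub> b, n \<oplus>\<^bsub>N\<^esub> r \<odot>\<^bsub>N\<^esub> n0) \<in> \<Delta>" if "(x, n) \<in> \<Gamma>" "r \<in> carrier R" for x n r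
      unfolding \<Delta>_def using that by blast
    have \<Gamma>\<Delta>: "\<Gamma> \<subseteq> \<Delta>"
    proof
      fix z assume z: "z \<in> \<Gamma>"
      obtain x n where xn: "z = (x, n)" by (cases z)
      show "z \<in> \<Delta>" using \<Delta>I[of x n \<zero>] z c[of x n] n0 b B N unfolding xn by simp
    qed
    have "K \<Delta>"
    proof (rule KI)
      show "\<Delta> \<subseteq> carrier B \<times> carrier N" using c n0 b B N by (auto simp: \<Delta>_def)
      show "(a, f a) \<in> \<Delta>" if "a \<in> A" for a using \<Gamma>\<Delta> Af[OF that] by blast
    next
      fix z n w m assume "(z, n) \<in> \<Delta>" "(w, m) \<in> \<Delta>"
      then obtain x k r y l s where *: "z = x \<oplus>\<^bsub>B\<^esub> r \<odot>\<^bsub>B\<^esub> b" "n = k \<oplus>\<^bsub>N\<^esub> r \<odot>\<^bsub>N\<^esub> n0" "(x, k) \<in> \<Gamma>"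
          "r \<in> carrier R"
        "w = y \<oplus>\<^bsub>B\<^esub> s \<odot>\<^bsub>B\<^esub> b" "m = l \<oplus>\<^bsub>N\<^esub> s \<odot>\<^bsub>N\<^esub> n0" "(y, l) \<in> \<Gamma>" "s \<in> carrier R"
          by (auto simp: \<Delta>_def)
      have "z \<oplus>\<^bsub>B\<^esub> w = (x \<oplus>\<^bsub>B\<^esub> y) \<oplus>\<^bsub>B\<^esub> (r \<oplus> s) \<odot>\<^bsub>B\<^esub> b" "n \<oplus>\<^bsub>N\<^esub> m = (k \<oplus>\<^bsub>N\<^esub> l) \<oplus>\<^bsub>N\<^esub> (r \<oplus> s) \<odot>\<^bsub>N\<^esub> n0"
        using * c[OF *(3)] c[OF *(7)] n0 b B N by (simp_all add: module_smult(2) module_ac[of B]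
            module_ac[of N])
      then show "(z \<oplus>\<^bsub>B\<^esub> w, n \<oplus>\<^bsub>N\<^esub> m) \<in> \<Delta>" using \<Delta>I[OF add[OF *(3,7)], of "r \<oplus> s"] *(4,8) by simp
    next
      fix t z n assume t: "t \<in> carrier R" and "(z, n) \<in> \<Delta>"
      then obtain x k r where *: "z = x \<oplus>\<^bsub>B\<^esub> r \<odot>\<^bsub>B\<^esub> b" "n = k \<oplus>\<^bsub>N\<^esub> r \<odot>\<^bsub>N\<^esub> n0" "(x, k) \<in> \<Gamma>"
          "r \<in> carrier R"
        by (auto simp: \<Delta>_def)
      have "t \<odot>\<^bsub>B\<^esub> z = t \<odot>\<^bsub>B\<^esub> x \<oplus>\<^bsub>B\<^esub> (t \<otimes> r) \<odot>\<^bsub>B\<^esub> b" "t \<odot>\<^bsub>N\<^esub> n = t \<odot>\<^bsub>N\<^esub> k \<oplus>\<^bsub>N\<^esub> (t \<otimes> r) \<odot>\<^bsub>N\<^esub> n0"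
        using * t c[OF *(3)] n0 b B N by (simp_all add: module_smult(1,3))
      then show "(t \<odot>\<^bsub>B\<^esub> z, t \<odot>\<^bsub>N\<^esub> n) \<in> \<Delta>" using \<Delta>I[OF smul[OF t *(3)], of "t \<otimes> r"] *(4) t by simp
    next
      fix n assume "(\<zero>\<^bsub>B\<^esub>, n) \<in> \<Delta>"
      then obtain x k r where *: "\<zero>\<^bsub>B\<^esub> = x \<oplus>\<^bsub>B\<^esub> r \<odot>\<^bsub>B\<^esub> b" "n = k \<oplus>\<^bsub>N\<^esub> r \<odot>\<^bsub>N\<^esub> n0" "(x, k) \<in> \<Gamma>"
          "r \<in> carrier R"
        by (auto simp: \<Delta>_def)
      have "r \<odot>\<^bsub>B\<^esub> b \<oplus>\<^bsub>B\<^esub> x = \<zero>\<^bsub>B\<^esub>" using *(1,4) c[OF *(3)] b B by (simp add: module_ac(2))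
      then have rb: "r \<odot>\<^bsub>B\<^esub> b = \<ominus>\<^bsub>B\<^esub> x" using module_diff(4)[OF B] *(4) b c[OF *(3)] B by simp
      then have r: "(r \<odot>\<^bsub>B\<^esub> b, \<ominus>\<^bsub>N\<^esub> k) \<in> \<Gamma>" using neg[OF *(3)] by simp
      then have "r \<in> I" using *(4) unfolding I_def by blast
      then have "r \<odot>\<^bsub>N\<^esub> n0 = \<ominus>\<^bsub>N\<^esub> k" using uniq[OF h r] hn by simp
      then show "n = \<zero>\<^bsub>N\<^esub>" using *(2) c[OF *(3)] N by simp
    qed
    then have "\<Delta> = \<Gamma>" by (rule max[OF _ \<Gamma>\<Delta>])
    then show ?thesis using \<Delta>I[OF z0 one_closed] b B by auto
  qed
  define g where "g b = (SOME n. (b, n) \<in> \<Gamma>)" for b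
  have g: "(b, g b) \<in> \<Gamma>" if "b \<in> carrier B" for b unfolding g_def
    by (rule someI_ex[OF dom[OF that]])
  show ?thesis
  proof
    show "(\<lambda>b\<in>carrier B. g b) \<in> Hom B N"
    proof (rule mod_homI[OF _ _ _ B])
      show "g b \<in> carrier N" if "b \<in> carrier B" for b by (rule c(2)[OF g[OF that]])
      show "g (x \<oplus>\<^bsub>B\<^esub> y) = g x \<oplus>\<^bsub>N\<^esub> g y" if "x \<in> carrier B" "y \<in> carrier B" for x y
        by (rule uniq[OF g add[OF g[OF that(1)] g[OF that(2)]]]) (use that B in simp)
      show "g (r \<odot>\<^bsub>B\<^esub> x) = r \<odot>\<^bsub>N\<^esub> g x" if "r \<in> carrier R" "x \<in> carrier B" for r x
        by (rule uniq[OF g smul[OF that(1) g[OF that(2)]]]) (use that B in simp)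
    qed
    show "(\<lambda>b\<in>carrier B. g b) a = f a" if "a \<in> A" for a
      using uniq[OF g[OF AB[OF that]] Af[OF that]] AB[OF that] by simp
  qed
qed

text \<open>As \<open>baer\<close> refers only to ideals of \<open>R\<close>, the injectivity that
  it implies holds against test modules of any type.\<close>

lemma baer_injective:
  fixes N :: "('r, 'n) module"
  assumes N: "module R N" and baer: "baer N"
  shows "injective V R N"
  unfolding injective_def left_module_iff_module[OF is_cring]
proof (intro conjI allI impI)
  fix A B :: "('r, 'v) module" and i f
  assume "module R A \<and> module R B \<and> i \<in> Hom A B \<and> inj_on i (carrier A) \<and> f \<in> Hom A N"
  then have A: "module R A" and B: "module R B" and i: "i \<in> Hom A B" "inj_on i (carrier A)"
      and f: "f \<in> Hom A N" by auto
  define I where "I = i ` carrier A"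
  have I: "submodule I R B" unfolding I_def by (rule image_submodule[OF A B i(1)])
  note mI = module_submod[OF B I]
  have i': "i \<in> Hom A (submod B I)" using i(1) by (auto simp: mod_hom_def I_def)
  have "bij_betw i (carrier A) (carrier (submod B I))" using i(2) by (simp add: bij_betw_def I_def)
  then obtain j where j: "j \<in> Hom (submod B I) A" "\<And>x. x \<in> carrier A \<Longrightarrow> j (i x) = x"
    using hom_inverse[OF A mI i'] by metis
  obtain g where g: "g \<in> Hom B N" "\<And>a. a \<in> I \<Longrightarrow> g a = compose (carrier (submod B I)) f j a"
    by (rule baer_extend[OF B N baer I hom_compose[OF mI j(1) f]]) blast
  show "\<exists>g\<in>Hom B N. \<forall>a\<in>carrier A. g (i a) = f a"
    by (rule bexI[OF _ g(1)]) (use g(2) j(2) in \<open>simp add: compose_eq I_def\<close>)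
qed (rule N)

text \<open>This carries a resolution of a copy in \<open>'u\<close> back to F \<otimes> G itself,
  where it can be compared with the cone.\<close>

lemma resolution_iso:
  fixes G :: "('r, 'g) module" and G' :: "('r, 'h) module" and P :: "nat \<Rightarrow> ('r, 'p) module"
  assumes P: "resolution G P d e" and G': "module R G'"
      and a: "a \<in> Hom G G'" "bij_betw a (carrier G) (carrier G')"
  shows "resolution G' P d (compose (carrier (P 0)) a e)"
proof -
  note PD = resolutionD[OF P]
  have h: "compose (carrier (P 0)) a e \<in> Hom (P 0) G'" by (rule hom_compose[OF PD(3,5) a(1)])
  have "compose (carrier (P 0)) a e ` carrier (P 0) = a ` e ` carrier (P 0)"
    by (auto simp: compose_def)
  then have s: "compose (carrier (P 0)) a e ` carrier (P 0) = carrier G'"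
    using PD(8) a(2) by (simp add: bij_betw_def)
  have z: "a x = \<zero>\<^bsub>G'\<^esub> \<longleftrightarrow> x = \<zero>\<^bsub>G\<^esub>" if x: "x \<in> carrier G" for x
  proof
    assume "a x = \<zero>\<^bsub>G'\<^esub>"
    then have "a x = a \<zero>\<^bsub>G\<^esub>" using hom_zero_neg(1)[OF a(1) PD(1) G'] by simp
    then show "x = \<zero>\<^bsub>G\<^esub>" using a(2) x module_addI(2)[OF PD(1)] unfolding bij_betw_def
      by (meson inj_on_eq_iff)
  qed (use hom_zero_neg(1)[OF a(1) PD(1) G'] in simp)
  have "{x \<in> carrier (P 0). compose (carrier (P 0)) a e x = \<zero>\<^bsub>G'\<^esub>} = {x \<in> carrier (P 0). e x
      = \<zero>\<^bsub>G\<^esub>}"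
    using z[OF homD(1)[OF PD(5)]] hom_zero_neg(1)[OF a(1) PD(1) G'] by (auto simp: compose_eq)
  then have "exact_at (P 1) (d 0) (P 0) (compose (carrier (P 0)) a e) G'"
    using PD(7) by (simp add: exact_at_iff)
  then show ?thesis unfolding resolution_def using PD G' h s by simp
qed

end

text \<open>For projective dimension at most \<open>m\<close> of all flat modules, \<open>Ext\<^sup>m\<^sup>+\<^sup>1(G, N) = 0\<close> for flat \<open>G\<close>, and descent
  in the degree reaches \<open>Hom(R, N) = 0\<close>.\<close>

lemma (in factor_data) N_trivial:
  assumes fin: "\<And>G :: ('r, 'u) module. flatU G \<Longrightarrow> proj_dim TYPE('u) R G \<le> enat m"
  shows "carrier N = {\<zero>\<^bsub>N\<^esub>}"
proof -
  \<comment> \<open>One resolution per flat module is enough here, because vanishing of Ext does not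
    depend on it.\<close>
  define V where "V n \<longleftrightarrow> (\<forall>G :: ('r, 'u) module. flatU G \<longrightarrow>
    (\<exists>(P :: nat \<Rightarrow> ('r, 'u) module) d e. resolution G P d e \<and> Ext_vanish P d N n))" for n
  have "V (Suc m)"
    unfolding V_def
  proof (intro allI impI)
    fix G :: "('r, 'u) module" assume G: "flatU G"
    obtain P :: "nat \<Rightarrow> ('r, 'u) module" and d e where P: "resolution G P d e"
        and z: "\<And>k. k > m \<Longrightarrow> carrier (P k) = {\<zero>\<^bsub>P k\<^esub>}"
      using finite_proj_dim[OF flat_module[OF G] fin[OF G]] by metis
    note PD = resolutionD[OF P]
    \<comment> \<open>The terms of \<open>P\<close> beyond degree \<open>m\<close> are zero, so
      every cochain of degree \<open>Suc m\<close> is zero.\<close>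
    have "Ext_vanish P d N (Suc m)"
    proof (rule Ext_vanish_SucI)
      show "module R (P (Suc m))" "d m \<in> Hom (P (Suc m)) (P m)" by (rule PD(3), rule PD(4))
      fix w assume w: "w \<in> Hom (P (Suc m)) N"
      have "w \<zero>\<^bsub>P (Suc m)\<^esub> = \<zero>\<^bsub>N\<^esub>" "d m \<zero>\<^bsub>P (Suc m)\<^esub> = \<zero>\<^bsub>P m\<^esub>"
        by (rule hom_zero_neg(1)[OF w PD(3) N], rule hom_zero_neg(1)[OF PD(4) PD(3) PD(3)])
      then have "\<forall>x\<in>carrier (P (Suc m)). w x = (\<lambda>x\<in>carrier (P m). \<zero>\<^bsub>N\<^esub>) (d m x)"
        using z[of "Suc m"] module_addI(2)[OF PD(3)[of m]] by simp
      then show "\<exists>v\<in>Hom (P m) N. \<forall>x\<in>carrier (P (Suc m)). w x = v (d m x)"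
        using hom_zero[OF PD(3) N] by blast
    qed
    then show "\<exists>(P :: nat \<Rightarrow> ('r, 'u) module) d e. resolution G P d e \<and> Ext_vanish P d N (Suc m)"
      using P by blast
  qed
  moreover have "V n" if V: "V (Suc n)" for n
    unfolding V_def
  proof (intro allI impI)
    fix G :: "('r, 'u) module" assume G: "flatU G"
    have mG: "module R G" by (rule flat_module[OF G])
    obtain P :: "nat \<Rightarrow> ('r, 'u) module" and d e where P: "resolution G P d e"
      using finite_proj_dim[OF flat_module[OF G] fin[OF G]] by metis
    have mFG: "module R (tens F G)" by (rule module_tens[OF mF mG])
    obtain G' :: "('r, 'u) module" and a where G': "module R G'" "a \<in> Hom (tens F G) G'"
        "bij_betw a (carrier (tens F G)) (carrier G')"
      using transfer_module[OF mFG small_tens[OF mF mG F_small small_U]] by metis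
    obtain b where b: "b \<in> Hom G' (tens F G)" "\<And>y. y \<in> carrier G' \<Longrightarrow> a (b y) = y"
        "bij_betw b (carrier G') (carrier (tens F G))"
      using hom_inverse[OF mFG G'] by metis
    have "flatU G'" by (rule flat_iso[OF flat_tens[OF F G small_U] G'(1,2) b(1,2)])
    then obtain P2 :: "nat \<Rightarrow> ('r, 'u) module" and d2 e2 where P2: "resolution G' P2 d2 e2"
        "Ext_vanish P2 d2 N (Suc n)"
      using V unfolding V_def by blast
    \<comment> \<open>\<open>P2\<close> resolves the copy \<open>G'\<close>; augmented through
      \<open>b\<close> it resolves F \<otimes> G, just as the cone does, so vanishing passes from
      the one to the other.\<close>
    have "Ext_vanish (T P) (D P d) N (Suc n)"
      by (rule Ext_vanish_independent[OF resolution_iso[OF P2(1) mFG b(1,3)] resolution_T[OF G P]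
          N P2(2)])
    then have "Ext_vanish P d N n" by (rule Ext_vanish_descend[OF G P])
    then show "\<exists>(P :: nat \<Rightarrow> ('r, 'u) module) d e. resolution G P d e \<and> Ext_vanish P d N n" using P
      by blast
  qed
  ultimately have "V 0" by (intro inc_induct[OF le0[of "Suc m"], of V]) blast+
  have "carrier Rmod \<lesssim> (UNIV :: 'u set)" using R_small by simp
  then obtain R' :: "('r, 'u) module" and a where R': "module R R'" "a \<in> Hom Rmod R'"
      "bij_betw a (carrier Rmod) (carrier R')"
    using transfer_module[OF module_Rmod] by metis
  obtain b where b: "b \<in> Hom R' Rmod" "\<And>x. x \<in> carrier Rmod \<Longrightarrow> b (a x) = x"
    using hom_inverse[OF module_Rmod R'] by metis
  have "flatU R'" by (rule proj_flat[OF proj_iso[OF proj_Rmod R']])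
  then obtain P :: "nat \<Rightarrow> ('r, 'u) module" and d e where P: "resolution R' P d e"
      "Ext_vanish P d N 0"
    using \<open>V 0\<close> unfolding V_def by blast
  note PD = resolutionD[OF P(1)]
  have "n = \<zero>\<^bsub>N\<^esub>" if n: "n \<in> carrier N" for n
  proof -
    \<comment> \<open>An element \<open>n\<close> is a map from \<open>R\<close> to
      \<open>N\<close>. Composed with the augmentation of the resolution of the copy of
      \<open>R\<close>, it becomes a cocycle of degree 0, which has to vanish.\<close>
    have c: "(\<lambda>r\<in>carrier Rmod. r \<odot>\<^bsub>N\<^esub> n) \<in> Hom Rmod N"
      by (rule mod_homI) (use n N in \<open>simp_all add: module_smult(2,3)\<close>)
    define z where "z = compose (carrier (P 0)) (\<lambda>r\<in>carrier Rmod. r \<odot>\<^bsub>N\<^esub> n)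
        (compose (carrier (P 0)) b e)"
    have z: "z \<in> Hom (P 0) N" unfolding z_def
      by (rule hom_compose[OF PD(3) hom_compose[OF PD(3) PD(5) b(1)] c])
    have zx: "z x = b (e x) \<odot>\<^bsub>N\<^esub> n" if "x \<in> carrier (P 0)" for x
      using that homD(1)[OF b(1) homD(1)[OF PD(5) that]] by (simp add: z_def compose_eq)
    have "z (d 0 x) = \<zero>\<^bsub>N\<^esub>" if "x \<in> carrier (P (Suc 0))" for x
      using zx[OF homD(1)[OF PD(4) that]] exact_atD(1)[OF PD(7) that] hom_zero_neg(1)[OF b(1)
          PD(1) module_Rmod] n N by simp
    then have z0: "\<forall>x\<in>carrier (P 0). z x = \<zero>\<^bsub>N\<^esub>" using P(2) z unfolding Ext_vanish_0_iff by blast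
    have "a \<one> \<in> carrier R'" using homD(1)[OF R'(2), of \<one>] by simp
    then have "a \<one> \<in> e ` carrier (P 0)" using PD(8) by simp
    then obtain x where x: "x \<in> carrier (P 0)" "a \<one> = e x" by blast
    then have "z x = n" using zx[OF x(1)] b(2)[of \<one>] n N by (simp add: x(2)[symmetric])
    then show ?thesis using z0 x(1) by simp
  qed
  then show ?thesis using module_addI(2)[OF N] by blast
qed

section \<open>Faithfully flat algebras\<close>

lemma mod_hom_compose:
  assumes "left_module S A" "f \<in> mod_hom S A B" "g \<in> mod_hom S B C"
  shows "compose (carrier A) g f \<in> mod_hom S A C"
proof -
  interpret A: left_module S A by fact
  show ?thesis using assms(2,3) A.smult_closed A.a_closed
    by (auto simp: mod_hom_def compose_def PiE_def Pi_def)
qed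

lemma mod_hom_inverse:
  fixes A :: "('s, 'a) module" and B :: "('s, 'b) module"
  assumes "left_module S A" "left_module S B" "f \<in> mod_hom S A B"
      "bij_betw f (carrier A) (carrier B)"
  obtains g where "g \<in> mod_hom S B A" "\<And>x. x \<in> carrier A \<Longrightarrow> g (f x) = x" "\<And>y. y \<in> carrier B \<Longrightarrow>
      f (g y) = y"
proof -
  interpret A: left_module S A by fact
  interpret B: left_module S B by fact
  define k where "k = inv_into (carrier A) f"
  have kf: "k (f x) = x" if "x \<in> carrier A" for x
    using that assms(4) by (simp add: k_def bij_betw_inv_into_left)
  have fk: "f (k y) = y" if "y \<in> carrier B" for y
    using that assms(4) by (simp add: k_def bij_betw_inv_into_right)
  have kA: "k y \<in> carrier A" if "y \<in> carrier B" for y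
    using that assms(4) unfolding k_def bij_betw_def by (metis inv_into_into)
  have fB: "f x \<in> carrier B" if "x \<in> carrier A" for x using that assms(3)
    by (auto simp: mod_hom_def)
  have add: "k (x \<oplus>\<^bsub>B\<^esub> y) = k x \<oplus>\<^bsub>A\<^esub> k y" if xy: "x \<in> carrier B" "y \<in> carrier B" for x y
  proof -
    have "f (k x \<oplus>\<^bsub>A\<^esub> k y) = x \<oplus>\<^bsub>B\<^esub> y" using assms(3) kA xy fk by (simp add: mod_hom_def)
    then show ?thesis using kf[of "k x \<oplus>\<^bsub>A\<^esub> k y"] kA xy by simp
  qed
  have smult: "k (r \<odot>\<^bsub>B\<^esub> y) = r \<odot>\<^bsub>A\<^esub> k y" if ry: "r \<in> carrier S" "y \<in> carrier B" for r y
  proof -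
    have "f (r \<odot>\<^bsub>A\<^esub> k y) = r \<odot>\<^bsub>B\<^esub> y" using assms(3) kA ry fk by (simp add: mod_hom_def)
    then show ?thesis using kf[of "r \<odot>\<^bsub>A\<^esub> k y"] kA ry A.smult_closed by simp
  qed
  have "(\<lambda>y\<in>carrier B. k y) \<in> mod_hom S B A"
    using kA add smult B.smult_closed by (auto simp: mod_hom_def)
  then show ?thesis by (rule that) (use kf fk fB in simp_all)
qed

text \<open>The counterpart of \<open>flat_exact\<close> for injectivity over the possibly
  noncommutative \<open>S\<close>: test modules of other types are replaced by copies in
  \<open>'u\<close>.\<close>

lemma injective_lepoll:
  fixes A :: "('s, 'a) module" and B :: "('s, 'b) module" and E :: "('s, 'e) module"
      and S :: "('s, 'z) ring_scheme"
  assumes E: "injective TYPE('u) S E" and A: "left_module S A" "carrier A \<lesssim> (UNIV :: 'u set)"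
    and B: "left_module S B" "carrier B \<lesssim> (UNIV :: 'u set)"
    and i: "i \<in> mod_hom S A B" "inj_on i (carrier A)" and f: "f \<in> mod_hom S A E"
  obtains g where "g \<in> mod_hom S B E" "\<And>a. a \<in> carrier A \<Longrightarrow> g (i a) = f a"
proof -
  obtain A' :: "('s, 'u) module" and a where A': "left_module S A'" "a \<in> mod_hom S A A'"
      "bij_betw a (carrier A) (carrier A')"
    by (rule transfer_left_module[OF A])
  obtain a' where a': "a' \<in> mod_hom S A' A" "\<And>x. x \<in> carrier A \<Longrightarrow> a' (a x) = x"
      "\<And>y. y \<in> carrier A' \<Longrightarrow> a (a' y) = y"
    by (rule mod_hom_inverse[OF A(1) A']) blast
  obtain B' :: "('s, 'u) module" and b where B': "left_module S B'" "b \<in> mod_hom S B B'"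
      "bij_betw b (carrier B) (carrier B')"
    by (rule transfer_left_module[OF B])
  have a'c: "a' x \<in> carrier A" if "x \<in> carrier A'" for x using a'(1) that
    by (auto simp: mod_hom_def)
  have ac: "a x \<in> carrier A'" if "x \<in> carrier A" for x using A'(2) that by (auto simp: mod_hom_def)
  have ic: "i x \<in> carrier B" if "x \<in> carrier A" for x using i(1) that by (auto simp: mod_hom_def)
  let ?i = "compose (carrier A') b (compose (carrier A') i a')" and ?f = "compose (carrier A') f a'"
  have i': "?i \<in> mod_hom S A' B'"
    by (rule mod_hom_compose[OF A'(1) mod_hom_compose[OF A'(1) a'(1) i(1)] B'(2)])
  have "inj_on ?i (carrier A')"
  proof (rule inj_onI)
    fix x y assume xy: "x \<in> carrier A'" "y \<in> carrier A'" "?i x = ?i y"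
    then have "b (i (a' x)) = b (i (a' y))" by (simp add: compose_eq)
    then have "i (a' x) = i (a' y)" using B'(3) ic a'c xy unfolding bij_betw_def
      by (meson inj_on_eq_iff)
    then have "a' x = a' y" using i(2) a'c xy by (meson inj_on_eq_iff)
    then show "x = y" using a'(3) xy by metis
  qed
  then obtain g where g: "g \<in> mod_hom S B' E" "\<forall>x\<in>carrier A'. g (?i x) = ?f x"
    using E A'(1) B'(1) i' mod_hom_compose[OF A'(1) a'(1) f] unfolding injective_def by blast
  show ?thesis
  proof
    show "compose (carrier B) g b \<in> mod_hom S B E" by (rule mod_hom_compose[OF B(1) B'(2) g(1)])
    show "compose (carrier B) g b (i x) = f x" if x: "x \<in> carrier A" for x
      using bspec[OF g(2) ac[OF x]] ac[OF x] a'(2)[OF x] ic[OF x] by (simp add: compose_eq)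
  qed
qed

text \<open>The hypotheses on \<open>S\<close> and \<open>M\<close>, read off on one resolution of
  length one. Since \<open>Q 2\<close> is zero, every map from \<open>Q 1\<close> to
  \<open>M\<close> is a cocycle, and \<open>ext\<close> says that it is a coboundary.\<close>

locale descent = small_ring R U
  for R :: "('r, 'z) ring_scheme" (structure) and U :: "'u itself" +
  fixes S :: "('r, 's) module" and M :: "('r, 'm) module"
    and Q :: "nat \<Rightarrow> ('r, 'u) module" and dQ :: "nat \<Rightarrow> 'u \<Rightarrow> 'u" and \<epsilon> :: "'u \<Rightarrow> 's"
  assumes alg: "assoc_algebra R S" and S_small: "carrier S \<lesssim> (UNIV :: 'u set)"
    and ff: "faithfully_flat TYPE('u) R S"
    and M: "module R M" and Q: "resolution S Q dQ \<epsilon>"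
        and Q2: "carrier (Q (Suc (Suc 0))) = {\<zero>\<^bsub>Q (Suc (Suc 0))\<^esub>}"
    and ext: "\<And>y. y \<in> Hom (Q (Suc 0)) M \<Longrightarrow> \<exists>x\<in>Hom (Q 0) M. \<forall>k\<in>carrier (Q (Suc 0)). y k = x (dQ 0 k)"
    and E_inj: "injective TYPE('u) S (coinduced R S M)"
begin

lemma mS: "module R S"
  using alg by (rule assoc_algebra.axioms)

lemma S_ring: "ring S"
  using alg by (rule assoc_algebra.axioms)

lemma S_simps:
  "\<one>\<^bsub>S\<^esub> \<in> carrier S" "x \<in> carrier S \<Longrightarrow> y \<in> carrier S \<Longrightarrow> x \<otimes>\<^bsub>S\<^esub> y \<in> carrier S"
  "x \<in> carrier S \<Longrightarrow> \<one>\<^bsub>S\<^esub> \<otimes>\<^bsub>S\<^esub> x = x" "x \<in> carrier S \<Longrightarrow> x \<otimes>\<^bsub>S\<^esub> \<one>\<^bsub>S\<^esub> = x"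
  "x \<in> carrier S \<Longrightarrow> y \<in> carrier S \<Longrightarrow> z \<in> carrier S \<Longrightarrow> (x \<oplus>\<^bsub>S\<^esub> y) \<otimes>\<^bsub>S\<^esub> z = x \<otimes>\<^bsub>S\<^esub> z \<oplus>\<^bsub>S\<^esub> y \<otimes>\<^bsub>S\<^esub> z"
  "x \<in> carrier S \<Longrightarrow> y \<in> carrier S \<Longrightarrow> z \<in> carrier S \<Longrightarrow> z \<otimes>\<^bsub>S\<^esub> (x \<oplus>\<^bsub>S\<^esub> y) = z \<otimes>\<^bsub>S\<^esub> x \<oplus>\<^bsub>S\<^esub> z \<otimes>\<^bsub>S\<^esub> y"
  "x \<in> carrier S \<Longrightarrow> y \<in> carrier S \<Longrightarrow> z \<in> carrier S \<Longrightarrow> x \<otimes>\<^bsub>S\<^esub> y \<otimes>\<^bsub>S\<^esub> z = x \<otimes>\<^bsub>S\<^esub> (y \<otimes>\<^bsub>S\<^esub> z)"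
  "a \<in> carrier R \<Longrightarrow> x \<in> carrier S \<Longrightarrow> y \<in> carrier S \<Longrightarrow> (a \<odot>\<^bsub>S\<^esub> x) \<otimes>\<^bsub>S\<^esub> y = a \<odot>\<^bsub>S\<^esub> (x \<otimes>\<^bsub>S\<^esub> y)"
  "a \<in> carrier R \<Longrightarrow> x \<in> carrier S \<Longrightarrow> y \<in> carrier S \<Longrightarrow> x \<otimes>\<^bsub>S\<^esub> (a \<odot>\<^bsub>S\<^esub> y) = a \<odot>\<^bsub>S\<^esub> (x \<otimes>\<^bsub>S\<^esub> y)"
proof -
  interpret S: ring S by (rule S_ring)
  interpret al: assoc_algebra R S by (rule alg)
  show "\<one>\<^bsub>S\<^esub> \<in> carrier S" "x \<in> carrier S \<Longrightarrow> y \<in> carrier S \<Longrightarrow> x \<otimes>\<^bsub>S\<^esub> y \<in> carrier S"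
    "x \<in> carrier S \<Longrightarrow> \<one>\<^bsub>S\<^esub> \<otimes>\<^bsub>S\<^esub> x = x" "x \<in> carrier S \<Longrightarrow> x \<otimes>\<^bsub>S\<^esub> \<one>\<^bsub>S\<^esub> = x" by simp_all
  show "x \<in> carrier S \<Longrightarrow> y \<in> carrier S \<Longrightarrow> z \<in> carrier S \<Longrightarrow> (x \<oplus>\<^bsub>S\<^esub> y) \<otimes>\<^bsub>S\<^esub> z = x \<otimes>\<^bsub>S\<^esub> z \<oplus>\<^bsub>S\<^esub> y \<otimes>\<^bsub>S\<^esub> z"
    "x \<in> carrier S \<Longrightarrow> y \<in> carrier S \<Longrightarrow> z \<in> carrier S \<Longrightarrow> z \<otimes>\<^bsub>S\<^esub> (x \<oplus>\<^bsub>S\<^esub> y) = z \<otimes>\<^bsub>S\<^esub> x \<oplus>\<^bsub>S\<^esub> z \<otimes>\<^bsub>S\<^esub> y"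
    "x \<in> carrier S \<Longrightarrow> y \<in> carrier S \<Longrightarrow> z \<in> carrier S \<Longrightarrow> x \<otimes>\<^bsub>S\<^esub> y \<otimes>\<^bsub>S\<^esub> z = x \<otimes>\<^bsub>S\<^esub> (y \<otimes>\<^bsub>S\<^esub> z)"
    by (rule S.l_distr S.r_distr S.m_assoc; assumption)+
  show "a \<in> carrier R \<Longrightarrow> x \<in> carrier S \<Longrightarrow> y \<in> carrier S \<Longrightarrow> (a \<odot>\<^bsub>S\<^esub> x) \<otimes>\<^bsub>S\<^esub> y = a \<odot>\<^bsub>S\<^esub> (x \<otimes>\<^bsub>S\<^esub> y)"
    "a \<in> carrier R \<Longrightarrow> x \<in> carrier S \<Longrightarrow> y \<in> carrier S \<Longrightarrow> x \<otimes>\<^bsub>S\<^esub> (a \<odot>\<^bsub>S\<^esub> y) = a \<odot>\<^bsub>S\<^esub> (x \<otimes>\<^bsub>S\<^esub> y)"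
    by (rule al.smult_mult_left al.smult_mult_right; assumption)+
qed

section \<open>Faithful flatness and purity\<close>

lemma S_flat: "flatU S"
  using ff unfolding faithfully_flat_def flat_def by blast

text \<open>Faithful flatness reflects exactness: 0 -> N -> 0 is exact after tensoring with
  \<open>S\<close>, hence was exact before.\<close>

lemma tens_S_trivial:
  fixes N :: "('r, 'n) module"
  assumes N: "module R N" and s: "carrier N \<lesssim> (UNIV :: 'u set)"
    and triv: "\<And>t. t \<in> carrier (tens S N) \<Longrightarrow> t = \<zero>\<^bsub>tens S N\<^esub>" and x: "x \<in> carrier N"
  shows "x = \<zero>\<^bsub>N\<^esub>"
proof -
  obtain N' :: "('r, 'u) module" and \<phi> \<psi> where N': "module R N'" "\<phi> \<in> Hom N N'" "\<psi> \<in> Hom N' N"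
    "\<And>x. x \<in> carrier N \<Longrightarrow> \<psi> (\<phi> x) = x" "\<And>y. y \<in> carrier N' \<Longrightarrow> \<phi> (\<psi> y) = y"
    by (rule small_transfer[OF N s]) blast
  have triv': "t = \<zero>\<^bsub>tens S N'\<^esub>" if t: "t \<in> carrier (tens S N')" for t
  proof -
    note a = tens_r(1)[OF mS N'(1) N N'(3)] and b = tens_r(1)[OF mS N N'(1,2)]
    have "t = tens_r S N N' \<phi> (tens_r S N' N \<psi> t)"
      using tens_r_tens_r[OF mS N'(1) N N'(1) N'(3,2) hom_id[OF N'(1)] _ t] N'(5) tens_r_id[OF mS
          N'(1) t hom_id[OF N'(1)]] by simp
    also have "\<dots> = tens_r S N N' \<phi> \<zero>\<^bsub>tens S N\<^esub>" using triv[OF homD(1)[OF a t]] by simp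
    also have "\<dots> = \<zero>\<^bsub>tens S N'\<^esub>"
      by (rule hom_zero_neg(1)[OF b module_tens[OF mS N] module_tens[OF mS N'(1)]])
    finally show ?thesis .
  qed
  let ?O = "Zmod :: ('r, 'u) module"
  let ?f = "\<lambda>x\<in>carrier ?O. \<zero>\<^bsub>N'\<^esub>" and ?g = "\<lambda>x\<in>carrier N'. \<zero>\<^bsub>?O\<^esub>"
  have f: "?f \<in> Hom ?O N'" by (rule hom_zero[OF module_Zmod N'(1)])
  have g: "?g \<in> Hom N' ?O" by (rule hom_zero[OF N'(1) module_Zmod])
  have "exact_at (tens S ?O) (tens_r S ?O N' ?f) (tens S N') (tens_r S N' ?O ?g) (tens S ?O)"
  proof (rule exact_atI)
    fix t assume t: "t \<in> carrier (tens S ?O)"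
    show "tens_r S ?O N' ?f t \<in> carrier (tens S N')"
      by (rule homD(1)[OF tens_r(1)[OF mS module_Zmod N'(1) f] t])
    then show "tens_r S N' ?O ?g (tens_r S ?O N' ?f t) = \<zero>\<^bsub>tens S ?O\<^esub>"
      by (intro tens_map_zero[OF mS N'(1) mS module_Zmod hom_id[OF mS] g]) simp_all
  next
    fix t assume "t \<in> carrier (tens S N')"
    then have "t = tens_r S ?O N' ?f \<zero>\<^bsub>tens S ?O\<^esub>"
      using triv' hom_zero_neg(1)[OF tens_r(1)[OF mS module_Zmod N'(1) f] module_tens[OF mS
          module_Zmod] module_tens[OF mS N'(1)]] by simp
    then show "t \<in> tens_r S ?O N' ?f ` carrier (tens S ?O)"
      using module_addI(2)[OF module_tens[OF mS module_Zmod]] by (rule image_eqI)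
  qed
  then have "exact_at ?O ?f N' ?g ?O"
    using ff module_Zmod N'(1) f g
    unfolding faithfully_flat_def tensor_map_eq[OF mS module_Zmod N'(1) f, symmetric]
        tensor_map_eq[OF mS N'(1) module_Zmod g, symmetric]
    by blast
  moreover have "\<phi> x \<in> carrier N'" by (rule homD(1)[OF N'(2) x])
  ultimately have "\<phi> x = \<zero>\<^bsub>N'\<^esub>" using exact_atD(3)[of ?O ?f N' ?g ?O "\<phi> x"] by auto
  then have "x = \<psi> \<zero>\<^bsub>N'\<^esub>" using N'(4)[OF x] by simp
  then show ?thesis using hom_zero_neg(1)[OF N'(3,1) N] by simp
qed

text \<open>The map N -> S \<otimes> N is injective. Left multiplication on \<open>S\<close> turns
  the vanishing of 1 \<otimes> x into that of a \<otimes> x for all \<open>a\<close>, so S \<otimes>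
  Rx has zero image in S \<otimes> N. It is zero by flatness, and then Rx is zero by
  faithfulness.\<close>

lemma pure:
  fixes N :: "('r, 'n) module"
  assumes N: "module R N" and s: "carrier N \<lesssim> (UNIV :: 'u set)" and x: "x \<in> carrier N"
    and z: "te S N \<one>\<^bsub>S\<^esub> x = \<zero>\<^bsub>tens S N\<^esub>"
  shows "x = \<zero>\<^bsub>N\<^esub>"
proof -
  have mT: "module R (tens S N)" by (rule module_tens[OF mS N])
  note tb = bilinD[OF te_bilin[OF mS N]]
  have zx: "te S N a x = \<zero>\<^bsub>tens S N\<^esub>" if a: "a \<in> carrier S" for a
  proof -
    have b: "bilin S N (tens S N) (\<lambda>s' n. te S N (a \<otimes>\<^bsub>S\<^esub> s') n)"
      by (rule bilinI) (use a mS N S_simps(2,6,9) in \<open>simp_all add: tb(2,3,4,5)\<close>)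
    note h = tens_lin[OF mS N mT b]
    have "te S N a x = tens_lin S N (tens S N) (\<lambda>s' n. te S N (a \<otimes>\<^bsub>S\<^esub> s') n) (te S N \<one>\<^bsub>S\<^esub> x)"
      using h(2)[OF S_simps(1) x] S_simps(4)[OF a] by simp
    then show ?thesis using z hom_zero_neg(1)[OF h(1) mT mT] by simp
  qed
  define N1 where "N1 = (\<lambda>r\<in>carrier Rmod. r \<odot>\<^bsub>N\<^esub> x) ` carrier Rmod"
  have c: "(\<lambda>r\<in>carrier Rmod. r \<odot>\<^bsub>N\<^esub> x) \<in> Hom Rmod N"
    by (rule mod_homI) (use x N in \<open>simp_all add: module_smult(2,3)\<close>)
  have N1: "submodule N1 R N" unfolding N1_def by (rule image_submodule[OF module_Rmod N c])
  have N1E: "\<exists>r\<in>carrier R. y = r \<odot>\<^bsub>N\<^esub> x" if "y \<in> N1" for y using that unfolding N1_def by auto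
  note N1N = submoduleD(1)[OF N N1]
  have mN1: "module R (submod N N1)" by (rule module_submod[OF N N1])
  have inc: "(\<lambda>y\<in>N1. y) \<in> Hom (submod N N1) N" by (rule submod_incl[OF N N1])
  have sN1: "carrier (submod N N1) \<lesssim> (UNIV :: 'u set)"
    using subset_imp_lepoll[OF N1N] s by (simp add: lepoll_trans)
  note i = tens_r[OF mS mN1 N inc]
  have "t = \<zero>\<^bsub>tens S (submod N N1)\<^esub>" if t: "t \<in> carrier (tens S (submod N N1))" for t
  proof (rule flat_kernel[OF S_flat mN1 N sN1 s inc _ t])
    show "tens_r S (submod N N1) N (\<lambda>y\<in>N1. y) t = \<zero>\<^bsub>tens S N\<^esub>"
    proof (rule tens_induct[OF mS mN1 t])
      fix a y assume a: "a \<in> carrier S" and y: "y \<in> carrier (submod N N1)"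
      then obtain r where r: "r \<in> carrier R" "y = r \<odot>\<^bsub>N\<^esub> x" using N1E by auto
      have "tens_r S (submod N N1) N (\<lambda>y\<in>N1. y) (te S (submod N N1) a y) = te S N a (r \<odot>\<^bsub>N\<^esub> x)"
        using i(2)[OF a y] y r(2) by simp
      also have "\<dots> = \<zero>\<^bsub>tens S N\<^esub>" using tb(5)[OF r(1) a x] zx[OF a] r(1) mT by simp
      finally show "tens_r S (submod N N1) N (\<lambda>y\<in>N1. y) (te S (submod N N1) a y) = \<zero>\<^bsub>tens S N\<^esub>" .
    next
      fix t u assume tu: "t \<in> carrier (tens S (submod N N1))" "u \<in> carrier (tens S (submod N N1))"
        "tens_r S (submod N N1) N (\<lambda>y\<in>N1. y) t = \<zero>\<^bsub>tens S N\<^esub>" "tens_r S (submod N N1) N (\<lambda>y\<in>N1. y)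
            u = \<zero>\<^bsub>tens S N\<^esub>"
      show "tens_r S (submod N N1) N (\<lambda>y\<in>N1. y) (t \<oplus>\<^bsub>tens S (submod N N1)\<^esub> u) = \<zero>\<^bsub>tens S N\<^esub>"
        unfolding homD(2)[OF i(1) tu(1,2)] tu(3,4) using mT by simp
    qed
  qed simp
  moreover have "x \<in> carrier (submod N N1)"
    unfolding N1_def using x N by (simp add: image_iff) (rule bexI[of _ \<one>], simp_all)
  ultimately have "x = \<zero>\<^bsub>submod N N1\<^esub>" by (rule tens_S_trivial[OF mN1 sN1])
  then show ?thesis by simp
qed

section \<open>The quotient F = S / R and its flatness\<close>

definition \<rho> :: "'r \<Rightarrow> 's"
  where "\<rho> = (\<lambda>r\<in>carrier Rmod. r \<odot>\<^bsub>S\<^esub> \<one>\<^bsub>S\<^esub>)"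

lemma \<rho>: "\<rho> \<in> Hom Rmod S"
  unfolding \<rho>_def by (rule mod_homI) (use S_simps(1) mS in \<open>simp_all add: module_smult(2,3)\<close>)

lemma \<rho>_eq: "r \<in> carrier R \<Longrightarrow> \<rho> r = r \<odot>\<^bsub>S\<^esub> \<one>\<^bsub>S\<^esub>"
  by (simp add: \<rho>_def)

text \<open>Purity for the module \<open>R\<close> itself: the scalar moves across the tensor sign
  from the unit of \<open>S\<close> to that of \<open>R\<close>.\<close>

lemma smult_one_inj:
  assumes "r \<in> carrier R" "r' \<in> carrier R" "r \<odot>\<^bsub>S\<^esub> \<one>\<^bsub>S\<^esub> = r' \<odot>\<^bsub>S\<^esub> \<one>\<^bsub>S\<^esub>"
  shows "r = r'"
proof -
  note tb = bilinD[OF te_bilin[OF mS module_Rmod]]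
  have d: "r \<ominus>\<^bsub>Rmod\<^esub> r' \<in> carrier Rmod" using assms module_addI(4)[OF module_Rmod] by simp
  then have dR: "r \<ominus>\<^bsub>Rmod\<^esub> r' \<in> carrier R" by simp
  have "\<rho> (r \<ominus>\<^bsub>Rmod\<^esub> r') = \<zero>\<^bsub>S\<^esub>"
    using hom_zero_neg(3)[OF \<rho> module_Rmod mS, of r r'] assms S_simps(1) mS by (simp add: \<rho>_eq)
  then have "te S Rmod ((r \<ominus>\<^bsub>Rmod\<^esub> r') \<odot>\<^bsub>S\<^esub> \<one>\<^bsub>S\<^esub>) \<one> = \<zero>\<^bsub>tens S Rmod\<^esub>"
    using te_zero(1)[OF mS module_Rmod, of \<one>] \<rho>_eq[OF dR] by simp
  then have "te S Rmod \<one>\<^bsub>S\<^esub> ((r \<ominus>\<^bsub>Rmod\<^esub> r') \<odot>\<^bsub>Rmod\<^esub> \<one>) = \<zero>\<^bsub>tens S Rmod\<^esub>"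
    using tb(4)[OF dR S_simps(1), of \<one>] tb(5)[OF dR S_simps(1), of \<one>] by (simp del: Rmod_simps(4))
  then have "r \<ominus>\<^bsub>Rmod\<^esub> r' = \<zero>\<^bsub>Rmod\<^esub>"
    using pure[OF module_Rmod _ d] R_small dR by simp
  then show ?thesis using module_diff(3)[OF module_Rmod, of r r'] assms by simp
qed

definition F :: "('r, 's set) module"
  where "F = quotient_module S (\<rho> ` carrier Rmod)"

definition \<kappa> :: "'s \<Rightarrow> 's set"
  where "\<kappa> = quot_map S (\<rho> ` carrier Rmod)"

lemmas F_props = quotient_module[OF mS image_submodule[OF module_Rmod mS \<rho>], folded F_def \<kappa>_def]

lemma F_lepoll: "carrier F \<lesssim> (UNIV :: 'u set)"
  by (rule lepoll_UNIV_trans[OF F_props(3) S_small])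

text \<open>A diagram chase in place of Tor. A lift \<open>y\<close> of \<open>t\<close> to S
  \<otimes> Y is sent by \<open>g\<close> into the image of R \<otimes> Z, that is, to some 1
  \<otimes> w. Purity shows \<open>w = g b\<close>. Subtracting 1 \<otimes> b, which dies in F
  \<otimes> Y, turns \<open>y\<close> into a cycle, and flatness of \<open>S\<close>
  finishes.\<close>

lemma F_flat: "flatU F"
proof (rule flatI[OF F_props(1)])
  fix X Y Z :: "('r, 'u) module" and f g t
  assume X: "module R X" and Y: "module R Y" and Z: "module R Z" and f: "f \<in> Hom X Y"
      and g: "g \<in> Hom Y Z"
    and e: "exact_at X f Y g Z" and t: "t \<in> carrier (tens F Y)"
        and z: "tens_r F Y Z g t = \<zero>\<^bsub>tens F Z\<^esub>"
  note mF = F_props(1) and \<kappa> = F_props(2)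
  have "tens_l S F Y \<kappa> ` carrier (tens S Y) = carrier (tens F Y)"
    by (rule tens_map_surj[OF mS Y mF Y \<kappa> hom_id[OF Y] F_props(3)]) simp
  then have "t \<in> tens_l S F Y \<kappa> ` carrier (tens S Y)" using t by (simp only:)
  then obtain y where y: "y \<in> carrier (tens S Y)" "t = tens_l S F Y \<kappa> y" by blast
  note gS = tens_r[OF mS Y Z g]
  have gy: "tens_r S Y Z g y \<in> carrier (tens S Z)" by (rule homD(1)[OF gS(1) y(1)])
  have "tens_l S F Z \<kappa> (tens_r S Y Z g y) = \<zero>\<^bsub>tens F Z\<^esub>"
    using tens_r_tens_l[OF mS mF Y Z \<kappa> g y(1)] z y(2) by simp
  then have "tens_r S Y Z g y \<in> tens_l Rmod S Z \<rho> ` carrier (tens Rmod Z)"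
    using F_props(5) by (intro tens_exact_left[OF mS module_Rmod mF Z \<rho> \<kappa> F_props(3) _ gy]) simp_all
  then obtain u where u: "u \<in> carrier (tens Rmod Z)" "tens_r S Y Z g y = tens_l Rmod S Z \<rho> u"
    by blast
  \<comment> \<open>R \<otimes> Z is Z: scalars move to the right, so every tensor is 1 \<otimes> w
    for a single \<open>w\<close>.\<close>
  have "\<exists>w\<in>carrier Z. u = te Rmod Z \<one> w"
  proof (rule tens_induct[OF module_Rmod Z u(1)])
    note tb = bilinD[OF te_bilin[OF module_Rmod Z]]
    show "\<exists>w\<in>carrier Z. te Rmod Z r v = te Rmod Z \<one> w" if "r \<in> carrier Rmod" "v \<in> carrier Z" for r v
      using tb(4)[of r \<one> v] tb(5)[of r \<one> v] that Z by (intro bexI[of _ "r \<odot>\<^bsub>Z\<^esub> v"]) simp_all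
    show "\<exists>w\<in>carrier Z. t \<oplus>\<^bsub>tens Rmod Z\<^esub> u = te Rmod Z \<one> w"
      if tu: "\<exists>w\<in>carrier Z. t = te Rmod Z \<one> w" "\<exists>w\<in>carrier Z. u = te Rmod Z \<one> w" for t u
    proof -
      obtain w w' where w: "w \<in> carrier Z" "t = te Rmod Z \<one> w" "w' \<in> carrier Z"
          "u = te Rmod Z \<one> w'" using tu by blast
      show ?thesis using tb(3)[of \<one> w w'] w Z by (intro bexI[of _ "w \<oplus>\<^bsub>Z\<^esub> w'"]) simp_all
    qed
  qed
  then obtain w where w: "w \<in> carrier Z" "u = te Rmod Z \<one> w" by blast
  have \<rho>1: "\<rho> \<one> = \<one>\<^bsub>S\<^esub>" using \<rho>_eq[OF one_closed] S_simps(1) mS by simp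
  have gyw: "tens_r S Y Z g y = te S Z \<one>\<^bsub>S\<^esub> w" using u(2) w tens_l(2)[OF Z module_Rmod mS \<rho>, of \<one>
      w] \<rho>1 by simp
  \<comment> \<open>In the cokernel of \<open>g\<close> the image of \<open>y\<close> vanishes, so 1
    tensored with the class of \<open>w\<close> is zero. Purity kills the class itself, which puts
    \<open>w\<close> in the image of \<open>g\<close>.\<close>
  let ?C = "quotient_module Z (g ` carrier Y)" and ?p = "quot_map Z (g ` carrier Y)"
  note C = quotient_module[OF Z image_submodule[OF Y Z g]]
  have "te S ?C \<one>\<^bsub>S\<^esub> (?p w) = tens_r S Z ?C ?p (tens_r S Y Z g y)"
    unfolding gyw using tens_r(2)[OF mS Z C(1,2) S_simps(1) w(1)] by simp
  also have "\<dots> = tens_r S Y ?C (\<lambda>x\<in>carrier Y. \<zero>\<^bsub>?C\<^esub>) y"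
    by (rule tens_r_tens_r[OF mS Y Z C(1) g C(2) hom_zero[OF Y C(1)] _ y(1)])
        (use C(5) homD(1)[OF g] in simp)
  also have "\<dots> = \<zero>\<^bsub>tens S ?C\<^esub>"
    by (rule tens_map_zero[OF mS Y mS C(1) hom_id[OF mS] hom_zero[OF Y C(1)] _ y(1)]) simp
  finally have "?p w = \<zero>\<^bsub>?C\<^esub>"
    using homD(1)[OF C(2) w(1)] by (intro pure[OF C(1) lepoll_UNIV_trans[OF C(3) small_U]])
  then obtain b where b: "b \<in> carrier Y" "w = g b" using C(5)[OF w(1)] by blast
  have tb1: "te S Y \<one>\<^bsub>S\<^esub> b \<in> carrier (tens S Y)" by (rule te_closed[OF mS Y S_simps(1) b(1)])
  have mSY: "module R (tens S Y)" and mSZ: "module R (tens S Z)" and mFY: "module R (tens F Y)"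
    by (rule module_tens[OF mS Y], rule module_tens[OF mS Z], rule module_tens[OF mF Y])
  have "tens_r S Y Z g (y \<ominus>\<^bsub>tens S Y\<^esub> te S Y \<one>\<^bsub>S\<^esub> b) = \<zero>\<^bsub>tens S Z\<^esub>"
    using hom_zero_neg(3)[OF gS(1) mSY mSZ y(1) tb1] gS(2)[OF S_simps(1) b(1)] gyw b(2) gy mSZ
      by simp
  then obtain v where v: "v \<in> carrier (tens S X)" "y \<ominus>\<^bsub>tens S Y\<^esub> te S Y \<one>\<^bsub>S\<^esub> b = tens_r S X Y f v"
    using exact_atD(3)[OF flat_exact[OF S_flat X Y Z small_U small_U small_U f g e]
        module_addI(4)[OF mSY y(1) tb1]] by blast
  have fv: "tens_r S X Y f v \<in> carrier (tens S Y)" by (rule homD(1)[OF tens_r(1)[OF mS X Y f] v(1)])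
  have "y = te S Y \<one>\<^bsub>S\<^esub> b \<oplus>\<^bsub>tens S Y\<^esub> tens_r S X Y f v" using module_diff(7)[OF mSY y(1) tb1] v(2)
    by simp
  then have "t = tens_l S F Y \<kappa> (te S Y \<one>\<^bsub>S\<^esub> b) \<oplus>\<^bsub>tens F Y\<^esub> tens_l S F Y \<kappa> (tens_r S X Y f v)"
    using y(2) homD(2)[OF tens_l(1)[OF Y mS mF \<kappa>] tb1 fv] by simp
  moreover have "tens_l S F Y \<kappa> (te S Y \<one>\<^bsub>S\<^esub> b) = \<zero>\<^bsub>tens F Y\<^esub>"
  proof -
    have "\<rho> \<one> \<in> \<rho> ` carrier Rmod" by simp
    then have "\<kappa> \<one>\<^bsub>S\<^esub> = \<zero>\<^bsub>F\<^esub>" using F_props(5)[OF S_simps(1)] \<rho>1 by simp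
    then show ?thesis using tens_l(2)[OF Y mS mF \<kappa> S_simps(1) b(1)] te_zero(1)[OF mF Y b(1)] by simp
  qed
  moreover have "tens_l S F Y \<kappa> (tens_r S X Y f v) = tens_r F X Y f (tens_l S F X \<kappa> v)"
    by (rule tens_r_tens_l[OF mS mF X Y \<kappa> f v(1), symmetric])
  moreover have \<kappa>v: "tens_l S F X \<kappa> v \<in> carrier (tens F X)"
    by (rule homD(1)[OF tens_l(1)[OF X mS mF \<kappa>] v(1)])
  ultimately have "t = tens_r F X Y f (tens_l S F X \<kappa> v)"
    using homD(1)[OF tens_r(1)[OF mF X Y f] \<kappa>v] mFY by simp
  then show "t \<in> tens_r F X Y f ` carrier (tens F X)" using \<kappa>v by blast
qed

section \<open>Injectivity of Hom(S, M) over R\<close>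

definition E :: "('r, 's \<Rightarrow> 'm) module"
  where "E = hom_module R S M"

lemma mE: "module R E"
  unfolding E_def by (rule module_hom_module[OF mS M])

lemma E_carrier: "carrier E = Hom S M"
  by (simp add: E_def hom_module_simps)

lemma E_simps:
  "x \<in> carrier S \<Longrightarrow> (f \<oplus>\<^bsub>E\<^esub> g) x = f x \<oplus>\<^bsub>M\<^esub> g x" "x \<in> carrier S \<Longrightarrow> (r \<odot>\<^bsub>E\<^esub> f) x = r \<odot>\<^bsub>M\<^esub> f x"
  by (simp_all add: E_def hom_module_simps)

lemma E_ext: "f \<in> carrier E \<Longrightarrow> g \<in> carrier E \<Longrightarrow> (\<And>x. x \<in> carrier S \<Longrightarrow> f x = g x) \<Longrightarrow> f = g"
  unfolding E_carrier by (rule hom_eqI)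

text \<open>The scalar action of \<open>coinduced\<close>: multiplying the argument on the right
  gives a left action on functions.\<close>

definition act :: "'s \<Rightarrow> ('s \<Rightarrow> 'm) \<Rightarrow> 's \<Rightarrow> 'm"
  where "act s f = (\<lambda>x\<in>carrier S. f (x \<otimes>\<^bsub>S\<^esub> s))"

lemma act_closed: "s \<in> carrier S \<Longrightarrow> f \<in> carrier E \<Longrightarrow> act s f \<in> carrier E"
  unfolding E_carrier act_def
  by (rule mod_homI[OF _ _ _ mS]) (simp_all add: S_simps homD(1)[of f S M] homD(2)[of f S M]
      homD(3)[of f S M])

lemma act_apply: "x \<in> carrier S \<Longrightarrow> act s f x = f (x \<otimes>\<^bsub>S\<^esub> s)"
  by (simp add: act_def)

text \<open>The field \<open>smult\<close> of \<open>S\<close> holds the action of \<open>R\<close>.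
  A left ideal, and \<open>S\<close> itself as an \<open>S\<close>-module, therefore need a record
  whose scalar action is the multiplication of \<open>S\<close>.\<close>

definition lmod :: "'s set \<Rightarrow> ('s, 's) module"
  where "lmod J = \<lparr>carrier = J, mult = undefined, one = undefined, zero = \<zero>\<^bsub>S\<^esub>, add
      = (\<lambda>x y. x \<oplus>\<^bsub>S\<^esub> y),
    smult = (\<lambda>x y. x \<otimes>\<^bsub>S\<^esub> y)\<rparr>"

lemma lmod_simps [simp]:
  "carrier (lmod J) = J" "\<zero>\<^bsub>lmod J\<^esub> = \<zero>\<^bsub>S\<^esub>" "x \<oplus>\<^bsub>lmod J\<^esub> y = x \<oplus>\<^bsub>S\<^esub> y" "x \<odot>\<^bsub>lmod J\<^esub> y = x \<otimes>\<^bsub>S\<^esub> y"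
  by (simp_all add: lmod_def)

lemma left_module_lmod:
  assumes J: "submodule J R S" and left: "\<And>s x. s \<in> carrier S \<Longrightarrow> x \<in> J \<Longrightarrow> s \<otimes>\<^bsub>S\<^esub> x \<in> J"
  shows "left_module S (lmod J)"
proof -
  note D = submoduleD[OF mS J]
  have JS: "x \<in> carrier S" if "x \<in> J" for x using D(1) that by blast
  have "abelian_group (lmod J)"
  proof (rule abelian_groupI)
    fix x assume "x \<in> carrier (lmod J)"
    then show "\<exists>y\<in>carrier (lmod J). y \<oplus>\<^bsub>lmod J\<^esub> x = \<zero>\<^bsub>lmod J\<^esub>"
      using D(4) JS mS by (intro bexI[of _ "\<ominus>\<^bsub>S\<^esub> x"]) simp_all
  qed (use D JS mS in \<open>simp_all add: module_ac(1), simp add: module_ac(2)\<close>)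
  then show ?thesis
    by (intro left_module.intro left_module_axioms.intro S_ring) (use left JS S_simps in simp_all)
qed

lemma mod_hom_lmod_coinduced:
  assumes J: "submodule J R S" and left: "\<And>s x. s \<in> carrier S \<Longrightarrow> x \<in> J \<Longrightarrow> s \<otimes>\<^bsub>S\<^esub> x \<in> J"
  shows "h \<in> mod_hom S (lmod J) (coinduced R S M) \<longleftrightarrow> h \<in> J \<rightarrow>\<^sub>E carrier E \<and>
    (\<forall>x\<in>J. \<forall>y\<in>J. h (x \<oplus>\<^bsub>S\<^esub> y) = h x \<oplus>\<^bsub>E\<^esub> h y) \<and> (\<forall>s\<in>carrier S. \<forall>x\<in>J. h (s \<otimes>\<^bsub>S\<^esub> x) = act s (h x))"
  by (simp add: mod_hom_def coinduced_def E_def hom_module_def act_def)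

text \<open>By flatness \<open>S \<otimes> I\<close> is a left ideal \<open>J\<close> of \<open>S\<close>, and \<open>R\<close>-maps \<open>I \<rightarrow> E\<close> correspond to \<open>S\<close>-maps \<open>J \<rightarrow> E\<close>.\<close>

lemma E_baer: "baer E"
  unfolding baer_def
proof (intro allI impI ballI)
  fix I f assume I: "submodule I R Rmod" and f: "f \<in> Hom (submod Rmod I) E"
  let ?I = "submod Rmod I"
  have mI: "module R ?I" by (rule module_submod[OF module_Rmod I])
  note ID = submoduleD[OF module_Rmod I]
  have IR: "a \<in> carrier R" if "a \<in> I" for a using ID(1) that by auto
  have sI: "carrier ?I \<lesssim> (UNIV :: 'u set)"
    using subset_imp_lepoll[OF ID(1)] R_small by (simp add: lepoll_trans)
  have inc: "(\<lambda>a\<in>I. a) \<in> Hom ?I Rmod" by (rule submod_incl[OF module_Rmod I])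
  have mT: "module R (tens S ?I)" by (rule module_tens[OF mS mI])
  have "bilin S ?I S (\<lambda>s a. a \<odot>\<^bsub>S\<^esub> s)"
    by (rule bilinI) (use IR mS in \<open>simp_all add: module_smult(1-4)\<close>)
  note \<mu> = tens_lin[OF mS mI mS this]
  define \<mu> where "\<mu> = tens_lin S ?I S (\<lambda>s a. a \<odot>\<^bsub>S\<^esub> s)"
  note \<mu> = \<mu>[folded \<mu>_def]
  have "bilin S Rmod S (\<lambda>s a. a \<odot>\<^bsub>S\<^esub> s)"
    by (rule bilinI) (use mS in \<open>simp_all add: module_smult(1-4)\<close>)
  note \<nu> = tens_lin[OF mS module_Rmod mS this]
  define \<nu> where "\<nu> = tens_lin S Rmod S (\<lambda>s a. a \<odot>\<^bsub>S\<^esub> s)"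
  note \<nu> = \<nu>[folded \<nu>_def]
  note i = tens_r[OF mS mI module_Rmod inc]
  \<comment> \<open>Injectivity of \<open>\<mu>\<close>: flatness embeds S \<otimes> I into S
    \<otimes> R, whose elements are all of the form s \<otimes> 1, and \<open>\<nu>\<close> recovers
    \<open>s\<close> from s \<otimes> 1.\<close>
  have \<mu>_ker: "t = \<zero>\<^bsub>tens S ?I\<^esub>" if t: "t \<in> carrier (tens S ?I)" and z: "\<mu> t = \<zero>\<^bsub>S\<^esub>" for t
  proof (rule flat_kernel[OF S_flat mI module_Rmod sI _ inc _ t])
    show "carrier Rmod \<lesssim> (UNIV :: 'u set)" using R_small by simp
    show "tens_r S ?I Rmod (\<lambda>a\<in>I. a) t = \<zero>\<^bsub>tens S Rmod\<^esub>"
    proof -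
      let ?u = "tens_r S ?I Rmod (\<lambda>a\<in>I. a) t"
      have u: "?u \<in> carrier (tens S Rmod)" by (rule homD(1)[OF i(1) t])
      have "\<exists>s\<in>carrier S. ?u = te S Rmod s \<one>"
      proof (rule tens_induct[OF mS module_Rmod u])
        note tb = bilinD[OF te_bilin[OF mS module_Rmod]]
        show "\<exists>s\<in>carrier S. te S Rmod x r = te S Rmod s \<one>" if "x \<in> carrier S" "r \<in> carrier Rmod"
            for x r
          using tb(4)[of r x \<one>] tb(5)[of r x \<one>] that mS by (intro bexI[of _ "r \<odot>\<^bsub>S\<^esub> x"]) simp_all
        show "\<exists>s\<in>carrier S. t \<oplus>\<^bsub>tens S Rmod\<^esub> u = te S Rmod s \<one>"
          if tu: "\<exists>s\<in>carrier S. t = te S Rmod s \<one>" "\<exists>s\<in>carrier S. u = te S Rmod s \<one>" for t u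
        proof -
          obtain w w' where w: "w \<in> carrier S" "t = te S Rmod w \<one>" "w' \<in> carrier S"
              "u = te S Rmod w' \<one>" using tu by blast
          show ?thesis using tb(2)[of w w' \<one>] w mS by (intro bexI[of _ "w \<oplus>\<^bsub>S\<^esub> w'"]) simp_all
        qed
      qed
      then obtain s where s: "s \<in> carrier S" "?u = te S Rmod s \<one>" by blast
      have "compose (carrier (tens S ?I)) \<nu> (tens_r S ?I Rmod (\<lambda>a\<in>I. a)) t = \<mu> t"
        by (rule tens_hom_eqI[OF mS mI hom_compose[OF mT i(1) \<nu>(1)] \<mu>(1) _ t])
          (use mS mI IR in \<open>simp add: compose_eq i(2) \<nu>(2) \<mu>(2)\<close>)
      then have "s = \<zero>\<^bsub>S\<^esub>" using t z s \<nu>(2)[OF s(1), of \<one>] mS by (simp add: compose_eq)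
      then show ?thesis using s(2) te_zero(1)[OF mS module_Rmod, of \<one>] by simp
    qed
  qed simp
  define J where "J = \<mu> ` carrier (tens S ?I)"
  have J: "submodule J R S" unfolding J_def by (rule image_submodule[OF mT mS \<mu>(1)])
  note JD = submoduleD[OF mS J]
  have \<mu>J: "\<mu> \<in> Hom (tens S ?I) (submod S J)" using \<mu>(1) by (auto simp: mod_hom_def J_def)
  have "inj_on \<mu> (carrier (tens S ?I))"
  proof (rule inj_onI)
    fix t u assume tu: "t \<in> carrier (tens S ?I)" "u \<in> carrier (tens S ?I)" "\<mu> t = \<mu> u"
    then have "\<mu> (t \<ominus>\<^bsub>tens S ?I\<^esub> u) = \<zero>\<^bsub>S\<^esub>"
      using hom_zero_neg(3)[OF \<mu>(1) mT mS tu(1,2)] homD(1)[OF \<mu>(1) tu(2)] mS by simp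
    then show "t = u" using \<mu>_ker[of "t \<ominus>\<^bsub>tens S ?I\<^esub> u"] tu mT module_diff(3)[OF mT tu(1,2)] by simp
  qed
  then have "bij_betw \<mu> (carrier (tens S ?I)) (carrier (submod S J))"
    by (simp add: bij_betw_def J_def)
  then obtain j where j: "j \<in> Hom (submod S J) (tens S ?I)" "\<And>t. t \<in> carrier (tens S ?I) \<Longrightarrow>
      j (\<mu> t) = t"
    "\<And>y. y \<in> carrier (submod S J) \<Longrightarrow> \<mu> (j y) = y"
    using hom_inverse[OF mT module_submod[OF mS J] \<mu>J] by metis
  have fE: "f a \<in> carrier E" if "a \<in> I" for a using homD(1)[OF f] that by simp
  have fH: "f a \<in> Hom S M" if "a \<in> I" for a using fE[OF that] E_carrier by simp
  have "bilin S ?I E (\<lambda>s a. act s (f a))"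
  proof (rule bilinI)
    fix s a assume "s \<in> carrier S" "a \<in> carrier ?I"
    then show "act s (f a) \<in> carrier E" using fE by (simp add: act_closed)
  next
    fix s s' a assume *: "s \<in> carrier S" "s' \<in> carrier S" "a \<in> carrier ?I"
    then have a: "a \<in> I" by simp
    show "act (s \<oplus>\<^bsub>S\<^esub> s') (f a) = act s (f a) \<oplus>\<^bsub>E\<^esub> act s' (f a)"
      by (rule E_ext) (use * a mS mE fE[OF a] in \<open>simp_all add: act_closed E_simps act_apply
          S_simps homD(2)[OF fH[OF a]]\<close>)
  next
    fix s a a' assume *: "s \<in> carrier S" "a \<in> carrier ?I" "a' \<in> carrier ?I"
    then have a: "a \<in> I" "a' \<in> I" "a \<oplus> a' \<in> I" using ID(3) by auto
    have fa: "f (a \<oplus> a') = f a \<oplus>\<^bsub>E\<^esub> f a'" using homD(2)[OF f *(2,3)] by simp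
    show "act s (f (a \<oplus>\<^bsub>?I\<^esub> a')) = act s (f a) \<oplus>\<^bsub>E\<^esub> act s (f a')"
      by (rule E_ext) (use * a mE fE[OF a(1)] fE[OF a(2)] fE[OF a(3)] fa in
          \<open>simp_all add: act_closed E_simps act_apply S_simps\<close>)
  next
    fix r s a assume *: "r \<in> carrier R" "s \<in> carrier S" "a \<in> carrier ?I"
    then have a: "a \<in> I" "r \<otimes> a \<in> I" using ID(6) by auto
    have fa: "f (r \<otimes> a) = r \<odot>\<^bsub>E\<^esub> f a" using homD(3)[OF f *(1,3)] by simp
    show "act (r \<odot>\<^bsub>S\<^esub> s) (f a) = r \<odot>\<^bsub>E\<^esub> act s (f a)"
      by (rule E_ext) (use * a mS mE fE[OF a(1)] in \<open>simp_all add: act_closed E_simps act_apply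
          S_simps homD(3)[OF fH[OF a(1)]]\<close>)
    show "act s (f (r \<odot>\<^bsub>?I\<^esub> a)) = r \<odot>\<^bsub>E\<^esub> act s (f a)"
      by (rule E_ext) (use * a mE fE[OF a(1)] fE[OF a(2)] fa in \<open>simp_all add: act_closed E_simps
          act_apply S_simps\<close>)
  qed
  note \<phi> = tens_lin[OF mS mI mE this]
  define \<phi> where "\<phi> = tens_lin S ?I E (\<lambda>s a. act s (f a))"
  note \<phi> = \<phi>[folded \<phi>_def]
  \<comment> \<open>That \<open>J\<close> is a left ideal and that the map on it is
    \<open>S\<close>-linear have one common source: left multiplication by \<open>s\<close> on S
    \<otimes> I, called \<open>m\<close>, is intertwined by \<open>\<mu>\<close> with multiplication
    and by \<open>\<phi>\<close> with \<open>act s\<close>.\<close>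
  have left: "s \<otimes>\<^bsub>S\<^esub> x \<in> J \<and> \<phi> (j (s \<otimes>\<^bsub>S\<^esub> x)) = act s (\<phi> (j x))" if s: "s \<in> carrier S"
      and x: "x \<in> J" for s x
  proof -
    note tb = bilinD[OF te_bilin[OF mS mI]]
    have "bilin S ?I (tens S ?I) (\<lambda>s' a. te S ?I (s \<otimes>\<^bsub>S\<^esub> s') a)"
      by (rule bilinI) (use s mS mI S_simps(2,6,9) in \<open>simp_all add: tb(2,4) tb(3)[simplified]
          tb(5)[simplified]\<close>)
    note m = tens_lin[OF mS mI mT this]
    define m where "m = tens_lin S ?I (tens S ?I) (\<lambda>s' a. te S ?I (s \<otimes>\<^bsub>S\<^esub> s') a)"
    note m = m[folded m_def]
    have jx: "j x \<in> carrier (tens S ?I)" using homD(1)[OF j(1)] x by simp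
    have "\<mu> (m t) = s \<otimes>\<^bsub>S\<^esub> \<mu> t \<and> \<phi> (m t) = act s (\<phi> t)" if t: "t \<in> carrier (tens S ?I)" for t
    proof (rule tens_induct[OF mS mI t])
      fix y a assume y: "y \<in> carrier S" and a: "a \<in> carrier ?I"
      have sy: "s \<otimes>\<^bsub>S\<^esub> y \<in> carrier S" using s y by (rule S_simps(2))
      have "\<mu> (m (te S ?I y a)) = s \<otimes>\<^bsub>S\<^esub> \<mu> (te S ?I y a)"
        using m(2)[OF y a] \<mu>(2)[OF sy a] \<mu>(2)[OF y a] S_simps(9)[of a s y] IR a s y by simp
      moreover have "act (s \<otimes>\<^bsub>S\<^esub> y) (f a) = act s (act y (f a))"
        using s y by (auto simp: act_def fun_eq_iff S_simps)
      ultimately show "\<mu> (m (te S ?I y a)) = s \<otimes>\<^bsub>S\<^esub> \<mu> (te S ?I y a) \<and> \<phi> (m (te S ?I y a)) = act s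
          (\<phi> (te S ?I y a))"
        using m(2)[OF y a] \<phi>(2)[OF sy a] \<phi>(2)[OF y a] by simp
    next
      fix t u assume t: "t \<in> carrier (tens S ?I)" and u: "u \<in> carrier (tens S ?I)"
        and *: "\<mu> (m t) = s \<otimes>\<^bsub>S\<^esub> \<mu> t \<and> \<phi> (m t) = act s (\<phi> t)" "\<mu> (m u) = s \<otimes>\<^bsub>S\<^esub> \<mu> u \<and>
            \<phi> (m u) = act s (\<phi> u)"
      note mtu = homD(1)[OF m(1) t] homD(1)[OF m(1) u]
      have "act s (\<phi> t \<oplus>\<^bsub>E\<^esub> \<phi> u) = act s (\<phi> t) \<oplus>\<^bsub>E\<^esub> act s (\<phi> u)"
        by (rule E_ext) (use s mE homD(1)[OF \<phi>(1) t] homD(1)[OF \<phi>(1) u] in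
            \<open>simp_all add: act_closed E_simps act_apply S_simps\<close>)
      then show "\<mu> (m (t \<oplus>\<^bsub>tens S ?I\<^esub> u)) = s \<otimes>\<^bsub>S\<^esub> \<mu> (t \<oplus>\<^bsub>tens S ?I\<^esub> u) \<and>
          \<phi> (m (t \<oplus>\<^bsub>tens S ?I\<^esub> u)) = act s (\<phi> (t \<oplus>\<^bsub>tens S ?I\<^esub> u))"
        using * homD(2)[OF m(1) t u] homD(2)[OF \<mu>(1) mtu] homD(2)[OF \<mu>(1) t u] homD(2)[OF \<phi>(1)
            mtu] homD(2)[OF \<phi>(1) t u]
          S_simps(6)[OF homD(1)[OF \<mu>(1) t] homD(1)[OF \<mu>(1) u] s] by simp
    qed
    from this[OF jx] have mj: "\<mu> (m (j x)) = s \<otimes>\<^bsub>S\<^esub> x" "\<phi> (m (j x)) = act s (\<phi> (j x))" using j(3)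
        x by auto
    have mjc: "m (j x) \<in> carrier (tens S ?I)" by (rule homD(1)[OF m(1) jx])
    have "s \<otimes>\<^bsub>S\<^esub> x \<in> J" unfolding mj(1)[symmetric] J_def using mjc by (rule imageI)
    moreover have "j (s \<otimes>\<^bsub>S\<^esub> x) = m (j x)" using j(2)[OF mjc] mj(1) by simp
    ultimately show ?thesis using mj(2) by simp
  qed
  have S_sub: "submodule (carrier S) R S" by (rule module.carrier_is_submodule[OF mS])
  have lJ: "left_module S (lmod J)" by (rule left_module_lmod[OF J]) (use left in blast)
  have lS: "left_module S (lmod (carrier S))" by (rule left_module_lmod[OF S_sub]) (rule S_simps(2))
  have sJ: "carrier (lmod J) \<lesssim> (UNIV :: 'u set)"
    using subset_imp_lepoll[OF JD(1)] S_small by (simp add: lepoll_trans)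
  have sS: "carrier (lmod (carrier S)) \<lesssim> (UNIV :: 'u set)" using S_small by simp
  have incJ: "(\<lambda>x\<in>J. x) \<in> mod_hom S (lmod J) (lmod (carrier S))"
    using JD left by (auto simp: mod_hom_def)
  have injJ: "inj_on (\<lambda>x\<in>J. x) (carrier (lmod J))" by (simp add: inj_on_def)
  have h: "(\<lambda>x\<in>J. \<phi> (j x)) \<in> mod_hom S (lmod J) (coinduced R S M)"
  proof -
    have "(\<lambda>x\<in>J. \<phi> (j x)) \<in> J \<rightarrow>\<^sub>E carrier E" using homD(1)[OF \<phi>(1) homD(1)[OF j(1)]] by simp
    moreover have "\<phi> (j (x \<oplus>\<^bsub>S\<^esub> y)) = \<phi> (j x) \<oplus>\<^bsub>E\<^esub> \<phi> (j y)" if "x \<in> J" "y \<in> J" for x y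
      using homD(2)[OF j(1), of x y] that homD(2)[OF \<phi>(1) homD(1)[OF j(1)] homD(1)[OF j(1)], of x
          y] by simp
    ultimately show ?thesis using left JD(3) by (subst mod_hom_lmod_coinduced[OF J]) simp_all
  qed
  obtain g where g: "g \<in> mod_hom S (lmod (carrier S)) (coinduced R S M)"
    "\<And>x. x \<in> carrier (lmod J) \<Longrightarrow> g ((\<lambda>x\<in>J. x) x) = (\<lambda>x\<in>J. \<phi> (j x)) x"
    by (rule injective_lepoll[OF E_inj lJ sJ lS sS incJ injJ h]) blast
  \<comment> \<open>Being \<open>S\<close>-linear on all of \<open>S\<close>, the extension
    \<open>g\<close> is determined by its value at the unit. This value is the element of
    \<open>E\<close> by which \<open>f\<close> is multiplication.\<close>
  have g1: "g \<one>\<^bsub>S\<^esub> \<in> carrier E" and gs: "\<And>s. s \<in> carrier S \<Longrightarrow> g (s \<otimes>\<^bsub>S\<^esub> \<one>\<^bsub>S\<^esub>) = act s (g \<one>\<^bsub>S\<^esub>)"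
    using g(1) S_simps(1) mod_hom_lmod_coinduced[OF S_sub S_simps(2), of g] by auto
  have g1H: "g \<one>\<^bsub>S\<^esub> \<in> Hom S M" using g1 E_carrier by simp
  show "\<exists>n\<in>carrier E. \<forall>a\<in>I. f a = a \<odot>\<^bsub>E\<^esub> n"
  proof (rule bexI[OF _ g1], rule ballI)
    fix a assume a: "a \<in> I"
    let ?t = "te S ?I \<one>\<^bsub>S\<^esub> a"
    have t: "?t \<in> carrier (tens S ?I)" by (rule te_closed[OF mS mI S_simps(1)]) (use a in simp)
    have \<mu>t: "\<mu> ?t = a \<odot>\<^bsub>S\<^esub> \<one>\<^bsub>S\<^esub>" using \<mu>(2)[OF S_simps(1)] a by simp
    have aJ: "a \<odot>\<^bsub>S\<^esub> \<one>\<^bsub>S\<^esub> \<in> J" unfolding \<mu>t[symmetric] J_def using t by (rule imageI)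
    have a1: "a \<odot>\<^bsub>S\<^esub> \<one>\<^bsub>S\<^esub> \<in> carrier S" using IR[OF a] S_simps(1) mS by simp
    have "g (a \<odot>\<^bsub>S\<^esub> \<one>\<^bsub>S\<^esub>) = \<phi> ?t" using g(2)[of "a \<odot>\<^bsub>S\<^esub> \<one>\<^bsub>S\<^esub>"] aJ j(2)[OF t] \<mu>t by simp
    also have "\<dots> = act \<one>\<^bsub>S\<^esub> (f a)" using \<phi>(2)[OF S_simps(1)] a by simp
    also have "\<dots> = f a"
      by (rule E_ext) (use fE[OF a] S_simps in \<open>simp_all add: act_closed act_apply\<close>)
    finally have "f a = act (a \<odot>\<^bsub>S\<^esub> \<one>\<^bsub>S\<^esub>) (g \<one>\<^bsub>S\<^esub>)" using gs[OF a1] S_simps(4)[OF a1] by simp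
    also have "\<dots> = a \<odot>\<^bsub>E\<^esub> g \<one>\<^bsub>S\<^esub>"
      by (rule E_ext) (use a1 g1 IR[OF a] mE S_simps in \<open>simp_all add: act_closed act_apply
          E_simps homD(3)[OF g1H]\<close>)
    finally show "f a = a \<odot>\<^bsub>E\<^esub> g \<one>\<^bsub>S\<^esub>" .
  qed
qed

end

section \<open>Vanishing of Ext and the descent of injectivity\<close>

context base_ring
begin

lemma hom_module_precompose:
  fixes A :: "('r, 'a) module" and B :: "('r, 'b) module" and C :: "('r, 'c) module"
  assumes A: "module R A" and B: "module R B" and C: "module R C" and d: "d \<in> Hom A B"
  shows "(\<lambda>h\<in>carrier (hom_module R B C). compose (carrier A) h d) \<in> Hom (hom_module R B C)
      (hom_module R A C)"
proof (rule mod_homI[OF _ _ _ module_hom_module[OF B C]])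
  show "compose (carrier A) h d \<in> carrier (hom_module R A C)" if "h \<in> carrier (hom_module R B C)"
      for h
    using hom_compose[OF A d] that by (simp add: hom_module_simps)
qed (auto simp: hom_module_def compose_def fun_eq_iff homD(1)[OF d])

lemma hom_diff:
  fixes A :: "('r, 'a) module" and B :: "('r, 'b) module"
  assumes "module R A" "module R B" "f \<in> Hom A B" "g \<in> Hom A B"
  shows "(\<lambda>x\<in>carrier A. f x \<ominus>\<^bsub>B\<^esub> g x) \<in> Hom A B"
proof -
  have "(\<lambda>x\<in>carrier A. f x \<oplus>\<^bsub>B\<^esub> (\<lambda>x\<in>carrier A. \<ominus>\<^bsub>B\<^esub> g x) x) \<in> Hom A B"
    by (rule hom_add[OF assms(1-3) hom_neg[OF assms(1,2,4)]])
  moreover have "(\<lambda>x\<in>carrier A. f x \<oplus>\<^bsub>B\<^esub> (\<lambda>x\<in>carrier A. \<ominus>\<^bsub>B\<^esub> g x) x) = (\<lambda>x\<in>carrier A. f x \<ominus>\<^bsub>B\<^esub> g x)"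
    using module_diff(1)[OF assms(2) homD(1)[OF assms(3)] homD(1)[OF assms(4)]]
      by (simp add: fun_eq_iff)
  ultimately show ?thesis by simp
qed

lemma hom_eval:
  fixes A :: "('r, 'a) module" and B :: "('r, 'b) module"
  assumes "module R A" "module R B" "x \<in> carrier A"
  shows "(\<lambda>h\<in>carrier (hom_module R A B). h x) \<in> Hom (hom_module R A B) B"
  by (rule mod_homI[OF _ _ _ module_hom_module[OF assms(1,2)]])
    (use assms(3) homD(1)[OF _ assms(3)] in \<open>simp_all add: hom_module_simps\<close>)

text \<open>\<open>Ext\<close> is computed from a chosen resolution. The existence of
  \<open>P0\<close> makes the choice a genuine resolution, and the information is returned for that
  one; independence will move it elsewhere.\<close>

lemma Ext_eq_zero:
  fixes N :: "('r, 'n) module" and P0 :: "nat \<Rightarrow> ('r, 'u) module"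
  assumes M: "module R M" and P0: "projective_resolution R N P0 d0 e0"
    and res: "\<And>(P :: nat \<Rightarrow> ('r, 'u) module) d e. projective_resolution R N P d e \<Longrightarrow>
        resolution N P d e"
    and z: "carrier (Ext TYPE('u) R (Suc n) N M) = {\<zero>\<^bsub>Ext TYPE('u) R (Suc n) N M\<^esub>}"
  obtains P :: "nat \<Rightarrow> ('r, 'u) module" and d e where "resolution N P d e" "Ext_vanish P d M (Suc n)"
proof -
  define t where "t = (SOME (P :: nat \<Rightarrow> ('r, 'u) module, d, e). projective_resolution R N P d e)"
  obtain P d e where t: "t = (P, d, e)" by (cases t)
  have "\<exists>t. case t of (P :: nat \<Rightarrow> ('r, 'u) module, d, e) \<Rightarrow> projective_resolution R N P d e"
    by (rule exI[of _ "(P0, d0, e0)"]) (simp add: P0)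
  then have "case t of (P, d, e) \<Rightarrow> projective_resolution R N P d e" unfolding t_def
    by (rule someI_ex)
  then have P: "resolution N P d e" using res unfolding t by simp
  note PD = resolutionD[OF P]
  let ?H = "hom_module R (P (Suc n)) M"
  let ?Z = "cocycles R P d M (Suc n)" and ?B = "coboundaries R P d M (Suc n)"
  have mH: "module R ?H" by (rule module_hom_module[OF PD(3) M])
  have Ext: "Ext TYPE('u) R (Suc n) N M = quotient_module (?H\<lparr>carrier := ?Z\<rparr>) ?B"
    unfolding Ext_def t_def[symmetric] t by simp
  have zero: "\<zero>\<^bsub>?H\<^esub> \<in> ?B"
  proof -
    have "compose (carrier (P (Suc n))) (\<lambda>x\<in>carrier (P n). \<zero>\<^bsub>M\<^esub>) (d n) = \<zero>\<^bsub>?H\<^esub>"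
      using homD(1)[OF PD(4)] by (auto simp: compose_def hom_module_def fun_eq_iff)
    then show ?thesis using hom_zero[OF PD(3)[of n] M] by (force simp: image_iff)
  qed
  \<comment> \<open>The coset of \<open>z\<close> is the zero coset, which is the set of
    coboundaries; since zero is a coboundary, \<open>z\<close> lies in its own coset.\<close>
  have "z \<in> ?B" if zZ: "z \<in> ?Z" for z
  proof -
    have zH: "z \<in> carrier ?H" using zZ by (simp add: cocycles_def hom_module_simps)
    have "?B +>\<^bsub>?H\<lparr>carrier := ?Z\<rparr>\<^esub> z \<in> carrier (Ext TYPE('u) R (Suc n) N M)"
      unfolding Ext using zZ by (auto simp: quotient_module_def A_RCOSETS_def')
    then have "?B +>\<^bsub>?H\<lparr>carrier := ?Z\<rparr>\<^esub> z = ?B" unfolding z by (simp add: Ext quotient_module_def)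
    moreover have "\<zero>\<^bsub>?H\<^esub> \<oplus>\<^bsub>?H\<^esub> z \<in> ?B +>\<^bsub>?H\<lparr>carrier := ?Z\<rparr>\<^esub> z" using zero
      by (auto simp: a_r_coset_def')
    ultimately show ?thesis using mH zH by simp
  qed
  then have "Ext_vanish P d M (Suc n)" unfolding Ext_vanish_def by blast
  then show ?thesis using that P by blast
qed

end

section \<open>The sequences 0 -> A1 -> A -> S -> 0 and 0 -> B -> A -> F -> 0\<close>

context descent
begin

lemmas QD = resolutionD[OF Q]

abbreviation A :: "('r, 'u) module" where "A \<equiv> Q 0"
abbreviation A1 :: "('r, 'u) module" where "A1 \<equiv> Q (Suc 0)"
abbreviation d :: "'u \<Rightarrow> 'u" where "d \<equiv> dQ 0"

text \<open>The length of the resolution is used here: the kernel of \<open>d\<close> is the image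
  of \<open>Q 2\<close>, which is zero.\<close>

lemma d_inj:
  assumes "k \<in> carrier A1" "d k = \<zero>\<^bsub>A\<^esub>"
  shows "k = \<zero>\<^bsub>A1\<^esub>"
proof -
  obtain x where x: "x \<in> carrier (Q (Suc (Suc 0)))" "k = dQ (Suc 0) x"
    using exact_atD(3)[OF QD(6)[of 0] assms] by blast
  have "x = \<zero>\<^bsub>Q (Suc (Suc 0))\<^esub>" using x(1) unfolding Q2 by simp
  then show ?thesis using x(2) hom_zero_neg(1)[OF QD(4)[of "Suc 0"] QD(3) QD(3)] by simp
qed

lemma \<epsilon>_d: "k \<in> carrier A1 \<Longrightarrow> \<epsilon> (d k) = \<zero>\<^bsub>S\<^esub>"
  by (rule exact_atD(1)[OF QD(7)])

lemma \<epsilon>_ker: "x \<in> carrier A \<Longrightarrow> \<epsilon> x = \<zero>\<^bsub>S\<^esub> \<Longrightarrow> \<exists>k\<in>carrier A1. x = d k"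
  by (rule exact_atD(3)[OF QD(7)])

definition \<pi> :: "'u \<Rightarrow> 's set" where "\<pi> = compose (carrier A) \<kappa> \<epsilon>"

text \<open>The preimage in \<open>A\<close> of the copy of \<open>R\<close> inside
  \<open>S\<close>, that is, the kernel of the map to \<open>F\<close>. Below, \<open>p\<close>
  reads off the element of \<open>R\<close>, and \<open>e0\<close>, a lift of the unit of
  \<open>S\<close>, splits \<open>p\<close>.\<close>

definition B :: "'u set" where "B = {x \<in> carrier A. \<epsilon> x \<in> \<rho> ` carrier Rmod}"

definition e0 :: 'u where "e0 = (SOME x. x \<in> carrier A \<and> \<epsilon> x = \<one>\<^bsub>S\<^esub>)"

definition p :: "'u \<Rightarrow> 'r" where "p = (\<lambda>x\<in>B. SOME r. r \<in> carrier R \<and> \<epsilon> x = \<rho> r)"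

lemma \<pi>: "\<pi> \<in> Hom A F"
  unfolding \<pi>_def by (rule hom_compose[OF QD(3,5) F_props(2)])

lemma \<pi>_surj: "\<pi> ` carrier A = carrier F"
proof -
  have "\<pi> ` carrier A = \<kappa> ` \<epsilon> ` carrier A" by (auto simp: \<pi>_def compose_def)
  then show ?thesis using QD(8) F_props(3) by simp
qed

lemma \<pi>_ker: "x \<in> carrier A \<Longrightarrow> \<pi> x = \<zero>\<^bsub>F\<^esub> \<longleftrightarrow> x \<in> B"
  using F_props(5)[OF homD(1)[OF QD(5)]] by (simp add: \<pi>_def B_def compose_eq)

lemma B_sub: "submodule B R A"
proof -
  have "B = {x \<in> carrier A. \<pi> x = \<zero>\<^bsub>F\<^esub>}" using \<pi>_ker B_def by blast
  then show ?thesis using kernel_submodule[OF QD(3) F_props(1) \<pi>] by simp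
qed

lemmas BD = submoduleD[OF QD(3) B_sub]

lemma mB: "module R (submod A B)"
  by (rule module_submod[OF QD(3) B_sub])

lemma B_A: "b \<in> B \<Longrightarrow> b \<in> carrier A"
  by (simp add: B_def)

lemma e0: "e0 \<in> carrier A" "\<epsilon> e0 = \<one>\<^bsub>S\<^esub>" "e0 \<in> B"
proof -
  have "\<one>\<^bsub>S\<^esub> \<in> \<epsilon> ` carrier A" using QD(8) S_simps(1) by simp
  then have "\<exists>x. x \<in> carrier A \<and> \<epsilon> x = \<one>\<^bsub>S\<^esub>" by force
  then have *: "e0 \<in> carrier A \<and> \<epsilon> e0 = \<one>\<^bsub>S\<^esub>" unfolding e0_def by (rule someI_ex)
  then show "e0 \<in> carrier A" "\<epsilon> e0 = \<one>\<^bsub>S\<^esub>" by auto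
  have "\<one>\<^bsub>S\<^esub> = \<rho> \<one>" using \<rho>_eq[OF one_closed] S_simps(1) mS by simp
  then show "e0 \<in> B" using * by (auto simp: B_def)
qed

lemma d_B: "k \<in> carrier A1 \<Longrightarrow> d k \<in> B"
proof -
  assume k: "k \<in> carrier A1"
  have "\<zero>\<^bsub>S\<^esub> = \<rho> \<zero>" using hom_zero_neg(1)[OF \<rho> module_Rmod mS] by simp
  then show ?thesis using \<epsilon>_d[OF k] homD(1)[OF QD(4) k] by (force simp: B_def)
qed

lemma p_closed: "x \<in> B \<Longrightarrow> p x \<in> carrier R" and p_eq: "x \<in> B \<Longrightarrow> \<epsilon> x = p x \<odot>\<^bsub>S\<^esub> \<one>\<^bsub>S\<^esub>"
proof -
  assume x: "x \<in> B"
  then have "\<exists>r. r \<in> carrier R \<and> \<epsilon> x = \<rho> r" by (auto simp: B_def)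
  then have "(SOME r. r \<in> carrier R \<and> \<epsilon> x = \<rho> r) \<in> carrier R \<and> \<epsilon> x = \<rho> (SOME r. r \<in> carrier R \<and>
      \<epsilon> x = \<rho> r)"
    by (rule someI_ex)
  then have *: "p x \<in> carrier R \<and> \<epsilon> x = \<rho> (p x)" using x by (simp add: p_def)
  then show "p x \<in> carrier R" "\<epsilon> x = p x \<odot>\<^bsub>S\<^esub> \<one>\<^bsub>S\<^esub>" by (auto simp: \<rho>_eq)
qed

text \<open>Uniqueness is the injectivity of \<open>\<rho>\<close> and so rests on purity; it makes
  the chosen value \<open>p x\<close> linear in \<open>x\<close>.\<close>

lemma p_unique: "x \<in> B \<Longrightarrow> r \<in> carrier R \<Longrightarrow> \<epsilon> x = r \<odot>\<^bsub>S\<^esub> \<one>\<^bsub>S\<^esub> \<Longrightarrow> p x = r"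
  using smult_one_inj[OF p_closed] p_eq by metis

lemma p: "p \<in> Hom (submod A B) Rmod"
proof -
  have "(\<lambda>x\<in>carrier (submod A B). p x) \<in> Hom (submod A B) Rmod"
  proof (rule mod_homI[OF _ _ _ mB])
    fix x y assume xy: "x \<in> carrier (submod A B)" "y \<in> carrier (submod A B)"
    then have xy: "x \<in> B" "y \<in> B" by auto
    have "p (x \<oplus>\<^bsub>A\<^esub> y) = p x \<oplus> p y"
      by (rule p_unique[OF BD(3)[OF xy]])
        (use xy p_closed p_eq S_simps(1) mS homD(2)[OF QD(5) B_A B_A] in
            \<open>simp_all add: module_smult(2)\<close>)
    then show "p (x \<oplus>\<^bsub>submod A B\<^esub> y) = p x \<oplus>\<^bsub>Rmod\<^esub> p y" by simp
  next
    fix r x assume r: "r \<in> carrier R" and "x \<in> carrier (submod A B)"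
    then have x: "x \<in> B" by simp
    have "p (r \<odot>\<^bsub>A\<^esub> x) = r \<otimes> p x"
      by (rule p_unique[OF BD(6)[OF r x]])
        (use r x p_closed p_eq S_simps(1) mS homD(3)[OF QD(5) r B_A] in
            \<open>simp_all add: module_smult(3)\<close>)
    then show "p (r \<odot>\<^bsub>submod A B\<^esub> x) = r \<odot>\<^bsub>Rmod\<^esub> p x" by simp
  qed (use p_closed in simp)
  moreover have "(\<lambda>x\<in>carrier (submod A B). p x) = p" by (simp add: p_def fun_eq_iff)
  ultimately show ?thesis by simp
qed

lemma p_d: "k \<in> carrier A1 \<Longrightarrow> p (d k) = \<zero>"
  by (rule p_unique[OF d_B]) (use \<epsilon>_d S_simps(1) mS in simp_all)

lemma p_e0: "p e0 = \<one>"
  by (rule p_unique[OF e0(3)]) (use e0(2) S_simps(1) mS in simp_all)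

lemma d_BM: "d \<in> Hom A1 (submod A B)"
  using QD(4)[of 0] d_B by (auto simp: mod_hom_def)

text \<open>\<open>B\<close> is an extension of \<open>R\<close> by \<open>A1\<close>, split by
  \<open>e0\<close>: the map \<open>f\<close> from the direct sum is bijective since
  \<open>p\<close> recovers the second coordinate, \<open>d\<close> is injective, and what remains
  after subtracting \<open>p x \<odot> e0\<close> lies in the kernel of
  \<open>\<epsilon>\<close>.\<close>

lemma proj_B: "proj (submod A B)"
proof -
  note m1 = QD(3)[of "Suc 0"]
  have mD: "module R (dsum A1 Rmod)" by (rule module_dsum[OF m1 module_Rmod])
  define f where "f = (\<lambda>z\<in>carrier (dsum A1 Rmod). d (fst z) \<oplus>\<^bsub>A\<^esub> snd z \<odot>\<^bsub>A\<^esub> e0)"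
  have dA: "d k \<in> carrier A" if "k \<in> carrier A1" for k using homD(1)[OF QD(4)] that .
  have fB: "d k \<oplus>\<^bsub>A\<^esub> r \<odot>\<^bsub>A\<^esub> e0 \<in> B" if "k \<in> carrier A1" "r \<in> carrier R" for k r
    using BD(3)[OF d_B[OF that(1)] BD(6)[OF that(2) e0(3)]] .
  have pf: "p (d k \<oplus>\<^bsub>A\<^esub> r \<odot>\<^bsub>A\<^esub> e0) = r" if kr: "k \<in> carrier A1" "r \<in> carrier R" for k r
  proof -
    have "p (d k \<oplus>\<^bsub>A\<^esub> r \<odot>\<^bsub>A\<^esub> e0) = p (d k) \<oplus> r \<otimes> p e0"
      using homD(2)[OF p, of "d k" "r \<odot>\<^bsub>A\<^esub> e0"] homD(3)[OF p, of r e0] d_B[OF kr(1)]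
          BD(6)[OF kr(2) e0(3)] e0(3) kr(2) by simp
    then show ?thesis using p_d[OF kr(1)] p_e0 kr(2) by simp
  qed
  have f: "f \<in> Hom (dsum A1 Rmod) (submod A B)"
    unfolding f_def
  proof (rule mod_homI[OF _ _ _ mD])
    fix z w assume "z \<in> carrier (dsum A1 Rmod)" "w \<in> carrier (dsum A1 Rmod)"
    then have zw: "fst z \<in> carrier A1" "fst w \<in> carrier A1" "snd z \<in> carrier R"
        "snd w \<in> carrier R" by auto
    show "d (fst (z \<oplus>\<^bsub>dsum A1 Rmod\<^esub> w)) \<oplus>\<^bsub>A\<^esub> snd (z \<oplus>\<^bsub>dsum A1 Rmod\<^esub> w) \<odot>\<^bsub>A\<^esub> e0 =
        (d (fst z) \<oplus>\<^bsub>A\<^esub> snd z \<odot>\<^bsub>A\<^esub> e0) \<oplus>\<^bsub>submod A B\<^esub> (d (fst w) \<oplus>\<^bsub>A\<^esub> snd w \<odot>\<^bsub>A\<^esub> e0)"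
      using zw dA e0(1) QD(3)[of 0] homD(2)[OF QD(4) zw(1,2)]
        by (simp add: module_smult(2) module_ac[of A])
  next
    fix r z assume r: "r \<in> carrier R" and "z \<in> carrier (dsum A1 Rmod)"
    then have z: "fst z \<in> carrier A1" "snd z \<in> carrier R" by auto
    show "d (fst (r \<odot>\<^bsub>dsum A1 Rmod\<^esub> z)) \<oplus>\<^bsub>A\<^esub> snd (r \<odot>\<^bsub>dsum A1 Rmod\<^esub> z) \<odot>\<^bsub>A\<^esub> e0 =
        r \<odot>\<^bsub>submod A B\<^esub> (d (fst z) \<oplus>\<^bsub>A\<^esub> snd z \<odot>\<^bsub>A\<^esub> e0)"
      using z r dA e0(1) QD(3)[of 0] homD(3)[OF QD(4) r z(1)] by (simp add: module_smult(1,3))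
  qed (use fB in auto)
  have "bij_betw f (carrier (dsum A1 Rmod)) (carrier (submod A B))"
  proof (rule bij_betw_imageI)
    show "inj_on f (carrier (dsum A1 Rmod))"
    proof (rule inj_onI)
      fix z w assume z: "z \<in> carrier (dsum A1 Rmod)" and w: "w \<in> carrier (dsum A1 Rmod)"
          and eq: "f z = f w"
      then have zw: "fst z \<in> carrier A1" "fst w \<in> carrier A1" "snd z \<in> carrier R"
          "snd w \<in> carrier R" by auto
      have eq': "d (fst z) \<oplus>\<^bsub>A\<^esub> snd z \<odot>\<^bsub>A\<^esub> e0 = d (fst w) \<oplus>\<^bsub>A\<^esub> snd w \<odot>\<^bsub>A\<^esub> e0" using eq z w
        by (simp add: f_def)
      then have s: "snd z = snd w" using pf[OF zw(1,3)] pf[OF zw(2,4)] by simp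
      have re: "snd w \<odot>\<^bsub>A\<^esub> e0 \<in> carrier A" using zw e0(1) QD(3)[of 0] by simp
      have "d (fst z) = d (fst w)"
        using arg_cong[OF eq'[unfolded s], of "\<lambda>y. y \<ominus>\<^bsub>A\<^esub> snd w \<odot>\<^bsub>A\<^esub> e0"]
        unfolding module_diff(6)[OF QD(3) dA[OF zw(1)] re] module_diff(6)[OF QD(3) dA[OF zw(2)]
            re] .
      then have "d (fst z \<ominus>\<^bsub>A1\<^esub> fst w) = \<zero>\<^bsub>A\<^esub>"
        using hom_zero_neg(3)[OF QD(4) QD(3) QD(3) zw(1,2)] dA[OF zw(2)] QD(3)[of 0] by simp
      then have "fst z = fst w"
        using d_inj[OF module_addI(4)[OF m1 zw(1,2)]] module_diff(3)[OF m1 zw(1,2)] by simp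
      then show "z = w" using s by (simp add: prod_eq_iff)
    qed
    show "f ` carrier (dsum A1 Rmod) = carrier (submod A B)"
    proof
      show "f ` carrier (dsum A1 Rmod) \<subseteq> carrier (submod A B)" using homD(1)[OF f] by blast
      show "carrier (submod A B) \<subseteq> f ` carrier (dsum A1 Rmod)"
      proof
        fix x assume "x \<in> carrier (submod A B)"
        then have x: "x \<in> B" by simp
        note pe = BD(6)[OF p_closed[OF x] e0(3)]
        have "\<epsilon> (x \<ominus>\<^bsub>A\<^esub> p x \<odot>\<^bsub>A\<^esub> e0) = \<zero>\<^bsub>S\<^esub>"
          using hom_zero_neg(3)[OF QD(5,3) mS B_A[OF x] B_A[OF pe]] homD(3)[OF QD(5)
              p_closed[OF x] e0(1)] e0(2)
            p_eq[OF x] p_closed[OF x] S_simps(1) mS by simp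
        then obtain k where k: "k \<in> carrier A1" "x \<ominus>\<^bsub>A\<^esub> p x \<odot>\<^bsub>A\<^esub> e0 = d k"
          using \<epsilon>_ker[OF module_addI(4)[OF QD(3) B_A[OF x] B_A[OF pe]]] by blast
        then have "x = f (k, p x)"
          using module_diff(5)[OF QD(3) B_A[OF x] B_A[OF pe]] p_closed[OF x] by (simp add: f_def)
        then show "x \<in> f ` carrier (dsum A1 Rmod)" using k(1) p_closed[OF x]
          by (intro image_eqI[of x f]) auto
      qed
    qed
  qed
  then show ?thesis by (rule proj_iso[OF proj_dsum[OF QD(2) proj_Rmod] mB f])
qed

abbreviation H0 :: "('r, 'u \<Rightarrow> 'm) module" where "H0 \<equiv> hom_module R A M"
abbreviation H1 :: "('r, 'u \<Rightarrow> 'm) module" where "H1 \<equiv> hom_module R A1 M"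

text \<open>The sequence \<open>0 \<rightarrow> Hom(S, M) \<rightarrow> Hom(A, M) \<rightarrow> Hom(A1, M) \<rightarrow> 0\<close> splits because \<open>Hom(S, M)\<close> is
  injective.\<close>

lemma restriction_section:
  obtains \<sigma> where "\<sigma> \<in> Hom H1 H0" "\<And>h k. h \<in> Hom A1 M \<Longrightarrow> k \<in> carrier A1 \<Longrightarrow> \<sigma> h (d k) = h k"
proof -
  have mH0: "module R H0" and mH1: "module R H1" by (rule module_hom_module[OF QD(3) M])+
  define r where "r = (\<lambda>h\<in>carrier H0. compose (carrier A1) h d)"
  have r: "r \<in> Hom H0 H1" unfolding r_def by (rule hom_module_precompose[OF QD(3,3) M QD(4)])
  have rk: "r h k = h (d k)" if "h \<in> carrier H0" "k \<in> carrier A1" for h k using that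
    by (simp add: r_def compose_eq)
  have H0D: "h \<in> Hom A M" if "h \<in> carrier H0" for h using that by (simp add: hom_module_simps)
  have surj: "r ` carrier H0 = carrier H1"
  proof
    show "r ` carrier H0 \<subseteq> carrier H1" using homD(1)[OF r] by blast
    show "carrier H1 \<subseteq> r ` carrier H0"
    proof
      fix y assume "y \<in> carrier H1"
      then have y: "y \<in> Hom A1 M" by (simp add: hom_module_simps)
      obtain x where x: "x \<in> Hom A M" "\<forall>k\<in>carrier A1. y k = x (d k)" using ext[OF y] by blast
      have "y = compose (carrier A1) x d"
        by (rule hom_eqI[OF y hom_compose[OF QD(3,4) x(1)]]) (use x(2) in \<open>simp add: compose_eq\<close>)
      then show "y \<in> r ` carrier H0" using x(1)
        by (intro image_eqI[of _ _ x]) (simp_all add: r_def hom_module_simps)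
    qed
  qed
  \<comment> \<open>By left exactness of Hom, this kernel is the copy of Hom(S, M) given by
    composition with \<open>\<epsilon>\<close>.\<close>
  define K where "K = {h \<in> carrier H0. r h = \<zero>\<^bsub>H1\<^esub>}"
  have K: "submodule K R H0" unfolding K_def by (rule kernel_submodule[OF mH0 mH1 r])
  note mK = module_submod[OF mH0 K]
  define i where "i = (\<lambda>f\<in>carrier E. compose (carrier A) f \<epsilon>)"
  have i: "i \<in> Hom E H0" unfolding i_def E_def by (rule hom_module_precompose[OF QD(3) mS M QD(5)])
  have ix: "i f x = f (\<epsilon> x)" if "f \<in> carrier E" "x \<in> carrier A" for f x using that
    by (simp add: i_def compose_eq)
  have ri: "r (i f) = \<zero>\<^bsub>H1\<^esub>" if f: "f \<in> carrier E" for f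
  proof (rule hom_eqI)
    note if0 = homD(1)[OF i f]
    show "r (i f) \<in> Hom A1 M" "\<zero>\<^bsub>H1\<^esub> \<in> Hom A1 M"
      using homD(1)[OF r if0] module_addI(2)[OF mH1] by (simp_all add: hom_module_simps)
    fix k assume k: "k \<in> carrier A1"
    have "f \<in> Hom S M" using f E_carrier by simp
    then have "f \<zero>\<^bsub>S\<^esub> = \<zero>\<^bsub>M\<^esub>" by (rule hom_zero_neg(1)[OF _ mS M])
    then show "r (i f) k = \<zero>\<^bsub>H1\<^esub> k"
      using rk[OF if0 k] ix[OF f homD(1)[OF QD(4) k]] \<epsilon>_d[OF k] k by (simp add: hom_module_simps)
  qed
  have iK: "i \<in> Hom E (submod H0 K)" using i ri by (auto simp: mod_hom_def K_def)
  have "bij_betw i (carrier E) (carrier (submod H0 K))"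
  proof (rule bij_betw_imageI)
    show "inj_on i (carrier E)"
    proof (rule inj_onI)
      fix f g assume f: "f \<in> carrier E" and g: "g \<in> carrier E" and eq: "i f = i g"
      show "f = g"
      proof (rule E_ext[OF f g])
        fix s assume "s \<in> carrier S"
        then have "s \<in> \<epsilon> ` carrier A" using QD(8) by simp
        then obtain x where x: "x \<in> carrier A" "s = \<epsilon> x" by blast
        show "f s = g s" unfolding x(2) using ix[OF f x(1)] ix[OF g x(1)] eq by simp
      qed
    qed
    show "i ` carrier E = carrier (submod H0 K)"
    proof
      show "i ` carrier E \<subseteq> carrier (submod H0 K)" using homD(1)[OF iK] by blast
      show "carrier (submod H0 K) \<subseteq> i ` carrier E"
      proof
        fix h assume "h \<in> carrier (submod H0 K)"
        then have h: "h \<in> carrier H0" "r h = \<zero>\<^bsub>H1\<^esub>" by (simp_all add: K_def)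
        note hH = H0D[OF h(1)]
        have ker: "h x = \<zero>\<^bsub>M\<^esub>" if x: "x \<in> carrier A" "\<epsilon> x = \<zero>\<^bsub>S\<^esub>" for x
        proof -
          obtain k where k: "k \<in> carrier A1" "x = d k" using \<epsilon>_ker[OF x] by blast
          show ?thesis using rk[OF h(1) k(1)] h(2) k by (simp add: hom_module_simps)
        qed
        obtain g where g: "g \<in> Hom S M" "\<And>x. x \<in> carrier A \<Longrightarrow> g (\<epsilon> x) = h x"
          by (rule hom_factor[OF QD(3) mS M QD(5,8) hH ker]) blast+
        have gE: "g \<in> carrier E" using g(1) E_carrier by simp
        have "i g \<in> Hom A M" using homD(1)[OF i gE] by (rule H0D)
        then have "h = i g" by (rule hom_eqI[OF hH]) (use ix[OF gE] g(2) in simp)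
        then show "h \<in> i ` carrier E" using gE by blast
      qed
    qed
  qed
  then obtain j where j: "j \<in> Hom (submod H0 K) E" "\<And>h. h \<in> carrier (submod H0 K) \<Longrightarrow> i (j h) = h"
    using hom_inverse[OF mE mK iK] by metis
  \<comment> \<open>The Baer condition for \<open>E\<close> extends the inverse of \<open>i\<close>
    from \<open>K\<close> to all of Hom(A, M). The difference \<open>\<theta>\<close> of the
    identity and \<open>i j'\<close> then kills \<open>K\<close>, so it factors through the
    surjection \<open>r\<close>; the factor is the section.\<close>
  obtain j' where j': "j' \<in> Hom H0 E" "\<And>h. h \<in> K \<Longrightarrow> j' h = j h"
    by (rule baer_extend[OF mH0 mE E_baer K j(1)]) blast
  define \<theta> where "\<theta> = (\<lambda>h\<in>carrier H0. (\<lambda>h\<in>carrier H0. h) h \<ominus>\<^bsub>H0\<^esub> compose (carrier H0) i j' h)"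
  have \<theta>: "\<theta> \<in> Hom H0 H0"
    unfolding \<theta>_def by (rule hom_diff[OF mH0 mH0 hom_id[OF mH0] hom_compose[OF mH0 j'(1) i]])
  have \<theta>h: "\<theta> h = h \<ominus>\<^bsub>H0\<^esub> i (j' h)" if "h \<in> carrier H0" for h using that
    by (simp add: \<theta>_def compose_eq)
  have ij: "i (j' h) \<in> carrier H0" if "h \<in> carrier H0" for h
    by (rule homD(1)[OF i homD(1)[OF j'(1) that]])
  have "\<theta> h = \<zero>\<^bsub>H0\<^esub>" if h: "h \<in> carrier H0" "r h = \<zero>\<^bsub>H1\<^esub>" for h
  proof -
    have "h \<in> K" using h by (simp add: K_def)
    then have "i (j' h) = h" using j'(2) j(2) by simp
    then show ?thesis using \<theta>h[OF h(1)] h(1) mH0 by simp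
  qed
  then obtain \<sigma> where \<sigma>: "\<sigma> \<in> Hom H1 H0" "\<And>h. h \<in> carrier H0 \<Longrightarrow> \<sigma> (r h) = \<theta> h"
    using hom_factor[OF mH0 mH1 mH0 r surj \<theta>] by metis
  show ?thesis
  proof
    show "\<sigma> \<in> Hom H1 H0" by fact
    fix h k assume h: "h \<in> Hom A1 M" and k: "k \<in> carrier A1"
    then have "h \<in> r ` carrier H0" using surj by (simp add: hom_module_simps)
    then obtain g where g: "g \<in> carrier H0" "h = r g" by blast
    note gH = H0D[OF g(1)] and ijH = H0D[OF ij[OF g(1)]]
    have dk: "d k \<in> carrier A" by (rule homD(1)[OF QD(4) k])
    have "\<sigma> h (d k) = g (d k) \<ominus>\<^bsub>M\<^esub> i (j' g) (d k)"
      unfolding g(2) \<sigma>(2)[OF g(1)] \<theta>h[OF g(1)] by (rule hom_module_minus(2)[OF QD(3) M dk gH ijH])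
    moreover have "i (j' g) (d k) = \<zero>\<^bsub>M\<^esub>"
      using rk[OF ij[OF g(1)] k] ri[OF homD(1)[OF j'(1) g(1)]] k by (simp add: hom_module_simps)
    ultimately show "\<sigma> h (d k) = h k" using rk[OF g(1) k] homD(1)[OF gH dk] g(2) M by simp
  qed
qed

section \<open>The module N attached to an ideal I\<close>

context
  fixes I :: "'r set"
  assumes I: "submodule I R Rmod"
begin

abbreviation IM :: "('r, 'r) module" where "IM \<equiv> submod Rmod I"

definition H :: "('r, 'r \<Rightarrow> 'm) module" where "H = hom_module R IM M"

text \<open>The restriction Hom(R, M) -> Hom(I, M), with Hom(R, M) identified with
  \<open>M\<close>.\<close>

definition jm :: "'m \<Rightarrow> 'r \<Rightarrow> 'm" where "jm = (\<lambda>m\<in>carrier M. (\<lambda>a\<in>I. a \<odot>\<^bsub>M\<^esub> m))"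

text \<open>This is \<open>Ext\<^sup>1(R / I, M)\<close>.\<close>

definition N :: "('r, ('r \<Rightarrow> 'm) set) module" where "N = quotient_module H (jm ` carrier M)"

definition pN :: "('r \<Rightarrow> 'm) \<Rightarrow> ('r \<Rightarrow> 'm) set" where "pN = quot_map H (jm ` carrier M)"

lemma mIM: "module R IM" by (rule module_submod[OF module_Rmod I])
lemma mH: "module R H" unfolding H_def by (rule module_hom_module[OF mIM M])
lemma IR: "a \<in> I \<Longrightarrow> a \<in> carrier R" using submoduleD(1)[OF module_Rmod I] by auto

lemma H_carrier: "carrier H = Hom IM M"
  by (simp add: H_def hom_module_simps)

lemma H_simps:
  "a \<in> I \<Longrightarrow> (f \<oplus>\<^bsub>H\<^esub> g) a = f a \<oplus>\<^bsub>M\<^esub> g a" "a \<in> I \<Longrightarrow> (r \<odot>\<^bsub>H\<^esub> f) a = r \<odot>\<^bsub>M\<^esub> f a"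
  by (simp_all add: H_def hom_module_simps)

lemma H_ext: "f \<in> carrier H \<Longrightarrow> g \<in> carrier H \<Longrightarrow> (\<And>a. a \<in> I \<Longrightarrow> f a = g a) \<Longrightarrow> f = g"
  using hom_eqI[of f IM M g] by (simp add: H_carrier)

lemma H_val: "f \<in> carrier H \<Longrightarrow> a \<in> I \<Longrightarrow> f a \<in> carrier M"
  using homD(1)[of f IM M a] by (simp add: H_carrier)

lemma jm_H: "m \<in> carrier M \<Longrightarrow> jm m \<in> carrier H"
proof -
  assume m: "m \<in> carrier M"
  have "(\<lambda>a\<in>carrier IM. a \<odot>\<^bsub>M\<^esub> m) \<in> Hom IM M"
    by (rule mod_homI[OF _ _ _ mIM]) (use m IR M in \<open>simp_all add: module_smult(2,3)\<close>)
  then show ?thesis using m by (simp add: jm_def H_carrier)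
qed

lemma jm_apply: "m \<in> carrier M \<Longrightarrow> a \<in> I \<Longrightarrow> jm m a = a \<odot>\<^bsub>M\<^esub> m"
  by (simp add: jm_def)

lemma jm: "jm \<in> Hom M H"
proof -
  have "(\<lambda>m\<in>carrier M. jm m) \<in> Hom M H"
  proof (rule mod_homI[OF _ _ _ M])
    fix x y assume xy: "x \<in> carrier M" "y \<in> carrier M"
    show "jm (x \<oplus>\<^bsub>M\<^esub> y) = jm x \<oplus>\<^bsub>H\<^esub> jm y"
      by (rule H_ext) (use xy M mH IR in \<open>simp_all add: jm_H H_simps jm_apply module_smult(1)\<close>)
  next
    fix r x assume rx: "r \<in> carrier R" "x \<in> carrier M"
    show "jm (r \<odot>\<^bsub>M\<^esub> x) = r \<odot>\<^bsub>H\<^esub> jm x"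
      by (rule H_ext) (use rx M mH IR in \<open>simp_all add: jm_H H_simps jm_apply module_smult(4)\<close>)
  qed (rule jm_H)
  moreover have "(\<lambda>m\<in>carrier M. jm m) = jm" by (simp add: jm_def fun_eq_iff)
  ultimately show ?thesis by simp
qed

lemmas N_props = quotient_module[OF mH image_submodule[OF M mH jm], folded N_def pN_def]

text \<open>This is Hom(S, N) = 0. A lift \<open>y'\<close> of \<open>y\<close> to Hom(I, M) has
  values from \<open>M\<close> on \<open>A1\<close>; the resulting map to \<open>M\<close> extends
  to \<open>x\<close> on \<open>A\<close> by \<open>ext\<close>. The difference of \<open>y'\<close>
  and \<open>x\<close> vanishes on \<open>A1\<close> and factors through \<open>S\<close>.
  Transposed, it is a map from \<open>I\<close> to Hom(S, M), which is multiplication by some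
  \<open>n\<close> since that module is injective. So \<open>y'\<close> has values from
  \<open>M\<close> throughout.\<close>

lemma Hom_A_N_zero:
  assumes y: "y \<in> Hom A N" and yd: "\<And>k. k \<in> carrier A1 \<Longrightarrow> y (d k) = \<zero>\<^bsub>N\<^esub>" and q: "q \<in> carrier A"
  shows "y q = \<zero>\<^bsub>N\<^esub>"
proof -
  note mA = QD(3)[of 0] and m1 = QD(3)[of "Suc 0"]
  obtain y' where y': "y' \<in> Hom A H" "\<And>q. q \<in> carrier A \<Longrightarrow> pN (y' q) = y q"
    by (rule proj_lift[OF QD(2) mH N_props(1,2,3) y]) blast
  have dk: "d k \<in> carrier A" if "k \<in> carrier A1" for k by (rule homD(1)[OF QD(4) that])
  have y'd: "y' (d k) \<in> jm ` carrier M" if k: "k \<in> carrier A1" for k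
    using N_props(5)[OF homD(1)[OF y'(1) dk[OF k]]] y'(2)[OF dk[OF k]] yd[OF k] by simp
  have c: "compose (carrier A1) y' d \<in> Hom A1 H" by (rule hom_compose[OF m1 QD(4) y'(1)])
  obtain \<psi> where \<psi>: "\<psi> \<in> Hom A1 M" "\<And>k. k \<in> carrier A1 \<Longrightarrow> jm (\<psi> k) = compose (carrier A1) y' d k"
    by (rule proj_lift_image[OF QD(2) M mH jm c]) (use y'd in \<open>auto simp: compose_eq\<close>)
  obtain x where x: "x \<in> Hom A M" "\<forall>k\<in>carrier A1. \<psi> k = x (d k)" using ext[OF \<psi>(1)] by blast
  define \<chi> where "\<chi> = (\<lambda>q\<in>carrier A. y' q \<ominus>\<^bsub>H\<^esub> compose (carrier A) jm x q)"
  have \<chi>: "\<chi> \<in> Hom A H" unfolding \<chi>_def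
    by (rule hom_diff[OF mA mH y'(1) hom_compose[OF mA x(1) jm]])
  have \<chi>q: "\<chi> q = y' q \<ominus>\<^bsub>H\<^esub> jm (x q)" if "q \<in> carrier A" for q using that
    by (simp add: \<chi>_def compose_eq)
  have "\<chi> q = \<zero>\<^bsub>H\<^esub>" if q: "q \<in> carrier A" "\<epsilon> q = \<zero>\<^bsub>S\<^esub>" for q
  proof -
    obtain k where k: "k \<in> carrier A1" "q = d k" using \<epsilon>_ker[OF q] by blast
    have "y' q = jm (x q)" using \<psi>(2)[OF k(1)] bspec[OF x(2) k(1)] k by (simp add: compose_eq)
    then show ?thesis using \<chi>q[OF q(1)] jm_H[OF homD(1)[OF x(1) q(1)]] mH by simp
  qed
  then obtain g where g: "g \<in> Hom S H" "\<And>q. q \<in> carrier A \<Longrightarrow> g (\<epsilon> q) = \<chi> q"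
    using hom_factor[OF mA mS mH QD(5,8) \<chi>] by metis
  note gH = homD(1)[OF g(1)]
  \<comment> \<open>The transposition: \<open>g\<close>, a map from \<open>S\<close> to Hom(I, M),
    is read as a map from \<open>I\<close> to Hom(S, M).\<close>
  have ga: "(\<lambda>s\<in>carrier S. g s a) \<in> carrier E" if a: "a \<in> I" for a
    unfolding E_carrier
    by (rule mod_homI[OF _ _ _ mS]) (use a gH H_val in \<open>simp_all add: homD(2)[OF g(1)]
        homD(3)[OF g(1)] H_simps\<close>)
  have "(\<lambda>a\<in>carrier IM. (\<lambda>s\<in>carrier S. g s a)) \<in> Hom IM E"
  proof (rule mod_homI[OF _ _ _ mIM])
    note ID = submoduleD[OF module_Rmod I]
    have gI: "g s \<in> Hom IM M" if "s \<in> carrier S" for s using gH[OF that] H_carrier by simp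
    fix a b assume "a \<in> carrier IM" "b \<in> carrier IM"
    then have ab: "a \<in> I" "b \<in> I" "a \<oplus> b \<in> I" using ID(3) by auto
    have "g s (a \<oplus> b) = g s a \<oplus>\<^bsub>M\<^esub> g s b" if "s \<in> carrier S" for s
      using homD(2)[OF gI[OF that], of a b] ab by simp
    then show "(\<lambda>s\<in>carrier S. g s (a \<oplus>\<^bsub>IM\<^esub> b)) = (\<lambda>s\<in>carrier S. g s a) \<oplus>\<^bsub>E\<^esub> (\<lambda>s\<in>carrier S. g s b)"
      by (intro E_ext) (use ab ga mE in \<open>simp_all add: E_simps\<close>)
  next
    note ID = submoduleD[OF module_Rmod I]
    have gI: "g s \<in> Hom IM M" if "s \<in> carrier S" for s using gH[OF that] H_carrier by simp
    fix r a assume r: "r \<in> carrier R" and "a \<in> carrier IM"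
    then have ab: "a \<in> I" "r \<otimes> a \<in> I" using ID(6) by auto
    have "g s (r \<otimes> a) = r \<odot>\<^bsub>M\<^esub> g s a" if "s \<in> carrier S" for s
      using homD(3)[OF gI[OF that] r, of a] ab by simp
    then show "(\<lambda>s\<in>carrier S. g s (r \<odot>\<^bsub>IM\<^esub> a)) = r \<odot>\<^bsub>E\<^esub> (\<lambda>s\<in>carrier S. g s a)"
      by (intro E_ext) (use ab r ga mE in \<open>simp_all add: E_simps\<close>)
  qed (use ga in simp)
  then obtain n where n: "n \<in> carrier E" "\<And>a. a \<in> I \<Longrightarrow> (\<lambda>a\<in>carrier IM. (\<lambda>s\<in>carrier S. g s a)) a = a
      \<odot>\<^bsub>E\<^esub> n"
    by (rule baerD[OF E_baer I]) blast
  have gn: "g s a = a \<odot>\<^bsub>M\<^esub> n s" if "a \<in> I" "s \<in> carrier S" for a s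
    using fun_cong[OF n(2)[OF that(1)], of s] that by (simp add: E_simps)
  have nS: "n s \<in> carrier M" if "s \<in> carrier S" for s using n(1) that unfolding E_carrier
    by (rule homD(1))
  have \<epsilon>q: "\<epsilon> q \<in> carrier S" by (rule homD(1)[OF QD(5) q])
  have xq: "x q \<in> carrier M" by (rule homD(1)[OF x(1) q])
  have m: "n (\<epsilon> q) \<oplus>\<^bsub>M\<^esub> x q \<in> carrier M" using nS[OF \<epsilon>q] xq M by simp
  have "y' q = \<chi> q \<oplus>\<^bsub>H\<^esub> jm (x q)"
    using \<chi>q[OF q] module_diff(5)[OF mH homD(1)[OF y'(1) q] jm_H[OF xq]] by simp
  also have "\<dots> = jm (n (\<epsilon> q) \<oplus>\<^bsub>M\<^esub> x q)"
    by (rule H_ext) (use homD(1)[OF \<chi> q] jm_H[OF xq] jm_H[OF m] mH xq m nS[OF \<epsilon>q]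
        g(2)[OF q, symmetric] gn[OF _ \<epsilon>q] IR M
      in \<open>simp_all add: H_simps jm_apply module_smult(1)\<close>)
  finally have "y' q \<in> jm ` carrier M" using m by blast
  then show ?thesis using N_props(5)[OF homD(1)[OF y'(1) q]] y'(2)[OF q] by simp
qed

text \<open>This is Ext^1(S, N) = 0. A lift of \<open>\<chi>\<close> to Hom(I, M) is transposed into
  a family \<open>u\<close> of maps from \<open>A1\<close> to \<open>M\<close> indexed by
  \<open>I\<close>. Each member extends to \<open>A\<close>, but separate choices need not be linear
  in the index; the linear section \<open>\<sigma>\<close> extends the whole family at once, so that
  it transposes back.\<close>

lemma Hom_A1_N_extend:
  assumes \<chi>: "\<chi> \<in> Hom A1 N"
  shows "\<exists>x\<in>Hom A N. \<forall>k\<in>carrier A1. \<chi> k = x (d k)"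
proof -
  note mA = QD(3)[of 0] and m1 = QD(3)[of "Suc 0"]
  obtain \<sigma> where \<sigma>: "\<sigma> \<in> Hom H1 H0" "\<And>h k. h \<in> Hom A1 M \<Longrightarrow> k \<in> carrier A1 \<Longrightarrow> \<sigma> h (d k) = h k"
    by (rule restriction_section) blast
  obtain y where y: "y \<in> Hom A1 H" "\<And>k. k \<in> carrier A1 \<Longrightarrow> pN (y k) = \<chi> k"
    by (rule proj_lift[OF QD(2) mH N_props(1,2,3) \<chi>]) blast
  have yk: "y k \<in> Hom IM M" if "k \<in> carrier A1" for k using homD(1)[OF y(1) that] H_carrier by simp
  define u where "u a = (\<lambda>k\<in>carrier A1. y k a)" for a
  have u: "u a \<in> Hom A1 M" if a: "a \<in> I" for a
    unfolding u_def
    by (rule mod_homI[OF _ _ _ m1]) (use a homD(1)[OF y(1)] H_val in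
        \<open>simp_all add: homD(2)[OF y(1)] homD(3)[OF y(1)] H_simps\<close>)
  have u1: "u a \<in> carrier H1" if "a \<in> I" for a using u[OF that] by (simp add: hom_module_simps)
  have mH1: "module R H1" and mH0: "module R H0" by (rule module_hom_module[OF QD(3) M])+
  note ID = submoduleD[OF module_Rmod I]
  have uadd: "u (a \<oplus> b) = u a \<oplus>\<^bsub>H1\<^esub> u b" if ab: "a \<in> I" "b \<in> I" for a b
  proof (rule hom_eqI)
    have abI: "a \<oplus> b \<in> I" using ID(3)[OF ab] by simp
    show "u (a \<oplus> b) \<in> Hom A1 M" by (rule u[OF abI])
    show "u a \<oplus>\<^bsub>H1\<^esub> u b \<in> Hom A1 M" using module_addI(1)[OF mH1 u1[OF ab(1)] u1[OF ab(2)]]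
      by (simp add: hom_module_simps)
    fix k assume k: "k \<in> carrier A1"
    show "u (a \<oplus> b) k = (u a \<oplus>\<^bsub>H1\<^esub> u b) k"
      using homD(2)[OF yk[OF k], of a b] ab k by (simp add: u_def hom_module_simps)
  qed
  have usm: "u (r \<otimes> a) = r \<odot>\<^bsub>H1\<^esub> u a" if ra: "r \<in> carrier R" "a \<in> I" for r a
  proof (rule hom_eqI)
    have raI: "r \<otimes> a \<in> I" using ID(6)[OF ra] by simp
    show "u (r \<otimes> a) \<in> Hom A1 M" by (rule u[OF raI])
    show "r \<odot>\<^bsub>H1\<^esub> u a \<in> Hom A1 M" using module_addI(5)[OF mH1 ra(1) u1[OF ra(2)]]
      by (simp add: hom_module_simps)
    fix k assume k: "k \<in> carrier A1"
    show "u (r \<otimes> a) k = (r \<odot>\<^bsub>H1\<^esub> u a) k"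
      using homD(3)[OF yk[OF k] ra(1), of a] ra k by (simp add: u_def hom_module_simps)
  qed
  have \<sigma>u: "\<sigma> (u a) \<in> Hom A M" if "a \<in> I" for a using homD(1)[OF \<sigma>(1) u1[OF that]]
    by (simp add: hom_module_simps)
  have xq: "(\<lambda>a\<in>I. \<sigma> (u a) q) \<in> carrier H" if q: "q \<in> carrier A" for q
  proof -
    have "(\<lambda>a\<in>carrier IM. \<sigma> (u a) q) \<in> Hom IM M"
    proof (rule mod_homI[OF _ _ _ mIM])
      show "\<sigma> (u a) q \<in> carrier M" if "a \<in> carrier IM" for a using homD(1)[OF \<sigma>u q] that by simp
      show "\<sigma> (u (a \<oplus>\<^bsub>IM\<^esub> b)) q = \<sigma> (u a) q \<oplus>\<^bsub>M\<^esub> \<sigma> (u b) q" if "a \<in> carrier IM" "b \<in> carrier IM"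
          for a b
        using homD(2)[OF \<sigma>(1) u1 u1, of a b] that uadd[of a b] q by (simp add: hom_module_simps)
      show "\<sigma> (u (r \<odot>\<^bsub>IM\<^esub> a)) q = r \<odot>\<^bsub>M\<^esub> \<sigma> (u a) q" if "r \<in> carrier R" "a \<in> carrier IM" for r a
        using homD(3)[OF \<sigma>(1) that(1) u1, of a] that usm[of r a] q by (simp add: hom_module_simps)
    qed
    then show ?thesis by (simp add: H_carrier)
  qed
  have x: "(\<lambda>q\<in>carrier A. (\<lambda>a\<in>I. \<sigma> (u a) q)) \<in> Hom A H"
  proof (rule mod_homI[OF xq _ _ mA])
    fix q q' assume q: "q \<in> carrier A" "q' \<in> carrier A"
    show "(\<lambda>a\<in>I. \<sigma> (u a) (q \<oplus>\<^bsub>A\<^esub> q')) = (\<lambda>a\<in>I. \<sigma> (u a) q) \<oplus>\<^bsub>H\<^esub> (\<lambda>a\<in>I. \<sigma> (u a) q')"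
      by (rule H_ext[OF xq module_addI(1)[OF mH xq xq]]) (use q mA in \<open>simp_all add: H_simps
          homD(2)[OF \<sigma>u]\<close>)
  next
    fix r q assume q: "r \<in> carrier R" "q \<in> carrier A"
    show "(\<lambda>a\<in>I. \<sigma> (u a) (r \<odot>\<^bsub>A\<^esub> q)) = r \<odot>\<^bsub>H\<^esub> (\<lambda>a\<in>I. \<sigma> (u a) q)"
      by (rule H_ext[OF xq module_addI(5)[OF mH _ xq]]) (use q mA in \<open>simp_all add: H_simps
          homD(3)[OF \<sigma>u]\<close>)
  qed
  show ?thesis
  proof (rule bexI[OF _ hom_compose[OF mA x N_props(2)]], rule ballI)
    fix k assume k: "k \<in> carrier A1"
    have dk: "d k \<in> carrier A" by (rule homD(1)[OF QD(4) k])
    have "y k = (\<lambda>a\<in>I. \<sigma> (u a) (d k))"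
      by (rule H_ext[OF homD(1)[OF y(1) k] xq[OF dk]]) (use \<sigma>(2)[OF u k] k in \<open>simp add: u_def\<close>)
    then show "\<chi> k = compose (carrier A) pN (\<lambda>q\<in>carrier A. (\<lambda>a\<in>I. \<sigma> (u a) q)) (d k)"
      using y(2)[OF k] dk by (simp add: compose_eq)
  qed
qed

text \<open>The restriction to \<open>A1\<close> of a map \<open>y\<close> on \<open>B\<close>
  extends uniquely to a map \<open>x\<close> on \<open>A\<close>. The difference of \<open>y\<close>
  and \<open>x\<close> vanishes on \<open>A1\<close>, hence is \<open>p\<close> times its value at
  \<open>e0\<close>, and \<open>\<tau>\<close> returns this value. For \<open>y\<close> restricted
  from \<open>A\<close> the difference is zero; for \<open>p\<close> times \<open>n\<close> the
  extension \<open>x\<close> is zero and \<open>p e0\<close> is \<open>\<one>\<close>.\<close>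

lemma \<tau>_exists:
  obtains \<tau> where "\<tau> \<in> Hom (hom_module R (submod A B) N) N" "\<And>x. x \<in> Hom A N \<Longrightarrow> \<tau> (\<lambda>b\<in>B. x b) = \<zero>\<^bsub>N\<^esub>"
    "\<And>n. n \<in> carrier N \<Longrightarrow> \<tau> (\<lambda>b\<in>B. p b \<odot>\<^bsub>N\<^esub> n) = n"
proof -
  note mA = QD(3)[of 0] and m1 = QD(3)[of "Suc 0"] and mN = N_props(1)
  let ?HA = "hom_module R A N" and ?H1 = "hom_module R A1 N" and ?HB = "hom_module R (submod A B) N"
  have mHA: "module R ?HA" and mH1: "module R ?H1" and mHB: "module R ?HB"
    by (rule module_hom_module[OF mA mN], rule module_hom_module[OF m1 mN], rule
        module_hom_module[OF mB mN])
  define r where "r = (\<lambda>h\<in>carrier ?HA. compose (carrier A1) h d)"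
  have r: "r \<in> Hom ?HA ?H1" unfolding r_def by (rule hom_module_precompose[OF m1 mA mN QD(4)])
  have rh: "r h = compose (carrier A1) h d" if "h \<in> Hom A N" for h using that
    by (simp add: r_def hom_module_simps)
  have "bij_betw r (carrier ?HA) (carrier ?H1)"
  proof (rule bij_betw_imageI)
    show "inj_on r (carrier ?HA)"
    proof (rule inj_onI)
      fix h g assume "h \<in> carrier ?HA" "g \<in> carrier ?HA" and eq: "r h = r g"
      then have h: "h \<in> Hom A N" and g: "g \<in> Hom A N" by (simp_all add: hom_module_simps)
      show "h = g"
      proof (rule hom_eqI[OF h g])
        fix q assume q: "q \<in> carrier A"
        have "(\<lambda>q\<in>carrier A. h q \<ominus>\<^bsub>N\<^esub> g q) q = \<zero>\<^bsub>N\<^esub>"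
        proof (rule Hom_A_N_zero[OF hom_diff[OF mA mN h g] _ q])
          fix k assume k: "k \<in> carrier A1"
          have dk: "d k \<in> carrier A" by (rule homD(1)[OF QD(4) k])
          have "h (d k) = g (d k)" using fun_cong[OF eq, of k] k rh[OF h] rh[OF g]
            by (simp add: compose_eq)
          then show "(\<lambda>q\<in>carrier A. h q \<ominus>\<^bsub>N\<^esub> g q) (d k) = \<zero>\<^bsub>N\<^esub>" using dk homD(1)[OF g dk] mN by simp
        qed
        then show "h q = g q" using q module_diff(3)[OF mN homD(1)[OF h q] homD(1)[OF g q]] by simp
      qed
    qed
    show "r ` carrier ?HA = carrier ?H1"
    proof
      show "r ` carrier ?HA \<subseteq> carrier ?H1" using homD(1)[OF r] by blast
      show "carrier ?H1 \<subseteq> r ` carrier ?HA"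
      proof
        fix y assume "y \<in> carrier ?H1"
        then have y: "y \<in> Hom A1 N" by (simp add: hom_module_simps)
        obtain x where x: "x \<in> Hom A N" "\<forall>k\<in>carrier A1. y k = x (d k)" using Hom_A1_N_extend[OF y]
          by blast
        have "y = r x"
          unfolding rh[OF x(1)] by (rule hom_eqI[OF y hom_compose[OF m1 QD(4) x(1)]])
              (use x(2) in \<open>simp add: compose_eq\<close>)
        then show "y \<in> r ` carrier ?HA" using x(1)
          by (intro image_eqI[of _ _ x]) (simp_all add: hom_module_simps)
      qed
    qed
  qed
  then obtain s where s: "s \<in> Hom ?H1 ?HA" "\<And>h. h \<in> carrier ?HA \<Longrightarrow> s (r h) = h"
    using hom_inverse[OF mHA mH1 r] by metis
  define t where "t = (\<lambda>h\<in>carrier ?HB. compose (carrier A1) h d)"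
  have t: "t \<in> Hom ?HB ?H1" unfolding t_def by (rule hom_module_precompose[OF m1 mB mN d_BM])
  have e0B: "e0 \<in> carrier (submod A B)" using e0(3) by simp
  note ev1 = hom_eval[OF mB mN e0B] and ev2 = hom_eval[OF mA mN e0(1)]
  define \<tau> where "\<tau> = (\<lambda>y\<in>carrier ?HB. (\<lambda>h\<in>carrier ?HB. h e0) y \<ominus>\<^bsub>N\<^esub>
    compose (carrier ?HB) (\<lambda>h\<in>carrier ?HA. h e0) (compose (carrier ?HB) s t) y)"
  have \<tau>: "\<tau> \<in> Hom ?HB N"
    unfolding \<tau>_def
      by (rule hom_diff[OF mHB mN ev1 hom_compose[OF mHB hom_compose[OF mHB t s(1)] ev2]])
  have \<tau>y: "\<tau> y = y e0 \<ominus>\<^bsub>N\<^esub> x e0" if y: "y \<in> Hom (submod A B) N" and x: "x \<in> Hom A N"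
    and eq: "\<And>k. k \<in> carrier A1 \<Longrightarrow> y (d k) = x (d k)" for x y
  proof -
    have yH: "y \<in> carrier ?HB" and xH: "x \<in> carrier ?HA" using x y
      by (simp_all add: hom_module_simps)
    have "t y = r x"
      unfolding rh[OF x] using yH eq by (simp add: t_def compose_def fun_eq_iff)
    then have "s (t y) = x" using s(2)[OF xH] by simp
    then show ?thesis using yH xH by (simp add: \<tau>_def compose_eq)
  qed
  show ?thesis
  proof (rule that[OF \<tau>])
    fix x assume x: "x \<in> Hom A N"
    have "compose (carrier (submod A B)) x (\<lambda>b\<in>B. b) \<in> Hom (submod A B) N"
      by (rule hom_compose[OF mB submod_incl[OF mA B_sub] x])
    then have xB: "(\<lambda>b\<in>B. x b) \<in> Hom (submod A B) N"
      by (simp add: compose_def restrict_def cong: if_cong)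
    have "\<tau> (\<lambda>b\<in>B. x b) = x e0 \<ominus>\<^bsub>N\<^esub> x e0" using \<tau>y[OF xB x] d_B e0(3) by simp
    then show "\<tau> (\<lambda>b\<in>B. x b) = \<zero>\<^bsub>N\<^esub>" using homD(1)[OF x e0(1)] mN by simp
  next
    fix n assume n: "n \<in> carrier N"
    have "(\<lambda>b\<in>carrier (submod A B). p b \<odot>\<^bsub>N\<^esub> n) \<in> Hom (submod A B) N"
      by (rule mod_homI[OF _ _ _ mB])
        (use n p_closed mN homD(2)[OF p] homD(3)[OF p] in \<open>simp_all add: module_smult(2,3)\<close>)
    then have pn: "(\<lambda>b\<in>B. p b \<odot>\<^bsub>N\<^esub> n) \<in> Hom (submod A B) N" by simp
    have "\<tau> (\<lambda>b\<in>B. p b \<odot>\<^bsub>N\<^esub> n) = (\<lambda>b\<in>B. p b \<odot>\<^bsub>N\<^esub> n) e0 \<ominus>\<^bsub>N\<^esub> (\<lambda>x\<in>carrier A. \<zero>\<^bsub>N\<^esub>) e0"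
      by (rule \<tau>y[OF pn hom_zero[OF mA mN]]) (use d_B p_d n mN homD(1)[OF QD(4)[of 0]] in simp)
    then show "\<tau> (\<lambda>b\<in>B. p b \<odot>\<^bsub>N\<^esub> n) = n" using e0 p_e0 n mN by simp
  qed
qed

lemma N_zero:
  assumes fin: "\<And>G :: ('r, 'u) module. flatU G \<Longrightarrow> proj_dim TYPE('u) R G \<le> enat m"
  shows "carrier N = {\<zero>\<^bsub>N\<^esub>}"
proof -
  obtain \<tau> where \<tau>: "\<tau> \<in> Hom (hom_module R (submod A B) N) N" "\<And>x. x \<in> Hom A N \<Longrightarrow>
      \<tau> (\<lambda>b\<in>B. x b) = \<zero>\<^bsub>N\<^esub>"
    "\<And>n. n \<in> carrier N \<Longrightarrow> \<tau> (\<lambda>b\<in>B. p b \<odot>\<^bsub>N\<^esub> n) = n"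
    by (rule \<tau>_exists) blast
  have "factor_data R U A B F \<pi> p N \<tau>"
    by (intro factor_data.intro factor_data_axioms.intro small_ring_axioms QD(2) B_sub proj_B
        F_flat F_lepoll
        \<pi> \<pi>_surj \<pi>_ker p N_props(1) \<tau>)
  then show ?thesis using fin by (rule factor_data.N_trivial)
qed

end

text \<open>Since \<open>N I\<close> is the cokernel of \<open>jm I\<close>, its vanishing for every
  ideal is precisely the Baer condition for \<open>M\<close>.\<close>

lemma M_baer:
  assumes fin: "\<And>G :: ('r, 'u) module. flatU G \<Longrightarrow> proj_dim TYPE('u) R G \<le> enat m"
  shows "baer M"
  unfolding baer_def
proof (intro allI impI ballI)
  fix I f assume I: "submodule I R Rmod" and f: "f \<in> Hom (submod Rmod I) M"
  have fH: "f \<in> carrier (H I)" using f by (simp add: H_carrier[OF I])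
  have "pN I f \<in> carrier (N I)" by (rule homD(1)[OF N_props(2)[OF I] fH])
  then have "pN I f = \<zero>\<^bsub>N I\<^esub>" using N_zero[OF I fin] by simp
  then obtain m where "m \<in> carrier M" "f = jm I m" using N_props(5)[OF I fH] by blast
  then show "\<exists>n\<in>carrier M. \<forall>a\<in>I. f a = a \<odot>\<^bsub>M\<^esub> n" using jm_apply[OF I] by blast
qed

end

theorem theorem4p3:
  fixes R :: "('r, 'z) ring_scheme" and S :: "('r, 's) module" and M :: "('r, 'm) module"
  assumes "infinite (UNIV :: 'u set)"
    and "carrier R \<lesssim> (UNIV :: 'u set)" and "carrier S \<lesssim> (UNIV :: 'u set)"
    and "cring R" and "splf TYPE('u) R < \<infinity>"
    and "assoc_algebra R S" and "faithfully_flat TYPE('u) R S" and "proj_dim TYPE('u) R S \<le> 1"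
    and "Module.module R M"
    and "carrier (Ext TYPE('u) R 1 S M) = {\<zero>\<^bsub>Ext TYPE('u) R 1 S M\<^esub>}"
    and "injective TYPE('u) S (coinduced R S M)"
  shows "injective TYPE('v) R M"
proof -
  interpret small_ring R "TYPE('u)"
    using assms(1,2,4) by (intro small_ring.intro base_ring.intro small_ring_axioms.intro)
  have mS: "module R S" using assms(6) by (rule assoc_algebra.axioms)
  obtain m where m: "\<And>G :: ('r, 'u) module. flat TYPE('u) R G \<Longrightarrow> proj_dim TYPE('u) R G \<le> enat m"
    using finite_splf[OF assms(5)] by blast
  have pd: "proj_dim TYPE('u) R S \<le> enat 1" using assms(8) by (simp add: one_enat_def)
  obtain Q :: "nat \<Rightarrow> ('r, 'u) module" and dQ \<epsilon> where Q: "projective_resolution R S Q dQ \<epsilon>"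
      "resolution S Q dQ \<epsilon>"
    "\<And>k. k > 1 \<Longrightarrow> carrier (Q k) = {\<zero>\<^bsub>Q k\<^esub>}"
    by (rule finite_proj_dim[OF mS pd]) blast
  obtain P :: "nat \<Rightarrow> ('r, 'u) module" and d e where P: "resolution S P d e"
      "Ext_vanish P d M (Suc 0)"
    using Ext_eq_zero[OF assms(9) Q(1) resolution_of_projective_resolution[OF mS], of 0] assms(10)
      by auto
  \<comment> \<open>The hypothesis on \<open>Ext\<close> concerns the chosen resolution
    \<open>P\<close>, the bound on the dimension provides \<open>Q\<close> of length one;
    independence lets \<open>Q\<close> have both properties.\<close>
  have v: "Ext_vanish Q dQ M (Suc 0)" by (rule Ext_vanish_independent[OF P(1) Q(2) assms(9) P(2)])
  have "descent R S M Q dQ \<epsilon>"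
  proof (intro descent.intro descent_axioms.intro small_ring_axioms assms(3,6,7,9,11) Q(2))
    show "carrier (Q (Suc (Suc 0))) = {\<zero>\<^bsub>Q (Suc (Suc 0))\<^esub>}" by (rule Q(3)) simp
    fix y assume y: "y \<in> mod_hom R (Q (Suc 0)) M"
    have "y (dQ (Suc 0) x) = \<zero>\<^bsub>M\<^esub>" if "x \<in> carrier (Q (Suc (Suc 0)))" for x
      using that Q(3)[of "Suc (Suc 0)"] hom_zero_neg(1)[OF resolutionD(4)[OF Q(2)]
          resolutionD(3)[OF Q(2)] resolutionD(3)[OF Q(2)], of "Suc 0"]
        hom_zero_neg(1)[OF y resolutionD(3)[OF Q(2)] assms(9)] by simp
    then show "\<exists>x\<in>mod_hom R (Q 0) M. \<forall>k\<in>carrier (Q (Suc 0)). y k = x (dQ 0 k)"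
      using Ext_vanish_SucD[OF v y] by metis
  qed
  then have "baer M" by (rule descent.M_baer) (rule m)
  then show ?thesis by (rule baer_injective[OF assms(9)])
qed

end
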